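(* Let $Q=(-10,10)^n\times(0,10]$ and $Q_{1/2}=(-5,5)^n\times(10-\tfrac{10}{4},10]$. Let $G:Q\times\mathbb R^n\times\mathbb S^n\to\mathbb R$ be measurable and uniformly parabolic, i.e. $$\mathcal P^-(X-Y)\le G(x,t,\xi,X)-G(x,t,\xi,Y)\le\mathcal P^+(X-Y)$$ for all $(x,t)\in Q$, $\xi\in\mathbb R^n$, $X,Y\in\mathbb S^n$. Assume that there are $q>n+2$ and $\mu\in L^q(Q)$ such that $|G(x,t,\xi,O)|\le\mu(x,t)|\xi|$ for all $(x,t)\in Q$, $\xi\in\mathbb R^n$, and that $f\in L^p(Q)$ for some $p\in(p_1,q]$. Then there exist $C>0$ and $\alpha\in(0,1)$ such that if $u\in C(Q)$ is an $L^p$-viscosity solution of $$u_t+G(x,t,Du,D^2u)-f(x,t)=0\quad\text{in }Q,$$ then $$|u(x,t)-u(\hat x,\hat t)|\le C\left(|x-\hat x|^2+|t-\hat t|\right)^{\alpha/2}\left(\|u\|_{L^\infty(Q)}+\|f\|_{L^p(Q)}\right)\quad\text{for all }(x,t),(\hat x,\hat t)\in Q_{1/2}.$$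
   Context: Fix $n\in\mathbb N$ and constants $0<\lambda\le\Lambda<\infty$. $\mathbb S^n$ is the set of real symmetric $n\times n$ matrices with the usual order, and $O$ is the zero matrix. The Pucci operators are $\mathcal P^+(X)=\max\{-\mathrm{Tr}(AX): A\in\mathbb S^n,\ \lambda I\le A\le\Lambda I\}$ and $\mathcal P^-(X)=\min\{-\mathrm{Tr}(AX): A\in\mathbb S^n,\ \lambda I\le A\le\Lambda I\}$ for $X\in\mathbb S^n$. $Du$, $D^2u$ are the first and second derivatives in the space variable $x$, and $u_t$ is the time derivative. For $Q=\Omega\times(0,T]$ the parabolic boundary is $\partial_pQ=(\Omega\times\{0\})\cup(\partial\Omega\times[0,T))$. The parabolic distance is $d((x,t),(y,s))=\sqrt{|x-y|^2+|t-s|}$, and $Q'\Subset Q$ means that the parabolic distance from $Q'$ to $\partial_pQ$ is positive. $W^{2,1}_p(Q)$ is the set of $f\in L^p(Q)$ with weak derivatives $f_t,f_{x_k},f_{x_kx_\ell}\in L^p(Q)$, with norm the sum of the $L^p$ norms of $f$ and of these derivatives; $W^{2,1}_{p,\mathrm{loc}}(Q)$ consists of functions in $W^{2,1}_p(Q')$ for all $Q'\Subset Q$. Set $Q_r(x,t)=(x,t)+(-r,r)^n\times(-r^2,0]$. $L^p$-viscosity solutions: $u\in C(Q)$ is an $L^p$-viscosity subsolution (resp. supersolution) of $u_t+F(x,t,Du,D^2u)=0$ in $Q$ if for every $\phi\in W^{2,1}_{p,\mathrm{loc}}(Q)$ and every $(x,t)\in Q$ such that $u-\phi$ attains a maximum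 (resp. minimum) at $(x,t)$ over some cylinder $Q_r(x,t)\subset Q$, one has $\lim_{\varepsilon\to0}\operatorname{ess\,inf}_{(y,s)\in Q_\varepsilon(x,t)}\{\phi_t+F(y,s,D\phi,D^2\phi)\}\le0$ (resp. $\lim_{\varepsilon\to0}\operatorname{ess\,sup}_{(y,s)\in Q_\varepsilon(x,t)}\{\phi_t+F(y,s,D\phi,D^2\phi)\}\ge0$). It is an $L^p$-viscosity solution if it is both. $p_1=p_1(n,\Lambda/\lambda)\in[\frac{n+2}2,n+1)$ is the constant giving the range $p>p_1$ of exponents for which the Aleksandrov-Bakelman-Pucci maximum principle holds, i.e. for every $p>p_1$ there is $C=C(n,\Lambda,\lambda,p)$ such that, with $Q^*=\{|x|<1\}\times(0,1]$, for every $f\in L^p(Q^* )$ there is $u\in C(\overline{Q^*})\cap W^{2,1}_{p,\mathrm{loc}}(Q^* )$ with $u_t+\mathcal P^+(D^2u)=f$ a.e. in $Q^*$, $u=0$ on $\partial_pQ^*$, $-C\|f^-\|_{L^p(Q^* )}\le u\le C\|f^+\|_{L^p(Q^* )}$, and $\|u\|_{W^{2,1}_p(Q')}\le C'\|f\|_{L^p(Q^* )}$ for every $Q'\Subset Q^*$, where $C'$ depends only on $n,\Lambda,\lambda,p$ and the distance of $Q'$ to $\partial_pQ^*$. *)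

theory Defs
  imports "HOL-Analysis.Analysis"
begin

text \<open>Points of space-time are pairs \<open>(x, t)\<close> in \<open>(real^'n) \<times> real\<close>; the dimension is \<open>CARD('n)\<close>.\<close>


section \<open>Symmetric matrices and Pucci operators\<close>

definition symm :: "real^'n^'n \<Rightarrow> bool" where
  "symm A \<longleftrightarrow> transpose A = A"

definition loewner_le :: "real^'n^'n \<Rightarrow> real^'n^'n \<Rightarrow> bool" where
  "loewner_le A B \<longleftrightarrow> (\<forall>\<xi>. \<xi> \<bullet> (A *v \<xi>) \<le> \<xi> \<bullet> (B *v \<xi>))"

definition pucci_matrices :: "real \<Rightarrow> real \<Rightarrow> (real^'n^'n) set" where
  "pucci_matrices lam Lam = {A. symm A \<and> loewner_le (mat lam) A \<and> loewner_le A (mat Lam)}"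

text \<open>For \<open>0 < lam \<le> Lam\<close> the set \<open>pucci_matrices lam Lam\<close> is compact and nonempty, so the
  supremum and the infimum below are a maximum and a minimum.\<close>

definition pucci_plus :: "real \<Rightarrow> real \<Rightarrow> real^'n^'n \<Rightarrow> real" where
  "pucci_plus lam Lam X = (SUP A\<in>pucci_matrices lam Lam. - trace (A ** X))"

definition pucci_minus :: "real \<Rightarrow> real \<Rightarrow> real^'n^'n \<Rightarrow> real" where
  "pucci_minus lam Lam X = (INF A\<in>pucci_matrices lam Lam. - trace (A ** X))"

definition sym_part :: "real^'n^'n \<Rightarrow> real^'n^'n" where
  "sym_part X = (1/2) *\<^sub>R (X + transpose X)"

text \<open>Measurability of \<open>G\<close> on \<open>Q \<times> \<real>\<^sup>n \<times> S\<^sup>n\<close>, where \<open>S\<^sup>n\<close> carries its own Lebesgue measure (of dimension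
  \<open>n(n+1)/2\<close>). As a subset of \<open>real^'n^'n\<close>, \<open>S\<^sup>n\<close> is a null set, so Lebesgue measurability relative
  to that ambient space would be void. Instead \<open>G\<close> is pulled back along the orthogonal projection
  onto \<open>S\<^sup>n\<close>; by Fubini the pull-back is measurable iff \<open>G\<close> is measurable on \<open>Q \<times> \<real>\<^sup>n \<times> S\<^sup>n\<close>.\<close>

definition operator_measurable ::
  "((real^'n) \<times> real) set \<Rightarrow> ((real^'n) \<times> real \<Rightarrow> real^'n \<Rightarrow> real^'n^'n \<Rightarrow> real) \<Rightarrow> bool" where
  "operator_measurable Q G \<longleftrightarrow>
     (\<lambda>(z, \<xi>, X). G z \<xi> (sym_part X)) \<in> borel_measurable (lebesgue_on (Q \<times> UNIV \<times> UNIV))"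


section \<open>Parabolic cylinders\<close>

definition cube :: "real \<Rightarrow> (real^'n) set" where
  "cube r = {x. \<forall>i. \<bar>x $ i\<bar> < r}"

definition cylinder :: "(real^'n) set \<Rightarrow> real \<Rightarrow> ((real^'n) \<times> real) set" where
  "cylinder \<Omega> T = \<Omega> \<times> {0<..T}"

definition par_boundary :: "(real^'n) set \<Rightarrow> real \<Rightarrow> ((real^'n) \<times> real) set" where
  "par_boundary \<Omega> T = (\<Omega> \<times> {0}) \<union> (frontier \<Omega> \<times> {0..<T})"

definition par_cube :: "real \<Rightarrow> (real^'n) \<times> real \<Rightarrow> ((real^'n) \<times> real) set" where
  "par_cube r z = {(y, s). (\<forall>i. \<bar>y $ i - fst z $ i\<bar> < r) \<and> snd z - r\<^sup>2 < s \<and> s \<le> snd z}"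

definition par_dist :: "(real^'n) \<times> real \<Rightarrow> (real^'n) \<times> real \<Rightarrow> real" where
  "par_dist z w = sqrt ((norm (fst z - fst w))\<^sup>2 + \<bar>snd z - snd w\<bar>)"

definition par_setdist :: "((real^'n) \<times> real) set \<Rightarrow> ((real^'n) \<times> real) set \<Rightarrow> ereal" where
  "par_setdist A B = (INF z\<in>A. INF w\<in>B. ereal (par_dist z w))"

text \<open>\<open>par_inside \<Omega> T Q'\<close> is the relation \<open>Q' \<Subset> \<Omega> \<times> (0,T]\<close>. The second conjunct only makes
  \<open>W\<^sup>2\<^sup>,\<^sup>1\<^sub>p(Q')\<close> meaningful: weak derivatives live on the interior of \<open>Q'\<close>, which has to be all of
  \<open>Q'\<close> up to a null set, as it is for cylinders \<open>\<Omega>' \<times> (s,t]\<close> over an open \<open>\<Omega>'\<close>.\<close>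

definition par_inside :: "(real^'n) set \<Rightarrow> real \<Rightarrow> ((real^'n) \<times> real) set \<Rightarrow> bool" where
  "par_inside \<Omega> T Q' \<longleftrightarrow> Q' \<subseteq> cylinder \<Omega> T \<and> Q' - interior Q' \<in> null_sets lebesgue \<and>
     par_setdist Q' (par_boundary \<Omega> T) > 0"


section \<open>Lebesgue spaces\<close>

definition in_Lp :: "real \<Rightarrow> 'a::euclidean_space set \<Rightarrow> ('a \<Rightarrow> real) \<Rightarrow> bool" where
  "in_Lp p S f \<longleftrightarrow> f \<in> borel_measurable (lebesgue_on S) \<and>
     integrable (lebesgue_on S) (\<lambda>z. \<bar>f z\<bar> powr p)"

definition Lp_norm :: "real \<Rightarrow> 'a::euclidean_space set \<Rightarrow> ('a \<Rightarrow> real) \<Rightarrow> real" where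
  "Lp_norm p S f = (integral\<^sup>L (lebesgue_on S) (\<lambda>z. \<bar>f z\<bar> powr p)) powr (1 / p)"

text \<open>With respect to the filter of almost-everywhere properties, \<open>Limsup\<close> is
  \<open>inf {c. f \<le> c almost everywhere}\<close>, and dually for \<open>Liminf\<close>. The constant \<open>esssup\<close> of the
  probability library coincides with this for measurable \<open>f\<close>, but is \<open>\<infinity>\<close> by convention otherwise;
  that convention would make the viscosity inequalities below void for non-measurable expressions.\<close>

definition ess_sup :: "'a::euclidean_space set \<Rightarrow> ('a \<Rightarrow> real) \<Rightarrow> ereal" where
  "ess_sup S f = Limsup (ae_filter (lebesgue_on S)) (\<lambda>z. ereal (f z))"

definition ess_inf :: "'a::euclidean_space set \<Rightarrow> ('a \<Rightarrow> real) \<Rightarrow> ereal" where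
  "ess_inf S f = Liminf (ae_filter (lebesgue_on S)) (\<lambda>z. ereal (f z))"

text \<open>Takes the value \<open>\<infinity>\<close> if \<open>f\<close> is not essentially bounded.\<close>

definition Linf_norm :: "'a::euclidean_space set \<Rightarrow> ('a \<Rightarrow> real) \<Rightarrow> ereal" where
  "Linf_norm S f = ess_sup S (\<lambda>z. \<bar>f z\<bar>)"


section \<open>Weak derivatives and parabolic Sobolev spaces\<close>

primrec iter_deriv :: "'a::euclidean_space list \<Rightarrow> ('a \<Rightarrow> real) \<Rightarrow> 'a \<Rightarrow> real" where
  "iter_deriv [] \<phi> = \<phi>"
| "iter_deriv (v # vs) \<phi> = (\<lambda>z. frechet_derivative (iter_deriv vs \<phi>) (at z) v)"

definition smooth :: "('a::euclidean_space \<Rightarrow> real) \<Rightarrow> bool" where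
  "smooth \<phi> \<longleftrightarrow> (\<forall>vs z. iter_deriv vs \<phi> differentiable (at z))"

definition test_function :: "'a::euclidean_space set \<Rightarrow> ('a \<Rightarrow> real) \<Rightarrow> bool" where
  "test_function U \<phi> \<longleftrightarrow> smooth \<phi> \<and> compact (closure {z. \<phi> z \<noteq> 0}) \<and> closure {z. \<phi> z \<noteq> 0} \<subseteq> U"

definition locally_integrable :: "'a::euclidean_space set \<Rightarrow> ('a \<Rightarrow> real) \<Rightarrow> bool" where
  "locally_integrable U f \<longleftrightarrow> (\<forall>K. compact K \<and> K \<subseteq> U \<longrightarrow> set_integrable lebesgue K f)"

definition has_weak_deriv ::
  "'a::euclidean_space set \<Rightarrow> 'a list \<Rightarrow> ('a \<Rightarrow> real) \<Rightarrow> ('a \<Rightarrow> real) \<Rightarrow> bool" where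
  "has_weak_deriv U vs f g \<longleftrightarrow> locally_integrable U f \<and> locally_integrable U g \<and>
     (\<forall>\<phi>. test_function U \<phi> \<longrightarrow>
        (LINT z:U|lebesgue. f z * iter_deriv vs \<phi> z)
          = (-1) ^ length vs * (LINT z:U|lebesgue. g z * \<phi> z))"

text \<open>Weak derivatives on an open set are unique up to null sets; \<open>weak_deriv\<close> picks a
  representative.\<close>

definition weak_deriv ::
  "'a::euclidean_space set \<Rightarrow> 'a list \<Rightarrow> ('a \<Rightarrow> real) \<Rightarrow> 'a \<Rightarrow> real" where
  "weak_deriv U vs f = (SOME g. has_weak_deriv U vs f g)"

definition dir_t :: "(real^'n) \<times> real" where
  "dir_t = (0, 1)"

definition dir_x :: "'n::finite \<Rightarrow> (real^'n) \<times> real" where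
  "dir_x k = (axis k 1, 0)"

definition W21 :: "real \<Rightarrow> ((real^'n) \<times> real) set \<Rightarrow> ((real^'n) \<times> real \<Rightarrow> real) \<Rightarrow> bool" where
  "W21 p Q f \<longleftrightarrow> in_Lp p Q f \<and>
     (\<forall>vs \<in> {[dir_t]} \<union> {[dir_x k] | k. True} \<union> {[dir_x k, dir_x l] | k l. True}.
        \<exists>g. has_weak_deriv (interior Q) vs f g \<and> in_Lp p Q g)"

definition W21_norm :: "real \<Rightarrow> ((real^'n) \<times> real) set \<Rightarrow> ((real^'n) \<times> real \<Rightarrow> real) \<Rightarrow> real" where
  "W21_norm p Q f = Lp_norm p Q f
     + Lp_norm p Q (weak_deriv (interior Q) [dir_t] f)
     + (\<Sum>k\<in>UNIV. Lp_norm p Q (weak_deriv (interior Q) [dir_x k] f))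
     + (\<Sum>k\<in>UNIV. \<Sum>l\<in>UNIV. Lp_norm p Q (weak_deriv (interior Q) [dir_x k, dir_x l] f))"

definition W21_loc ::
  "real \<Rightarrow> (real^'n) set \<Rightarrow> real \<Rightarrow> ((real^'n) \<times> real \<Rightarrow> real) \<Rightarrow> bool" where
  "W21_loc p \<Omega> T f \<longleftrightarrow> (\<forall>Q'. par_inside \<Omega> T Q' \<longrightarrow> W21 p Q' f)"

text \<open>The derivatives \<open>f\<^sub>t\<close>, \<open>Df\<close>, \<open>D\<^sup>2f\<close> of a function on \<open>Q\<close>, as functions defined almost everywhere.\<close>

definition Dt :: "((real^'n) \<times> real) set \<Rightarrow> ((real^'n) \<times> real \<Rightarrow> real) \<Rightarrow> (real^'n) \<times> real \<Rightarrow> real" where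
  "Dt Q f z = weak_deriv (interior Q) [dir_t] f z"

definition Dx ::
  "((real^'n) \<times> real) set \<Rightarrow> ((real^'n) \<times> real \<Rightarrow> real) \<Rightarrow> (real^'n) \<times> real \<Rightarrow> real^'n" where
  "Dx Q f z = (\<chi> k. weak_deriv (interior Q) [dir_x k] f z)"

definition D2x ::
  "((real^'n) \<times> real) set \<Rightarrow> ((real^'n) \<times> real \<Rightarrow> real) \<Rightarrow> (real^'n) \<times> real \<Rightarrow> real^'n^'n" where
  "D2x Q f z = (\<chi> k l. weak_deriv (interior Q) [dir_x k, dir_x l] f z)"


section \<open>Viscosity solutions\<close>

text \<open>\<open>F z \<xi> X\<close> stands for \<open>F(x,t,\<xi>,X)\<close> with \<open>z = (x,t)\<close>. Test functions are required to be continuous: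
  for \<open>p > (n+2)/2\<close> every element of \<open>W\<^sup>2\<^sup>,\<^sup>1\<^sub>p\<^sub>,\<^sub>l\<^sub>o\<^sub>c(Q)\<close> has a unique continuous representative, and it is
  this representative that touches \<open>u\<close>. (Altering \<open>\<phi>\<close> at a single point would otherwise produce
  spurious contact points.)\<close>

definition Lp_visc_subsolution ::
  "real \<Rightarrow> (real^'n) set \<Rightarrow> real \<Rightarrow> ((real^'n) \<times> real \<Rightarrow> real^'n \<Rightarrow> real^'n^'n \<Rightarrow> real) \<Rightarrow>
   ((real^'n) \<times> real \<Rightarrow> real) \<Rightarrow> bool" where
  "Lp_visc_subsolution p \<Omega> T F u \<longleftrightarrow>
     (let Q = cylinder \<Omega> T in
      continuous_on Q u \<and>
      (\<forall>\<phi> z r. W21_loc p \<Omega> T \<phi> \<and> continuous_on Q \<phi> \<and> z \<in> Q \<and> r > 0 \<and> par_cube r z \<subseteq> Q \<and>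
         (\<forall>w\<in>par_cube r z. u w - \<phi> w \<le> u z - \<phi> z) \<longrightarrow>
         Lim (at_right 0) (\<lambda>\<epsilon>. ess_inf (par_cube \<epsilon> z)
           (\<lambda>w. Dt Q \<phi> w + F w (Dx Q \<phi> w) (D2x Q \<phi> w))) \<le> 0))"

definition Lp_visc_supersolution ::
  "real \<Rightarrow> (real^'n) set \<Rightarrow> real \<Rightarrow> ((real^'n) \<times> real \<Rightarrow> real^'n \<Rightarrow> real^'n^'n \<Rightarrow> real) \<Rightarrow>
   ((real^'n) \<times> real \<Rightarrow> real) \<Rightarrow> bool" where
  "Lp_visc_supersolution p \<Omega> T F u \<longleftrightarrow>
     (let Q = cylinder \<Omega> T in
      continuous_on Q u \<and>
      (\<forall>\<phi> z r. W21_loc p \<Omega> T \<phi> \<and> continuous_on Q \<phi> \<and> z \<in> Q \<and> r > 0 \<and> par_cube r z \<subseteq> Q \<and>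
         (\<forall>w\<in>par_cube r z. u w - \<phi> w \<ge> u z - \<phi> z) \<longrightarrow>
         Lim (at_right 0) (\<lambda>\<epsilon>. ess_sup (par_cube \<epsilon> z)
           (\<lambda>w. Dt Q \<phi> w + F w (Dx Q \<phi> w) (D2x Q \<phi> w))) \<ge> 0))"

definition Lp_visc_solution ::
  "real \<Rightarrow> (real^'n) set \<Rightarrow> real \<Rightarrow> ((real^'n) \<times> real \<Rightarrow> real^'n \<Rightarrow> real^'n^'n \<Rightarrow> real) \<Rightarrow>
   ((real^'n) \<times> real \<Rightarrow> real) \<Rightarrow> bool" where
  "Lp_visc_solution p \<Omega> T F u \<longleftrightarrow> Lp_visc_subsolution p \<Omega> T F u \<and> Lp_visc_supersolution p \<Omega> T F u"


section \<open>The exponent of the Aleksandrov-Bakelman-Pucci maximum principle\<close>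

text \<open>\<open>ABP_exponent TYPE('n) lam Lam p1\<close> says that \<open>p1\<close> lies in \<open>[(n+2)/2, n+1)\<close> and that the maximum
  principle holds for all exponents \<open>p > p1\<close>. The constant \<open>C'\<close> of the interior estimate is a
  function of the parabolic distance from \<open>Q'\<close> to the parabolic boundary, chosen before \<open>f\<close>.\<close>

definition ABP_exponent :: "'n::finite itself \<Rightarrow> real \<Rightarrow> real \<Rightarrow> real \<Rightarrow> bool" where
  "ABP_exponent _ lam Lam p1 \<longleftrightarrow>
     (real CARD('n) + 2) / 2 \<le> p1 \<and> p1 < real CARD('n) + 1 \<and>
     (let \<Omega> = ball (0 :: real^'n) 1; Q = cylinder \<Omega> 1 in
      \<forall>p>p1. \<exists>C C'. \<forall>f. in_Lp p Q f \<longrightarrow>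
        (\<exists>u. continuous_on (closure Q) u \<and> W21_loc p \<Omega> 1 u \<and>
          (AE z in lebesgue_on Q. Dt Q u z + pucci_plus lam Lam (D2x Q u z) = f z) \<and>
          (\<forall>z\<in>par_boundary \<Omega> 1. u z = 0) \<and>
          (\<forall>z\<in>Q. - C * Lp_norm p Q (\<lambda>z. max 0 (- f z)) \<le> u z \<and>
                  u z \<le> C * Lp_norm p Q (\<lambda>z. max 0 (f z))) \<and>
          (\<forall>Q'. par_inside \<Omega> 1 Q' \<longrightarrow>
             W21_norm p Q' u \<le> C' (par_setdist Q' (par_boundary \<Omega> 1)) * Lp_norm p Q f)))"

end

(* The proof follows Krylov and Safonov. With right-hand side -g the maximum principle yields, after a
cut-off, nonpositive strong solutions w of w_t + P+(D2w) <= -g near a given point whose derivatives are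
bounded in L^p by g. Since mu is in L^q with q > n + 2, multiplying the gradient by mu is a small operation on
them at small scales, so a Neumann series adds the drift mu |Dw|. Testing with such a w plus the
barrier h y^3 exp(-k t), y = t/4 - |x|^2, shows that a nonnegative function of the form c + u or c - u which
is below h only on a small part of a cube is at least a fixed multiple of h later on. A Calderon-Zygmund
decomposition, with stacks of cubes forward in time, lowers the required density from almost 1 to 1/2;
applied to u - min u and max u - u this makes the oscillation of u decay geometrically. *)

theory Submission
  imports Defs "HOL-Computational_Algebra.Polynomial" "HOL-Real_Asymp.Real_Asymp"
begin

text \<open>The hypothesis on \<open>p1\<close> offers only existence, for the pure Pucci equation,
  and the function under study cannot be differentiated; so the work is to manufacture test
  functions. Each is an explicit smooth barrier plus a strong solution whose right-hand side absorbs
  everything the barrier gets wrong. The obstacle is the drift: p may lie below n+2, where functions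
  in W^{2,1}_p can have unbounded gradients, so mu |Dw| cannot be estimated by a supremum of |Dw|.
  What q > n+2 provides is decay of the L^p mass of mu on small parabolic boxes; paired with a bound
  of Dw by dyadic potentials of the derivatives of w, this gives an estimate in L^p with a small
  constant. G disappears early: u and -u satisfy the same one-sided inequality for the extremal
  operator. Signs replace boundary arguments: the correction w is nonpositive and the compared
  function nonnegative, so a contact point can only lie where the barrier is positive, away from the
  lateral boundary and the initial time.\<close>

abbreviation nnint :: "('a::euclidean_space => ennreal) => ennreal" (binder "NN " 10) where "nnint f == nn_integral lborel f"
abbreviation nnleb :: "('a::euclidean_space => ennreal) => ennreal" (binder "NL " 10) where "nnleb f == nn_integral lebesgue f"
abbreviation borelf :: "('a::topological_space => 'b::topological_space) set" where "borelf == borel_measurable borel"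
abbreviation vol :: "'a::euclidean_space set => real" where "vol == measure lborel"
abbreviation evol :: "'a::euclidean_space set => ennreal" where "evol == emeasure lborel"
abbreviation PP :: "real => real => ('n::finite => 'n => 'a => real) => 'a => real" where "PP lam Lam X z == pucci_plus lam Lam (\<chi> k l. X k l z)"
type_synonym 'n pt = "(real, 'n) vec * real"

section \<open>Smooth functions\<close>

definition dd :: "'a::euclidean_space => ('a => real) => 'a => real" where
 "dd v f z = frechet_derivative f (at z) v"

lemma iter_deriv_Cons: "iter_deriv (v # vs) f = dd v (iter_deriv vs f)" by (auto simp: dd_def)

lemma dd_eq: "(f has_derivative D) (at z) ==> dd v f z = D v" unfolding dd_def by (metis frechet_derivative_at)

text \<open>Smoothness quantifies over all finite lists of directions; one invariant family closed
  under \<open>dd\<close> replaces an induction on lists in every later proof.\<close>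

lemma smooth_coinduct:
 assumes "f : S" "!!f z. f : S ==> f differentiable (at z)" "!!f v. f : S ==> dd v f : S"
 shows "smooth f"
proof -
 have "iter_deriv vs f : S" for vs by (induction vs) (use assms in "auto simp: iter_deriv_Cons simp del: iter_deriv.simps(2)")
 thus ?thesis using assms(2) by (auto simp: smooth_def)
qed

lemma smooth_differentiable: "smooth f ==> f differentiable (at z)" unfolding smooth_def by (metis iter_deriv.simps(1))

lemma iter_deriv_append: "iter_deriv (vs @ ws) f = iter_deriv vs (iter_deriv ws f)" by (induction vs) auto

lemma smooth_iter_deriv: "smooth f ==> smooth (iter_deriv vs f)" unfolding smooth_def by (metis iter_deriv_append)

lemma smooth_dd: "smooth f ==> smooth (dd v f)" using smooth_iter_deriv[of f "[v]"] by (simp add: dd_def[abs_def])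

lemma smooth_has_derivative: "smooth f ==> (f has_derivative (%v. dd v f z)) (at z)"
 unfolding dd_def using smooth_differentiable[of f z] frechet_derivative_works[of f "at z"] by (simp add: eta_contract_eq)

lemma smooth_continuous_on: "smooth f ==> continuous_on S f" by (metis continuous_at_imp_continuous_on differentiable_imp_continuous_within smooth_differentiable)

lemma smooth_const: "smooth (%_. c)"
proof (rule smooth_coinduct[of _ "{%_. c | c. True}"])
 fix f :: "'a => real" and v z assume "f : {%_. c | c. True}"
 then obtain c where f: "f = (%_. c)" by blast
 show "f differentiable (at z)" unfolding f by simp
 show "dd v f : {%_. c | c. True}"
 proof -
  have "dd v f = (%_. 0)" unfolding f by (rule ext, rule dd_eq[where D="%_. 0"], rule has_derivative_const)
  thus ?thesis by blast
 qed
qed blast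

lemma dd_mult: "smooth f ==> smooth g ==> dd v (%z. f z * g z) = (%z. f z * dd v g z + dd v f z * g z)"
 by (rule ext, rule dd_eq[OF has_derivative_mult[OF smooth_has_derivative smooth_has_derivative]])

text \<open>The product rule leads out of the set of products of two smooth functions, so the
  invariant family for sums and products is the whole algebra generated by smooth functions.\<close>

inductive_set smooth_alg :: "('a::euclidean_space => real) set" where
 base: "smooth f ==> f : smooth_alg"
| add: "f : smooth_alg ==> g : smooth_alg ==> (%z. f z + g z) : smooth_alg"
| mult: "f : smooth_alg ==> g : smooth_alg ==> (%z. f z * g z) : smooth_alg"

lemma smooth_alg_deriv:
 "f : smooth_alg ==> (ALL z. f differentiable (at z)) & (ALL v. dd v f : smooth_alg)"
proof (induction rule: smooth_alg.induct)
 case (base f)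
 thus ?case by (auto intro: smooth_differentiable smooth_alg.base smooth_dd)
next
 case (add f g)
 have d: "((%z. f z + g z) has_derivative (%v. dd v f z + dd v g z)) (at z)" for z
  unfolding dd_def by (rule has_derivative_add) (use add frechet_derivative_works in blast)+
 have "dd v (%z. f z + g z) = (%z. dd v f z + dd v g z)" for v by (rule ext) (rule dd_eq[OF d])
 hence "dd v (%z. f z + g z) : smooth_alg" for v using smooth_alg.add[of "dd v f" "dd v g"] add by simp
 thus ?case using d unfolding differentiable_def by blast
next
 case (mult f g)
 have d: "((%z. f z * g z) has_derivative (%v. f z * dd v g z + dd v f z * g z)) (at z)" for z
  unfolding dd_def by (rule has_derivative_mult) (use mult frechet_derivative_works in blast)+
 have "dd v (%z. f z * g z) = (%z. f z * dd v g z + dd v f z * g z)" for v by (rule ext) (rule dd_eq[OF d])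
 hence "dd v (%z. f z * g z) : smooth_alg" for v using smooth_alg.add[OF smooth_alg.mult[of f "dd v g"] smooth_alg.mult[of "dd v f" g]] mult by simp
 thus ?case using d unfolding differentiable_def by blast
qed

lemma smooth_alg_smooth: "f : smooth_alg ==> smooth f" by (erule smooth_coinduct) (use smooth_alg_deriv in blast)+

lemma smooth_add: "smooth f ==> smooth g ==> smooth (%z. f z + g z)" by (rule smooth_alg_smooth[OF smooth_alg.add[OF smooth_alg.base smooth_alg.base]])

lemma smooth_mult: "smooth f ==> smooth g ==> smooth (%z. f z * g z)" by (rule smooth_alg_smooth[OF smooth_alg.mult[OF smooth_alg.base smooth_alg.base]])

lemma smooth_diff: "smooth f ==> smooth g ==> smooth (%z. f z - g z)" using smooth_add[of f "%z. -1 * g z"] smooth_mult[OF smooth_const[of "-1"], of g] by simp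

lemma smooth_sum: "finite I ==> (!!i. i : I ==> smooth (f i)) ==> smooth (%z. SUM i:I. f i z)"
 by (induction rule: finite_induct) (auto intro: smooth_const smooth_add)

lemma smooth_prod: "finite I ==> (!!i. i : I ==> smooth (f i)) ==> smooth (%z. PROD i:I. f i z)"
 by (induction rule: finite_induct) (auto intro: smooth_const smooth_mult)

lemma smooth_power: "smooth f ==> smooth (%z. f z ^ k)" by (induction k) (auto intro: smooth_const smooth_mult)

lemma has_derivative_affine:
 assumes "smooth f" "bounded_linear L"
 shows "((%x. f (L x + c)) has_derivative (%v. dd (L v) f (L z + c))) (at z)"
proof -
 have "((%x. L x + c) has_derivative L) (at z)" using bounded_linear_imp_has_derivative[OF assms(2)] by (auto intro!: derivative_eq_intros)
 from has_derivative_compose[OF this smooth_has_derivative[OF assms(1)]] show ?thesis .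
qed

lemma smooth_affine:
 fixes L :: "'a::euclidean_space => 'b::euclidean_space"
 assumes "smooth f" "bounded_linear L" shows "smooth (%x. f (L x + c))"
proof (rule smooth_coinduct[of _ "{%x. f (L x + c) | f. smooth f}"])
 show "(%x. f (L x + c)) : {%x. f (L x + c) | f. smooth f}" using assms by blast
next
 fix g :: "'a => real" and z v assume "g : {%x. f (L x + c) | f. smooth f}"
 then obtain f where g: "g = (%x. f (L x + c))" "smooth f" by blast
 show "g differentiable (at z)" unfolding g differentiable_def using has_derivative_affine[OF g(2) assms(2)] by blast
 have "dd v g = (%x. dd (L v) f (L x + c))" unfolding g by (rule ext, rule dd_eq[OF has_derivative_affine[OF g(2) assms(2)]])
 thus "dd v g : {%x. f (L x + c) | f. smooth f}" using smooth_dd[OF g(2)] by blast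
qed

lemma dd_affine:
 assumes "smooth f" "bounded_linear L" shows "dd v (%x. f (L x + c)) = (%x. dd (L v) f (L x + c))" by (rule ext, rule dd_eq[OF has_derivative_affine[OF assms]])

lemma smooth_inner: "smooth (%x. x \<bullet> e)"
proof (rule smooth_coinduct[of _ "{%x. x \<bullet> e} Un {%_. c | c. True}"])
 fix g :: "'a => real" and z v assume "g : {%x. x \<bullet> e} Un {%_. c | c. True}"
 then consider "g = (%x. x \<bullet> e)" | c where "g = (%_. c)" by blast
 hence "g differentiable (at z) & dd v g : {%x. x \<bullet> e} Un {%_. c | c. True}"
 proof cases
  case 1
  have d: "(g has_derivative (%x. x \<bullet> e)) (at z)" for z unfolding 1 by (rule bounded_linear_imp_has_derivative[OF bounded_linear_inner_left])
  hence "dd v g = (%_. v \<bullet> e)" by (intro ext dd_eq[OF d])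
  thus ?thesis using d unfolding differentiable_def by blast
 next
  case 2
  have "dd v g = (%_. 0)" unfolding 2 by (rule ext, rule dd_eq[where D="%_. 0"], rule has_derivative_const)
  moreover have "g differentiable (at z)" unfolding 2 by simp
  ultimately show ?thesis by blast
 qed
 thus "g differentiable (at z)" "dd v g : {%x. x \<bullet> e} Un {%_. c | c. True}" by blast+
qed blast

text \<open>The functions f (1/g)^k form a family closed under differentiation, with k raised by
  one; \<open>smooth_inverse\<close> uses it as its invariant.\<close>

lemma dd_inverse:
 assumes "smooth g" "smooth f" "!!z. g z > 0"
 shows "((%z. f z * (1 / g z) ^ k) has_derivative
     (%v. (dd v f z * g z - real k * f z * dd v g z) * (1 / g z) ^ (Suc k))) (at z)"
proof -
 have p: "g z ~= 0" using assms(3)[of z] by simp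
 have d: "((%z. 1 / g z) has_derivative (%v. - dd v g z * (1 / g z)^2)) (at z)"
  by (rule derivative_eq_intros smooth_has_derivative assms p refl | simp add: p power2_eq_square)+
 have "((%z. f z * (1 / g z) ^ k) has_derivative (%v. f z * (real k * (- dd v g z * (1 / g z)^2) * (1 / g z) ^ (k - 1)) +
   dd v f z * (1 / g z) ^ k)) (at z)" using has_derivative_mult[OF smooth_has_derivative[OF assms(2)] has_derivative_power[OF d, of k]] by (simp add: mult_ac)
 moreover have "f z * (real k * (- dd v g z * (1 / g z)^2) * (1 / g z) ^ (k - 1)) + dd v f z * (1 / g z) ^ k
  = (dd v f z * g z - real k * f z * dd v g z) * (1 / g z) ^ (Suc k)" for v using p by (cases k) (auto simp: field_simps power2_eq_square)
 ultimately show ?thesis by simp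
qed

lemma smooth_inverse:
 assumes "smooth g" "!!z. g z > 0" shows "smooth (%z. 1 / g z)"
proof (rule smooth_coinduct[of _ "{%z. f z * (1 / g z) ^ k | f k. smooth f}"])
 show "(%z. 1 / g z) : {%z. f z * (1 / g z) ^ k | f k. smooth f}" by (rule CollectI, rule exI[of _ "%_. 1"], rule exI[of _ 1]) (auto intro: smooth_const)
next
 fix h :: "'a => real" and z v assume "h : {%z. f z * (1 / g z) ^ k | f k. smooth f}"
 then obtain f k where h: "h = (%z. f z * (1 / g z) ^ k)" "smooth f" by blast
 note d = dd_inverse[OF assms(1) h(2) assms(2), where k=k, folded h(1)]
 show "h differentiable (at z)" using d[of z] by (auto simp: differentiable_def)
 have "dd v h = (%z. (dd v f z * g z - real k * f z * dd v g z) * (1 / g z) ^ (Suc k))" by (rule ext, rule dd_eq[OF d])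
 moreover have "smooth (%z. dd v f z * g z - real k * f z * dd v g z)" by (intro smooth_diff smooth_mult smooth_dd h assms smooth_const)
 ultimately show "dd v h : {%z. f z * (1 / g z) ^ k | f k. smooth f}"
  by (intro CollectI exI[of _ "%z. dd v f z * g z - real k * f z * dd v g z"] exI[of _ "Suc k"]) simp
qed

subsection \<open>A smooth step function\<close>

text \<open>With s = 1/x, the flat function exp(-s) and all its derivatives have the form poly(s)
  exp(-s); carrying the polynomial along closes the family under differentiation.\<close>

definition flat_exp :: "real poly => real => real" where
 "flat_exp p x = (if x > 0 then poly p (1/x) * exp (- (1/x)) else 0)"

lemma poly_exp_tendsto_0: "((%y. poly p y * exp (- y)) \<longlongrightarrow> (0::real)) at_top"
proof -
 have "((%y. SUM i<=degree p. coeff p i * (y ^ i / exp y)) \<longlongrightarrow> (SUM i<=degree p. coeff p i * 0)) at_top"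
  by (intro tendsto_sum tendsto_mult tendsto_const tendsto_power_div_exp_0)
 thus ?thesis by (simp add: poly_altdef sum_distrib_right exp_minus divide_inverse mult.assoc)
qed

text \<open>In s = 1/x one has d/dx = -s^2 d/ds, hence p becomes s^2 (p - p'), the product with
  \<open>[:0,0,1:]\<close>. At 0 the right difference quotient is s p(s) exp(-s), which tends to
  0.\<close>

lemma flat_exp_deriv:
 "(flat_exp p has_real_derivative flat_exp ([:0,0,1:] * (p - pderiv p)) x) (at x)"
proof -
 consider "x > 0" | "x < 0" | "x = 0" by linarith
 thus ?thesis
 proof cases
  case 1
  have "((%x. poly p (1/x) * exp (- (1/x))) has_real_derivative flat_exp ([:0,0,1:] * (p - pderiv p)) x) (at x)"
   using 1 by (auto intro!: derivative_eq_intros DERIV_chain2[OF poly_DERIV] simp: flat_exp_def field_simps power2_eq_square)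
  thus ?thesis by (rule has_field_derivative_transform_within_open[where S="{0<..}"]) (use 1 in "auto simp: flat_exp_def")
 next
  case 2
  have "((%x. 0) has_real_derivative flat_exp ([:0,0,1:] * (p - pderiv p)) x) (at x)" using 2 by (auto simp: flat_exp_def)
  thus ?thesis by (rule has_field_derivative_transform_within_open[where S="{..<0}"]) (use 2 in "auto simp: flat_exp_def")
 next
  case 3
  have "((%y. poly (pCons 0 p) y * exp (- y)) \<longlongrightarrow> (0::real)) at_top" by (rule poly_exp_tendsto_0)
  hence "((%h. poly (pCons 0 p) (inverse h) * exp (- inverse h)) \<longlongrightarrow> (0::real)) (at_right 0)"
   by (rule filterlim_compose) (rule filterlim_inverse_at_top_right)
  hence r: "((%h. flat_exp p h / h) \<longlongrightarrow> 0) (at_right 0)"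
   by (rule Lim_transform_eventually) (auto simp: eventually_at_filter flat_exp_def field_simps)
  have l: "((%h. flat_exp p h / h) \<longlongrightarrow> 0) (at_left 0)"
   by (rule Lim_transform_eventually[OF tendsto_const]) (auto simp: eventually_at_filter flat_exp_def)
  have "((%h. flat_exp p h / h) \<longlongrightarrow> 0) (at 0)" using l r by (simp add: filterlim_split_at)
  thus ?thesis unfolding 3 DERIV_def by (simp add: flat_exp_def)
 qed
qed

lemma smooth_flat_exp: "smooth (flat_exp p)"
proof (rule smooth_coinduct[of _ "{%x. c * flat_exp p x | c p. True}"])
 show "flat_exp p : {%x. c * flat_exp p x | c p. True}" by (rule CollectI, rule exI[of _ 1], rule exI[of _ p]) auto
next
 fix h :: "real => real" and z v assume "h : {%x. c * flat_exp p x | c p. True}"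
 then obtain c p where h: "h = (%x. c * flat_exp p x)" by blast
 have d: "(h has_derivative (%v. c * (flat_exp ([:0,0,1:] * (p - pderiv p)) z * v))) (at z)" for z
  unfolding h using flat_exp_deriv[of p z] by (intro has_derivative_mult_right) (simp add: has_field_derivative_def)
 show "h differentiable (at z)" using d[of z] by (auto simp: differentiable_def)
 have "dd v h = (%z. (c * v) * flat_exp ([:0,0,1:] * (p - pderiv p)) z)" by (rule ext, subst dd_eq[OF d]) simp
 thus "dd v h : {%x. c * flat_exp p x | c p. True}" by blast
qed

text \<open>A smooth transition from 0 left of -1 to 1 right of 1. Box cut-offs are products of it,
  and its derivative is the one-dimensional mollifier.\<close>

definition step :: "real => real" where
 "step x = flat_exp 1 (x + 1) / (flat_exp 1 (x + 1) + flat_exp 1 (1 - x))"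

lemma flat_exp_1: "flat_exp 1 x >= 0" "x > 0 ==> flat_exp 1 x > 0" "x <= 0 ==> flat_exp 1 x = 0" by (auto simp: flat_exp_def)

lemma step_denominator_pos: "flat_exp 1 (x + 1) + flat_exp 1 (1 - x) > 0"
 using flat_exp_1(1)[of "x+1"] flat_exp_1(1)[of "1-x"] flat_exp_1(2)[of "x+1"] flat_exp_1(2)[of "1-x"]
 by (cases "x + 1 > 0") (auto intro: add_pos_nonneg add_nonneg_pos)

lemma smooth_step: "smooth step"
proof -
 have "smooth (%x. flat_exp 1 (x + 1))" using smooth_affine[OF smooth_flat_exp bounded_linear_ident] by simp
 moreover have "smooth (%x::real. flat_exp 1 (1 - x))"
  using smooth_affine[OF smooth_flat_exp bounded_linear_minus[OF bounded_linear_ident], of 1 1] by (simp add: algebra_simps)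
 ultimately have "smooth (%x. flat_exp 1 (x + 1) * (1 / (flat_exp 1 (x + 1) + flat_exp 1 (1 - x))))"
  by (intro smooth_mult smooth_inverse smooth_add step_denominator_pos)
 thus ?thesis by (simp add: step_def[abs_def])
qed

lemma step_range: "0 <= step x" "step x <= 1" using step_denominator_pos[of x] flat_exp_1(1)[of "x+1"] flat_exp_1(1)[of "1-x"] by (auto simp: step_def divide_simps)

lemma step_eq: "x <= -1 ==> step x = 0" "x >= 1 ==> step x = 1"
 using step_denominator_pos[of x] flat_exp_1(3)[of "x+1"] flat_exp_1(3)[of "1-x"] by (auto simp: step_def divide_simps)

subsection \<open>Equality of mixed derivatives\<close>

lemma dd_line:
 assumes "smooth f" shows "((%t. f (z + t *\<^sub>R v)) has_real_derivative dd v f (z + t *\<^sub>R v)) (at t)"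
proof -
 have d: "((%t. z + t *\<^sub>R v) has_derivative (%s. s *\<^sub>R v)) (at t)" by (auto intro!: derivative_eq_intros)
 have "((%t. f (z + t *\<^sub>R v)) has_derivative (%s. dd (s *\<^sub>R v) f (z + t *\<^sub>R v))) (at t)"
  using has_derivative_compose[OF d smooth_has_derivative[OF assms]] .
 moreover have "dd (s *\<^sub>R v) f w = dd v f w * s" for s w using linear_cmul[OF has_derivative_linear[OF smooth_has_derivative[OF assms]], of s v w] by simp
 ultimately show ?thesis by (simp add: has_field_derivative_def mult_commute_abs)
qed

text \<open>The mean value theorem, used first along \<open>u\<close> and then along
  \<open>v\<close>, gives a mixed derivative in one order, while the second difference is symmetric
  in \<open>u\<close> and \<open>v\<close>; letting h tend to 0 therefore exchanges the
  derivatives.\<close>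

lemma second_difference:
 assumes f: "smooth f" and h: "h > 0"
 shows "EX s t. 0 < s & s < h & 0 < t & t < h &
  f (z + h *\<^sub>R u + h *\<^sub>R v) - f (z + h *\<^sub>R u) - f (z + h *\<^sub>R v) + f z
   = h * h * dd v (dd u f) (z + s *\<^sub>R u + t *\<^sub>R v)"
proof -
 let ?g = "%s. f (z + h *\<^sub>R v + s *\<^sub>R u) - f (z + s *\<^sub>R u)"
 have "EX s. 0 < s & s < h & ?g h - ?g 0 = (h - 0) * (dd u f (z + h *\<^sub>R v + s *\<^sub>R u) - dd u f (z + s *\<^sub>R u))"
  by (rule MVT2[OF h]) (auto intro!: derivative_intros dd_line[OF f])
 then obtain s where s: "0 < s" "s < h"
  "?g h - ?g 0 = h * (dd u f (z + h *\<^sub>R v + s *\<^sub>R u) - dd u f (z + s *\<^sub>R u))" by auto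
 let ?k = "%t. dd u f (z + s *\<^sub>R u + t *\<^sub>R v)"
 have "EX t. 0 < t & t < h & ?k h - ?k 0 = (h - 0) * dd v (dd u f) (z + s *\<^sub>R u + t *\<^sub>R v)"
  by (rule MVT2[OF h]) (auto intro!: derivative_intros dd_line[OF smooth_dd[OF f]])
 then obtain t where "0 < t" "t < h" "?k h - ?k 0 = h * dd v (dd u f) (z + s *\<^sub>R u + t *\<^sub>R v)" by auto
 thus ?thesis using s by (intro exI[of _ s] exI[of _ t]) (simp add: algebra_simps)
qed

lemma second_difference_tendsto:
 assumes f: "smooth f"
 shows "(%m. (f (z + (1/Suc m) *\<^sub>R u + (1/Suc m) *\<^sub>R v) - f (z + (1/Suc m) *\<^sub>R u) - f (z + (1/Suc m) *\<^sub>R v) + f z) * (real (Suc m))^2)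
     \<longlonglongrightarrow> dd v (dd u f) z"
proof -
 have "ALL m. EX s t. 0 < s & s < 1/Suc m & 0 < t & t < 1/Suc m &
  f (z + (1/Suc m) *\<^sub>R u + (1/Suc m) *\<^sub>R v) - f (z + (1/Suc m) *\<^sub>R u) - f (z + (1/Suc m) *\<^sub>R v) + f z
   = (1/Suc m) * (1/Suc m) * dd v (dd u f) (z + s *\<^sub>R u + t *\<^sub>R v)" by (intro allI second_difference[OF f]) simp
 then obtain s t where st: "!!m. 0 < s m & s m < 1/Suc m & 0 < t m & t m < 1/Suc m &
  f (z + (1/Suc m) *\<^sub>R u + (1/Suc m) *\<^sub>R v) - f (z + (1/Suc m) *\<^sub>R u) - f (z + (1/Suc m) *\<^sub>R v) + f z
   = (1/Suc m) * (1/Suc m) * dd v (dd u f) (z + s m *\<^sub>R u + t m *\<^sub>R v)" by metis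
 have i: "(%m. 1 / real (Suc m)) \<longlonglongrightarrow> 0" using LIMSEQ_inverse_real_of_nat by (simp add: inverse_eq_divide)
 have s0: "s \<longlonglongrightarrow> 0" by (rule tendsto_sandwich[OF _ _ tendsto_const i]) (use st less_imp_le in "auto intro!: always_eventually")
 have t0: "t \<longlonglongrightarrow> 0" by (rule tendsto_sandwich[OF _ _ tendsto_const i]) (use st less_imp_le in "auto intro!: always_eventually")
 have "isCont (dd v (dd u f)) z" using smooth_continuous_on[OF smooth_dd[OF smooth_dd[OF f]], of UNIV] by (simp add: continuous_on_eq_continuous_at)
 moreover have "(%m. z + s m *\<^sub>R u + t m *\<^sub>R v) \<longlonglongrightarrow> z"
  using tendsto_add[OF tendsto_add[OF tendsto_const[of z] tendsto_scaleR[OF s0 tendsto_const[of u]]] tendsto_scaleR[OF t0 tendsto_const[of v]]] by simp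
 ultimately have "(%m. dd v (dd u f) (z + s m *\<^sub>R u + t m *\<^sub>R v)) \<longlonglongrightarrow> dd v (dd u f) z" by (rule isCont_tendsto_compose)
 moreover have "(f (z + (1/Suc m) *\<^sub>R u + (1/Suc m) *\<^sub>R v) - f (z + (1/Suc m) *\<^sub>R u) - f (z + (1/Suc m) *\<^sub>R v) + f z) * (real (Suc m))^2
  = dd v (dd u f) (z + s m *\<^sub>R u + t m *\<^sub>R v)" for m using st[of m] by (simp add: power2_eq_square)
 ultimately show ?thesis by simp
qed

lemma dd_commute: assumes "smooth f" shows "dd v (dd u f) = dd u (dd v f)"
proof
 fix z
 show "dd v (dd u f) z = dd u (dd v f) z" using second_difference_tendsto[OF assms, of z u v] second_difference_tendsto[OF assms, of z v u]
  by (intro LIMSEQ_unique) (auto simp: algebra_simps)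
qed

subsection \<open>Test functions\<close>

lemma test_functionI:
 assumes "smooth f" "compact K" "K <= U" "!!z. z ~: K ==> f z = 0"
 shows "test_function U f"
proof -
 have "closure {z. f z ~= 0} <= K" by (rule closure_minimal) (use assms(4) compact_imp_closed[OF assms(2)] in auto)
 thus ?thesis unfolding test_function_def using assms(1-3) compact_Int_closed[OF assms(2) closed_closure, of "{z. f z ~= 0}"] by (auto simp: Int_absorb1)
qed

lemma test_functionE:
 assumes "test_function U f"
 obtains K where "smooth f" "compact K" "K <= U" "!!z. z ~: K ==> f z = 0"
proof (rule that[of "closure {z. f z ~= 0}"])
 show "f z = 0" if "z ~: closure {z. f z ~= 0}" for z using that closure_subset[of "{z. f z ~= 0}"] by auto
qed (use assms in "auto simp: test_function_def")

lemma test_function_smooth: "test_function U f ==> smooth f" by (simp add: test_function_def)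

lemma test_function_mono: "test_function U f ==> U <= V ==> test_function V f" by (auto simp: test_function_def)

lemma test_function_mult: assumes "test_function U f" "smooth g" shows "test_function U (%z. f z * g z)"
 using assms(1) by (rule test_functionE) (rule test_functionI, auto intro: smooth_mult assms)

lemma test_function_mult2: assumes "test_function U f" "smooth g" shows "test_function U (%z. g z * f z)"
 using test_function_mult[OF assms] by (simp add: mult.commute)

lemma dd_eq_0_outside: assumes "closed K" "!!z. z ~: K ==> f z = 0" "z ~: K" shows "dd v f z = 0"
proof -
 have "(f has_derivative (%_. 0)) (at z)" by (rule has_derivative_transform_within_open[OF has_derivative_const[of 0], of "- K"]) (use assms in auto)
 thus ?thesis using dd_eq[of f "%_. 0"] by simp
qed

lemma test_function_dd: assumes "test_function U f" shows "test_function U (dd v f)" using assms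
proof (rule test_functionE)
 fix K assume K: "smooth f" "compact K" "K <= U" "!!z. z ~: K ==> f z = 0"
 show ?thesis by (rule test_functionI[OF smooth_dd[OF K(1)] K(2,3)])
  (rule dd_eq_0_outside[OF compact_imp_closed[OF K(2)] K(4)], auto)
qed

lemma compact_support_bounded:
 assumes "compact K" "!!z. z ~: K ==> f z = 0" "continuous_on UNIV (f :: 'a::euclidean_space => real)"
 obtains B where "B >= 0" "!!z. abs (f z) <= B"
proof -
 have "compact (f ` K)" by (rule compact_continuous_image[OF continuous_on_subset[OF assms(3)] assms(1)]) simp
 then obtain B where B: "!!y. y : f ` K ==> norm y <= B" using compact_imp_bounded bounded_iff by metis
 have "abs (f z) <= max 0 B" for z using B[of "f z"] assms(2)[of z] by (cases "z : K") (auto intro: order_trans)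
 thus ?thesis using that[of "max 0 B"] by auto
qed

lemma test_function_bounded:
 assumes "test_function U f" obtains B where "B >= 0" "!!z. abs (f z) <= B" using assms by (metis test_functionE compact_support_bounded smooth_continuous_on)

lemma compact_support_integrable:
 assumes "compact K" "!!z. z ~: K ==> f z = 0" "continuous_on UNIV (f :: 'a::euclidean_space => real)"
 shows "integrable lborel f"
proof -
 have "integrable lborel (%x. indicator K x *\<^sub>R f x)" by (rule borel_integrable_compact[OF assms(1) continuous_on_subset[OF assms(3)]]) simp
 moreover have "(%x. indicator K x *\<^sub>R f x) = f" by (intro ext) (use assms(2) in "auto simp: indicator_def")
 ultimately show ?thesis by simp
qed

lemma test_function_integrable: "test_function U f ==> integrable lborel f" by (metis test_functionE compact_support_integrable smooth_continuous_on)

lemma smooth_borel [measurable (raw)]: "smooth f ==> f : borelf" by (simp add: borel_measurable_continuous_onI smooth_continuous_on)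

text \<open>Translation invariance makes every difference quotient integrate to zero; the quotients
  are uniformly bounded and supported in one ball, so dominated convergence passes this on to the
  derivative. All integrations by parts with smooth functions rest on it.\<close>

lemma test_function_integral_dd:
 assumes "test_function U f" shows "(LINT z|lborel. dd v f z) = 0" using assms
proof (rule test_functionE)
 fix K assume K: "smooth f" "compact K" "K <= U" "!!z. z ~: K ==> f z = 0"
 obtain r where r: "r > 0" "K <= ball 0 r" using bounded_subset_ballD[OF compact_imp_bounded[OF K(2)]] by metis
 obtain B where B: "B >= 0" "!!z. abs (dd v f z) <= B" using test_function_bounded[OF test_function_dd[OF assms]] by metis
 define q where "q m z = (f (z + (1 / Suc m) *\<^sub>R v) - f z) * real (Suc m)" for m z
 have fb[measurable]: "f : borelf" by (rule smooth_borel[OF K(1)])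
 have fi: "integrable lborel f" by (rule test_function_integrable[OF assms])
 have q0: "(LINT z|lborel. q m z) = 0" for m
 proof -
  let ?c = "(1 / Suc m) *\<^sub>R v"
  have i: "integrable lborel (%z. f (?c + z))" by (rule integrable_distr[where M'=borel]) (use fi in "auto simp: lborel_distr_plus")
  have "(LINT z|lborel. f (?c + z)) = (LINT z|distr lborel borel ((+) ?c). f z)" by (rule integral_distr[symmetric]) auto
  hence "(LINT z|lborel. f (?c + z)) = (LINT z|lborel. f z)" by (simp add: lborel_distr_plus)
  thus ?thesis unfolding q_def using i fi by (simp add: add.commute)
 qed
 have mvt: "EX t. q m z = dd v f (z + t *\<^sub>R v)" for m z
 proof -
  have "EX t. 0 < t & t < 1 / Suc m & f (z + (1 / Suc m) *\<^sub>R v) - f (z + 0 *\<^sub>R v) = (1 / Suc m - 0) * dd v f (z + t *\<^sub>R v)"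
   by (rule MVT2) (auto intro!: dd_line[OF K(1)])
  thus ?thesis unfolding q_def by auto
 qed
 have qb: "abs (q m z) <= B" for m z using mvt[of m z] B(2) by auto
 have q_out: "q m z = 0" if "z ~: cball 0 (r + norm v)" for m z
 proof -
  have "norm z > r + norm v" using that by simp
  moreover have "norm ((1 / Suc m) *\<^sub>R v) <= norm v" by (simp add: field_simps)
  moreover have "norm z - norm ((1 / Suc m) *\<^sub>R v) <= norm (z + (1 / Suc m) *\<^sub>R v)" by (rule norm_diff_ineq)
  ultimately have "norm (z + (1 / Suc m) *\<^sub>R v) > r" "norm z > r" using norm_ge_zero[of v] by linarith+
  hence "z + (1 / Suc m) *\<^sub>R v ~: K" "z ~: K" using r(2) by fastforce+
  thus ?thesis unfolding q_def using K(4) by auto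
 qed
 have lim: "(%m. q m z) \<longlonglongrightarrow> dd v f z" for z
 proof -
  have "((%h. (f (z + h *\<^sub>R v) - f z) / h) \<longlongrightarrow> dd v f z) (at 0)" using dd_line[OF K(1), of z v 0] by (simp add: DERIV_def)
  moreover have "filterlim (%m. 1 / real (Suc m)) (at 0) sequentially" using LIMSEQ_inverse_real_of_nat by (auto simp: filterlim_at inverse_eq_divide)
  ultimately show ?thesis unfolding q_def by (auto dest: filterlim_compose simp: field_simps)
 qed
 have "(%m. LINT z|lborel. q m z) \<longlonglongrightarrow> (LINT z|lborel. dd v f z)"
 proof (rule integral_dominated_convergence[where w="%z. indicator (cball 0 (r + norm v)) z * B"])
  show "dd v f : borel_measurable lborel" using smooth_borel[OF smooth_dd[OF K(1)]] by simp
  show "q m : borel_measurable lborel" for m unfolding q_def[abs_def] by measurable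
  show "integrable lborel (%z. indicator (cball 0 (r + norm v)) z * B)"
   using borel_integrable_compact[OF compact_cball continuous_on_const, of 0 "r + norm v" B] by simp
  show "AE z in lborel. norm (q m z) <= indicator (cball 0 (r + norm v)) z * B" for m by (rule AE_I2) (use qb q_out B(1) in "auto simp: indicator_def")
 qed (use lim in auto)
 thus ?thesis unfolding q0 by (simp add: LIMSEQ_const_iff)
qed

subsection \<open>The fundamental lemma of the calculus of variations\<close>

text \<open>The shift by 2 puts the transition of each factor between the distances 1/m and 3/m from
  a face: the product vanishes closer than 1/m, equals 1 beyond 3/m, and tends to the indicator of
  the open box.\<close>

definition box_bump :: "nat => 'a::euclidean_space => 'a => 'a => real" where
 "box_bump m a b z = (PROD e:Basis. step (real m * (z \<bullet> e - a \<bullet> e) - 2) * step (real m * (b \<bullet> e - z \<bullet> e) - 2))"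

lemma smooth_box_bump: "smooth (box_bump m a b)"
proof -
 have "smooth (%z. step (real m * (z \<bullet> e - a \<bullet> e) - 2))" for e
  using smooth_affine[OF smooth_step, of "%z. real m * (z \<bullet> e)" "- real m * (a \<bullet> e) - 2"] by (simp add: bounded_linear_intros algebra_simps)
 moreover have "smooth (%z. step (real m * (b \<bullet> e - z \<bullet> e) - 2))" for e
  using smooth_affine[OF smooth_step, of "%z. - (real m * (z \<bullet> e))" "real m * (b \<bullet> e) - 2"]
  by (simp add: bounded_linear_intros bounded_linear_minus algebra_simps)
 ultimately show ?thesis unfolding box_bump_def[abs_def] by (intro smooth_prod smooth_mult) auto
qed

lemma box_bump_range: "0 <= box_bump m a b z" "box_bump m a b z <= 1"
 unfolding box_bump_def by (auto intro!: prod_nonneg prod_le_1 mult_le_one step_range mult_nonneg_nonneg)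

lemma box_bump_outside:
 assumes "m > 0" "z ~: cbox (a + (1/m) *\<^sub>R One) (b - (1/m) *\<^sub>R One)" shows "box_bump m a b z = 0"
proof -
 obtain e where e: "e : Basis" "z \<bullet> e < a \<bullet> e + 1/m | z \<bullet> e > b \<bullet> e - 1/m" using assms(2) by (force simp: mem_box inner_simps)
 hence "real m * (z \<bullet> e - a \<bullet> e) - 2 <= -1 | real m * (b \<bullet> e - z \<bullet> e) - 2 <= -1" using assms(1) by (auto simp: field_simps)
 hence "step (real m * (z \<bullet> e - a \<bullet> e) - 2) * step (real m * (b \<bullet> e - z \<bullet> e) - 2) = 0" using step_eq(1) by fastforce
 thus ?thesis unfolding box_bump_def using e(1) by (intro prod_zero) auto
qed

lemma box_bump_test: assumes "m > 0" shows "test_function (box a b) (box_bump m a b)"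
proof (rule test_functionI[OF smooth_box_bump compact_cbox])
 show "cbox (a + (1/m) *\<^sub>R One) (b - (1/m) *\<^sub>R One) <= box a b"
 proof
  fix x assume x: "x : cbox (a + (1/m) *\<^sub>R One) (b - (1/m) *\<^sub>R One)"
  have "0 < 1 / real m" using assms by simp
  show "x : box a b" unfolding mem_box
  proof
   fix i :: 'a assume i: "i : Basis"
   hence "(a + (1/m) *\<^sub>R One) \<bullet> i <= x \<bullet> i" "x \<bullet> i <= (b - (1/m) *\<^sub>R One) \<bullet> i" using x by (auto simp: mem_box)
   hence "a \<bullet> i + 1/m <= x \<bullet> i" "x \<bullet> i <= b \<bullet> i - 1/m" using i by (simp_all add: inner_simps)
   thus "a \<bullet> i < x \<bullet> i & x \<bullet> i < b \<bullet> i" using \<open>0 < 1 / real m\<close> by linarith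
  qed
 qed
qed (use box_bump_outside[OF assms] in auto)

lemma box_bump_tendsto: "(%m. box_bump m a b z) \<longlonglongrightarrow> indicator (box a b) z"
proof (cases "z : box a b")
 case True
 have s: "(%m. step (real m * c - 2)) \<longlonglongrightarrow> 1" if "c > 0" for c
 proof (rule tendsto_eventually)
  have "filterlim (%m. real m * c - 2) at_top sequentially" using that by real_asymp
  thus "\<forall>\<^sub>F m in sequentially. step (real m * c - 2) = 1" using step_eq(2) by (auto simp: filterlim_at_top elim!: allE[of _ 1] eventually_mono)
 qed
 have "(%m. box_bump m a b z) \<longlonglongrightarrow> (PROD e:(Basis::'a set). 1 * 1)"
  unfolding box_bump_def by (intro tendsto_prod tendsto_mult s) (use True in "auto simp: mem_box")
 thus ?thesis using True by simp
next
 case False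
 have "\<forall>\<^sub>F m in sequentially. box_bump m a b z = 0"
 proof (rule eventually_mono[OF eventually_gt_at_top[of 0]])
  fix m :: nat assume "m > 0"
  from box_bump_test[OF this, of a b] show "box_bump m a b z = 0" using False by (auto elim!: test_functionE)
 qed
 thus ?thesis using False by (simp add: tendsto_eventually)
qed

lemma integrable_indicator_times:
 "A : sets M ==> integrable M f ==> integrable M (%x. indicator A x * f x :: real)" using integrable_mult_indicator[of A M f] by simp

text \<open>The positive and the negative part of g are densities of two measures that agree on
  boxes, an intersection-stable generator; so the measures agree, and then the densities.\<close>

lemma integral_boxes_zero_AE:
 fixes g :: "'a::euclidean_space => real"
 assumes g: "integrable lborel g" and z: "!!a b. (LINT z|lborel. indicator (box a b) z * g z) = 0"
 shows "AE z in lborel. g z = 0"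
proof -
 have [measurable]: "g : borelf" using g by auto
 define D where "D s = density lborel (%z. ennreal (max 0 (s * g z)))" for s
 have ii: "integrable lborel (%z. indicator (box a b) z * max 0 (s * g z))" for a b s using g by (intro integrable_indicator_times integrable_max) auto
 have em: "emeasure (D s) (box a b) = ennreal (LINT z|lborel. indicator (box a b) z * max 0 (s * g z))" for s a b
 proof -
  have "emeasure (D s) (box a b) = (NN z. ennreal (max 0 (s * g z)) * indicator (box a b) z)" unfolding D_def by (rule emeasure_density) auto
  also have "... = (NN z. ennreal (indicator (box a b) z * max 0 (s * g z)))" by (intro nn_integral_cong) (auto simp: indicator_def)
  also have "... = ennreal (LINT z|lborel. indicator (box a b) z * max 0 (s * g z))" using ii by (intro nn_integral_eq_integral) (auto simp: indicator_def)
  finally show ?thesis .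
 qed
 have "D 1 = D (-1)"
 proof (rule measure_eqI_generator_eq)
  let ?E = "range (%(a, b). box a b::'a set)"
  show "Int_stable ?E" by (auto simp: Int_stable_def box_Int_box)
  show "?E <= Pow UNIV" "sets (D 1) = sigma_sets UNIV ?E" "sets (D (-1)) = sigma_sets UNIV ?E" by (simp_all add: D_def borel_eq_box)
  let ?A = "%n::nat. box (- (real n *\<^sub>R One)) (real n *\<^sub>R One) :: 'a set"
  show "range ?A <= ?E" "(\<Union>i. ?A i) = UNIV" unfolding UN_box_eq_UNIV by auto
  show "emeasure (D 1) (?A i) ~= \<infinity>" for i by (simp add: em)
  fix X :: "'a set" assume "X : ?E"
  then obtain a b where X: "X = box a b" by auto
  have "(LINT z|lborel. indicator (box a b) z * max 0 (1 * g z)) - (LINT z|lborel. indicator (box a b) z * max 0 (-1 * g z))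
   = (LINT z|lborel. indicator (box a b) z * g z)"
   by (subst Bochner_Integration.integral_diff[symmetric, OF ii ii]) (auto intro!: Bochner_Integration.integral_cong simp: indicator_def)
  thus "emeasure (D 1) X = emeasure (D (-1)) X" unfolding X em z by simp
 qed
 hence "AE z in lborel. ennreal (max 0 (1 * g z)) = ennreal (max 0 (-1 * g z))" unfolding D_def
 proof (subst (asm) finite_density_unique)
  have "(NN z. ennreal (max 0 (1 * g z))) = ennreal (LINT z|lborel. max 0 (1 * g z))" using g by (intro nn_integral_eq_integral) auto
  thus "(NN z. ennreal (max 0 (1 * g z))) ~= \<infinity>" by simp
 qed auto
 thus ?thesis by eventually_elim (auto simp: max_def split: if_splits)
qed

text \<open>Bumps approximating the indicator of a box give zero integrals over boxes inside
  \<open>U\<close>. On one closed box a Borel representative reduces the claim to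
  \<open>integral_boxes_zero_AE\<close>, and countably many closed boxes exhaust
  \<open>U\<close>.\<close>

lemma fundamental_lemma:
 fixes g :: "'a::euclidean_space => real"
 assumes U: "open U" and g: "locally_integrable U g"
  and z: "!!ph. test_function U ph ==> (LINT z:U|lebesgue. g z * ph z) = 0"
 shows "AE z in lebesgue. z : U --> g z = 0"
proof -
 have gi: "integrable lebesgue (%z. indicator (cbox a b) z * g z)" if "cbox a b <= U" for a b
  using g that unfolding locally_integrable_def set_integrable_def by auto
 have boxz: "(LINT z|lebesgue. indicator (box a b) z * g z) = 0" if ab: "cbox a b <= U" for a b
 proof -
  let ?h = "%z. indicator (cbox a b) z * g z"
  have bx[measurable]: "box a b : sets lebesgue" by simp
  have bm[measurable]: "box_bump m a b : borel_measurable lebesgue" for m using smooth_borel[OF smooth_box_bump] by (intro measurable_completion) auto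
  have "(%m. LINT z|lebesgue. ?h z * box_bump (Suc m) a b z) \<longlonglongrightarrow> (LINT z|lebesgue. ?h z * indicator (box a b) z)"
  proof (rule integral_dominated_convergence[where w="%z. abs (?h z)"])
   show "AE z in lebesgue. (%m. ?h z * box_bump (Suc m) a b z) \<longlonglongrightarrow> ?h z * indicator (box a b) z"
    by (rule AE_I2) (intro tendsto_mult tendsto_const filterlim_compose[OF box_bump_tendsto filterlim_Suc])
   show "AE z in lebesgue. norm (?h z * box_bump (Suc m) a b z) <= abs (?h z)" for m by (rule AE_I2) (auto simp: abs_mult box_bump_range intro!: mult_left_le)
   have hm: "?h : borel_measurable lebesgue" using gi[OF ab] by auto
   show "(%z. ?h z * indicator (box a b) z) : borel_measurable lebesgue" by (rule borel_measurable_times[OF hm borel_measurable_indicator[OF bx]])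
   show "(%z. ?h z * box_bump (Suc m) a b z) : borel_measurable lebesgue" for m by (rule borel_measurable_times[OF hm bm])
  qed (use gi[OF ab] in auto)
  moreover have "(LINT z|lebesgue. ?h z * box_bump (Suc m) a b z) = 0" for m
  proof -
   have t: "test_function (box a b) (box_bump (Suc m) a b)" by (rule box_bump_test) simp
   hence "box_bump (Suc m) a b z = 0" if "z ~: box a b" for z using that by (auto elim!: test_functionE)
   hence "?h z * box_bump (Suc m) a b z = indicator U z *\<^sub>R (g z * box_bump (Suc m) a b z)" for z
    using box_subset_cbox[of a b] ab by (cases "z : box a b") (auto simp: indicator_def)
   hence "(LINT z|lebesgue. ?h z * box_bump (Suc m) a b z) = (LINT z:U|lebesgue. g z * box_bump (Suc m) a b z)"
    unfolding set_lebesgue_integral_def by (rule Bochner_Integration.integral_cong[OF refl])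
   thus ?thesis using z[OF test_function_mono[OF t]] box_subset_cbox[of a b] ab by auto
  qed
  moreover have "?h z * indicator (box a b) z = indicator (box a b) z * g z" for z using box_subset_cbox[of a b] by (auto simp: indicator_def)
  ultimately show ?thesis by (simp add: LIMSEQ_const_iff)
 qed
 have pc: "AE z in lebesgue. z : cbox c d --> g z = 0" if cd: "cbox c d <= U" for c d
 proof -
  let ?h = "%z. indicator (box c d) z * g z"
  have "integrable lebesgue (%z. indicator (box c d) z * (indicator (cbox c d) z * g z))" by (rule integrable_indicator_times[OF _ gi[OF cd]]) simp
  moreover have "(%z. indicator (box c d) z * (indicator (cbox c d) z * g z)) = ?h" by (intro ext) (use box_subset_cbox[of c d] in "auto simp: indicator_def")
  ultimately have hi: "integrable lebesgue ?h" by simp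
  hence hm: "?h : borel_measurable (completion lborel)" by auto
  from completion_ex_borel_measurable_real[OF hm] obtain k where
   k: "k : borel_measurable lborel" "AE z in lborel. ?h z = k z" by blast
  have kL[measurable]: "k : borel_measurable lebesgue" using k(1) by (rule measurable_completion)
  have ki: "integrable lborel k" using integrable_cong_AE[OF hm kL AE_completion[OF k(2)]] hi integrable_completion[OF k(1)] by simp
  have "AE z in lborel. k z = 0"
  proof (rule integral_boxes_zero_AE[OF ki])
   fix a b :: 'a
   obtain a' b' where ab': "box a b Int box c d = box a' b'" by (rule that[OF box_Int_box])
   have "(LINT z|lborel. indicator (box a b) z * k z) = (LINT z|lebesgue. indicator (box a b) z * k z)"
    by (rule integral_completion[symmetric, OF borel_measurable_times[OF borel_measurable_indicator k(1)]]) simp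
   also have "... = (LINT z|lebesgue. indicator (box a b) z * ?h z)"
   proof (rule integral_cong_AE)
    have bx: "box a b : sets lebesgue" by simp
    show "(%z. indicator (box a b) z * k z) : borel_measurable lebesgue" by (rule borel_measurable_times[OF borel_measurable_indicator[OF bx] kL])
    show "(%z. indicator (box a b) z * ?h z) : borel_measurable lebesgue" by (rule borel_measurable_times[OF borel_measurable_indicator[OF bx] hm])
    show "AE z in lebesgue. indicator (box a b) z * k z = indicator (box a b) z * ?h z" using AE_completion[OF k(2)] by eventually_elim simp
   qed
   also have "... = (LINT z|lebesgue. indicator (box a' b') z * g z)" by (intro Bochner_Integration.integral_cong) (auto simp: ab'[symmetric] indicator_def)
   also have "... = 0"
   proof (cases "box a' b' = {}")
    case False
    hence "cbox a' b' = closure (box a' b')" by (simp add: closure_box)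
    also have "... <= closure (box c d)" using ab' by (intro closure_mono) auto
    also have "... <= cbox c d" using box_subset_cbox closed_cbox by (rule closure_minimal)
    finally show ?thesis using boxz cd by blast
   qed simp
   finally show "(LINT z|lborel. indicator (box a b) z * k z) = 0" .
  qed
  with k(2) have "AE z in lborel. ?h z = 0" by eventually_elim simp
  hence 1: "AE z in lebesgue. ?h z = 0" by (rule AE_completion)
  have "AE z in lebesgue. z ~: cbox c d - box c d" using negligible_frontier_interval[of c d] by (intro AE_not_in) (simp add: negligible_iff_null_sets)
  with 1 show ?thesis by eventually_elim (auto simp: indicator_def)
 qed
 obtain \<D> where D: "countable \<D>" "\<D> <= Pow U" "!!X. X : \<D> ==> EX a b. X = cbox a b" "\<Union>\<D> = U"
  using open_countable_Union_open_cbox[OF U] by metis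
 have "AE z in lebesgue. ALL X:\<D>. z : X --> g z = 0"
 proof (subst AE_ball_countable[OF D(1)], rule ballI)
  fix X assume X: "X : \<D>"
  then obtain a b where "X = cbox a b" using D(3) by blast
  thus "AE z in lebesgue. z : X --> g z = 0" using pc[of a b] X D(2) by auto
 qed
 thus ?thesis by eventually_elim (use D(4) in blast)
qed

section \<open>Weak derivatives\<close>

lemma lebesgue_AE_eq:
 fixes f g :: "'a::euclidean_space => real"
 assumes "integrable lebesgue f" "AE z in lebesgue. f z = g z"
 shows "integrable lebesgue g" "integral\<^sup>L lebesgue g = integral\<^sup>L lebesgue f"
proof -
 have f: "f : borel_measurable lebesgue" using assms(1) by auto
 note g = borel_measurable_AE[OF f assms(2)]
 show "integrable lebesgue g" using integrable_cong_AE[OF f g assms(2)] assms(1) by simp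
 show "integral\<^sup>L lebesgue g = integral\<^sup>L lebesgue f" using integral_cong_AE[OF f g assms(2)] by simp
qed

lemma smooth_lebesgue_measurable: "smooth f ==> f : borel_measurable lebesgue" by (rule measurable_completion) (simp add: smooth_borel)

lemma integrable_bounded_times:
 fixes f ph :: "'a => real"
 assumes "integrable M f" "ph : borel_measurable M" "!!z. abs (ph z) <= B"
 shows "integrable M (%z. f z * ph z)"
proof (rule Bochner_Integration.integrable_bound[of _ "%z. B * f z"])
 show "integrable M (%z. B * f z)" using assms(1) by simp
 show "(%z. f z * ph z) : borel_measurable M" by (rule borel_measurable_times[OF borel_measurable_integrable[OF assms(1)] assms(2)])
 show "AE z in M. norm (f z * ph z) <= norm (B * f z)"
 proof (rule AE_I2)
  fix z
  have "abs (f z) * abs (ph z) <= abs (f z) * abs B" by (rule mult_left_mono) (use assms(3)[of z] in auto)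
  thus "norm (f z * ph z) <= norm (B * f z)" by (simp add: abs_mult mult.commute)
 qed
qed

lemma integrable_times_test:
 assumes "locally_integrable U f" "test_function U ph"
 shows "integrable lebesgue (%z. f z * ph z)" using assms(2)
proof (rule test_functionE)
 fix K assume K: "smooth ph" "compact K" "K <= U" "!!z. z ~: K ==> ph z = 0"
 obtain B where B: "!!z. abs (ph z) <= B" using test_function_bounded[OF assms(2)] by metis
 have "integrable lebesgue (%z. indicator K z * f z)" using assms(1) K unfolding locally_integrable_def set_integrable_def by auto
 from integrable_bounded_times[OF this smooth_lebesgue_measurable[OF K(1)] B]
 show ?thesis by (rule Bochner_Integration.integrable_cong[OF refl, THEN iffD1, rotated]) (use K(4) in "auto simp: indicator_def")
qed

lemma set_integral_test:
 assumes "test_function U ph"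
 shows "(LINT z:U|lebesgue. f z * ph z) = (LINT z|lebesgue. f z * ph z)" using assms unfolding set_lebesgue_integral_def
 by (intro Bochner_Integration.integral_cong) (auto simp: indicator_def elim!: test_functionE)

lemma test_function_iter_deriv: "test_function U ph ==> test_function U (iter_deriv vs ph)"
 by (induction vs) (auto simp: iter_deriv_Cons test_function_dd simp del: iter_deriv.simps(2))

lemma has_weak_deriv_iff:
 "has_weak_deriv U vs f g \<longleftrightarrow> locally_integrable U f & locally_integrable U g &
  (ALL ph. test_function U ph -->
    (LINT z|lebesgue. f z * iter_deriv vs ph z) = (-1) ^ length vs * (LINT z|lebesgue. g z * ph z))"
 unfolding has_weak_deriv_def by (auto simp: set_integral_test test_function_iter_deriv)

lemma locally_integrable_mono: "locally_integrable U f ==> V <= U ==> locally_integrable V f" unfolding locally_integrable_def by auto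

lemma has_weak_deriv_mono: "has_weak_deriv U vs f g ==> V <= U ==> has_weak_deriv V vs f g"
 unfolding has_weak_deriv_iff by (metis locally_integrable_mono test_function_mono)

lemma locally_integrable_diff:
 "locally_integrable U f ==> locally_integrable U g ==> locally_integrable U (%z. f z - g z)" unfolding locally_integrable_def by (auto intro: set_integral_diff)

lemma locally_integrable_add:
 "locally_integrable U f ==> locally_integrable U g ==> locally_integrable U (%z. f z + g z)" unfolding locally_integrable_def by (auto intro: set_integral_add)

lemma has_weak_deriv_unique:
 assumes U: "open U" and 1: "has_weak_deriv U vs f g" and 2: "has_weak_deriv U vs f h"
 shows "AE z in lebesgue. z : U --> g z = h z"
proof -
 have "AE z in lebesgue. z : U --> g z - h z = 0"
 proof (rule fundamental_lemma[OF U])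
  show "locally_integrable U (%z. g z - h z)" using 1 2 by (auto simp: has_weak_deriv_def locally_integrable_diff)
  fix ph assume t: "test_function U ph"
  have gi: "integrable lebesgue (%z. g z * ph z)" "integrable lebesgue (%z. h z * ph z)" using 1 2 t by (auto simp: has_weak_deriv_def integrable_times_test)
  have "(-1) ^ length vs * (LINT z|lebesgue. g z * ph z) = (-1) ^ length vs * (LINT z|lebesgue. h z * ph z)" using 1 2 t unfolding has_weak_deriv_iff by metis
  hence "(LINT z|lebesgue. g z * ph z) = (LINT z|lebesgue. h z * ph z)" by simp
  thus "(LINT z:U|lebesgue. (g z - h z) * ph z) = 0" unfolding left_diff_distrib[symmetric]
   by (subst set_integral_test[OF t]) (use Bochner_Integration.integral_diff[OF gi] in "simp add: left_diff_distrib")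
 qed
 thus ?thesis by eventually_elim auto
qed

lemma has_weak_deriv_weak_deriv: "has_weak_deriv U vs f g ==> has_weak_deriv U vs f (weak_deriv U vs f)"
 unfolding weak_deriv_def by (rule someI[of "%g. has_weak_deriv U vs f g"])

lemma weak_deriv_AE_eq:
 assumes "open U" "has_weak_deriv U vs f g" shows "AE z in lebesgue. z : U --> weak_deriv U vs f z = g z"
 by (rule has_weak_deriv_unique[OF assms(1) has_weak_deriv_weak_deriv[OF assms(2)] assms(2)])

lemma has_weak_deriv_swap: assumes "has_weak_deriv U [u, v] f g" shows "has_weak_deriv U [v, u] f g"
proof -
 have "iter_deriv [u, v] ph = iter_deriv [v, u] ph" if "test_function U ph" for ph
  using dd_commute[OF test_function_smooth[OF that], of u v] by (simp add: iter_deriv_Cons del: iter_deriv.simps(2))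
 thus ?thesis using assms unfolding has_weak_deriv_iff by simp
qed

lemma locally_integrable_AE:
 assumes "locally_integrable U f" "AE z in lebesgue. z : U --> f z = g z" shows "locally_integrable U g" unfolding locally_integrable_def set_integrable_def
proof (intro allI impI)
 fix K assume K: "compact K & K <= U"
 show "integrable lebesgue (%x. indicator K x *\<^sub>R g x)"
 proof (rule lebesgue_AE_eq(1)[of "%x. indicator K x *\<^sub>R f x"])
  show "integrable lebesgue (%x. indicator K x *\<^sub>R f x)" using K assms(1) unfolding locally_integrable_def set_integrable_def by auto
  show "AE z in lebesgue. indicator K z *\<^sub>R f z = indicator K z *\<^sub>R g z" using assms(2) by eventually_elim (use K in "auto simp: indicator_def")
 qed
qed

lemma has_weak_deriv_AE:
 assumes "has_weak_deriv U vs f g" "AE z in lebesgue. z : U --> g z = h z"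
 shows "has_weak_deriv U vs f h" unfolding has_weak_deriv_iff
proof (intro conjI allI impI)
 show "locally_integrable U f" "locally_integrable U h" using assms locally_integrable_AE unfolding has_weak_deriv_def by blast+
 fix ph assume t: "test_function U ph"
 have "(LINT z|lebesgue. h z * ph z) = (LINT z|lebesgue. g z * ph z)"
 proof (rule lebesgue_AE_eq(2))
  show "integrable lebesgue (%z. g z * ph z)" using assms(1) t by (auto simp: has_weak_deriv_def integrable_times_test)
  show "AE z in lebesgue. g z * ph z = h z * ph z" using assms(2) by eventually_elim (use t in "auto elim!: test_functionE")
 qed
 thus "(LINT z|lebesgue. f z * iter_deriv vs ph z) = (-1) ^ length vs * (LINT z|lebesgue. h z * ph z)" using assms(1) t unfolding has_weak_deriv_iff by simp
qed

text \<open>By uniqueness the derivatives agree on overlaps, so they can be glued by using at each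
  point the first \<open>V m\<close> that contains it. By compactness every test function on the
  union already lives in some \<open>V m\<close>.\<close>

lemma weak_deriv_exhaustion:
 fixes V :: "nat => 'a::euclidean_space set"
 assumes V: "!!m. open (V m)" "incseq V" and ex: "!!m. EX g. has_weak_deriv (V m) vs f g"
 shows "EX g. has_weak_deriv (\<Union>m. V m) vs f g"
proof -
 obtain G where G: "!!m. has_weak_deriv (V m) vs f (G m)" using ex by metis
 define g where "g z = G (LEAST m. z : V m) z" for z
 have ae: "AE z in lebesgue. ALL k m. k <= m --> z : V k --> G k z = G m z"
 proof (intro AE_all_countable[THEN iffD2] allI)
  fix k m
  show "AE z in lebesgue. k <= m --> z : V k --> G k z = G m z"
  proof (cases "k <= m")
   case True
   show ?thesis using has_weak_deriv_unique[OF V(1) G has_weak_deriv_mono[OF G incseqD[OF V(2) True]]] by eventually_elim simp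
  qed simp
 qed
 have gG: "AE z in lebesgue. z : V m --> G m z = g z" for m using ae
 proof eventually_elim
  fix z assume a: "ALL k m. k <= m --> z : V k --> G k z = G m z"
  show "z : V m --> G m z = g z" using a LeastI[of "%m. z : V m" m] Least_le[of "%m. z : V m" m] by (auto simp: g_def)
 qed
 have gm: "has_weak_deriv (V m) vs f g" for m by (rule has_weak_deriv_AE[OF G gG])
 have cov: "EX m. K <= V m" if K: "compact K" "K <= (\<Union>m. V m)" for K
 proof -
  obtain I where I: "finite I" "K <= (UN m:I. V m)" using compactE_image[OF K(1), of UNIV V] V(1) K(2) by metis
  obtain M where "ALL i:I. i <= M" using I(1) finite_nat_set_iff_bounded_le by metis
  hence "K <= V M" using I(2) incseqD[OF V(2)] by blast
  thus ?thesis by blast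
 qed
 have li: "locally_integrable (\<Union>m. V m) k" if "!!m. locally_integrable (V m) k" for k using that cov unfolding locally_integrable_def by metis
 have "has_weak_deriv (\<Union>m. V m) vs f g" unfolding has_weak_deriv_iff
 proof (intro conjI allI impI)
  show "locally_integrable (\<Union>m. V m) f" "locally_integrable (\<Union>m. V m) g" using gm li by (auto simp: has_weak_deriv_def)
  fix ph assume t: "test_function (\<Union>m. V m) ph"
  then obtain m where "closure {z. ph z ~= 0} <= V m" using cov unfolding test_function_def by metis
  hence "test_function (V m) ph" using t unfolding test_function_def by auto
  thus "(LINT z|lebesgue. f z * iter_deriv vs ph z) = (-1) ^ length vs * (LINT z|lebesgue. g z * ph z)" using gm[of m] unfolding has_weak_deriv_iff by simp
 qed
 thus ?thesis by blast
qed

subsection \<open>Globally integrable functions\<close>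

text \<open>Global integrability removes the domain from weak derivatives: such functions can be
  rescaled, summed in L^1 and differentiated again. Second derivatives are two nested
  instances.\<close>

definition wd :: "'a::euclidean_space => ('a => real) => ('a => real) => bool" where
 "wd v f g \<longleftrightarrow> integrable lebesgue f & integrable lebesgue g &
  (ALL ph. test_function UNIV ph --> (LINT z|lebesgue. f z * dd v ph z) = - (LINT z|lebesgue. g z * ph z))"

lemma integrable_locally: assumes "integrable lebesgue f" shows "locally_integrable U f" unfolding locally_integrable_def set_integrable_def
 by (intro allI impI integrable_mult_indicator assms) (auto intro!: sets_completionI_sets borel_closed compact_imp_closed)

lemma wd_has_weak_deriv: assumes "wd v f g" shows "has_weak_deriv U [v] f g" unfolding has_weak_deriv_iff
 using assms integrable_locally test_function_mono[of U _ UNIV] by (auto simp: wd_def dd_def[abs_def])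

lemma wd_wd_has_weak_deriv: assumes "wd u f g" "wd v g h" shows "has_weak_deriv U [u, v] f h" unfolding has_weak_deriv_iff
proof (intro conjI allI impI)
 show "locally_integrable U f" "locally_integrable U h" using assms by (auto simp: wd_def integrable_locally)
 fix ph assume "test_function U ph"
 hence t: "test_function UNIV ph" by (rule test_function_mono) simp
 have "(LINT z|lebesgue. f z * dd u (dd v ph) z) = - (LINT z|lebesgue. g z * dd v ph z)" using assms(1) test_function_dd[OF t] by (simp add: wd_def)
 also have "... = (LINT z|lebesgue. h z * ph z)" using assms(2) t by (simp add: wd_def)
 finally show "(LINT z|lebesgue. f z * iter_deriv [u, v] ph z) = (-1) ^ length [u, v] * (LINT z|lebesgue. h z * ph z)"
  by (simp add: iter_deriv_Cons del: iter_deriv.simps(2))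
qed

text \<open>\<open>W21\<close> provides second derivatives of \<open>f\<close> directly, whereas the
  cut-off rule wants them as first derivatives of the gradient. Testing the gradient identity with
  \<open>dd v ph\<close> converts one into the other.\<close>

lemma has_weak_deriv_second:
 assumes 2: "has_weak_deriv U [u, v] f h" and 1: "has_weak_deriv U [u] f g"
 shows "has_weak_deriv U [v] g h" unfolding has_weak_deriv_iff
proof (intro conjI allI impI)
 show "locally_integrable U g" "locally_integrable U h" using assms by (auto simp: has_weak_deriv_def)
 fix ph assume t: "test_function U ph"
 have "(LINT z|lebesgue. f z * dd u (dd v ph) z) = - (LINT z|lebesgue. g z * dd v ph z)"
  using 1 test_function_dd[OF t] by (simp add: has_weak_deriv_iff dd_def[abs_def])
 moreover have "(LINT z|lebesgue. f z * dd u (dd v ph) z) = (LINT z|lebesgue. h z * ph z)" using 2 t by (simp add: has_weak_deriv_iff dd_def[abs_def])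
 ultimately show "(LINT z|lebesgue. g z * iter_deriv [v] ph z) = (-1) ^ length [v] * (LINT z|lebesgue. h z * ph z)" by (simp add: dd_def[abs_def])
qed

text \<open>Testing with the product of \<open>ze\<close> and \<open>ph\<close> yields the product
  rule. Multiplication by a test function is how a local object becomes a globally integrable
  one.\<close>

lemma wd_cutoff:
 assumes "has_weak_deriv U [v] f g" "test_function U ze"
 shows "wd v (%z. f z * ze z) (%z. g z * ze z + f z * dd v ze z)" unfolding wd_def
proof (intro conjI allI impI)
 have lf: "locally_integrable U f" "locally_integrable U g" using assms by (auto simp: has_weak_deriv_def)
 note z = test_function_smooth[OF assms(2)]
 note i = integrable_times_test[OF lf(1)] integrable_times_test[OF lf(2)]
 show "integrable lebesgue (%z. f z * ze z)" by (rule i(1)[OF assms(2)])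
 show "integrable lebesgue (%z. g z * ze z + f z * dd v ze z)" by (intro Bochner_Integration.integrable_add i assms test_function_dd)
 fix ph :: "'a => real" assume "test_function UNIV ph"
 hence s: "smooth ph" by (rule test_function_smooth)
 note t1 = test_function_mult[OF assms(2) s] and t2 = test_function_mult[OF assms(2) smooth_dd[OF s], of v]
  and t3 = test_function_mult[OF test_function_dd[OF assms(2), of v] s]
 have "(LINT z|lebesgue. f z * dd v (%z. ze z * ph z) z) = - (LINT z|lebesgue. g z * (ze z * ph z))"
  using assms(1) t1 by (simp add: has_weak_deriv_iff dd_def[abs_def])
 moreover have "(LINT z|lebesgue. f z * dd v (%z. ze z * ph z) z) =
  (LINT z|lebesgue. f z * (ze z * dd v ph z)) + (LINT z|lebesgue. f z * (dd v ze z * ph z))"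
  unfolding dd_mult[OF z s] distrib_left by (rule Bochner_Integration.integral_add[OF i(1)[OF t2] i(1)[OF t3]])
 moreover have "(LINT z|lebesgue. (g z * ze z + f z * dd v ze z) * ph z) =
  (LINT z|lebesgue. g z * (ze z * ph z)) + (LINT z|lebesgue. f z * (dd v ze z * ph z))"
  unfolding distrib_right mult.assoc by (rule Bochner_Integration.integral_add[OF i(2)[OF t1] i(1)[OF t3]])
 ultimately show "(LINT z|lebesgue. f z * ze z * dd v ph z) = - (LINT z|lebesgue. (g z * ze z + f z * dd v ze z) * ph z)" by (simp add: mult.assoc)
qed

lemma wd_add: assumes "wd v f g" "wd v f' g'" shows "wd v (%z. f z + f' z) (%z. g z + g' z)" unfolding wd_def
proof (intro conjI allI impI)
 show "integrable lebesgue (%z. f z + f' z)" "integrable lebesgue (%z. g z + g' z)" using assms by (auto simp: wd_def)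
 fix ph :: "'a => real" assume t: "test_function UNIV ph"
 have i: "integrable lebesgue (%z. k z * ps z)" if "integrable lebesgue k" "test_function UNIV ps" for k ps
  using integrable_times_test[OF integrable_locally that(2)] that(1) .
 show "(LINT z|lebesgue. (f z + f' z) * dd v ph z) = - (LINT z|lebesgue. (g z + g' z) * ph z)" unfolding distrib_right using assms t test_function_dd[OF t, of v]
  by (subst (1 2) Bochner_Integration.integral_add) (auto simp: wd_def i)
qed

lemma wd_scale: assumes "wd v f g" shows "wd v (%z. c * f z) (%z. c * g z)" using assms by (simp add: wd_def mult.assoc)

lemma wd_AE: assumes "wd v f g" "AE z in lebesgue. f z = f' z" "AE z in lebesgue. g z = g' z" shows "wd v f' g'" unfolding wd_def
proof (intro conjI allI impI)
 show "integrable lebesgue f'" "integrable lebesgue g'" using assms lebesgue_AE_eq(1) by (auto simp: wd_def)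
 fix ph :: "'a => real" assume t: "test_function UNIV ph"
 have i: "(LINT z|lebesgue. k' z * ps z) = (LINT z|lebesgue. k z * ps z)"
  if "integrable lebesgue k" "AE z in lebesgue. k z = k' z" "test_function UNIV ps" for k k' ps
  by (rule lebesgue_AE_eq(2)[OF integrable_times_test[OF integrable_locally[OF that(1)] that(3)]])
   (use that(2) in eventually_elim, simp)
 show "(LINT z|lebesgue. f' z * dd v ph z) = - (LINT z|lebesgue. g' z * ph z)"
  using assms(1) i[OF _ assms(2) test_function_dd[OF t, of v]] i[OF _ assms(3) t] t by (auto simp: wd_def)
qed

lemma smooth_locally_integrable: assumes "smooth b" shows "locally_integrable U b" unfolding locally_integrable_def set_integrable_def
proof (intro allI impI)
 fix K :: "'a set" assume K: "compact K & K <= U"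
 have "integrable lborel (%x. indicator K x *\<^sub>R b x)" by (rule borel_integrable_compact) (use K smooth_continuous_on[OF assms] in auto)
 thus "integrable lebesgue (%x. indicator K x *\<^sub>R b x)" using integrable_completion by (metis borel_measurable_integrable)
qed

lemma smooth_by_parts:
 assumes "smooth b" "test_function U ph"
 shows "(LINT z|lebesgue. b z * dd v ph z) = - (LINT z|lebesgue. dd v b z * ph z)"
proof -
 note s = test_function_smooth[OF assms(2)]
 note i = integrable_times_test[OF smooth_locally_integrable]
 have "(LINT z|lborel. dd v (%z. b z * ph z) z) = 0" by (rule test_function_integral_dd[OF test_function_mult2[OF assms(2,1)]])
 hence "(LINT z|lebesgue. dd v (%z. b z * ph z) z) = 0" using smooth_borel[OF smooth_dd[OF smooth_mult[OF assms(1) s]]] by (subst integral_completion) auto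
 hence "(LINT z|lebesgue. b z * dd v ph z) + (LINT z|lebesgue. dd v b z * ph z) = 0" unfolding dd_mult[OF assms(1) s]
  by (subst (asm) Bochner_Integration.integral_add[OF i[OF assms(1) test_function_dd[OF assms(2)]] i[OF smooth_dd[OF assms(1)] assms(2)]])
 thus ?thesis by simp
qed

lemma smooth_has_weak_deriv: assumes "smooth b" shows "has_weak_deriv U [v] b (dd v b)"
 unfolding has_weak_deriv_iff using smooth_by_parts[OF assms] smooth_locally_integrable[OF assms] smooth_locally_integrable[OF smooth_dd[OF assms]]
 by (auto simp: iter_deriv_Cons simp del: iter_deriv.simps(2))

lemma smooth_has_weak_deriv2: assumes "smooth b" shows "has_weak_deriv U [u, v] b (dd u (dd v b))"
proof -
 have "(LINT z|lebesgue. b z * dd u (dd v ph) z) = (LINT z|lebesgue. dd u (dd v b) z * ph z)" if t: "test_function U ph" for ph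
  using smooth_by_parts[OF assms test_function_dd[OF t]] smooth_by_parts[OF smooth_dd[OF assms] t] dd_commute[OF assms] by simp
 thus ?thesis unfolding has_weak_deriv_iff using smooth_locally_integrable[OF assms] smooth_locally_integrable[OF smooth_dd[OF smooth_dd[OF assms]]]
  by (auto simp: iter_deriv_Cons simp del: iter_deriv.simps(2))
qed

lemma has_weak_deriv_add:
 assumes "has_weak_deriv U vs f g" "has_weak_deriv U vs f' g'"
 shows "has_weak_deriv U vs (%z. f z + f' z) (%z. g z + g' z)" unfolding has_weak_deriv_iff
proof (intro conjI allI impI)
 have l: "locally_integrable U f" "locally_integrable U f'" "locally_integrable U g" "locally_integrable U g'" using assms by (auto simp: has_weak_deriv_def)
 thus "locally_integrable U (%z. f z + f' z)" "locally_integrable U (%z. g z + g' z)" by (auto intro: locally_integrable_add)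
 fix ph assume t: "test_function U ph"
 note i = integrable_times_test[where U=U]
 show "(LINT z|lebesgue. (f z + f' z) * iter_deriv vs ph z) = (-1) ^ length vs * (LINT z|lebesgue. (g z + g' z) * ph z)"
  using assms t unfolding distrib_right has_weak_deriv_iff by (subst (1 2) Bochner_Integration.integral_add) (auto simp: i l test_function_iter_deriv distrib_left)
qed

subsection \<open>Series of weak derivatives\<close>

lemma AE_summable_abs:
 fixes f :: "nat => 'a => real"
 assumes "!!m. integrable M (f m)" "summable (%m. LINT z|M. abs (f m z))"
 shows "AE z in M. summable (%m. abs (f m z))"
proof -
 have mb[measurable]: "f m : borel_measurable M" for m using assms(1) by auto
 have "(\<integral>\<^sup>+z. (\<Sum>m. ennreal (abs (f m z))) \<partial>M) = (\<Sum>m. \<integral>\<^sup>+z. ennreal (abs (f m z)) \<partial>M)"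
  by (rule nn_integral_suminf) measurable
 also have "... = (\<Sum>m. ennreal (LINT z|M. abs (f m z)))" using assms(1) by (intro suminf_cong nn_integral_eq_integral) auto
 also have "... = ennreal (\<Sum>m. LINT z|M. abs (f m z))" by (rule suminf_ennreal2[OF _ assms(2)]) simp
 finally have "(\<integral>\<^sup>+z. (\<Sum>m. ennreal (abs (f m z))) \<partial>M) ~= \<infinity>" by simp
 hence "AE z in M. (\<Sum>m. ennreal (abs (f m z))) ~= \<infinity>" by (rule nn_integral_PInf_AE[rotated]) measurable
 thus ?thesis by eventually_elim (auto intro: summable_suminf_not_top)
qed

lemma suminf_times:
 fixes k :: "nat => 'a::euclidean_space => real"
 assumes k: "!!m. integrable lebesgue (k m)" "summable (%m. LINT z|lebesgue. abs (k m z))"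
  and ph: "ph : borel_measurable lebesgue" "!!z. abs (ph z) <= B" "B >= 0"
 shows "integrable lebesgue (%z. (\<Sum>m. k m z) * ph z)"
  "(%m. LINT z|lebesgue. k m z * ph z) sums (LINT z|lebesgue. (\<Sum>m. k m z) * ph z)"
proof -
 have a: "AE z in lebesgue. summable (%m. abs (k m z))" by (rule AE_summable_abs[OF k])
 hence a': "AE z in lebesgue. summable (%m. norm (k m z * ph z))" by eventually_elim (simp add: abs_mult summable_mult2)
 have ki: "integrable lebesgue (%z. k m z * ph z)" for m by (rule integrable_bounded_times[OF k(1) ph(1,2)])
 have s: "summable (%m. LINT z|lebesgue. norm (k m z * ph z))"
 proof (rule summable_comparison_test'[of "%m. B * (LINT z|lebesgue. abs (k m z))" 0])
  show "summable (%m. B * (LINT z|lebesgue. abs (k m z)))" by (rule summable_mult[OF k(2)])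
  fix m :: nat
  have "(LINT z|lebesgue. norm (k m z * ph z)) <= (LINT z|lebesgue. B * abs (k m z))"
  proof (rule integral_mono)
   show "integrable lebesgue (%z. norm (k m z * ph z))" by (rule Bochner_Integration.integrable_norm[OF ki])
   show "integrable lebesgue (%z. B * abs (k m z))" using k(1)[of m] by auto
   show "norm (k m z * ph z) <= B * abs (k m z)" for z using mult_left_mono[OF ph(2)[of z], of "abs (k m z)"] by (simp add: abs_mult mult.commute)
  qed
  thus "norm (LINT z|lebesgue. norm (k m z * ph z)) <= B * (LINT z|lebesgue. abs (k m z))" by simp
 qed
 have e: "AE z in lebesgue. (\<Sum>m. k m z * ph z) = (\<Sum>m. k m z) * ph z" using a by eventually_elim (rule suminf_mult2[symmetric], rule summable_rabs_cancel)
 note i = integrable_suminf[OF ki a' s]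
 show "integrable lebesgue (%z. (\<Sum>m. k m z) * ph z)" by (rule lebesgue_AE_eq(1)[OF i e])
 show "(%m. LINT z|lebesgue. k m z * ph z) sums (LINT z|lebesgue. (\<Sum>m. k m z) * ph z)" unfolding lebesgue_AE_eq(2)[OF i e] by (rule sums_integral[OF ki a' s])
qed

text \<open>Summable L^1 norms permit termwise integration against a bounded test function on both
  sides of the identity; this is what differentiates the Neumann series.\<close>

lemma wd_suminf:
 fixes f g :: "nat => 'a::euclidean_space => real"
 assumes wd: "!!m. wd v (f m) (g m)"
  and s: "summable (%m. LINT z|lebesgue. abs (f m z))" "summable (%m. LINT z|lebesgue. abs (g m z))"
 shows "wd v (%z. \<Sum>m. f m z) (%z. \<Sum>m. g m z)" unfolding wd_def
proof (intro conjI allI impI)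
 have i: "integrable lebesgue (f m)" "integrable lebesgue (g m)" for m using wd[of m] by (auto simp: wd_def)
 show "integrable lebesgue (%z. \<Sum>m. f m z)" "integrable lebesgue (%z. \<Sum>m. g m z)"
  using suminf_times(1)[OF i(1) s(1), of "%_. 1" 1] suminf_times(1)[OF i(2) s(2), of "%_. 1" 1] by auto
 fix ph :: "'a => real" assume t: "test_function UNIV ph"
 obtain B B' where B: "B >= 0" "!!z. abs (ph z) <= B" "B' >= 0" "!!z. abs (dd v ph z) <= B'"
  using test_function_bounded[OF t] test_function_bounded[OF test_function_dd[OF t]] by metis
 note m = smooth_lebesgue_measurable[OF test_function_smooth]
 have e: "(LINT z|lebesgue. f m z * dd v ph z) = - (LINT z|lebesgue. g m z * ph z)" for m using wd[of m] t by (simp add: wd_def)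
 show "(LINT z|lebesgue. (\<Sum>m. f m z) * dd v ph z) = - (LINT z|lebesgue. (\<Sum>m. g m z) * ph z)"
  using suminf_times(2)[OF i(1) s(1) m[OF test_function_dd[OF t]] B(4,3), unfolded e]
   sums_minus[OF suminf_times(2)[OF i(2) s(2) m[OF t] B(2,1)]] by (rule sums_unique2)
qed

subsection \<open>Parabolic scaling\<close>

definition par_map :: "real => (real^'n) * real => 'n pt => 'n pt" where
 "par_map r z0 z = (fst z0 + r *\<^sub>R fst z, snd z0 + r^2 * snd z)"

definition par_inv :: "real => (real^'n) * real => 'n pt => 'n pt" where
 "par_inv r z0 z = ((1 / r) *\<^sub>R (fst z - fst z0), (snd z - snd z0) / r^2)"

lemma par_map_inv: "r > 0 ==> par_map r z0 (par_inv r z0 z) = z" "r > 0 ==> par_inv r z0 (par_map r z0 z) = z" by (auto simp: par_map_def par_inv_def prod_eq_iff)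

lemma par_map_linear: "bounded_linear (%z::(real^'n) * real. (r *\<^sub>R fst z, s * snd z))" by (intro bounded_linear_intros)

text \<open>One factor per basis vector, with the square in the time direction only, is the shape to
  which the affine change of variables for Lebesgue measure applies; the product of the factors is
  r^(n+2).\<close>

lemma par_map_affine:
 fixes z0 :: "(real^'n) * real"
 shows "par_map r z0 = (%z. z0 + (SUM j:Basis. ((if j = (0, 1) then r^2 else r) * (z \<bullet> j)) *\<^sub>R j))"
proof
 fix z :: "'n pt"
 have "(r *\<^sub>R fst z, r^2 * snd z) = (SUM j:Basis. ((if j = (0, 1) then r^2 else r) * (z \<bullet> j)) *\<^sub>R j)"
 proof (rule euclidean_eqI)
  fix b :: "'n pt" assume b: "b : Basis"
  have "(SUM j:Basis. ((if j = (0, 1) then r^2 else r) * (z \<bullet> j)) *\<^sub>R j) \<bullet> b = (if b = (0, 1) then r^2 else r) * (z \<bullet> b)"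
   using b by (simp add: inner_sum_left inner_Basis if_distrib cong: if_cong)
  also have "... = (r *\<^sub>R fst z, r^2 * snd z) \<bullet> b"
  proof (cases "b = (0, 1)")
   case True thus ?thesis by (simp add: inner_prod_def)
  next
   case False
   hence "snd b = 0" using b by (auto simp: Basis_prod_def)
   thus ?thesis using False by (simp add: inner_prod_def)
  qed
  finally show "(r *\<^sub>R fst z, r^2 * snd z) \<bullet> b = (SUM j:Basis. ((if j = (0, 1) then r^2 else r) * (z \<bullet> j)) *\<^sub>R j) \<bullet> b" by simp
 qed
 thus "par_map r z0 z = z0 + (SUM j:Basis. ((if j = (0, 1) then r^2 else r) * (z \<bullet> j)) *\<^sub>R j)" by (simp add: par_map_def prod_eq_iff)
qed

lemma par_map_jacobian:
 fixes r :: real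
 assumes "r > 0"
 shows "(PROD j:(Basis::((real^'n) * real) set). abs (if j = (0, 1) then r^2 else r)) = r ^ (CARD('n) + 2)"
proof -
 have ar: "abs r = r" using assms by simp
 have B: "(Basis::'n pt set) = insert (0, 1) ((%u. (u, 0)) ` Basis)" by (auto simp: Basis_prod_def)
 have "(PROD j:(%u::real^'n. (u, 0::real)) ` Basis. abs (if j = (0, 1) then r^2 else r)) = r ^ CARD('n)"
  using assms by (subst prod.reindex) (auto simp: inj_on_def ar)
 thus ?thesis unfolding B using assms by (subst prod.insert) (auto simp: power_add power2_eq_square ar)
qed

lemma par_map_measurable: "r > 0 ==> par_map r z0 : lebesgue \<rightarrow>\<^sub>M lebesgue" unfolding par_map_affine by (rule lebesgue_affine_measurable) auto

lemma par_map_lebesgue: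
 fixes z0 :: "(real^'n) * real"
 assumes "r > 0"
 shows "lebesgue = density (distr lebesgue lebesgue (par_map r z0)) (%_. ennreal (r ^ (CARD('n) + 2)))"
 using lebesgue_affine_euclidean[of "%j::'n pt. if j = (0, 1) then r^2 else r" z0]
  par_map_jacobian[OF assms, where 'n='n] assms unfolding par_map_affine by auto

lemma nn_integral_par_map:
 fixes F :: "(real^'n) * real => ennreal"
 assumes "r > 0" "F : borel_measurable lebesgue"
 shows "(NL z. F z) = ennreal (r ^ (CARD('n) + 2)) * (NL z. F (par_map r z0 z))"
proof -
 note m = par_map_measurable[OF assms(1), of z0]
 have "(NL z. F z) = (\<integral>\<^sup>+z. F z \<partial>density (distr lebesgue lebesgue (par_map r z0)) (%_. ennreal (r ^ (CARD('n) + 2))))"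
  using par_map_lebesgue[OF assms(1), of z0] by simp
 also have "... = (\<integral>\<^sup>+z. ennreal (r ^ (CARD('n) + 2)) * F z \<partial>distr lebesgue lebesgue (par_map r z0))"
  using assms(2) by (subst nn_integral_density) auto
 also have "... = ennreal (r ^ (CARD('n) + 2)) * (\<integral>\<^sup>+z. F z \<partial>distr lebesgue lebesgue (par_map r z0))"
  using assms(2) by (subst nn_integral_cmult) auto
 also have "... = ennreal (r ^ (CARD('n) + 2)) * (NL z. F (par_map r z0 z))" using assms(2) m by (subst nn_integral_distr) auto
 finally show ?thesis .
qed

lemma integral_par_map:
 fixes F :: "(real^'n) * real => real"
 assumes "r > 0" "integrable lebesgue F"
 shows "integrable lebesgue (%z. F (par_map r z0 z))"
  "(LINT z|lebesgue. F z) = r ^ (CARD('n) + 2) * (LINT z|lebesgue. F (par_map r z0 z))"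
proof -
 note m = par_map_measurable[OF assms(1), of z0]
 have Fm: "F : borel_measurable lebesgue" using assms(2) by auto
 have p: "r ^ (CARD('n) + 2) > 0" using assms(1) by simp
 have "integrable (density (distr lebesgue lebesgue (par_map r z0)) (%_. ennreal (r ^ (CARD('n) + 2)))) F"
  using par_map_lebesgue[OF assms(1), of z0] assms(2) by simp
 hence "integrable (distr lebesgue lebesgue (par_map r z0)) (%z. r ^ (CARD('n) + 2) *\<^sub>R F z)" using Fm p by (subst (asm) integrable_density) auto
 hence "integrable (distr lebesgue lebesgue (par_map r z0)) F" using assms(1) by simp
 thus "integrable lebesgue (%z. F (par_map r z0 z))" by (rule integrable_distr[OF m])
 have "(LINT z|lebesgue. F z) = integral\<^sup>L (density (distr lebesgue lebesgue (par_map r z0)) (%_. ennreal (r ^ (CARD('n) + 2)))) F"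
  using par_map_lebesgue[OF assms(1), of z0] by simp
 also have "... = (LINT z|distr lebesgue lebesgue (par_map r z0). r ^ (CARD('n) + 2) *\<^sub>R F z)" using Fm p by (subst integral_density) auto
 also have "... = r ^ (CARD('n) + 2) * (LINT z|lebesgue. F (par_map r z0 z))" using Fm by (simp add: integral_distr[OF m])
 finally show "(LINT z|lebesgue. F z) = r ^ (CARD('n) + 2) * (LINT z|lebesgue. F (par_map r z0 z))" .
qed

lemma par_inv_eq_par_map: "r > 0 ==> par_inv r z0 = par_map (1 / r) (par_inv r z0 0)"
 by (auto simp: par_map_def par_inv_def fun_eq_iff field_simps scaleR_diff_right)

lemma AE_par_map:
 assumes "r > 0" "AE z in lebesgue. P z" shows "AE z in lebesgue. P (par_map r z0 z)"
proof -
 obtain N where N: "N : null_sets lebesgue" "!!z. z ~: N ==> P z" using assms(2) by (auto simp: eventually_ae_filter)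
 note m = par_map_measurable[OF assms(1), of z0]
 have Nm: "N : sets lebesgue" using N(1) by auto
 have ind: "(NL z. indicator N z) = 0" using N(1) Nm by (simp add: null_setsD1)
 have "ennreal (r ^ (CARD('a) + 2)) * (NL z. indicator N (par_map r z0 z)) = 0" using nn_integral_par_map[OF assms(1), of "indicator N" z0] Nm ind by simp
 hence "(NL z. indicator N (par_map r z0 z)) = 0" using assms(1) by simp
 moreover have "(%z. indicator N (par_map r z0 z) :: ennreal) : borel_measurable lebesgue" by (rule measurable_compose[OF m]) (use Nm in auto)
 ultimately have "AE z in lebesgue. indicator N (par_map r z0 z) = (0::ennreal)" by (simp add: nn_integral_0_iff_AE)
 thus ?thesis by eventually_elim (use N(2) in "auto simp: indicator_def split: if_splits")
qed

text \<open>The third assumption makes \<open>v\<close> an eigenvector of the linear part of the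
  dilation: the eigenvalue is r for space directions and r^2 for time, and it is the factor of the
  chain rule.\<close>

lemma wd_par_map:
 fixes f :: "(real^'n) * real => real"
 assumes wd: "wd v f g" and r: "r > 0" and v: "(r *\<^sub>R fst v, r^2 * snd v) = c *\<^sub>R v"
 shows "wd v (%z. f (par_map r z0 z)) (%z. c * g (par_map r z0 z))" unfolding wd_def
proof (intro conjI allI impI)
 have i: "integrable lebesgue f" "integrable lebesgue g" using wd by (auto simp: wd_def)
 show "integrable lebesgue (%z. f (par_map r z0 z))" "integrable lebesgue (%z. c * g (par_map r z0 z))" by (intro integrable_mult_right integral_par_map(1)[OF r] i)+
 fix ph :: "'n pt => real" assume t: "test_function UNIV ph"
 define ps where "ps z = ph (par_inv r z0 z)" for z
 have inv: "par_inv r z0 = (%z. ((1/r) *\<^sub>R fst z, (1/r)^2 * snd z) + par_inv r z0 0)"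
  by (auto simp: fun_eq_iff par_inv_def diff_divide_distrib power_divide scaleR_diff_right)
 have map: "par_map r z0 = (%z. (r *\<^sub>R fst z, r^2 * snd z) + z0)" by (auto simp: fun_eq_iff par_map_def prod_eq_iff)
 note s = test_function_smooth[OF t]
 have sps: "smooth ps" unfolding ps_def[abs_def] by (subst inv) (rule smooth_affine[OF s par_map_linear])
 have tps: "test_function UNIV ps" using t
 proof (rule test_functionE)
  fix K assume K: "compact K" "!!z. z ~: K ==> ph z = 0"
  have "continuous_on K (par_map r z0)" unfolding par_map_def by (intro continuous_intros)
  hence "compact (par_map r z0 ` K)" by (rule compact_continuous_image[OF _ K(1)])
  thus ?thesis
  proof (rule test_functionI[OF sps])
   fix z assume "z ~: par_map r z0 ` K"
   hence "par_inv r z0 z ~: K" using par_map_inv(1)[OF r, of z0 z] by (metis imageI)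
   thus "ps z = 0" unfolding ps_def by (rule K(2))
  qed auto
 qed
 have ph: "ph z = ps (par_map r z0 z)" for z by (simp add: ps_def par_map_inv r)
 have "dd v (%z. ps ((r *\<^sub>R fst z, r^2 * snd z) + z0)) = (%z. dd (c *\<^sub>R v) ps ((r *\<^sub>R fst z, r^2 * snd z) + z0))"
  using dd_affine[OF sps par_map_linear, of v r "r^2" z0] v by simp
 moreover have "dd (c *\<^sub>R v) ps z = c * dd v ps z" for z using linear_cmul[OF has_derivative_linear[OF smooth_has_derivative[OF sps]], of c v z] by simp
 ultimately have dv: "dd v ph z = c * dd v ps (par_map r z0 z)" for z by (simp add: ph[abs_def] map)
 note it = integrable_times_test[OF integrable_locally]
 have "r ^ (CARD('n) + 2) * (LINT z|lebesgue. f (par_map r z0 z) * dd v ps (par_map r z0 z))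
   = (LINT z|lebesgue. f z * dd v ps z)" using integral_par_map(2)[OF r it[OF i(1) test_function_dd[OF tps, of v]], of z0] by simp
 also have "... = - (LINT z|lebesgue. g z * ps z)" using wd tps by (simp add: wd_def)
 also have "... = - (r ^ (CARD('n) + 2) * (LINT z|lebesgue. g (par_map r z0 z) * ps (par_map r z0 z)))"
  using integral_par_map(2)[OF r it[OF i(2) tps], of z0] by simp
 finally have "(LINT z|lebesgue. f (par_map r z0 z) * dd v ps (par_map r z0 z))
   = - (LINT z|lebesgue. g (par_map r z0 z) * ps (par_map r z0 z))" using r by (subst (asm) mult_minus_right[symmetric], subst (asm) mult_left_cancel) auto
 thus "(LINT z|lebesgue. f (par_map r z0 z) * dd v ph z) = - (LINT z|lebesgue. c * g (par_map r z0 z) * ph z)"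
  unfolding dv ph by (simp add: mult.left_commute mult.assoc)
qed

section \<open>A mollifier whose dyadic differences are divergences\<close>

definition unit_box :: "'a::euclidean_space set" where
 "unit_box = cbox (- One) One"

lemma unit_box_iff: "z : unit_box \<longleftrightarrow> (ALL b:Basis. abs (z \<bullet> b) <= 1)" by (auto simp: unit_box_def mem_box abs_le_iff)

lemma compact_unit_box: "compact unit_box" by (simp add: unit_box_def)

definition bump1 :: "real => real" where
 "bump1 x = dd 1 step x"

lemma smooth_bump1: "smooth bump1" using smooth_dd[OF smooth_step, of 1] by (simp add: bump1_def[abs_def])

lemma step_deriv: "(step has_real_derivative bump1 x) (at x)" using dd_line[OF smooth_step, of 0 1 x] by (simp add: bump1_def)

lemma step_mono: assumes "x <= y" shows "step x <= step y"
proof -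
 have fm: "flat_exp 1 a <= flat_exp 1 b" if "a <= b" for a b :: real using that by (auto simp: flat_exp_def frac_le)
 define A A' B B' where "A = flat_exp 1 (x + 1)" and "A' = flat_exp 1 (y + 1)"
  and "B = flat_exp 1 (1 - x)" and "B' = flat_exp 1 (1 - y)"
 have "A <= A'" "B' <= B" "0 <= A" "0 <= B'" using assms flat_exp_1(1) by (auto simp: A_def A'_def B_def B'_def intro!: fm)
 hence "A * B' <= A' * B" by (intro mult_mono) auto
 moreover have "A + B > 0" "A' + B' > 0" using step_denominator_pos by (auto simp: A_def A'_def B_def B'_def)
 ultimately show ?thesis unfolding step_def A_def[symmetric] A'_def[symmetric] B_def[symmetric] B'_def[symmetric] by (simp add: divide_simps algebra_simps)
qed

lemma bump1_nonneg: "bump1 x >= 0" by (rule mono_on_imp_deriv_nonneg[OF _ step_deriv, of UNIV]) (auto simp: mono_on_def step_mono)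

lemma bump1_outside: assumes "abs x > 1" shows "bump1 x = 0"
proof -
 obtain c where c: "!!y. y : (if x > 1 then {1<..} else {..<-1}) ==> step y = c" using step_eq by (cases "x > 1") (auto intro: less_imp_le)
 have "(step has_real_derivative 0) (at x)" by (rule has_field_derivative_transform_within_open[of "%_. c" _ _ "if x > 1 then {1<..} else {..<-1}"])
   (use assms c in auto)
 thus ?thesis using step_deriv DERIV_unique by blast
qed

lemma nn_integral_bump1: "(NN x. ennreal (bump1 x)) = 1"
proof -
 have "(NN x. ennreal (bump1 x)) = (NN x. ennreal (bump1 x) * indicator {-2..2} x)" by (intro nn_integral_cong) (auto simp: indicator_def bump1_outside)
 also have "... = ennreal (step 2 - step (-2))"
 proof (rule nn_integral_FTC_Icc)
  show "bump1 : borelf" by (rule smooth_borel[OF smooth_bump1])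
  show "(step has_real_derivative bump1 x) (at x)" for x by (rule step_deriv)
 qed (auto simp: bump1_nonneg)
 finally show ?thesis by (simp add: step_eq)
qed

lemma smooth_coordinate: "smooth h ==> smooth (%z. h (z \<bullet> e))" using smooth_affine[OF _ bounded_linear_inner_left, of h e 0] by simp

lemma dd_coordinate:
 fixes e :: "'a::euclidean_space"
 assumes "smooth h" "!!x. (h has_real_derivative h' x) (at x)"
 shows "dd v (%z. h (z \<bullet> e)) z = (v \<bullet> e) * h' (z \<bullet> e)"
proof -
 have "((%z. h (z \<bullet> e)) has_derivative (%v. h' (z \<bullet> e) * (v \<bullet> e))) (at z)"
  using has_derivative_compose[OF bounded_linear_imp_has_derivative[OF bounded_linear_inner_left]
   assms(2)[unfolded has_field_derivative_def], where x = z] by simp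
 from dd_eq[OF this] show ?thesis by (simp add: mult.commute)
qed

text \<open>The factors are exchanged one at a time. Exchanging the factor in direction e changes
  the product by a difference of one-dimensional kernels, the derivative of \<open>D e\<close>,
  times factors that are constant along e; so the change is a derivative in direction e of a
  function supported in the unit box.\<close>

lemma prod_difference_divergence:
 fixes kp0 kp1 :: "'a::euclidean_space => real => real" and D :: "'a => real => real"
 assumes sm: "!!b. b : Basis ==> smooth (kp0 b)" "!!b. b : Basis ==> smooth (kp1 b)" "!!b. b : Basis ==> smooth (D b)"
  and d: "!!b x. b : Basis ==> (D b has_real_derivative kp1 b x - kp0 b x) (at x)"
  and o: "!!b x. b : Basis ==> abs x > 1 ==> kp0 b x = 0 & kp1 b x = 0 & D b x = 0"
  and S: "S <= Basis"
 shows "EX M. (ALL e:S. smooth (M e) & (ALL z. z ~: unit_box --> M e z = 0)) &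
  (ALL z. (PROD b:Basis. (if b : S then kp1 b (z \<bullet> b) else kp0 b (z \<bullet> b))) - (PROD b:Basis. kp0 b (z \<bullet> b)) = (SUM e:S. dd e (M e) z))"
proof -
 define P where "P S M \<longleftrightarrow> (ALL e:S. smooth (M e) & (ALL z. z ~: unit_box --> M e z = 0)) &
  (ALL z. (PROD b:Basis. (if b : S then kp1 b (z \<bullet> b) else kp0 b (z \<bullet> b))) - (PROD b:Basis. kp0 b (z \<bullet> b)) = (SUM e:S. dd e (M e) z))"
  for S and M :: "'a => 'a => real"
 have "finite S" by (rule finite_subset[OF S finite_Basis])
 hence "EX M. P S M" using S
 proof (induction S rule: finite_induct)
  case empty
  thus ?case by (simp add: P_def)
 next
  case (insert e S)
  have S': "S <= Basis" using insert.prems by simp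
  obtain M where PM: "P S M" by (rule exE[OF insert.IH[OF S']])
  have M1: "ALL e:S. smooth (M e) & (ALL z. z ~: unit_box --> M e z = 0)" using PM unfolding P_def by (rule conjunct1)
  have M2: "ALL z. (PROD b:Basis. (if b : S then kp1 b (z \<bullet> b) else kp0 b (z \<bullet> b))) - (PROD b:Basis. kp0 b (z \<bullet> b)) = (SUM e:S. dd e (M e) z)"
   using PM unfolding P_def by (rule conjunct2)
  have e: "e : Basis" using insert.prems by simp
  define c where "c b = (if b : S then kp1 b else kp0 b)" for b
  define R where "R z = (PROD b:Basis - {e}. c b (z \<bullet> b))" for z
  have sR: "smooth R" unfolding R_def[abs_def] by (intro smooth_prod smooth_coordinate) (auto simp: c_def sm)
  have "R (z + t *\<^sub>R e) = R z" for z t unfolding R_def using e by (intro prod.cong refl) (auto simp: inner_add_left inner_Basis)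
  hence "((%t. R z) has_real_derivative dd e R z) (at 0)" for z using dd_line[OF sR, of z e 0] by simp
  hence dR: "dd e R z = 0" for z using DERIV_const DERIV_unique by blast
  define m where "m z = D e (z \<bullet> e) * R z" for z
  have sm': "smooth m" unfolding m_def[abs_def] by (intro smooth_mult smooth_coordinate sm e sR)
  have dm: "dd e m z = (kp1 e (z \<bullet> e) - kp0 e (z \<bullet> e)) * R z" for z unfolding m_def[abs_def] dd_mult[OF smooth_coordinate[OF sm(3)[OF e]] sR] dR
   using dd_coordinate[OF sm(3)[OF e] d[OF e], of e e z] e by simp
  have mo: "m z = 0" if z: "z ~: unit_box" for z
  proof -
   obtain b where b: "b : Basis" "abs (z \<bullet> b) > 1" using z by (auto simp: unit_box_iff)
   show ?thesis
   proof (cases "b = e")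
    case True thus ?thesis using o b by (simp add: m_def)
   next
    case False
    have "c b (z \<bullet> b) = 0" using o[OF b(1) b(2)] by (simp add: c_def)
    hence "R z = 0" unfolding R_def using b(1) False by (intro prod_zero) auto
    thus ?thesis by (simp add: m_def)
   qed
  qed
  have split: "(PROD b:Basis. (if b : T then kp1 b (z \<bullet> b) else kp0 b (z \<bullet> b))) =
   (if e : T then kp1 e (z \<bullet> e) else kp0 e (z \<bullet> e)) * R z" if T: "T = S | T = insert e S" for T z
  proof -
   have "(PROD b:Basis - {e}. (if b : T then kp1 b (z \<bullet> b) else kp0 b (z \<bullet> b))) = R z"
    unfolding R_def by (intro prod.cong) (use T in "auto simp: c_def")
   thus ?thesis using prod.remove[OF finite_Basis e, of "%b. if b : T then kp1 b (z \<bullet> b) else kp0 b (z \<bullet> b)"] by simp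
  qed
  have "(PROD b:Basis. (if b : insert e S then kp1 b (z \<bullet> b) else kp0 b (z \<bullet> b))) - (PROD b:Basis. kp0 b (z \<bullet> b))
   = (SUM e':insert e S. dd e' ((M(e := m)) e') z)" for z
  proof -
   have "(SUM e':S. dd e' ((M(e := m)) e') z) = (SUM e':S. dd e' (M e') z)" using insert.hyps(2) by (intro sum.cong) auto
   thus ?thesis using M2[rule_format, of z] insert.hyps split[of S z] split[of "insert e S" z] dm[of z] by (simp add: algebra_simps)
  qed
  hence "P (insert e S) (M(e := m))" unfolding P_def using M1 sm' mo by simp
  thus ?case by (rule exI[of "P (insert e S)"])
 qed
 thus ?thesis unfolding P_def .
qed

lemma par_map_0_inner: "b : Basis ==> par_map r 0 z \<bullet> b = (if b = (0, 1) then r^2 else r) * (z \<bullet> b)"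
 by (simp add: par_map_affine inner_sum_left inner_Basis if_distrib cong: if_cong)

text \<open>The kernel and its normalised parabolic dilate by 2 both have integral one, so their
  difference can be a divergence of compactly supported functions. The compact support of
  \<open>M e\<close> keeps the later potentials local.\<close>

lemma mollifier_exists:
 obtains k :: "(real^'n) * real => real" and M where
  "test_function UNIV k" "!!z. k z >= 0" "!!z. z ~: unit_box ==> k z = 0" "(LINT z|lborel. k z) = 1"
  "!!e. e : Basis ==> test_function UNIV (M e)" "!!e z. e : Basis ==> z ~: unit_box ==> M e z = 0"
  "!!z. 2 ^ (CARD('n) + 2) * k (par_map 2 0 z) - k z = (SUM e:Basis. dd e (M e) z)"
proof -
 define s :: "'n pt => real" where "s b = (if b = (0, 1) then 2^2 else 2)" for b
 define k :: "'n pt => real" where "k z = (PROD b:Basis. bump1 (z \<bullet> b))" for z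
 have s1: "s b >= 1" for b by (simp add: s_def)
 have ss: "smooth (%x. h (s b * x))" if "smooth h" for h b using smooth_affine[OF that bounded_linear_mult_right, of "s b" 0] by simp
 have sk: "smooth k" unfolding k_def[abs_def] by (intro smooth_prod smooth_coordinate smooth_bump1) simp
 have ko: "k z = 0" if z: "z ~: unit_box" for z
 proof -
  obtain b where b: "b : Basis" "abs (z \<bullet> b) > 1" using z unfolding unit_box_iff by fastforce
  thus ?thesis unfolding k_def by (intro prod_zero) (auto intro!: bexI[of _ b] bump1_outside)
 qed
 have tk: "test_function UNIV k" by (rule test_functionI[OF sk compact_unit_box]) (auto simp: ko)
 have k0: "k z >= 0" for z unfolding k_def by (intro prod_nonneg) (simp add: bump1_nonneg)
 have ki: "integrable lborel k" by (rule test_function_integrable[OF tk])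
 have "ennreal (LINT z|lborel. k z) = (NN z. ennreal (k z))" using ki k0 by (intro nn_integral_eq_integral[symmetric]) auto
 also have "... = (\<integral>\<^sup>+z. (PROD b:Basis. ennreal (bump1 (z \<bullet> b))) \<partial>(lborel :: ('n pt) measure))"
  unfolding k_def by (simp add: prod_ennreal bump1_nonneg)
 also have "... = (PROD b:(Basis::'n pt set). (NN x. ennreal (bump1 x)))" using smooth_borel[OF smooth_bump1] by (intro nn_integral_lborel_prod) auto
 also have "... = 1" by (simp add: nn_integral_bump1)
 finally have ik: "(LINT z|lborel. k z) = 1" by (simp add: ennreal_eq_1)
 have "EX M. (ALL e:Basis. smooth (M e) & (ALL z. z ~: unit_box --> M e z = 0)) &
  (ALL z. (PROD b:Basis. (if b : Basis then s b * bump1 (s b * (z \<bullet> b)) else bump1 (z \<bullet> b))) - (PROD b:Basis. bump1 (z \<bullet> b)) = (SUM e:Basis. dd e (M e) z))"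
 \<comment> \<open>The difference of steps is the antiderivative of the difference of the
   one-dimensional kernels. It vanishes for |x| > 1, where both steps are already constant because s
   b >= 1.\<close>
 proof (rule prod_difference_divergence[where D = "%b x. step (s b * x) - step x" and ?kp1.0 = "%b x. s b * bump1 (s b * x)"
    and ?kp0.0 = "%b. bump1"])
  fix b :: "'n pt" assume b: "b : Basis"
  show "smooth bump1" by (rule smooth_bump1)
  show "smooth (%x. s b * bump1 (s b * x))" by (intro smooth_mult smooth_const ss smooth_bump1)
  show "smooth (%x. step (s b * x) - step x)" by (intro smooth_diff ss smooth_step)
  show "((%x. step (s b * x) - step x) has_real_derivative s b * bump1 (s b * x) - bump1 x) (at x)" for x
  proof (intro DERIV_diff step_deriv)
   have "((%x. s b * x) has_real_derivative s b) (at x)" by (auto intro!: derivative_eq_intros)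
   from DERIV_chain2[OF step_deriv this] show "((%x. step (s b * x)) has_real_derivative s b * bump1 (s b * x)) (at x)" by (simp add: mult.commute)
  qed
  fix x :: real assume x: "abs x > 1"
  have "abs (s b * x) > 1" using x s1[of b] mult_mono[of 1 "s b" "abs x" "abs x"] by (simp add: abs_mult)
  moreover have "step (s b * x) - step x = 0"
  proof (cases "x > 0")
   case True
   hence "x >= 1" "s b * x >= 1" using x calculation s1[of b] by (auto simp: abs_mult)
   thus ?thesis by (simp add: step_eq)
  next
   case False
   hence "s b * x <= 0" using s1[of b] by (intro mult_nonneg_nonpos) auto
   hence "x <= -1" "s b * x <= -1" using x calculation False by auto
   thus ?thesis by (simp add: step_eq)
  qed
  ultimately show "bump1 x = 0 & s b * bump1 (s b * x) = 0 & step (s b * x) - step x = 0" using x by (simp add: bump1_outside)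
 qed simp
 then obtain M where M: "!!e. e : Basis ==> smooth (M e)" "!!e z. e : Basis ==> z ~: unit_box ==> M e z = 0"
  "!!z. (PROD b:Basis. (if b : Basis then s b * bump1 (s b * (z \<bullet> b)) else bump1 (z \<bullet> b))) - (PROD b:Basis. bump1 (z \<bullet> b)) = (SUM e:Basis. dd e (M e) z)"
  by blast
 have "(PROD b:Basis. s b * bump1 (s b * (z \<bullet> b))) = 2 ^ (CARD('n) + 2) * k (par_map 2 0 z)" for z
 proof -
  have "(PROD b:(Basis::'n pt set). s b) = 2 ^ (CARD('n) + 2)" using par_map_jacobian[of 2, where 'n='n] by (simp add: s_def if_distrib cong: if_cong)
  thus ?thesis unfolding k_def prod.distrib by (simp add: par_map_0_inner s_def)
 qed
 hence "2 ^ (CARD('n) + 2) * k (par_map 2 0 z) - k z = (SUM e:Basis. dd e (M e) z)" for z using M(3)[of z] by (simp add: k_def)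
 moreover have "test_function UNIV (M e)" if "e : Basis" for e by (rule test_functionI[OF M(1)[OF that] compact_unit_box]) (auto simp: M(2)[OF that])
 ultimately show ?thesis using that tk k0 ko ik M(2) by blast
qed

section \<open>Gradient bounds by potentials\<close>

text \<open>The parabolic box around z with half-sides 2^-j in space and 4^-j in time; since j is a
  natural number, the scale is at most 1.\<close>

definition near :: "nat => (real^'n) * real => 'n pt set" where
 "near j z = {z'. par_map (2 ^ j) 0 (z - z') : unit_box}"

lemma near_commute: "z' : near j z \<longleftrightarrow> z : near j z'"
proof -
 have "par_map (2 ^ j) 0 (z - z') = - par_map (2 ^ j) 0 (z' - z)" by (auto simp: par_map_def prod_eq_iff algebra_simps)
 thus ?thesis by (simp add: near_def unit_box_iff)
qed

lemma closed_near: "closed (near j z)"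
proof -
 have "continuous_on UNIV (%z'. par_map (2 ^ j) 0 (z - z'))" unfolding par_map_def by (intro continuous_intros)
 thus ?thesis unfolding near_def using continuous_closed_vimage[of unit_box "%z'. par_map (2 ^ j) 0 (z - z')"] compact_imp_closed[OF compact_unit_box]
  by (auto simp: vimage_def continuous_on_eq_continuous_at)
qed

lemma near_sets [measurable]: "near j z : sets borel" by (rule borel_closed[OF closed_near])

lemma par_map_measurable_borel [measurable]: "par_map r z0 : borelf" by (rule borel_measurable_continuous_onI) (auto simp: par_map_def intro!: continuous_intros)

lemma par_map_diff: "par_map r 0 (z - z') = ((- r) *\<^sub>R fst z', (- (r^2)) * snd z') + par_map r 0 z" by (auto simp: par_map_def prod_eq_iff algebra_simps)

lemma smooth_scaled: "smooth F ==> smooth (%z'. F (par_map r 0 (z - z')))" unfolding par_map_diff by (rule smooth_affine[OF _ par_map_linear])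

lemma test_scaled:
 assumes "test_function UNIV F" "r > 0" shows "test_function UNIV (%z'. F (par_map r 0 (z - z')))" using assms(1)
proof (rule test_functionE)
 fix K assume K: "smooth F" "compact K" "!!z. z ~: K ==> F z = 0"
 have "continuous_on K (%y. z - par_inv r 0 y)" unfolding par_inv_def using assms(2) by (intro continuous_intros) auto
 hence "compact ((%y. z - par_inv r 0 y) ` K)" by (rule compact_continuous_image[OF _ K(2)])
 thus ?thesis
 proof (rule test_functionI[OF smooth_scaled[OF K(1)]])
  fix z' assume a: "z' ~: (%y. z - par_inv r 0 y) ` K"
  have "z' = z - par_inv r 0 (par_map r 0 (z - z'))" using assms(2) by (simp add: par_map_inv)
  hence "par_map r 0 (z - z') ~: K" using a by blast
  thus "F (par_map r 0 (z - z')) = 0" by (rule K(3))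
 qed auto
qed

lemma dd_scaled:
 assumes "smooth F" "(r *\<^sub>R fst v, r^2 * snd v) = c *\<^sub>R v"
 shows "dd v (%z'. F (par_map r 0 (z - z'))) z' = - c * dd v F (par_map r 0 (z - z'))"
proof -
 have "dd v (%z'. F (((- r) *\<^sub>R fst z', (- (r^2)) * snd z') + par_map r 0 z)) =
  (%z'. dd ((- r) *\<^sub>R fst v, (- (r^2)) * snd v) F (((- r) *\<^sub>R fst z', (- (r^2)) * snd z') + par_map r 0 z))"
  by (rule dd_affine[OF assms(1) par_map_linear])
 moreover have "((- r) *\<^sub>R fst v, (- (r^2)) * snd v) = (- c) *\<^sub>R v" using assms(2) by (simp add: prod_eq_iff)
 moreover have "dd ((- c) *\<^sub>R v) F y = - c * dd v F y" for y
  using linear_cmul[OF has_derivative_linear[OF smooth_has_derivative[OF assms(1)]], of "- c" v y] by simp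
 ultimately show ?thesis by (simp add: par_map_diff)
qed

lemma wd_lborel:
 assumes "wd v f g" "f : borelf" "g : borelf"
 shows "integrable lborel f" "integrable lborel g"
  "test_function UNIV ph ==> (LINT z|lborel. f z * dd v ph z) = - (LINT z|lborel. g z * ph z)"
proof -
 have m: "f : borel_measurable lborel" "g : borel_measurable lborel" using assms by auto
 show "integrable lborel f" "integrable lborel g" using assms(1) integrable_completion[OF m(1)] integrable_completion[OF m(2)] by (auto simp: wd_def)
 assume t: "test_function UNIV ph"
 have s: "ph : borel_measurable lborel" "dd v ph : borel_measurable lborel"
  using smooth_borel[OF test_function_smooth[OF t]] smooth_borel[OF smooth_dd[OF test_function_smooth[OF t]]] by auto
 show "(LINT z|lborel. f z * dd v ph z) = - (LINT z|lborel. g z * ph z)"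
  using assms(1) t integral_completion[OF borel_measurable_times[OF m(1) s(2)]] integral_completion[OF borel_measurable_times[OF m(2) s(1)]] by (simp add: wd_def)
qed

text \<open>A function together with chosen Borel representatives of its derivatives: carrying them
  explicitly avoids the choice hidden in \<open>weak_deriv\<close>. That \<open>w2\<close>
  differentiates \<open>w1\<close> allows integration by parts one order at a time.\<close>

definition jet :: "((real^'n) * real => real) => ('n pt => real) => ('n => 'n pt => real)
  => ('n => 'n => 'n pt => real) => bool" where
 "jet w wt w1 w2 \<longleftrightarrow> w : borelf & wt : borelf &
  (ALL k. w1 k : borelf) & (ALL k l. w2 k l : borelf) &
  wd dir_t w wt & (ALL k. wd (dir_x k) w (w1 k)) & (ALL k l. wd (dir_x l) (w1 k) (w2 k l))"

definition jet_size :: "((real^'n) * real => real) => ('n pt => real) => ('n => 'n pt => real)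
  => ('n => 'n => 'n pt => real) => 'n pt => real" where
 "jet_size w wt w1 w2 z = abs (w z) + abs (wt z) + (SUM k:UNIV. abs (w1 k z)) + (SUM k:UNIV. SUM l:UNIV. abs (w2 k l z))"

abbreviation jint where "jint p w wt w1 w2 == (NN z. ennreal (jet_size w wt w1 w2 z powr p))"

lemma jet_size_ge:
 "abs (w z) <= jet_size w wt w1 w2 z" "abs (wt z) <= jet_size w wt w1 w2 z"
 "(SUM k:UNIV. abs (w1 k z)) <= jet_size w wt w1 w2 z" "abs (wt z) + (SUM l:UNIV. abs (w2 k l z)) <= jet_size w wt w1 w2 z"
 "0 <= jet_size w wt w1 w2 z"
proof -
 have n: "0 <= (SUM k:UNIV. abs (w1 k z))" "0 <= (SUM k:UNIV. SUM l:UNIV. abs (w2 k l z))" by (intro sum_nonneg abs_ge_zero)+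
 have "(SUM l:UNIV. abs (w2 k l z)) <= (SUM k:UNIV. SUM l:UNIV. abs (w2 k l z))" by (rule member_le_sum) (auto intro: sum_nonneg)
 with n show "abs (w z) <= jet_size w wt w1 w2 z" "abs (wt z) <= jet_size w wt w1 w2 z"
  "(SUM k:UNIV. abs (w1 k z)) <= jet_size w wt w1 w2 z" "abs (wt z) + (SUM l:UNIV. abs (w2 k l z)) <= jet_size w wt w1 w2 z"
  "0 <= jet_size w wt w1 w2 z" unfolding jet_size_def using abs_ge_zero[of "w z"] abs_ge_zero[of "wt z"] by linarith+
qed

lemma jet_integrable:
 assumes "jet w wt w1 w2"
 shows "integrable lborel w" "integrable lborel wt" "integrable lborel (w1 k)" "integrable lborel (w2 k l)"
  "integrable lborel (jet_size w wt w1 w2)"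
proof -
 show i: "integrable lborel w" "integrable lborel wt" "integrable lborel (w1 k)" "integrable lborel (w2 k l)" for k l
  using assms wd_lborel(1,2) unfolding jet_def by blast+
 show "integrable lborel (jet_size w wt w1 w2)"
  unfolding jet_size_def[abs_def] by (intro Bochner_Integration.integrable_add Bochner_Integration.integrable_sum integrable_abs i)
qed

lemma scaled_integral_bound:
 fixes v :: "(real^'n) * real => real"
 assumes v: "integrable lborel v" and F: "F : borelf" "!!z. abs (F z) <= B" "!!z. z ~: unit_box ==> F z = 0"
 shows "integrable lborel (%z'. v z' * F (par_map (2 ^ j) 0 (z - z')))"
  "abs (LINT z'|lborel. v z' * F (par_map (2 ^ j) 0 (z - z'))) <= B * (LINT z'|lborel. indicator (near j z) z' * abs (v z'))"
proof -
 note [measurable] = F(1)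
 show i: "integrable lborel (%z'. v z' * F (par_map (2 ^ j) 0 (z - z')))" by (rule integrable_bounded_times[OF v _ F(2)]) measurable
 have i2: "integrable lborel (%z'. indicator (near j z) z' * abs (v z'))" using v by (intro integrable_indicator_times) auto
 have "abs (LINT z'|lborel. v z' * F (par_map (2 ^ j) 0 (z - z'))) <= (LINT z'|lborel. abs (v z' * F (par_map (2 ^ j) 0 (z - z'))))" by (rule integral_abs_bound)
 moreover have "(LINT z'|lborel. abs (v z' * F (par_map (2 ^ j) 0 (z - z')))) <= (LINT z'|lborel. B * (indicator (near j z) z' * abs (v z')))"
 proof (rule integral_mono)
  show "integrable lborel (%z'. abs (v z' * F (par_map (2 ^ j) 0 (z - z'))))" using i by simp
  show "integrable lborel (%z'. B * (indicator (near j z) z' * abs (v z')))" using i2 by simp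
  fix z'
  show "abs (v z' * F (par_map (2 ^ j) 0 (z - z'))) <= B * (indicator (near j z) z' * abs (v z'))"
  proof (cases "z' : near j z")
   case True
   thus ?thesis using mult_left_mono[OF F(2)[of "par_map (2 ^ j) 0 (z - z')"], of "abs (v z')"] by (simp add: abs_mult mult.commute)
  next
   case False
   thus ?thesis using F(3) by (simp add: near_def)
  qed
 qed
 ultimately show "abs (LINT z'|lborel. v z' * F (par_map (2 ^ j) 0 (z - z'))) <= B * (LINT z'|lborel. indicator (near j z) z' * abs (v z'))"
  by (simp only: integral_mult_right_zero)
qed

lemma sum_Basis_dir:
 "(SUM e:(Basis::((real^'n) * real) set). F e) = F dir_t + (SUM l:UNIV. F (dir_x l))"
proof -
 have B: "(Basis::'n pt set) = insert dir_t (range dir_x)" by (auto simp: Basis_prod_def Basis_vec_def dir_t_def dir_x_def)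
 have i: "inj (dir_x :: 'n => 'n pt)" by (auto simp: inj_def dir_x_def axis_eq_axis)
 have n: "(dir_t :: 'n pt) ~: range dir_x" by (auto simp: dir_t_def dir_x_def)
 show ?thesis unfolding B by (subst sum.insert) (use n in "auto simp: sum.reindex[OF i]")
qed

lemma dir_Basis: "dir_t : Basis" "dir_x l : Basis" by (auto simp: Basis_prod_def Basis_vec_def dir_t_def dir_x_def)

lemma dir_scale: "(r *\<^sub>R fst dir_t, r^2 * snd dir_t) = r^2 *\<^sub>R dir_t" "(r *\<^sub>R fst (dir_x l), r^2 * snd (dir_x l)) = r *\<^sub>R dir_x l"
 by (auto simp: dir_t_def dir_x_def)

lemma scaled_space_derivative:
 assumes J: "jet w wt w1 w2" and M: "test_function UNIV M"
 shows "(LINT z'|lborel. w1 k z' * dd (dir_x l) M (par_map (2 ^ j) 0 (z - z')))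
  = (1 / 2 ^ j) * (LINT z'|lborel. w2 k l z' * M (par_map (2 ^ j) 0 (z - z')))"
proof -
 have t: "test_function UNIV (%z'. M (par_map (2 ^ j) 0 (z - z')))" by (rule test_scaled[OF M]) simp
 have "(LINT z'|lborel. w1 k z' * dd (dir_x l) (%z'. M (par_map (2 ^ j) 0 (z - z'))) z') = - (LINT z'|lborel. w2 k l z' * M (par_map (2 ^ j) 0 (z - z')))"
  using J by (intro wd_lborel(3)[OF _ _ _ t]) (auto simp: jet_def)
 moreover have "(LINT z'|lborel. w1 k z' * dd (dir_x l) (%z'. M (par_map (2 ^ j) 0 (z - z'))) z') =
  (LINT z'|lborel. (- (2 ^ j)) * (w1 k z' * dd (dir_x l) M (par_map (2 ^ j) 0 (z - z'))))" by (intro Bochner_Integration.integral_cong refl)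
   (simp add: dd_scaled[OF test_function_smooth[OF M] dir_scale(2)])
 ultimately have "(- (2 ^ j)) * (LINT z'|lborel. w1 k z' * dd (dir_x l) M (par_map (2 ^ j) 0 (z - z'))) = - (LINT z'|lborel. w2 k l z' * M (par_map (2 ^ j) 0 (z - z')))"
  by (simp only: integral_mult_right_zero)
 thus ?thesis by (simp add: field_simps)
qed

text \<open>No time derivative of \<open>w1 k\<close> is available. Both derivatives are moved to
  the test function, exchanged there, and the time derivative is returned to \<open>w\<close>. The
  dilation contributes 2^j against 4^j, so the gain is 2^-j, the same as for the space
  directions.\<close>

lemma scaled_time_derivative:
 assumes J: "jet w wt w1 w2" and M: "test_function UNIV M"
 shows "(LINT z'|lborel. w1 k z' * dd dir_t M (par_map (2 ^ j) 0 (z - z')))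
  = (1 / 2 ^ j) * (LINT z'|lborel. wt z' * dd (dir_x k) M (par_map (2 ^ j) 0 (z - z')))"
proof -
 let ?Ph = "%z'. M (par_map (2 ^ j) 0 (z - z'))"
 have t: "test_function UNIV ?Ph" by (rule test_scaled[OF M]) simp
 note s = test_function_smooth[OF M]
 have "(LINT z'|lborel. w1 k z' * dd dir_t ?Ph z') = - (LINT z'|lborel. w z' * dd (dir_x k) (dd dir_t ?Ph) z')"
  using J wd_lborel(3)[of "dir_x k" w "w1 k" "dd dir_t ?Ph"] test_function_dd[OF t] by (auto simp: jet_def)
 also have "... = - (LINT z'|lborel. w z' * dd dir_t (dd (dir_x k) ?Ph) z')" using dd_commute[OF test_function_smooth[OF t], of dir_t "dir_x k"] by simp
 also have "... = (LINT z'|lborel. wt z' * dd (dir_x k) ?Ph z')"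
  using J wd_lborel(3)[of dir_t w wt "dd (dir_x k) ?Ph"] test_function_dd[OF t] by (auto simp: jet_def)
 also have "... = (LINT z'|lborel. (- (2 ^ j)) * (wt z' * dd (dir_x k) M (par_map (2 ^ j) 0 (z - z'))))"
  by (intro Bochner_Integration.integral_cong refl) (simp add: dd_scaled[OF s dir_scale(2)])
 finally have 1: "(LINT z'|lborel. w1 k z' * dd dir_t ?Ph z') = - (2 ^ j) * (LINT z'|lborel. wt z' * dd (dir_x k) M (par_map (2 ^ j) 0 (z - z')))" by simp
 have "(LINT z'|lborel. w1 k z' * dd dir_t ?Ph z') =
  (LINT z'|lborel. (- ((2 ^ j)^2)) * (w1 k z' * dd dir_t M (par_map (2 ^ j) 0 (z - z'))))"
  by (intro Bochner_Integration.integral_cong refl) (simp add: dd_scaled[OF s dir_scale(1)])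
 hence "(2 ^ j)^2 * (LINT z'|lborel. w1 k z' * dd dir_t M (par_map (2 ^ j) 0 (z - z'))) = 2 ^ j * (LINT z'|lborel. wt z' * dd (dir_x k) M (par_map (2 ^ j) 0 (z - z')))"
  using 1 by simp
 thus ?thesis by (simp add: field_simps power2_eq_square)
qed

text \<open>The dyadic block at scale 2^-j of a parabolic Riesz potential of order one: the box has
  measure proportional to 2^(-j(n+2)), so up to a constant the value is 2^-j times an
  average.\<close>

definition potential :: "((real^'n) * real => real) => nat => 'n pt => real" where
 "potential H j z = 2 ^ (j * (CARD('n) + 1)) * (LINT z'|lborel. indicator (near j z) z' * H z')"

definition mollified :: "((real^'n) * real => real) => ('n pt => real) => nat => 'n pt => real" where
 "mollified k v j z = 2 ^ (j * (CARD('n) + 2)) * (LINT z'|lborel. v z' * k (par_map (2 ^ j) 0 (z - z')))"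

text \<open>Consecutive mollifications of \<open>w1\<close> differ by an integral against a
  divergence; integration by parts replaces \<open>w1\<close> by \<open>w2\<close> and
  \<open>wt\<close> and gains the factor 2^-j. Finitely many test functions occur, so one constant
  serves all jets, points and scales.\<close>

lemma mollified_bounds:
 fixes k :: "(real^'n) * real => real" and w wt w1 w2
 assumes k: "test_function UNIV k" "!!z. z ~: unit_box ==> k z = 0"
  and M: "!!e. e : Basis ==> test_function UNIV (M e)" "!!e z. e : Basis ==> z ~: unit_box ==> M e z = 0"
  and kM: "!!z. 2 ^ (CARD('n) + 2) * k (par_map 2 0 z) - k z = (SUM e:Basis. dd e (M e) z)"
 shows "EX B>=0. ALL w wt w1 w2 i j z. jet w wt w1 w2 -->
  abs (mollified k (w1 i) 0 z) <= B * potential (jet_size w wt w1 w2) 0 z &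
  abs (mollified k (w1 i) (Suc j) z - mollified k (w1 i) j z) <= B * potential (jet_size w wt w1 w2) j z"
proof -
 \<comment> \<open>All functions whose suprema enter. The last family comes from the time direction,
   where a space derivative remains on the test function.\<close>
 define Ts where "Ts = insert k (M ` Basis Un (%i. dd (dir_x i) (M dir_t)) ` UNIV)"
 have "EX B>=0. ALL z. abs (T z) <= B" if T: "T : Ts" for T
 proof -
  have "test_function UNIV T" using T k(1) M(1) test_function_dd[OF M(1)[OF dir_Basis(1)]] unfolding Ts_def by blast
  thus ?thesis by (rule test_function_bounded) blast
 qed
 then obtain b where b: "!!T. T : Ts ==> b T >= 0 & (ALL z. abs (T z) <= b T)" by metis
 have "finite Ts" unfolding Ts_def by simp
 define B where "B = sum b Ts"
 have bB: "abs (T z) <= B" if "T : Ts" for T z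
  using b[OF that] member_le_sum[of T Ts b] b \<open>finite Ts\<close> that unfolding B_def by (meson order_trans DiffD1)
 have B0: "B >= 0" unfolding B_def using b by (intro sum_nonneg) auto
 have "abs (mollified k (w1 i) 0 z) <= B * potential (jet_size w wt w1 w2) 0 z &
  abs (mollified k (w1 i) (Suc j) z - mollified k (w1 i) j z) <= B * potential (jet_size w wt w1 w2) j z"
  if J: "jet w wt w1 w2" for w wt w1 w2 i j z
 proof -
  define H where "H = jet_size w wt w1 w2"
  note i = jet_integrable[OF J]
  have iH: "integrable lborel (%z'. indicator (near j z) z' * H z')" for j unfolding H_def using i(5) by (intro integrable_indicator_times) auto
  have iv: "integrable lborel (%z'. indicator (near j z) z' * abs (v z'))" if "integrable lborel v" for v :: "'n pt => real" and j
   using that by (intro integrable_indicator_times) auto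
  have c: "smooth T ==> T : borelf" for T :: "'n pt => real" by (rule smooth_borel)
  have w1H: "abs (w1 i z') <= H z'" for z' using jet_size_ge(3)[of w1 z' w wt w2] member_le_sum[of i UNIV "%k. abs (w1 k z')"] unfolding H_def by simp
  have "abs (LINT z'|lborel. w1 i z' * k (par_map (2 ^ 0) 0 (z - z'))) <= B * (LINT z'|lborel. indicator (near 0 z) z' * abs (w1 i z'))"
   by (rule scaled_integral_bound(2)[OF i(3) c[OF test_function_smooth[OF k(1)]] bB[where T=k] k(2)]) (simp_all add: Ts_def)
  moreover have "(LINT z'|lborel. indicator (near 0 z) z' * abs (w1 i z')) <= (LINT z'|lborel. indicator (near 0 z) z' * H z')"
   by (intro integral_mono iv iH i mult_left_mono w1H) auto
  ultimately have 1: "abs (mollified k (w1 i) 0 z) <= B * potential H 0 z" unfolding mollified_def potential_def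
   using mult_left_mono[of "LINT z'|lborel. indicator (near 0 z) z' * abs (w1 i z')" "LINT z'|lborel. indicator (near 0 z) z' * H z'", OF _ B0] by simp
  let ?P = "%z'. par_map (2 ^ j) 0 (z - z')"
  have PP: "par_map (2 ^ Suc j) 0 (z - z') = par_map 2 0 (?P z')" for z' by (simp add: par_map_def power_mult_distrib)
  have ii: "integrable lborel (%z'. w1 i z' * dd e (M e) (?P z'))" if e: "e : Basis" for e
  proof -
   obtain C where "!!z. abs (dd e (M e) z) <= C" by (rule test_function_bounded[OF test_function_dd[OF M(1)[OF e]]], rule that)
   thus ?thesis by (intro scaled_integral_bound(1)[OF i(3) c[OF smooth_dd[OF test_function_smooth[OF M(1)[OF e]]]]])
     (auto intro: dd_eq_0_outside[OF compact_imp_closed[OF compact_unit_box] M(2)[OF e]])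
  qed
  have "mollified k (w1 i) (Suc j) z - mollified k (w1 i) j z
   = 2 ^ (j * (CARD('n) + 2)) * (LINT z'|lborel. w1 i z' * (2 ^ (CARD('n) + 2) * k (par_map 2 0 (?P z')) - k (?P z')))"
  proof -
   note kb = c[OF test_function_smooth[OF k(1)]]
   have ka: "abs (k z) <= B" for z by (rule bB) (simp add: Ts_def)
   have "integrable lborel (%z'. w1 i z' * k (par_map (2 ^ j) 0 (z - z')))" for j by (rule scaled_integral_bound(1)[OF i(3) kb ka k(2)])
   from this[of j] this[of "Suc j", unfolded PP]
   have I: "integrable lborel (%z'. w1 i z' * k (?P z'))" "integrable lborel (%z'. w1 i z' * k (par_map 2 0 (?P z')))" .
   let ?c = "2 ^ (CARD('n) + 2) :: real"
   have "(LINT z'|lborel. w1 i z' * (?c * k (par_map 2 0 (?P z')) - k (?P z')))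
    = (LINT z'|lborel. ?c * (w1 i z' * k (par_map 2 0 (?P z'))) - w1 i z' * k (?P z'))"
    by (intro Bochner_Integration.integral_cong refl) (simp add: right_diff_distrib)
   also have "... = ?c * (LINT z'|lborel. w1 i z' * k (par_map 2 0 (?P z'))) - (LINT z'|lborel. w1 i z' * k (?P z'))"
    by (subst Bochner_Integration.integral_diff[OF integrable_mult_right[OF I(2)] I(1)]) (simp only: integral_mult_right_zero)
   finally have e: "(LINT z'|lborel. w1 i z' * (?c * k (par_map 2 0 (?P z')) - k (?P z')))
    = ?c * (LINT z'|lborel. w1 i z' * k (par_map 2 0 (?P z'))) - (LINT z'|lborel. w1 i z' * k (?P z'))" .
   have p: "(2::real) ^ (Suc j * (CARD('n) + 2)) = 2 ^ (j * (CARD('n) + 2)) * ?c" by (simp add: power_add[symmetric] algebra_simps)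
   show ?thesis unfolding mollified_def PP e p by (simp only: right_diff_distrib mult.assoc)
  qed
  also have "... = 2 ^ (j * (CARD('n) + 2)) * (SUM e:Basis. LINT z'|lborel. w1 i z' * dd e (M e) (?P z'))"
  proof -
   have "(LINT z'|lborel. w1 i z' * (SUM e:Basis. dd e (M e) (?P z'))) = (LINT z'|lborel. (SUM e:Basis. w1 i z' * dd e (M e) (?P z')))"
    by (simp only: sum_distrib_left)
   also have "... = (SUM e:Basis. LINT z'|lborel. w1 i z' * dd e (M e) (?P z'))" by (rule Bochner_Integration.integral_sum[OF ii])
   finally show ?thesis unfolding kM by simp
  qed
  also have "... = 2 ^ (j * (CARD('n) + 2)) * ((1 / 2 ^ j) * ((LINT z'|lborel. wt z' * dd (dir_x i) (M dir_t) (?P z'))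
    + (SUM l:UNIV. LINT z'|lborel. w2 i l z' * M (dir_x l) (?P z'))))"
   unfolding sum_Basis_dir scaled_space_derivative[OF J M(1)[OF dir_Basis(2)]] scaled_time_derivative[OF J M(1)[OF dir_Basis(1)]]
   by (simp add: sum_distrib_left distrib_left)
  also have "... = 2 ^ (j * (CARD('n) + 1)) * ((LINT z'|lborel. wt z' * dd (dir_x i) (M dir_t) (?P z'))
    + (SUM l:UNIV. LINT z'|lborel. w2 i l z' * M (dir_x l) (?P z')))" by (simp add: power_add)
  finally have d: "mollified k (w1 i) (Suc j) z - mollified k (w1 i) j z = 2 ^ (j * (CARD('n) + 1)) * ((LINT z'|lborel. wt z' * dd (dir_x i) (M dir_t) (?P z'))
    + (SUM l:UNIV. LINT z'|lborel. w2 i l z' * M (dir_x l) (?P z')))" .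
  have e1: "abs (LINT z'|lborel. wt z' * dd (dir_x i) (M dir_t) (?P z')) <= B * (LINT z'|lborel. indicator (near j z) z' * abs (wt z'))"
   by (rule scaled_integral_bound(2)[OF i(2) c[OF smooth_dd[OF test_function_smooth[OF M(1)[OF dir_Basis(1)]]]] bB[where T="dd (dir_x i) (M dir_t)"]])
    (auto simp: Ts_def intro: dd_eq_0_outside[OF compact_imp_closed[OF compact_unit_box] M(2)[OF dir_Basis(1)]])
  have e2: "abs (LINT z'|lborel. w2 i l z' * M (dir_x l) (?P z')) <= B * (LINT z'|lborel. indicator (near j z) z' * abs (w2 i l z'))" for l
   by (rule scaled_integral_bound(2)[OF i(4) c[OF test_function_smooth[OF M(1)[OF dir_Basis(2)]]] bB[where T="M (dir_x l)"] M(2)[OF dir_Basis(2)]])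
    (auto simp: Ts_def dir_Basis)
  have "abs ((LINT z'|lborel. wt z' * dd (dir_x i) (M dir_t) (?P z')) + (SUM l:UNIV. LINT z'|lborel. w2 i l z' * M (dir_x l) (?P z')))
   <= abs (LINT z'|lborel. wt z' * dd (dir_x i) (M dir_t) (?P z')) + (SUM l:UNIV. abs (LINT z'|lborel. w2 i l z' * M (dir_x l) (?P z')))"
   by (rule order_trans[OF abs_triangle_ineq add_left_mono[OF sum_abs]])
  moreover have "abs (LINT z'|lborel. wt z' * dd (dir_x i) (M dir_t) (?P z')) + (SUM l:UNIV. abs (LINT z'|lborel. w2 i l z' * M (dir_x l) (?P z')))
   <= B * (LINT z'|lborel. indicator (near j z) z' * abs (wt z')) + (SUM l:UNIV. B * (LINT z'|lborel. indicator (near j z) z' * abs (w2 i l z')))"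
   by (intro add_mono sum_mono e1 e2)
  moreover have "B * (LINT z'|lborel. indicator (near j z) z' * abs (wt z')) + (SUM l:UNIV. B * (LINT z'|lborel. indicator (near j z) z' * abs (w2 i l z')))
   = B * (LINT z'|lborel. indicator (near j z) z' * (abs (wt z') + (SUM l:UNIV. abs (w2 i l z'))))"
  proof -
   have "(LINT z'|lborel. indicator (near j z) z' * (abs (wt z') + (SUM l:UNIV. abs (w2 i l z'))))
    = (LINT z'|lborel. indicator (near j z) z' * abs (wt z') + (SUM l:UNIV. indicator (near j z) z' * abs (w2 i l z')))"
    by (simp only: distrib_left sum_distrib_left)
   also have "... = (LINT z'|lborel. indicator (near j z) z' * abs (wt z')) + (LINT z'|lborel. (SUM l:UNIV. indicator (near j z) z' * abs (w2 i l z')))"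
    by (intro Bochner_Integration.integral_add Bochner_Integration.integrable_sum iv i)
   also have "(LINT z'|lborel. (SUM l:UNIV. indicator (near j z) z' * abs (w2 i l z'))) = (SUM l:UNIV. LINT z'|lborel. indicator (near j z) z' * abs (w2 i l z'))"
    by (intro Bochner_Integration.integral_sum iv i)
   finally show ?thesis by (simp only: distrib_left sum_distrib_left)
  qed
  moreover have "B * (LINT z'|lborel. indicator (near j z) z' * (abs (wt z') + (SUM l:UNIV. abs (w2 i l z')))) <= B * (LINT z'|lborel. indicator (near j z) z' * H z')"
  proof (intro mult_left_mono[OF _ B0] integral_mono iH)
   show "integrable lborel (%z'. indicator (near j z) z' * (abs (wt z') + (SUM l:UNIV. abs (w2 i l z'))))"
    by (intro integrable_indicator_times Bochner_Integration.integrable_add Bochner_Integration.integrable_sum integrable_abs i) simp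
   show "indicator (near j z) z' * (abs (wt z') + (SUM l:UNIV. abs (w2 i l z'))) <= indicator (near j z) z' * H z'" for z'
    unfolding H_def by (intro mult_left_mono jet_size_ge) simp
  qed
  ultimately have "abs ((LINT z'|lborel. wt z' * dd (dir_x i) (M dir_t) (?P z')) + (SUM l:UNIV. LINT z'|lborel. w2 i l z' * M (dir_x l) (?P z')))
   <= B * (LINT z'|lborel. indicator (near j z) z' * H z')" by linarith
  from mult_left_mono[OF this, of "2 ^ (j * (CARD('n) + 1))"]
  have 2: "abs (mollified k (w1 i) (Suc j) z - mollified k (w1 i) j z) <= B * potential H j z" unfolding d potential_def by (simp add: abs_mult mult.left_commute)
  show ?thesis using 1 2 unfolding H_def by simp
 qed
 thus ?thesis using B0 by blast
qed

lemma near_indicator: "indicator (near j z) z' = indicator unit_box (par_map (2 ^ j) 0 (z - z'))" by (auto simp: near_def indicator_def)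

lemma unit_box_sets [measurable]: "unit_box : sets borel" by (simp add: unit_box_def)

lemma near_volume:
 fixes z :: "(real^'n) * real"
 shows "evol (near j z) = ennreal (vol (unit_box :: 'n pt set) / 2 ^ (j * (CARD('n) + 2)))"
proof -
 let ?V = "vol (unit_box :: 'n pt set)" and ?c = "2 ^ (j * (CARD('n) + 2)) :: real"
 have fin: "evol (unit_box :: 'n pt set) = ennreal ?V" by (rule emeasure_eq_ennreal_measure) (simp add: unit_box_def)
 have m: "par_map (2 ^ j) (par_map (2 ^ j) 0 (- z)) z' : unit_box \<longleftrightarrow> z' : near j z" for z'
 proof -
  have "par_map (2 ^ j) (par_map (2 ^ j) 0 (- z)) z' = - par_map (2 ^ j) 0 (z - z')" by (auto simp: par_map_def prod_eq_iff algebra_simps)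
  thus ?thesis by (simp add: near_def unit_box_iff)
 qed
 have "evol (unit_box :: 'n pt set) = (\<integral>\<^sup>+z. indicator unit_box z \<partial>(lebesgue :: ('n pt) measure))"
  by (simp add: emeasure_completion)
 also have "... = ennreal ((2 ^ j) ^ (CARD('n) + 2)) * (NL z'. indicator unit_box (par_map (2 ^ j) (par_map (2 ^ j) 0 (- z)) z'))"
  by (rule nn_integral_par_map, simp, rule measurable_completion, simp)
 also have "(%z'. indicator unit_box (par_map (2 ^ j) (par_map (2 ^ j) 0 (- z)) z') :: ennreal) = indicator (near j z)"
  using m by (auto simp: indicator_def fun_eq_iff)
 also have "(NL z'. indicator (near j z) z') = evol (near j z)" using near_sets[of j z] by (simp add: emeasure_completion)
 finally have e: "ennreal ?V = ennreal ?c * evol (near j z)" unfolding fin by (simp only: power_mult)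
 hence "evol (near j z) ~= \<infinity>" using ennreal_mult_eq_top_iff[of "ennreal ?c"] by (auto simp: ennreal_mult_eq_top_iff)
 then obtain x where x: "evol (near j z) = ennreal x" "x >= 0" by (cases "evol (near j z)") auto
 have "?V = ?c * x" using e x by (simp add: ennreal_mult'[symmetric])
 thus ?thesis using x by simp
qed

text \<open>Tonelli and the symmetry of \<open>near\<close>. Afterwards a weight enters only through
  its mass on boxes, which is what a Morrey bound controls.\<close>

lemma near_swap:
 fixes m h :: "(real^'n) * real => ennreal"
 assumes [measurable]: "m : borelf" "h : borelf"
 shows "(NN z. m z * (NN z'. indicator (near j z) z' * h z'))
  = (NN z'. h z' * (NN z. indicator (near j z') z * m z))"
proof -
 have "(NN z. m z * (NN z'. indicator (near j z) z' * h z'))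
  = (NN z. (NN z'. m z * (indicator unit_box (par_map (2 ^ j) 0 (z - z')) * h z')))"
  unfolding near_indicator by (intro nn_integral_cong nn_integral_cmult[symmetric]) measurable
 also have "... = (NN z'. (NN z. m z * (indicator unit_box (par_map (2 ^ j) 0 (z - z')) * h z')))" by (rule lborel_pair.Fubini') measurable
 also have "... = (NN z'. (NN z. h z' * (indicator (near j z') z * m z)))"
 proof (intro nn_integral_cong)
  fix z z' :: "'n pt"
  have "indicator unit_box (par_map (2 ^ j) 0 (z - z')) = (indicator (near j z') z :: ennreal)" using near_commute[of z' j z] by (simp add: near_def indicator_def)
  thus "m z * (indicator unit_box (par_map (2 ^ j) 0 (z - z')) * h z') = h z' * (indicator (near j z') z * m z)" by (simp add: mult_ac)
 qed
 also have "... = (NN z'. h z' * (NN z. indicator (near j z') z * m z))" by (intro nn_integral_cong nn_integral_cmult) measurable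
 finally show ?thesis .
qed

lemma ennreal_potential:
 assumes "integrable lborel H" "!!z. H z >= 0"
 shows "ennreal (potential H j z) = ennreal (2 ^ (j * (CARD('n) + 1))) * (NN z'. indicator (near j (z :: (real^'n) * real)) z' * ennreal (H z'))"
proof -
 have "(NN z'. indicator (near j z) z' * ennreal (H z')) = (NN z'. ennreal (indicator (near j z) z' * H z'))" by (intro nn_integral_cong) (auto simp: indicator_def)
 also have "... = ennreal (LINT z'|lborel. indicator (near j z) z' * H z')"
  by (rule nn_integral_eq_integral) (auto intro!: integrable_indicator_times assms AE_I2 mult_nonneg_nonneg)
 finally show ?thesis by (simp add: potential_def ennreal_mult')
qed

text \<open>The factor 2^-j in the L^1 norm makes the telescoping series of mollifications converge
  absolutely in L^1.\<close>

lemma potential_integral: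
 fixes H :: "(real^'n) * real => real"
 assumes H: "integrable lborel H" "!!z. H z >= 0"
 shows "has_bochner_integral lborel (potential H j) (vol (unit_box :: 'n pt set) / 2 ^ j * (LINT z|lborel. H z))"
proof (rule has_bochner_integral_nn_integral)
 have [measurable]: "H : borelf" using H(1) by auto
 show "potential H j : borel_measurable lborel" unfolding potential_def[abs_def] near_indicator by measurable
 show "AE z in lborel. 0 <= potential H j z" unfolding potential_def by (intro AE_I2 mult_nonneg_nonneg Bochner_Integration.integral_nonneg H) auto
 let ?V = "vol (unit_box :: 'n pt set)" and ?c = "2 ^ (j * (CARD('n) + 1)) :: real"
 have mpos: "(LINT z|lborel. H z) >= 0" by (rule Bochner_Integration.integral_nonneg) (rule H)
 show "0 <= ?V / 2 ^ j * (LINT z|lborel. H z)" using mpos by simp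
 have "(NN z. ennreal (potential H j z))
  = ennreal ?c * (NN z. (NN z'. indicator (near j z) z' * ennreal (H z')))" unfolding ennreal_potential[OF H] near_indicator by (rule nn_integral_cmult) measurable
 also have "(NN z. (NN z'. indicator (near j z) z' * ennreal (H z')))
  = (NN z'. ennreal (H z') * evol (near j z'))" using near_swap[of "%_. 1" "%z. ennreal (H z)" j] by simp
 also have "... = (NN z'. ennreal (H z')) * ennreal (?V / 2 ^ (j * (CARD('n) + 2)))" unfolding near_volume by (rule nn_integral_multc) measurable
 also have "(NN z'. ennreal (H z')) = ennreal (LINT z|lborel. H z)" by (rule nn_integral_eq_integral) (auto intro: H)
 also have "ennreal ?c * (ennreal (LINT z|lborel. H z) * ennreal (?V / 2 ^ (j * (CARD('n) + 2)))) = ennreal (?V / 2 ^ j * (LINT z|lborel. H z))"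
  using mpos by (simp add: ennreal_mult'[symmetric] power_add field_simps)
 finally show "(NN z. ennreal (potential H j z)) = ennreal (?V / 2 ^ j * (LINT z|lborel. H z))" .
qed

lemma mollified_measurable:
 assumes [measurable]: "v : borelf" "k : borelf"
 shows "mollified k v j : borelf" unfolding mollified_def[abs_def] by measurable

lemma integral_par_map_lborel:
 fixes F :: "(real^'n) * real => real"
 assumes "r > 0" "integrable lborel F"
 shows "(LINT z|lborel. F z) = r ^ (CARD('n) + 2) * (LINT z|lborel. F (par_map r z0 z))"
proof -
 have m: "F : borel_measurable lborel" "(%z. F (par_map r z0 z)) : borel_measurable lborel" using assms(2) by auto
 have "integrable lebesgue F" using assms(2) integrable_completion[OF m(1)] by simp
 from integral_par_map(2)[OF assms(1) this, of z0] show ?thesis by (simp add: integral_completion[OF m(1)] integral_completion[OF m(2)])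
qed

text \<open>Fubini moves the mollification onto the test function, where it stays bounded and
  converges pointwise by continuity; the integral of the kernel being one fixes the limit.\<close>

lemma mollified_weak_limit:
 fixes k v :: "(real^'n) * real => real"
 assumes k: "test_function UNIV k" "(LINT z|lborel. k z) = 1" and v: "integrable lborel v" and ph: "test_function UNIV ph"
 shows "(%j. LINT z|lborel. mollified k v j z * ph z) \<longlonglongrightarrow> (LINT z|lborel. v z * ph z)"
proof -
 have [measurable]: "v : borelf" "k : borelf" "ph : borelf" using v k ph by (auto simp: smooth_borel test_function_smooth)
 obtain B where B: "B >= 0" "!!z. abs (k z) <= B" by (rule test_function_bounded[OF k(1)]) (rule that)
 obtain C where C: "C >= 0" "!!z. abs (ph z) <= C" by (rule test_function_bounded[OF ph]) (rule that)
 have ki: "integrable lborel k" and phi: "integrable lborel ph" by (auto intro: test_function_integrable k ph)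
 define c where "c j = (2::real) ^ (j * (CARD('n) + 2))" for j
 define ps where "ps j z' = (LINT y|lborel. k y * ph (par_map (1 / 2 ^ j) z' y))" for j z'
 have in1: "integrable lborel (%z. k (par_map (2 ^ j) 0 (z - z')) * ph z)" for j z'
  using integrable_bounded_times[OF phi, of "%z. k (par_map (2 ^ j) 0 (z - z'))" B] B(2) by (simp add: mult.commute)
 have ps: "c j * (LINT z|lborel. k (par_map (2 ^ j) 0 (z - z')) * ph z) = ps j z'" for j z'
 proof -
  have p: "par_map (2 ^ j) 0 (par_map (1 / 2 ^ j) z' y - z') = y" for y by (auto simp: par_map_def prod_eq_iff power2_eq_square)
  have "(LINT z|lborel. k (par_map (2 ^ j) 0 (z - z')) * ph z) = (1 / 2 ^ j) ^ (CARD('n) + 2) * ps j z'"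
   unfolding ps_def using integral_par_map_lborel[OF _ in1, of "1 / 2 ^ j" j z' z'] by (simp add: p)
  thus ?thesis by (simp only: c_def power_mult power_one_over) simp
 qed
 have fub: "(LINT z|lborel. mollified k v j z * ph z) = (LINT z'|lborel. v z' * ps j z')" for j
 proof -
  let ?f = "%z' z. v z' * (k (par_map (2 ^ j) 0 (z - z')) * ph z)"
  have "integrable (lborel \<Otimes>\<^sub>M lborel) (%p. ?f (fst p) (snd p))"
  proof (rule lborel_pair.Fubini_integrable)
   show "(%p. ?f (fst p) (snd p)) : borel_measurable (lborel \<Otimes>\<^sub>M lborel)" by measurable
   show "AE x in lborel. integrable lborel (%y. ?f (fst (x, y)) (snd (x, y)))" using in1 by (intro AE_I2) simp
   show "integrable lborel (%x. LINT y|lborel. norm (?f (fst (x, y)) (snd (x, y))))"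
   proof (rule Bochner_Integration.integrable_bound[of _ "%x. (B * (LINT y|lborel. abs (ph y))) * v x"])
    show "integrable lborel (%x. (B * (LINT y|lborel. abs (ph y))) * v x)" using v by simp
    show "(%x. LINT y|lborel. norm (?f (fst (x, y)) (snd (x, y)))) : borel_measurable lborel" by measurable
    show "AE x in lborel. norm (LINT y|lborel. norm (?f (fst (x, y)) (snd (x, y)))) <= norm ((B * (LINT y|lborel. abs (ph y))) * v x)"
    proof (rule AE_I2)
     fix x
     have "(LINT y|lborel. abs (k (par_map (2 ^ j) 0 (y - x)) * ph y)) <= (LINT y|lborel. B * abs (ph y))"
      by (intro integral_mono integrable_abs in1 integrable_mult_right phi) (simp add: abs_mult mult_right_mono B(2))
     hence "abs (v x) * (LINT y|lborel. abs (k (par_map (2 ^ j) 0 (y - x)) * ph y)) <= abs (v x) * (B * (LINT y|lborel. abs (ph y)))" by (intro mult_left_mono) auto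
     moreover have e: "(LINT y|lborel. norm (?f (fst (x, y)) (snd (x, y)))) = abs (v x) * (LINT y|lborel. abs (k (par_map (2 ^ j) 0 (y - x)) * ph y))"
      unfolding fst_conv snd_conv real_norm_def abs_mult[of "v x"] by (rule integral_mult_right_zero)
     moreover have "0 <= (LINT y|lborel. abs (k (par_map (2 ^ j) 0 (y - x)) * ph y))" "0 <= (LINT y|lborel. abs (ph y))"
      by (intro Bochner_Integration.integral_nonneg abs_ge_zero)+
     ultimately show "norm (LINT y|lborel. norm (?f (fst (x, y)) (snd (x, y)))) <= norm ((B * (LINT y|lborel. abs (ph y))) * v x)"
      unfolding e using B(1) by (simp only: real_norm_def abs_mult abs_of_nonneg abs_abs mult.commute mult.left_commute abs_idempotent)
    qed
   qed
  qed
  hence I: "integrable (lborel \<Otimes>\<^sub>M lborel) (%(z', z). ?f z' z)" unfolding case_prod_beta' .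
  have "(LINT z|lborel. mollified k v j z * ph z) = (LINT z|lborel. c j * (LINT z'|lborel. ?f z' z))"
  proof (intro Bochner_Integration.integral_cong refl)
   fix z
   have "(LINT z'|lborel. ?f z' z) = (LINT z'|lborel. (v z' * k (par_map (2 ^ j) 0 (z - z'))) * ph z)" by (intro Bochner_Integration.integral_cong refl) simp
   thus "mollified k v j z * ph z = c j * (LINT z'|lborel. ?f z' z)" by (simp add: mollified_def c_def)
  qed
  also have "... = c j * (LINT z'|lborel. (LINT z|lborel. ?f z' z))" using lborel_pair.Fubini_integral[OF I] by simp
  also have "... = (LINT z'|lborel. v z' * ps j z')" unfolding ps[symmetric] by (simp add: mult.left_commute)
  finally show ?thesis .
 qed
 have psb: "abs (ps j z') <= C * (LINT y|lborel. abs (k y))" for j z'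
 proof -
  have "abs (ps j z') <= (LINT y|lborel. abs (k y * ph (par_map (1 / 2 ^ j) z' y)))" unfolding ps_def by (rule integral_abs_bound)
  also have "(LINT y|lborel. abs (k y * ph (par_map (1 / 2 ^ j) z' y))) <= (LINT y|lborel. C * abs (k y))"
  proof (intro integral_mono integrable_abs integrable_mult_right ki)
   show "integrable lborel (%y. k y * ph (par_map (1 / 2 ^ j) z' y))" by (rule integrable_bounded_times[OF ki _ C(2)]) measurable
   show "abs (k y * ph (par_map (1 / 2 ^ j) z' y)) <= C * abs (k y)" for y
    using mult_left_mono[OF C(2)[of "par_map (1 / 2 ^ j) z' y"], of "abs (k y)"] by (simp add: abs_mult mult.commute)
  qed
  finally show ?thesis by simp
 qed
 have pslim: "(%j. ps j z') \<longlonglongrightarrow> ph z'" for z'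
 proof -
  have "(%j. LINT y|lborel. k y * ph (par_map (1 / 2 ^ j) z' y)) \<longlonglongrightarrow> (LINT y|lborel. k y * ph z')"
  proof (rule integral_dominated_convergence[where w="%y. C * abs (k y)"])
   show "integrable lborel (%y. C * abs (k y))" using ki by simp
   show "AE y in lborel. norm (k y * ph (par_map (1 / 2 ^ j) z' y)) <= C * abs (k y)" for j
    by (rule AE_I2, unfold real_norm_def abs_mult mult.commute[of C], rule mult_left_mono[OF C(2) abs_ge_zero])
   show "AE y in lborel. (%j. k y * ph (par_map (1 / 2 ^ j) z' y)) \<longlonglongrightarrow> k y * ph z'"
   proof (intro AE_I2 tendsto_mult tendsto_const)
    fix y :: "'n pt"
    have z: "(%j. 1 / 2 ^ j :: real) \<longlonglongrightarrow> 0" using LIMSEQ_power_zero[of "1/2 :: real"] by (simp add: power_one_over)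
    have "(%j. (fst z' + (1 / 2 ^ j) *\<^sub>R fst y, snd z' + (1 / 2 ^ j)^2 * snd y)) \<longlonglongrightarrow> (fst z' + 0 *\<^sub>R fst y, snd z' + 0^2 * snd y)"
     by (intro tendsto_intros z)
    hence "(%j. par_map (1 / 2 ^ j) z' y) \<longlonglongrightarrow> z'" by (simp add: par_map_def)
    moreover have "isCont ph z'" by (rule differentiable_imp_continuous_within[OF smooth_differentiable[OF test_function_smooth[OF ph]]])
    ultimately show "(%j. ph (par_map (1 / 2 ^ j) z' y)) \<longlonglongrightarrow> ph z'" by (rule isCont_tendsto_compose[rotated])
   qed
  qed measurable
  thus ?thesis unfolding ps_def using k(2) by simp
 qed
 show ?thesis unfolding fub
 proof (rule integral_dominated_convergence[where w="%z. (C * (LINT y|lborel. abs (k y))) * abs (v z)"])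
  show "integrable lborel (%z. (C * (LINT y|lborel. abs (k y))) * abs (v z))" using v by simp
  show "AE z in lborel. (%j. v z * ps j z) \<longlonglongrightarrow> v z * ph z" by (intro AE_I2 tendsto_mult tendsto_const pslim)
  show "AE z in lborel. norm (v z * ps j z) <= (C * (LINT y|lborel. abs (k y))) * abs (v z)" for j
   by (rule AE_I2, unfold real_norm_def abs_mult mult.commute[of "C * _"], rule mult_left_mono[OF psb abs_ge_zero])
  show "(%z. v z * ps j z) : borel_measurable lborel" for j
  proof -
   have "(%z. ps j z) : borelf" unfolding ps[symmetric] by measurable
   thus ?thesis by measurable
  qed
 qed measurable
qed

text \<open>The gradient is its mollification at scale 1 plus the telescoping sum of dyadic
  differences, and each of these terms is dominated by a potential.\<close>

lemma gradient_potential_bound: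
 "EX C>=0. ALL (w :: (real^'n) * real => real) wt w1 w2 i. jet w wt w1 w2 -->
  (AE z in lebesgue. ennreal (abs (w1 i z)) <= ennreal C * (\<Sum>j. ennreal (potential (jet_size w wt w1 w2) j z)))"
proof -
 obtain k :: "'n pt => real" and M where k: "test_function UNIV k" "!!z. z ~: unit_box ==> k z = 0" "(LINT z|lborel. k z) = 1"
  and M: "!!e. e : Basis ==> test_function UNIV (M e)" "!!e z. e : Basis ==> z ~: unit_box ==> M e z = 0"
  "!!z. 2 ^ (CARD('n) + 2) * k (par_map 2 0 z) - k z = (SUM e:Basis. dd e (M e) z)" by (rule mollifier_exists) (rule that)
 obtain B where B: "B >= 0" "!!w wt w1 w2 i j z. jet w wt w1 w2 ==>
  abs (mollified k (w1 i) 0 z) <= B * potential (jet_size w wt w1 w2) 0 z &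
  abs (mollified k (w1 i) (Suc j) z - mollified k (w1 i) j z) <= B * potential (jet_size w wt w1 w2) j z" using mollified_bounds[OF k(1,2) M] by blast
 have "AE z in lebesgue. ennreal (abs (w1 i z)) <= ennreal (2 * B) * (\<Sum>j. ennreal (potential (jet_size w wt w1 w2) j z))"
  if J: "jet w wt w1 w2" for w :: "'n pt => real" and wt w1 w2 i
 proof -
  define H where "H = jet_size w wt w1 w2"
  define a where "a = mollified k (w1 i)"
  define D where "D j z = a (Suc j) z - a j z" for j z
  define V where "V = vol (unit_box :: 'n pt set)"
  note i = jet_integrable[OF J]
  have H: "integrable lborel H" "!!z. H z >= 0" unfolding H_def using i(5) jet_size_ge(5) by auto
  have ab: "abs (a 0 z) <= B * potential H 0 z" "abs (D j z) <= B * potential H j z" for z j using B(2)[OF J] unfolding a_def D_def H_def by auto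
  have pot: "integrable lborel (potential H j)" "(LINT z|lborel. potential H j z) = V / 2 ^ j * (LINT z|lborel. H z)" for j
   using potential_integral[OF H, of j] unfolding V_def by (auto simp: has_bochner_integral_iff)
  have pot0: "potential H j z >= 0" for j z unfolding potential_def by (intro mult_nonneg_nonneg Bochner_Integration.integral_nonneg H) auto
  have am[measurable]: "a j : borelf" for j unfolding a_def using i(3) smooth_borel[OF test_function_smooth[OF k(1)]] by (intro mollified_measurable) auto
  have Dm[measurable]: "D j : borelf" for j unfolding D_def[abs_def] by measurable
  have bnd: "integrable lborel f" if "f : borelf" "!!z. abs (f z) <= B * potential H j z" for f :: "'n pt => real" and j
   by (rule Bochner_Integration.integrable_bound[of _ "%z. B * potential H j z"])
    (use that pot pot0 B(1) in "auto intro!: AE_I2")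
  have Di: "integrable lborel (D j)" for j by (rule bnd[OF Dm ab(2)])
  have ai: "integrable lborel (a j)" for j
  proof (induction j)
   case 0 show ?case by (rule bnd[OF am ab(1)])
  next
   case (Suc j)
   have "a (Suc j) = (%z. a j z + D j z)" by (auto simp: D_def)
   thus ?case using Suc Di by simp
  qed
  have leb: "integrable lebesgue f" "(LINT z|lebesgue. f z) = (LINT z|lborel. f z)" if "integrable lborel f" for f :: "'n pt => real"
  proof -
   have m: "f : borel_measurable lborel" using that by auto
   show "integrable lebesgue f" "(LINT z|lebesgue. f z) = (LINT z|lborel. f z)" using integrable_completion[OF m] integral_completion[OF m] that by auto
  qed
  have DL: "integrable lebesgue (D j)" for j by (rule leb(1)[OF Di])
  have sum: "summable (%j. LINT z|lebesgue. abs (D j z))"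
  proof (rule summable_comparison_test'[of "%j. (B * V * (LINT z|lborel. H z)) * (1 / 2) ^ j" 0])
   show "summable (%j. (B * V * (LINT z|lborel. H z)) * (1 / 2) ^ j)" by (intro summable_mult summable_geometric) auto
   fix j :: nat
   have "(LINT z|lborel. abs (D j z)) <= (LINT z|lborel. B * potential H j z)" by (intro integral_mono integrable_abs Di integrable_mult_right pot ab)
   thus "norm (LINT z|lebesgue. abs (D j z)) <= (B * V * (LINT z|lborel. H z)) * (1 / 2) ^ j"
    using leb(2)[OF integrable_abs[OF Di], of j] pot(2)[of j] by (simp add: power_one_over field_simps)
  qed
  define F where "F z = a 0 z + (\<Sum>j. D j z)" for z
  have Di': "integrable lebesgue (%z. \<Sum>j. D j z)" using suminf_times(1)[OF DL sum, of "%_. 1" 1] by simp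
  \<comment> \<open>The sum of the series is identified by testing: its partial sums telescope to
    mollifications, which converge weakly to \<open>w1 i\<close>.\<close>
  have "AE z in lebesgue. z : UNIV --> F z - w1 i z = 0"
  proof (rule fundamental_lemma)
   show "locally_integrable UNIV (%z. F z - w1 i z)"
    unfolding F_def by (intro integrable_locally Bochner_Integration.integrable_diff Bochner_Integration.integrable_add leb(1)[OF ai] leb(1)[OF i(3)] Di')
   fix ph :: "'n pt => real" assume t: "test_function UNIV ph"
   have phm[measurable]: "ph : borelf" by (rule smooth_borel[OF test_function_smooth[OF t]])
   obtain C where C: "C >= 0" "!!z. abs (ph z) <= C" by (rule test_function_bounded[OF t]) (rule that)
   have phL: "ph : borel_measurable lebesgue" by (rule smooth_lebesgue_measurable[OF test_function_smooth[OF t]])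
   have ti: "integrable lborel (%z. f z * ph z)" if "integrable lborel f" for f by (rule integrable_bounded_times[OF that _ C(2)]) measurable
   have "(%J. \<Sum>j<J. LINT z|lebesgue. D j z * ph z) \<longlonglongrightarrow> (LINT z|lebesgue. (\<Sum>j. D j z) * ph z)"
    using suminf_times(2)[OF DL sum phL C(2,1)] by (simp add: sums_def)
   moreover have "(\<Sum>j<J. LINT z|lebesgue. D j z * ph z) = (LINT z|lborel. a J z * ph z) - (LINT z|lborel. a 0 z * ph z)" for J
   proof -
    have "(LINT z|lebesgue. D j z * ph z) = (LINT z|lborel. a (Suc j) z * ph z) - (LINT z|lborel. a j z * ph z)" for j
     unfolding leb(2)[OF ti[OF Di]] unfolding D_def left_diff_distrib by (rule Bochner_Integration.integral_diff[OF ti[OF ai] ti[OF ai]])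
    thus ?thesis by (simp add: sum_lessThan_telescope[of "%j. LINT z|lborel. a j z * ph z"])
   qed
   moreover have "(%J. (LINT z|lborel. a J z * ph z) - (LINT z|lborel. a 0 z * ph z)) \<longlonglongrightarrow> (LINT z|lborel. w1 i z * ph z) - (LINT z|lborel. a 0 z * ph z)"
    unfolding a_def by (intro tendsto_diff tendsto_const mollified_weak_limit k i(3) t)
   ultimately have e: "(LINT z|lebesgue. (\<Sum>j. D j z) * ph z) = (LINT z|lborel. w1 i z * ph z) - (LINT z|lborel. a 0 z * ph z)" using LIMSEQ_unique by fastforce
   have "(LINT z|lebesgue. (F z - w1 i z) * ph z) = (LINT z|lebesgue. (a 0 z * ph z + (\<Sum>j. D j z) * ph z) - w1 i z * ph z)"
    unfolding F_def by (simp only: left_diff_distrib distrib_right)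
   also have "... = (LINT z|lebesgue. a 0 z * ph z) + (LINT z|lebesgue. (\<Sum>j. D j z) * ph z) - (LINT z|lebesgue. w1 i z * ph z)"
    using leb(1)[OF ti[OF ai]] leb(1)[OF ti[OF i(3)]] suminf_times(1)[OF DL sum phL C(2,1)] by simp
   also have "... = 0" unfolding e leb(2)[OF ti[OF ai]] leb(2)[OF ti[OF i(3)]] by simp
   finally show "(LINT z:UNIV|lebesgue. (F z - w1 i z) * ph z) = 0" unfolding set_integral_test[OF t] .
  qed simp
  moreover have "AE z in lebesgue. summable (%j. abs (D j z))" by (rule AE_summable_abs[OF DL sum])
  ultimately show ?thesis
  proof eventually_elim
   fix z assume "z : UNIV --> F z - w1 i z = 0" and s: "summable (%j. abs (D j z))"
   hence wF: "w1 i z = F z" by simp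
   let ?S = "\<Sum>j. ennreal (potential H j z)"
   have "abs (w1 i z) <= abs (a 0 z) + (\<Sum>j. abs (D j z))" unfolding wF F_def using summable_rabs[OF s] by linarith
   hence "ennreal (abs (w1 i z)) <= ennreal (abs (a 0 z) + (\<Sum>j. abs (D j z)))" by (rule ennreal_leI)
   also have "... = ennreal (abs (a 0 z)) + ennreal (\<Sum>j. abs (D j z))" by (rule ennreal_plus) (auto intro: suminf_nonneg s)
   also have "ennreal (\<Sum>j. abs (D j z)) = (\<Sum>j. ennreal (abs (D j z)))" by (rule suminf_ennreal2[symmetric, OF _ s]) simp
   also have "... <= (\<Sum>j. ennreal B * ennreal (potential H j z))"
    using ab(2)[of _ z] B(1) by (intro suminf_le) (auto simp: ennreal_mult'[symmetric] intro!: ennreal_leI)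
   also have "... = ennreal B * ?S" by simp
   also have "ennreal (abs (a 0 z)) <= ennreal B * ?S"
   proof -
    have "ennreal (abs (a 0 z)) <= ennreal B * ennreal (potential H 0 z)" using ab(1)[of z] B(1) by (simp add: ennreal_mult'[symmetric] ennreal_leI)
    also have "... <= ennreal B * ?S" using sum_le_suminf[of "%j. ennreal (potential H j z)" "{0}"] by (intro mult_left_mono) auto
    finally show ?thesis .
   qed
   finally have "ennreal (abs (w1 i z)) <= ennreal B * ?S + ennreal B * ?S" by (simp add: add_mono)
   also have "... = ennreal (2 * B) * ?S" using B(1) by (simp add: distrib_right[symmetric] ennreal_plus[symmetric])
   finally show "ennreal (abs (w1 i z)) <= ennreal (2 * B) * (\<Sum>j. ennreal (potential (jet_size w wt w1 w2) j z))" unfolding H_def .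
  qed
 qed
 thus ?thesis using B(1) by (intro exI[of _ "2 * B"]) auto
qed

section \<open>Trace inequality for potentials against a weight with a Morrey bound\<close>

lemma powr_young:
 fixes x l a b :: real
 assumes "x >= 0" "l > 0" "0 < a" "a <= b"
 shows "x powr a <= l powr a + l powr (a - b) * x powr b"
proof (cases "x <= l")
 case True
 hence "x powr a <= l powr a" using assms by (intro powr_mono2) auto
 thus ?thesis by (simp add: add_increasing2)
next
 case False
 hence "x powr (a - b) <= l powr (a - b)" using assms by (intro powr_mono2') auto
 hence "x powr (a - b) * x powr b <= l powr (a - b) * x powr b" by (intro mult_right_mono) auto
 hence "x powr a <= l powr (a - b) * x powr b" using False assms by (simp add: powr_add[symmetric])
 thus ?thesis by (simp add: add_increasing)
qed

text \<open>Hoelder's inequality with the constant 2: the threshold l is chosen so that both terms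
  of \<open>powr_young\<close> have the same integral bound.\<close>

lemma nn_integral_powr_mono:
 fixes h :: "'a::euclidean_space => real"
 assumes h: "h : borelf" "!!z. h z >= 0" and E: "E : sets borel" "evol E = ennreal v" "v > 0"
  and ab: "0 < a" "a <= b" and I: "(NN z. indicator E z * ennreal (h z powr b)) <= ennreal I" "I > 0"
 shows "(NN z. indicator E z * ennreal (h z powr a)) <= ennreal (2 * v powr (1 - a / b) * I powr (a / b))"
proof -
 note [measurable] = h(1) E(1)
 define l where "l = (I / v) powr (1 / b)"
 have l: "l > 0" using I(2) E(3) by (simp add: l_def)
 have la: "l powr a * v = v powr (1 - a / b) * I powr (a / b)" "l powr (a - b) * I = v powr (1 - a / b) * I powr (a / b)"
 proof -
  have lp: "l powr c = I powr (c / b) / v powr (c / b)" for c using I(2) E(3) by (simp add: l_def powr_powr powr_divide)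
  have vv: "v powr (1 - a / b) = v / v powr (a / b)" using E(3) by (simp add: powr_diff)
  show "l powr a * v = v powr (1 - a / b) * I powr (a / b)" unfolding lp vv by simp
  have b: "(a - b) / b = a / b - 1" using ab by (simp add: diff_divide_distrib)
  show "l powr (a - b) * I = v powr (1 - a / b) * I powr (a / b)" unfolding lp b vv using I(2) E(3) by (simp add: powr_diff)
 qed
 have "(NN z. indicator E z * ennreal (h z powr a)) <= (NN z. ennreal (l powr a) * indicator E z + ennreal (l powr (a - b)) * (indicator E z * ennreal (h z powr b)))"
  using powr_young[OF h(2) l ab] by (intro nn_integral_mono)
   (auto simp: indicator_def ennreal_mult'[symmetric] ennreal_plus[symmetric] simp del: ennreal_plus intro!: ennreal_leI)
 also have "... = ennreal (l powr a) * ennreal v + ennreal (l powr (a - b)) * (NN z. indicator E z * ennreal (h z powr b))"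
  using E by (subst nn_integral_add) (auto simp: nn_integral_cmult)
 also have "... <= ennreal (l powr a) * ennreal v + ennreal (l powr (a - b)) * ennreal I" by (intro add_left_mono mult_left_mono I) simp
 also have "... = ennreal (l powr a * v + l powr (a - b) * I)" using I(2) E(3) by (simp add: ennreal_mult'[symmetric] ennreal_plus[symmetric] del: ennreal_plus)
 also have "l powr a * v + l powr (a - b) * I = 2 * v powr (1 - a / b) * I powr (a / b)" unfolding la by simp
 finally show ?thesis .
qed

text \<open>If every term stayed within its share om j * w, the sum would stay below w, because the
  weights sum to less than 1. So some term exceeds its share, and the sum over all j contains that
  term. This plays the role of Minkowski's inequality for the series.\<close>

lemma powr_le_suminf:
 fixes T om :: "nat => real"
 assumes w: "ennreal w <= ennreal C * (\<Sum>j. ennreal (T j))" "w >= 0" and T: "!!j. T j >= 0" and C: "C >= 0" and p: "p > 0"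
  and om: "!!j. om j > 0" "summable om" "suminf om < 1"
 shows "ennreal (w powr p) <= (\<Sum>j. ennreal ((C * T j / om j) powr p))"
proof (cases "w = 0")
 case True
 thus ?thesis by simp
next
 case False
 hence w0: "w > 0" using w(2) by simp
 have "EX j. w < C * T j / om j"
 proof (rule ccontr)
  assume neg: "~ ?thesis"
  have le: "C * T j <= w * om j" for j
  proof -
   have "C * T j / om j <= w" using neg by (auto simp: not_less)
   thus ?thesis using om(1)[of j] by (simp add: pos_divide_le_eq)
  qed
  have "ennreal w <= (\<Sum>j. ennreal (C * T j))" using w(1) C T by (simp add: ennreal_mult')
  also have "... <= (\<Sum>j. ennreal (w * om j))" using le by (intro suminf_le ennreal_leI) auto
  also have "... = ennreal (\<Sum>j. w * om j)" using w0 om by (intro suminf_ennreal2 summable_mult) (auto intro: less_imp_le)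
  also have "(\<Sum>j. w * om j) = w * suminf om" using om(2) by (rule suminf_mult)
  finally have "w <= w * suminf om" using w0 suminf_pos[OF om(2,1)] by (subst (asm) ennreal_le_iff) auto
  thus False using w0 om(3) by simp
 qed
 then obtain j where "w < C * T j / om j" by blast
 hence "ennreal (w powr p) <= ennreal ((C * T j / om j) powr p)" by (intro ennreal_leI powr_mono2 less_imp_le[OF p] w(2) less_imp_le)
 also have "... <= (\<Sum>j. ennreal ((C * T j / om j) powr p))"
 proof -
  have "(SUM i:{j}. ennreal ((C * T i / om i) powr p)) <= (\<Sum>j. ennreal ((C * T j / om j) powr p))" by (rule sum_le_suminf) simp_all
  thus ?thesis by simp
 qed
 finally show ?thesis .
qed

text \<open>Jensen's inequality on a box, obtained by interpolation between the exponents 1 and p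
  and hence with the factor 2^p. The interpolation wants a finite positive bound, so infinite and
  vanishing integrals are treated apart.\<close>

lemma potential_powr_le:
 fixes H :: "(real^'n) * real => real"
 assumes H: "integrable lborel H" "!!z. H z >= 0" and p: "p >= 1" and V: "V = vol (unit_box :: 'n pt set)" "V > 0"
 shows "ennreal (potential H j z powr p) <= ennreal ((2 ^ (j * (CARD('n) + 1))) powr p * 2 powr p * (V / 2 ^ (j * (CARD('n) + 2))) powr (p - 1))
  * (NN z'. indicator (near j z) z' * ennreal (H z' powr p))"
proof -
 note [measurable] = borel_measurable_integrable[OF H(1)]
 define v where "v = V / 2 ^ (j * (CARD('n) + 2))"
 define c where "c = (2::real) ^ (j * (CARD('n) + 1))"
 have c: "c > 0" by (simp add: c_def)
 define J where "J = (LINT z'|lborel. indicator (near j z) z' * H z')"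
 have J0: "J >= 0" unfolding J_def by (intro Bochner_Integration.integral_nonneg mult_nonneg_nonneg H) auto
 have v: "v > 0" "evol (near j z) = ennreal v" using V near_volume[of j z] by (auto simp: v_def)
 have Je: "ennreal J = (NN z'. indicator (near j z) z' * ennreal (H z' powr 1))"
 proof -
  have "ennreal J = (NN z'. ennreal (indicator (near j z) z' * H z'))"
   unfolding J_def by (rule nn_integral_eq_integral[symmetric]) (auto intro!: integrable_indicator_times H AE_I2 mult_nonneg_nonneg)
  also have "... = (NN z'. indicator (near j z) z' * ennreal (H z' powr 1))" using H(2) by (intro nn_integral_cong) (auto simp: indicator_def)
  finally show ?thesis .
 qed
 have pJ: "potential H j z = c * J" by (simp add: potential_def c_def J_def)
 let ?X = "NN z'. indicator (near j z) z' * ennreal (H z' powr p)"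
 have "ennreal ((c * J) powr p) <= ennreal (c powr p * 2 powr p * v powr (p - 1)) * ?X"
 proof (cases "?X = \<infinity>")
  case True
  thus ?thesis using c v by (simp add: ennreal_mult_eq_top_iff ennreal_mult_top)
 next
  case False
  then obtain I where I: "?X = ennreal I" "I >= 0" by (cases ?X) auto
  show ?thesis
  proof (cases "I = 0")
   case True
   hence "?X = 0" using I by simp
   hence "AE z' in lborel. indicator (near j z) z' * ennreal (H z' powr p) = 0" by (subst (asm) nn_integral_0_iff_AE) auto
   hence "AE z' in lborel. indicator (near j z) z' * ennreal (H z' powr 1) = 0" by eventually_elim (use H(2) in "auto simp: indicator_def split: if_splits")
   hence "ennreal J = 0" unfolding Je by (subst nn_integral_0_iff_AE) auto
   hence "J = 0" using J0 by simp
   thus ?thesis by simp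
  next
   case False
   hence I0: "I > 0" using I by simp
   have "ennreal J <= ennreal (2 * v powr (1 - 1 / p) * I powr (1 / p))"
    unfolding Je by (rule nn_integral_powr_mono[OF _ H(2) near_sets v(2,1) _ p _ I0]) (use I in auto)
   hence "J <= 2 * v powr (1 - 1 / p) * I powr (1 / p)" using v I0 by (simp add: ennreal_le_iff)
   hence "c * J <= c * (2 * v powr (1 - 1 / p) * I powr (1 / p))" using c by simp
   hence "(c * J) powr p <= (c * (2 * v powr (1 - 1 / p) * I powr (1 / p))) powr p" using c J0 p by (intro powr_mono2) auto
   also have "... = c powr p * 2 powr p * v powr (p - 1) * I" using c v I0 p by (simp add: powr_mult powr_powr algebra_simps)
   finally show ?thesis unfolding I using I0 by (simp add: ennreal_mult'[symmetric] ennreal_leI)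
  qed
 qed
 thus ?thesis unfolding pJ c_def v_def .
qed

lemma unit_box_measure_pos: "vol (unit_box :: 'a::euclidean_space set) > 0"
 unfolding unit_box_def by (subst measure_lborel_cbox_eq) (auto intro!: prod_pos simp: inner_add_left)

text \<open>Exponents of 2 per unit of j: p kp/2 from the summation weights, p(N-1) from the
  potential, -(p-1)N from the box volume, -(N - pN/q) from the Morrey bound. They add up to -p kp/2
  with kp = 1 - N/q: half of the gain pays for the summation weights.\<close>

lemma trace_coefficient:
 fixes p q N kp rh V C0 E :: real and j n :: nat
 assumes N: "N = real n + 2" and p: "p >= 1" and q: "q > 0" and kp: "kp = 1 - N / q" and rh: "rh = 2 powr (- kp / 2)" "rh < 1"
  and V: "V > 0" and C0: "C0 >= 0" and E: "E >= 0"
 shows "(C0 / ((1 - rh) / 2 * rh ^ j)) powr p * ((2 ^ (j * (n + 1))) powr p * 2 powr p * (V / 2 ^ (j * (n + 2))) powr (p - 1))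
   * (E * 2 powr (- (real j * (N - p * N / q))))
  = ((2 * C0 / (1 - rh)) powr p * 2 powr p * V powr (p - 1)) * E * (rh powr p) ^ j"
proof -
 have r0: "rh > 0" using rh by simp
 have 1: "(C0 / ((1 - rh) / 2 * rh ^ j)) powr p = (2 * C0 / (1 - rh)) powr p * 2 powr (p * real j * kp / 2)"
 proof -
  have rj: "rh ^ j = 2 powr (- (real j * kp / 2))" unfolding rh(1) by (simp add: powr_realpow[symmetric] powr_powr mult.commute)
  have "C0 / ((1 - rh) / 2 * rh ^ j) = (2 * C0 / (1 - rh)) * (1 / rh ^ j)" using rh(2) r0 by (simp add: field_simps)
  also have "1 / rh ^ j = 2 powr (real j * kp / 2)" unfolding rj by (simp add: powr_minus field_simps)
  finally have e: "C0 / ((1 - rh) / 2 * rh ^ j) = (2 * C0 / (1 - rh)) * 2 powr (real j * kp / 2)" .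
  have "(2 * C0 / (1 - rh) * 2 powr (real j * kp / 2)) powr p = (2 * C0 / (1 - rh)) powr p * (2 powr (real j * kp / 2)) powr p" by (rule powr_mult)
  thus ?thesis unfolding e by (simp add: powr_powr mult_ac)
 qed
 have 2: "(2 ^ (j * (n + 1)) :: real) powr p = 2 powr (p * real j * (N - 1))" unfolding N by (simp add: powr_realpow[symmetric] powr_powr algebra_simps)
 have 3: "(V / 2 ^ (j * (n + 2))) powr (p - 1) = V powr (p - 1) * 2 powr (- (p - 1) * real j * N)"
 proof -
  have "(2 ^ (j * (n + 2)) :: real) powr (p - 1) = 2 powr ((p - 1) * real j * N)" unfolding N by (simp add: powr_realpow[symmetric] powr_powr algebra_simps)
  moreover have "- (p - 1) * real j * N = - ((p - 1) * real j * N)" by (simp add: algebra_simps)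
  ultimately show ?thesis unfolding powr_divide by (simp only: powr_minus_divide) simp
 qed
 have 4: "(rh powr p) ^ j = 2 powr (- (p * real j * kp / 2))" unfolding rh(1) by (simp add: powr_realpow[symmetric] powr_powr mult_ac)
 have "2 powr (p * real j * kp / 2) * 2 powr (p * real j * (N - 1)) * 2 powr (- (p - 1) * real j * N) * 2 powr (- (real j * (N - p * N / q)))
  = 2 powr (p * real j * kp / 2 + p * real j * (N - 1) + (- (p - 1) * real j * N) + (- (real j * (N - p * N / q))))" by (simp only: powr_add)
 also have "p * real j * kp / 2 + p * real j * (N - 1) + (- (p - 1) * real j * N) + (- (real j * (N - p * N / q))) = - (p * real j * kp / 2)"
  unfolding kp using q by (simp add: field_simps)
 finally have 5: "2 powr (p * real j * kp / 2) * 2 powr (p * real j * (N - 1)) * 2 powr (- (p - 1) * real j * N) * 2 powr (- (real j * (N - p * N / q))) = 2 powr (- (p * real j * kp / 2))" .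
 show ?thesis unfolding 1 2 3 4 5[symmetric] by (simp only: mult_ac)
qed

text \<open>The gradient is split into dyadic potentials and, by \<open>near_swap\<close>, each
  block meets \<open>mu\<close> only through its mass on boxes of the same scale. Since q > n+2 the
  blocks decay geometrically. The constant is proportional to \<open>E\<close>, so a small Morrey
  bound makes the drift a small perturbation.\<close>

lemma trace_inequality:
 fixes p q :: real
 assumes p: "1 <= p" "p <= q" and q: "q > real CARD('n) + 2"
 shows "EX C>=0. ALL (w :: (real^'n) * real => real) wt w1 w2 i mu E. jet w wt w1 w2 --> mu : borelf --> E >= 0 -->
  (ALL z j. (NN z'. indicator (near j z) z' * ennreal (mu z' powr p))
   <= ennreal (E * 2 powr (- (real j * (real CARD('n) + 2 - p * (real CARD('n) + 2) / q))))) -->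
  (NN z. ennreal (mu z powr p) * ennreal (abs (w1 i z) powr p))
   <= ennreal (C * E) * jint p w wt w1 w2"
proof -
 obtain C0 where C0: "C0 >= 0" "!!(w :: 'n pt => real) wt w1 w2 i. jet w wt w1 w2 ==>
  (AE z in lebesgue. ennreal (abs (w1 i z)) <= ennreal C0 * (\<Sum>j. ennreal (potential (jet_size w wt w1 w2) j z)))" using gradient_potential_bound by blast
 define N where "N = real CARD('n) + 2"
 define kp where "kp = 1 - N / q"
 define rh where "rh = 2 powr (- kp / 2)"
 define V where "V = vol (unit_box :: 'n pt set)"
 have V: "V > 0" unfolding V_def by (rule unit_box_measure_pos)
 have q0: "q > 0" using q by linarith
 have p0: "p > 0" using p by simp
 have "kp > 0" using q q0 by (simp add: kp_def N_def field_simps)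
 hence "rh < 2 powr 0" unfolding rh_def by (intro powr_less_mono) auto
 hence rh: "rh < 1" "rh > 0" by (auto simp: rh_def)
 \<comment> \<open>The total weight is 1/2, below the 1 that \<open>powr_le_suminf\<close>
   demands.\<close>
 define om where "om j = (1 - rh) / 2 * rh ^ j" for j :: nat
 have om: "om j > 0" for j using rh by (simp add: om_def)
 have sg: "(%j. rh ^ j) sums (1 / (1 - rh))" using rh geometric_sums[of rh] by simp
 have "om sums ((1 - rh) / 2 * (1 / (1 - rh)))" unfolding om_def by (rule sums_mult[OF sg])
 hence oms: "summable om" "suminf om < 1" using rh by (auto simp: sums_iff)
 have rp: "0 <= rh powr p" "rh powr p < 1" using rh p powr_less_mono2[of p rh 1] by auto
 define c where "c = (2 * C0 / (1 - rh)) powr p * 2 powr p * V powr (p - 1)"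
 have c: "c >= 0" by (simp add: c_def)
 define K where "K j = (2 ^ (j * (CARD('n) + 1))) powr p * 2 powr p * (V / 2 ^ (j * (CARD('n) + 2))) powr (p - 1)" for j
 have K: "K j >= 0" for j by (simp add: K_def)
 have "(NN z. ennreal (mu z powr p) * ennreal (abs (w1 i z) powr p))
   <= ennreal (c / (1 - rh powr p) * E) * jint p w wt w1 w2"
  if J: "jet w wt w1 w2" and m[measurable]: "mu : borelf" and E: "E >= 0"
   and mor: "!!z j. (NN z'. indicator (near j z) z' * ennreal (mu z' powr p))
   <= ennreal (E * 2 powr (- (real j * (N - p * N / q))))"
  for w :: "'n pt => real" and wt w1 w2 i mu E
 proof -
  define H where "H = jet_size w wt w1 w2"
  have H: "integrable lborel H" "!!z. H z >= 0" unfolding H_def using jet_integrable(5)[OF J] jet_size_ge(5) by auto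
  note Hm[measurable] = borel_measurable_integrable[OF H(1)]
  have pm[measurable]: "potential H j : borelf" for j using potential_integral[OF H, of j] by (auto simp: has_bochner_integral_iff)
  have pot0: "potential H j z >= 0" for j z unfolding potential_def by (intro mult_nonneg_nonneg Bochner_Integration.integral_nonneg H) auto
  define X where "X = (NN z. ennreal (H z powr p))"
  have "AE z in lborel. ennreal (abs (w1 i z)) <= ennreal C0 * (\<Sum>j. ennreal (potential H j z))"
   using C0(2)[OF J] unfolding H_def by (simp add: AE_completion_iff)
  hence ae: "AE z in lborel. ennreal (mu z powr p) * ennreal (abs (w1 i z) powr p)
   <= (\<Sum>j. ennreal (mu z powr p) * ennreal ((C0 * potential H j z / om j) powr p))"
  proof eventually_elim
   fix z assume "ennreal (abs (w1 i z)) <= ennreal C0 * (\<Sum>j. ennreal (potential H j z))"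
   from powr_le_suminf[OF this abs_ge_zero pot0 C0(1) p0 om oms]
   have "ennreal (abs (w1 i z) powr p) <= (\<Sum>j. ennreal ((C0 * potential H j z / om j) powr p))" .
   hence "ennreal (mu z powr p) * ennreal (abs (w1 i z) powr p) <= ennreal (mu z powr p) * (\<Sum>j. ennreal ((C0 * potential H j z / om j) powr p))"
    by (rule mult_left_mono) simp
   thus "ennreal (mu z powr p) * ennreal (abs (w1 i z) powr p) <= (\<Sum>j. ennreal (mu z powr p) * ennreal ((C0 * potential H j z / om j) powr p))" by simp
  qed
  have term_le: "(NN z. ennreal (mu z powr p) * ennreal ((C0 * potential H j z / om j) powr p)) <= ennreal (c * E * (rh powr p) ^ j) * X" for j
  proof -
   have "(NN z. ennreal (mu z powr p) * ennreal ((C0 * potential H j z / om j) powr p))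
    <= (NN z. ennreal ((C0 / om j) powr p * K j) * (ennreal (mu z powr p) * (NN z'. indicator (near j z) z' * ennreal (H z' powr p))))"
   proof (rule nn_integral_mono)
    fix z
    have "(C0 * potential H j z / om j) powr p = (C0 / om j) powr p * potential H j z powr p" using C0(1) om[of j] pot0 by (simp add: powr_mult[symmetric])
    hence "ennreal ((C0 * potential H j z / om j) powr p) = ennreal ((C0 / om j) powr p) * ennreal (potential H j z powr p)" by (simp add: ennreal_mult'[symmetric])
    also have "... <= ennreal ((C0 / om j) powr p) * (ennreal (K j) * (NN z'. indicator (near j z) z' * ennreal (H z' powr p)))"
     unfolding K_def by (intro mult_left_mono potential_powr_le[OF H p(1) V_def V]) simp
    finally have "ennreal (mu z powr p) * ennreal ((C0 * potential H j z / om j) powr p)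
     <= ennreal (mu z powr p) * (ennreal ((C0 / om j) powr p) * (ennreal (K j) * (NN z'. indicator (near j z) z' * ennreal (H z' powr p))))"
     by (rule mult_left_mono) simp
    thus "ennreal (mu z powr p) * ennreal ((C0 * potential H j z / om j) powr p)
     <= ennreal ((C0 / om j) powr p * K j) * (ennreal (mu z powr p) * (NN z'. indicator (near j z) z' * ennreal (H z' powr p)))"
     using K[of j] by (simp add: ennreal_mult mult_ac)
   qed
   also have "... = ennreal ((C0 / om j) powr p * K j) * (NN z. ennreal (mu z powr p) * (NN z'. indicator (near j z) z' * ennreal (H z' powr p)))"
    unfolding near_indicator by (rule nn_integral_cmult) measurable
   also have "(NN z. ennreal (mu z powr p) * (NN z'. indicator (near j z) z' * ennreal (H z' powr p)))
    = (NN z'. ennreal (H z' powr p) * (NN z. indicator (near j z') z * ennreal (mu z powr p)))" by (rule near_swap) measurable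
   also have "... <= (NN z'. ennreal (H z' powr p) * ennreal (E * 2 powr (- (real j * (N - p * N / q)))))" by (intro nn_integral_mono mult_left_mono mor) simp
   also have "... = X * ennreal (E * 2 powr (- (real j * (N - p * N / q))))" unfolding X_def by (rule nn_integral_multc) measurable
   finally have "(NN z. ennreal (mu z powr p) * ennreal ((C0 * potential H j z / om j) powr p))
    <= ennreal ((C0 / om j) powr p * K j) * (X * ennreal (E * 2 powr (- (real j * (N - p * N / q)))))" by (simp add: mult_left_mono)
   also have "... = ennreal ((C0 / om j) powr p * K j * (E * 2 powr (- (real j * (N - p * N / q))))) * X" using K[of j] E by (simp add: ennreal_mult mult_ac)
   also have "(C0 / om j) powr p * K j * (E * 2 powr (- (real j * (N - p * N / q)))) = c * E * (rh powr p) ^ j"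
    unfolding om_def K_def c_def by (rule trace_coefficient[OF N_def p(1) q0 kp_def rh_def rh(1) V C0(1) E])
   finally show ?thesis .
  qed
  have "(NN z. ennreal (mu z powr p) * ennreal (abs (w1 i z) powr p))
   <= (NN z. (\<Sum>j. ennreal (mu z powr p) * ennreal ((C0 * potential H j z / om j) powr p)))" by (rule nn_integral_mono_AE[OF ae])
  also have "... = (\<Sum>j. NN z. ennreal (mu z powr p) * ennreal ((C0 * potential H j z / om j) powr p))" by (rule nn_integral_suminf) measurable
  also have "... <= (\<Sum>j. ennreal (c * E * (rh powr p) ^ j) * X)" by (intro suminf_le term_le) auto
  also have "... = (\<Sum>j. ennreal (c * E * (rh powr p) ^ j)) * X" by simp
  also have "(\<Sum>j. ennreal (c * E * (rh powr p) ^ j)) = ennreal (\<Sum>j. c * E * (rh powr p) ^ j)"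
   using rp c E by (intro suminf_ennreal2 summable_mult summable_geometric) auto
  also have "(\<Sum>j. c * E * (rh powr p) ^ j) = c / (1 - rh powr p) * E" using rp by (subst suminf_mult) (auto intro: summable_geometric simp: suminf_geometric)
  finally show ?thesis unfolding X_def H_def .
 qed
 thus ?thesis using c rp unfolding N_def by (intro exI[of _ "c / (1 - rh powr p)"]) auto
qed

section \<open>Strong solutions from the maximum principle\<close>

lemma sum_powr_le:
 fixes x :: "'i => real"
 assumes "finite I" "!!i. i : I ==> x i >= 0" "p > 0"
 shows "(SUM i:I. x i) powr p <= real (card I) powr p * (SUM i:I. x i powr p)"
proof (cases "I = {}")
 case True thus ?thesis by simp
next
 case False
 obtain j where j: "j : I" "!!i. i : I ==> x i <= x j"
 proof -
  have "Max (x ` I) : x ` I" using assms(1) False by (intro Max_in) auto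
  then obtain j where "j : I" "Max (x ` I) = x j" by auto
  thus ?thesis using that[of j] Max_ge[of "x ` I"] assms(1) by auto
 qed
 have "(SUM i:I. x i) <= real (card I) * x j" using sum_bounded_above[of I x "x j"] j(2) by simp
 hence "(SUM i:I. x i) powr p <= (real (card I) * x j) powr p" using assms by (intro powr_mono2) (auto intro: sum_nonneg)
 also have "... = real (card I) powr p * x j powr p" by (rule powr_mult)
 also have "... <= real (card I) powr p * (SUM i:I. x i powr p)" using member_le_sum[OF j(1) _ assms(1), of "%i. x i powr p"] by (intro mult_left_mono) auto
 finally show ?thesis .
qed

lemma Lp_norm_nn_integral:
 assumes f: "in_Lp p S f" and S: "S : sets lebesgue" and p: "p > 0" and K: "Lp_norm p S f <= K"
 shows "(NL z. indicator S z * ennreal (abs (f z) powr p)) <= ennreal (K powr p)"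
proof -
 let ?I = "integral\<^sup>L (lebesgue_on S) (%z. abs (f z) powr p)"
 have I0: "?I >= 0" by (rule Bochner_Integration.integral_nonneg) simp
 have "(NL z. indicator S z * ennreal (abs (f z) powr p)) = (NL z. ennreal (abs (f z) powr p) * indicator S z)" by (simp add: mult.commute)
 also have "... = (\<integral>\<^sup>+z. ennreal (abs (f z) powr p) \<partial>lebesgue_on S)" using S by (subst nn_integral_restrict_space) auto
 also have "... = ennreal ?I" using f by (intro nn_integral_eq_integral) (auto simp: in_Lp_def)
 also have "?I <= K powr p"
 proof -
  have "(?I powr (1 / p)) powr p <= K powr p" using K p unfolding Lp_norm_def by (intro powr_mono2) auto
  thus ?thesis using I0 p by (simp add: powr_powr)
 qed
 finally show ?thesis by (simp add: ennreal_leI)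
qed

lemma par_inside_unit:
 fixes V :: "((real^'n) * real) set"
 assumes "open V" "V <= {z. norm (fst z) <= 1 - d & d <= snd z & snd z <= 1}" "0 < d" "d < 1"
 shows "par_inside (ball 0 1) 1 V" unfolding par_inside_def
proof (intro conjI)
 show "V <= cylinder (ball 0 1) 1"
 proof
  fix z assume "z : V"
  hence "norm (fst z) <= 1 - d & d <= snd z & snd z <= 1" using assms(2) by blast
  thus "z : cylinder (ball 0 1) 1" using assms(3) by (cases z) (auto simp: cylinder_def)
 qed
 show "V - interior V : null_sets lebesgue" using assms(1) by (simp add: interior_open)
 have "par_dist z w >= d" if z: "z : V" and w: "w : par_boundary (ball 0 1) 1" for z w
 proof -
  have zz: "norm (fst z) <= 1 - d" "d <= snd z" using z assms(2) by auto
  consider "snd w = 0" | "norm (fst w) = 1" using w by (auto simp: par_boundary_def)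
  thus ?thesis
  proof cases
   case 1
   have "d * d <= d" using assms(3,4) by (simp add: mult_left_le)
   hence "d^2 <= snd z" unfolding power2_eq_square using zz by linarith
   hence "d^2 <= abs (snd z - snd w)" using 1 by simp
   hence "sqrt (d^2) <= par_dist z w" unfolding par_dist_def by (intro real_sqrt_le_mono) (auto intro: add_increasing)
   thus ?thesis using assms(3) by simp
  next
   case 2
   have "d <= norm (fst z - fst w)" using norm_triangle_ineq3[of "fst z" "fst w"] zz 2 by auto
   hence "d^2 <= (norm (fst z - fst w))^2" using assms(3) by (intro power_mono) auto
   hence "sqrt (d^2) <= par_dist z w" unfolding par_dist_def by (intro real_sqrt_le_mono) (auto intro: add_increasing2)
   thus ?thesis using assms(3) by simp
  qed
 qed
 hence "ereal d <= par_setdist V (par_boundary (ball 0 1) 1)" unfolding par_setdist_def by (intro INF_greatest) simp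
 thus "0 < par_setdist V (par_boundary (ball 0 1) 1)" using assms(3) less_le_trans[of 0 "ereal d"] by simp
qed

definition jet_indices :: "((real^'n) * real) list set" where
 "jet_indices = {[dir_t]} Un {[dir_x k] | k. True} Un {[dir_x k, dir_x l] | k l. True}"

lemma finite_jet_indices: "finite (jet_indices :: ((real^'n) * real) list set)"
proof -
 have e: "(jet_indices :: ('n pt) list set) = {[dir_t]} Un range (%k. [dir_x k]) Un (%(k, l). [dir_x k, dir_x l]) ` UNIV" by (auto simp: jet_indices_def)
 show ?thesis unfolding e by (intro finite_UnI finite_imageI) auto
qed

lemma jet_indicesI: "[dir_t] : jet_indices" "[dir_x k] : jet_indices" "[dir_x k, dir_x l] : jet_indices" by (auto simp: jet_indices_def)

text \<open>\<open>Dt\<close> and \<open>D2x\<close> in the hypothesis are chosen derivatives on the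
  whole cylinder, while \<open>W21_loc\<close> speaks of sets away from the parabolic boundary.
  Exhaustion shows that derivatives exist on the whole interior, so the chosen ones are
  genuine.\<close>

lemma unit_cylinder_weak_derivs:
 fixes u :: "(real^'n) * real => real"
 assumes u: "W21_loc p (ball 0 1) 1 u" and vs: "vs : jet_indices"
 shows "has_weak_deriv (interior (cylinder (ball 0 1) 1)) vs u (weak_deriv (interior (cylinder (ball 0 1) 1)) vs u)"
proof (rule has_weak_deriv_weak_deriv[OF someI_ex])
 define V :: "nat => 'n pt set" where
  "V m = ball 0 (1 - 1 / (real m + 2)) \<times> {1 / (real m + 2)<..<1 - 1 / (real m + 2)}" for m
 have d: "0 < 1 / (real m + 2)" "1 / (real m + 2) < 1" for m by auto
 have mono: "1 / (real n + 2) <= 1 / (real m + 2)" if "m <= n" for m n using that by (simp add: frac_le)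
 have "EX g. has_weak_deriv (\<Union>m. V m) vs u g"
 proof (rule weak_deriv_exhaustion)
  show o: "open (V m)" for m unfolding V_def by (intro open_Times) auto
  show "incseq V"
  proof (rule incseq_SucI)
   fix m
   have "1 / (real (Suc m) + 2) <= 1 / (real m + 2)" using mono[of m "Suc m"] by simp
   thus "V m <= V (Suc m)" unfolding V_def by (intro Sigma_mono) auto
  qed
  fix m
  have "V m <= {z. norm (fst z) <= 1 - 1 / (real m + 2) & 1 / (real m + 2) <= snd z & snd z <= 1}"
  proof
   fix z assume "z : V m"
   thus "z : {z. norm (fst z) <= 1 - 1 / (real m + 2) & 1 / (real m + 2) <= snd z & snd z <= 1}"
    using d[of m] by (cases z) (auto simp: V_def intro: less_imp_le order_trans[of _ "1 - 1 / (real m + 2)"])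
  qed
  from par_inside_unit[OF o this d] have "W21 p (V m) u" using u unfolding W21_loc_def by blast
  thus "EX g. has_weak_deriv (V m) vs u g" using vs o[of m] unfolding W21_def jet_indices_def by (auto simp: interior_open)
 qed
 moreover have "(\<Union>m. V m) = interior (cylinder (ball 0 1) 1)"
 proof -
  have "interior (cylinder (ball (0::real^'n) 1) 1) = ball 0 1 \<times> {0<..<1}" by (simp add: cylinder_def interior_Times interior_open)
  moreover have "(\<Union>m. V m) = ball 0 1 \<times> {0<..<1}"
  proof (intro set_eqI iffI)
   fix z assume "z : (\<Union>m. V m)"
   then obtain m where "norm (fst z) < 1 - 1 / (real m + 2)" "1 / (real m + 2) < snd z" "snd z < 1 - 1 / (real m + 2)" by (cases z) (auto simp: V_def)
   hence "norm (fst z) < 1" "0 < snd z" "snd z < 1" using d[of m] by linarith+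
   thus "z : ball 0 1 \<times> {0<..<1}" by (cases z) auto
  next
   fix z :: "'n pt" assume "z : ball 0 1 \<times> {0<..<1}"
   hence z: "norm (fst z) < 1" "0 < snd z" "snd z < 1" by (cases z, auto)+
   define e where "e = Min {1 - norm (fst z), snd z, 1 - snd z}"
   have e: "e > 0" "e <= 1 - norm (fst z)" "e <= snd z" "e <= 1 - snd z" using z by (auto simp: e_def)
   obtain m where m: "1 / real (Suc m) < e" using reals_Archimedean[OF e(1)] by (auto simp: inverse_eq_divide)
   have "1 / (real m + 2) < e" using m mono[of m "Suc m"] by (intro le_less_trans[OF _ m]) (simp add: frac_le)
   hence "z : V m" using e by (cases z) (auto simp: V_def)
   thus "z : (\<Union>m. V m)" by blast
  qed
  ultimately show ?thesis by simp
 qed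
 ultimately show "EX g. has_weak_deriv (interior (cylinder (ball 0 1) 1)) vs u g" by simp
qed

lemma ball_Basis_dir: "(ALL e:(Basis :: ((real^'n) * real) set). P e) \<longleftrightarrow> P dir_t & (ALL l. P (dir_x l))"
proof -
 have B: "(Basis::'n pt set) = insert dir_t (range dir_x)" by (auto simp: Basis_prod_def Basis_vec_def dir_t_def dir_x_def)
 show ?thesis unfolding B by blast
qed

lemma inner_dir: "z \<bullet> dir_t = snd z" "z \<bullet> dir_x l = fst z $ l" by (auto simp: dir_t_def dir_x_def inner_prod_def inner_axis)

text \<open>Division by the dimension keeps the boxes inside the unit ball, via the l1 norm. The
  time interval also avoids t = 1, because derivatives live on the open interior and the cut-off has
  to vanish before the top.\<close>

definition core :: "((real^'n) * real) set" where
 "core = {z. (ALL i. abs (fst z $ i) <= 1 / (4 * real CARD('n))) & 1 / 4 <= snd z & snd z <= 3 / 4}"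

definition core_box :: "real => real => ((real^'n) * real) set" where
 "core_box c d = box ((\<chi> i. - c / real CARD('n)), d) ((\<chi> i. c / real CARD('n)), 1 - d)"

lemma mem_core_box:
 "(z :: (real^'n) * real) : core_box c d \<longleftrightarrow> (ALL i. abs (fst z $ i) < c / real CARD('n)) & d < snd z & snd z < 1 - d"
proof -
 have k: "- c / real CARD('n) < x & x < c / real CARD('n) \<longleftrightarrow> abs x < c / real CARD('n)" for x
  by (simp only: abs_less_iff minus_divide_left[symmetric]) linarith
 show ?thesis unfolding core_box_def mem_box ball_Basis_dir inner_dir fst_conv snd_conv vec_lambda_beta k by blast
qed

lemma box_bump_eq_1:
 assumes "m > 0" "!!e. e : Basis ==> a \<bullet> e + 3 / real m <= z \<bullet> e & z \<bullet> e <= b \<bullet> e - 3 / real m"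
 shows "box_bump m a b z = 1"
proof -
 have "step (real m * (z \<bullet> e - a \<bullet> e) - 2) = 1" "step (real m * (b \<bullet> e - z \<bullet> e) - 2) = 1" if "e : Basis" for e
  using assms(2)[OF that] assms(1) by (auto intro!: step_eq(2) simp: field_simps)
 thus ?thesis by (simp add: box_bump_def)
qed

lemma core_cutoff:
 obtains ze :: "(real^'n) * real => real" where "test_function (core_box (1/2) (1/8)) ze" "!!z. 0 <= ze z & ze z <= 1"
  "!!z. z : core_box (3/8) (3/16) ==> ze z = 1"
proof (rule that)
 \<comment> \<open>With m = 48n the transition width 3/m is 1/(16n): less than the gap 1/(8n)
   between the two boxes in space, and at most their gap 1/16 in time.\<close>
 let ?n = "real CARD('n)" and ?m = "48 * CARD('n)"
 let ?a = "((\<chi> i. - (1/2) / ?n), 1/8) :: 'n pt" and ?b = "((\<chi> i. (1/2) / ?n), 1 - 1/8) :: 'n pt"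
 have n: "?n >= 1" by simp
 show "test_function (core_box (1/2) (1/8)) (box_bump ?m ?a ?b)" unfolding core_box_def by (rule box_bump_test) simp
 show "0 <= box_bump ?m ?a ?b z & box_bump ?m ?a ?b z <= 1" for z using box_bump_range by blast
 fix z :: "'n pt" assume "z : core_box (3/8) (3/16)"
 hence z: "!!i. abs (fst z $ i) < (3/8) / ?n" "3/16 < snd z" "snd z < 1 - 3/16" by (auto simp: mem_core_box)
 have m: "3 / real ?m = (1/16) / ?n" by simp
 have m1: "(1/16) / ?n <= 1/16" using n by (simp add: field_simps)
 have "ALL e:Basis. ?a \<bullet> e + 3 / real ?m <= z \<bullet> e & z \<bullet> e <= ?b \<bullet> e - 3 / real ?m" unfolding ball_Basis_dir inner_dir m
 proof (intro conjI allI)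
  show "snd ?a + (1/16) / ?n <= snd z" "snd z <= snd ?b - (1/16) / ?n" using z(2,3) m1 unfolding snd_conv by linarith+
  fix i
  have e: "(3/8) / ?n = (1/2) / ?n - (1/8) / ?n" "(1/16) / ?n <= (1/8) / ?n" using n by (auto simp: field_simps)
  show "fst ?a $ i + (1/16) / ?n <= fst z $ i" "fst z $ i <= fst ?b $ i - (1/16) / ?n"
   using z(1)[of i] e unfolding fst_conv vec_lambda_beta by (simp_all add: minus_divide_left[symmetric])
 qed
 thus "box_bump ?m ?a ?b z = 1" by (intro box_bump_eq_1) auto
qed

lemma core_subset: "(core :: ((real^'n) * real) set) <= core_box (3/8) (3/16)"
proof
 fix z :: "'n pt" assume z: "z : core"
 have "1 / (4 * real CARD('n)) < (3/8) / real CARD('n)" by (simp add: field_simps)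
 thus "z : core_box (3/8) (3/16)" using z unfolding core_def mem_core_box by (auto intro: le_less_trans)
qed

lemma core_box_subset: "(core_box (1/2) (1/8) :: ((real^'n) * real) set) <= {z. norm (fst z) <= 1 - 1/8 & 1/8 <= snd z & snd z <= 1}"
proof
 fix z :: "'n pt" assume z: "z : core_box (1/2) (1/8)"
 have "norm (fst z) <= (SUM i:UNIV. abs (fst z $ i))" by (rule norm_le_l1_cart)
 also have "... <= (SUM i:(UNIV::'n set). (1/2) / real CARD('n))" using z by (intro sum_mono) (auto simp: mem_core_box intro: less_imp_le)
 also have "... = 1/2" by simp
 finally show "z : {z. norm (fst z) <= 1 - 1/8 & 1/8 <= snd z & snd z <= 1}" using z by (auto simp: mem_core_box)
qed

lemma in_Lp_iff:
 assumes "S : sets lebesgue"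
 shows "in_Lp p S f \<longleftrightarrow> (%z. indicator S z * f z) : borel_measurable lebesgue & integrable lebesgue (%z. indicator S z * abs (f z) powr p)"
 unfolding in_Lp_def using assms by (simp add: borel_measurable_restrict_space_iff integrable_restrict_space)

lemma in_Lp_AE:
 assumes S: "S : sets lebesgue" and f: "in_Lp p S f" and e: "AE z in lebesgue. z : S --> f z = g z"
 shows "in_Lp p S g"
proof -
 have f: "(%z. indicator S z * f z) : borel_measurable lebesgue" "integrable lebesgue (%z. indicator S z * abs (f z) powr p)" using f in_Lp_iff[OF S] by auto
 have "AE z in lebesgue. indicator S z * f z = indicator S z * g z" using e by eventually_elim (auto simp: indicator_def)
 moreover have "AE z in lebesgue. indicator S z * abs (f z) powr p = indicator S z * abs (g z) powr p" using e by eventually_elim (auto simp: indicator_def)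
 ultimately show ?thesis unfolding in_Lp_iff[OF S] by (intro conjI borel_measurable_AE[OF f(1)] lebesgue_AE_eq(1)[OF f(2)])
qed

lemma in_Lp_borel:
 fixes g :: "'a::euclidean_space => real"
 assumes g: "g : borelf" and G: "(NN z. ennreal (abs (g z) powr p)) <= ennreal G" "G >= 0"
  and S: "S : sets lebesgue" and p: "p > 0"
 shows "in_Lp p S g" "Lp_norm p S g <= G powr (1 / p)"
proof -
 have gm: "(%z. abs (g z) powr p) : borel_measurable lborel" using g by measurable
 have "integrable lborel (%z. abs (g z) powr p)" by (rule integrableI_bounded[OF gm]) (use G in "auto intro: le_less_trans")
 hence i: "integrable lebesgue (%z. abs (g z) powr p)" using integrable_completion[OF gm] by simp
 have gl: "g : borel_measurable lebesgue" using g by (intro measurable_completion) simp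
 show L: "in_Lp p S g" unfolding in_Lp_iff[OF S] by (intro conjI borel_measurable_times borel_measurable_indicator S gl integrable_indicator_times i)
 have "ennreal (integral\<^sup>L (lebesgue_on S) (%z. abs (g z) powr p)) = (\<integral>\<^sup>+z. ennreal (abs (g z) powr p) \<partial>lebesgue_on S)"
  using L by (intro nn_integral_eq_integral[symmetric]) (auto simp: in_Lp_def)
 also have "... = (NL z. ennreal (abs (g z) powr p) * indicator S z)" using S by (subst nn_integral_restrict_space) auto
 also have "... <= (NL z. ennreal (abs (g z) powr p))" by (intro nn_integral_mono) (auto simp: indicator_def)
 also have "... <= ennreal G" using G by (simp add: nn_integral_completion)
 finally have "integral\<^sup>L (lebesgue_on S) (%z. abs (g z) powr p) <= G" using G by simp
 thus "Lp_norm p S g <= G powr (1 / p)" unfolding Lp_norm_def using p by (intro powr_mono2) (auto intro: Bochner_Integration.integral_nonneg)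
qed

lemma W21_norm_ge:
 fixes f :: "(real^'n) * real => real"
 shows
 "Lp_norm p S f <= W21_norm p S f" "vs : jet_indices ==> Lp_norm p S (weak_deriv (interior S) vs f) <= W21_norm p S f"
proof -
 have nn: "Lp_norm p S h >= 0" for h :: "'n pt => real" by (simp add: Lp_norm_def)
 let ?t = "Lp_norm p S (weak_deriv (interior S) [dir_t] f)"
 let ?a = "%k. Lp_norm p S (weak_deriv (interior S) [dir_x k] f)"
 let ?b = "%k l. Lp_norm p S (weak_deriv (interior S) [dir_x k, dir_x l] f)"
 have s: "0 <= sum ?a UNIV" "0 <= (SUM k:UNIV. sum (?b k) UNIV)" by (intro sum_nonneg nn)+
 have sa: "?a k <= sum ?a UNIV" for k by (rule member_le_sum) (auto simp: nn)
 have sb: "?b k l <= (SUM k:UNIV. sum (?b k) UNIV)" for k l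
 proof -
  have "?b k l <= sum (?b k) UNIV" by (rule member_le_sum) (auto simp: nn)
  also have "... <= (SUM k:UNIV. sum (?b k) UNIV)" by (rule member_le_sum) (auto intro: sum_nonneg nn)
  finally show ?thesis .
 qed
 show "Lp_norm p S f <= W21_norm p S f" unfolding W21_norm_def using nn s by (simp add: add_increasing2)
 assume "vs : jet_indices"
 then consider "vs = [dir_t]" | k where "vs = [dir_x k]" | k l where "vs = [dir_x k, dir_x l]" by (auto simp: jet_indices_def)
 thus "Lp_norm p S (weak_deriv (interior S) vs f) <= W21_norm p S f"
 proof cases
  case 1 thus ?thesis unfolding W21_norm_def using nn[of f] s by simp
 next
  case 2 thus ?thesis unfolding W21_norm_def using nn[of f] nn[of "weak_deriv (interior S) [dir_t] f"] s(2) sa[of k] by simp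
 next
  case 3 thus ?thesis unfolding W21_norm_def using nn[of f] nn[of "weak_deriv (interior S) [dir_t] f"] s(1) sb[of k l] by simp
 qed
qed

text \<open>Ellipticity of G is assumed for symmetric matrices, so Hessians of test functions must
  be symmetric almost everywhere. Mixed weak derivatives agree because those of test functions
  do.\<close>

lemma jet_symmetric:
 assumes "jet w wt w1 w2" shows "AE z in lebesgue. ALL k l. w2 k l z = w2 l k z"
proof -
 have "AE z in lebesgue. w2 k l z = w2 l k z" for k l
 proof -
  have h: "has_weak_deriv UNIV [dir_x k, dir_x l] w (w2 k l)" for k l using assms by (intro wd_wd_has_weak_deriv[of _ _ "w1 k"]) (auto simp: jet_def)
  from has_weak_deriv_unique[OF open_UNIV h has_weak_deriv_swap[OF h], of k l] show ?thesis by simp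
 qed
 thus ?thesis by (intro AE_all_countable[THEN iffD2] allI) (auto simp: AE_all_countable)
qed

lemma borel_representative:
 fixes f :: "'a::euclidean_space => real"
 assumes "f : borel_measurable lebesgue" "S : sets borel" "!!z. z ~: S ==> f z = 0"
 obtains g where "g : borelf" "AE z in lebesgue. f z = g z" "!!z. z ~: S ==> g z = 0"
proof -
 have "f : borel_measurable (completion lborel)" using assms(1) by simp
 then obtain h where h: "h : borel_measurable lborel" "AE z in lborel. f z = h z" using completion_ex_borel_measurable_real by blast
 have hb[measurable]: "h : borelf" using h(1) by simp
 note [measurable] = assms(2)
 show ?thesis
 proof (rule that[of "%z. indicator S z * h z"])
  show "(%z. indicator S z * h z) : borelf" by measurable
  show "AE z in lebesgue. f z = indicator S z * h z" using AE_completion[OF h(2)] by eventually_elim (use assms(3) in "auto simp: indicator_def")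
 qed auto
qed

abbreviation neg_jet where
 "neg_jet w wt w1 w2 \<equiv> jet w wt w1 w2 & continuous_on UNIV w & (ALL z. w z <= 0)"

text \<open>For the right-hand side -g the upper bound of the maximum principle is zero, so the
  solution is nonpositive, and the interior estimate on the support of the cut-off controls its
  derivatives. Multiplication by the cut-off keeps the sign, gives a jet on the whole space and
  leaves the equation untouched on \<open>core\<close>.\<close>

lemma abp_core:
 assumes abp: "ABP_exponent TYPE('n::finite) lam Lam p1" and p: "p > p1"
 shows "EX C>=0. ALL (g :: 'n pt => real) G. g : borelf --> (ALL z. g z >= 0) --> (ALL z. z ~: core --> g z = 0) -->
  G >= 0 --> (NN z. ennreal (g z powr p)) <= ennreal G -->
  (EX w wt w1 w2. neg_jet w wt w1 w2 & (ALL z. abs (w z) powr p <= C * G) &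
   (ALL z. z ~: core_box (1/2) (1/8) --> jet_size w wt w1 w2 z = 0) &
   (AE z in lborel. z : core --> wt z + PP lam Lam w2 z <= - g z) &
   jint p w wt w1 w2 <= ennreal (C * G))"
 (is "EX C>=0. ALL g G. _ --> _ --> _ --> _ --> _ --> ?R C g G")
proof -
 let ?Q = "cylinder (ball (0::real^'n) 1) 1"
 let ?U = "core_box (1/2) (1/8) :: 'n pt set"
 have p1: "(real CARD('n) + 2) / 2 <= p1" using abp unfolding ABP_exponent_def by simp
 hence p0: "p > 1" using p by simp
 have "EX C C'. ALL f. in_Lp p ?Q f -->
    (EX u. continuous_on (closure ?Q) u & W21_loc p (ball 0 1) 1 u &
     (AE z in lebesgue_on ?Q. Dt ?Q u z + pucci_plus lam Lam (D2x ?Q u z) = f z) &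
     (ALL z:par_boundary (ball 0 1) 1. u z = 0) &
     (ALL z:?Q. - C * Lp_norm p ?Q (%z. max 0 (- f z)) <= u z & u z <= C * Lp_norm p ?Q (%z. max 0 (f z))) &
     (ALL Q'. par_inside (ball 0 1) 1 Q' -->
      W21_norm p Q' u <= C' (par_setdist Q' (par_boundary (ball 0 1) 1)) * Lp_norm p ?Q f))" (is "EX C C'. ALL f. _ --> ?A C C' f")
  using abp p unfolding ABP_exponent_def Let_def by blast
 then obtain C0 C' where ABP: "!!f. in_Lp p ?Q f ==> ?A C0 C' f" by blast
 obtain ze :: "'n pt => real" where ze: "test_function ?U ze" "!!z. 0 <= ze z & ze z <= 1"
  "!!z. z : core_box (3/8) (3/16) ==> ze z = 1" by (rule core_cutoff) (rule that)
 note sze = test_function_smooth[OF ze(1)]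
 define c1 where "c1 = abs (C' (par_setdist ?U (par_boundary (ball 0 1) 1)))"
 define I :: "('n pt) list set" where "I = insert [] jet_indices"
 have fI: "finite I" unfolding I_def using finite_jet_indices by simp
 define Ts where "Ts = insert ze ((%e. dd e ze) ` Basis Un (UN e:Basis. (%e'. dd e (dd e' ze)) ` Basis))"
 have "EX B>=0. ALL z. abs (T z) <= B" if T: "T : Ts" for T
 proof -
  have "test_function ?U T" using T ze(1) test_function_dd unfolding Ts_def by auto
  thus ?thesis by (rule test_function_bounded) blast
 qed
 then obtain b where b: "!!T. T : Ts ==> b T >= 0 & (ALL z. abs (T z) <= b T)" by metis
 have fT: "finite Ts" unfolding Ts_def by simp
 define B where "B = sum b Ts"
 have bB: "abs (T z) <= B" if T: "T : Ts" for T z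
 proof -
  have "b T <= B" unfolding B_def using b fT T by (intro member_le_sum) auto
  thus ?thesis using b[OF T] order_trans by blast
 qed
 have B0: "B >= 0" unfolding B_def using b by (intro sum_nonneg) auto
 have bz: "abs (ze z) <= B" "abs (dd (dir_x k) ze z) <= B" "abs (dd dir_t ze z) <= B" "abs (dd (dir_x l) (dd (dir_x k) ze) z) <= B" for z k l
 proof -
  have "ze : Ts" unfolding Ts_def by simp
  moreover have "dd e ze : Ts" if "e : Basis" for e unfolding Ts_def using that by (intro insertI2 UnI1 imageI)
  moreover have "dd e (dd e' ze) : Ts" if "e : Basis" "e' : Basis" for e e'
   unfolding Ts_def by (rule insertI2, rule UnI2, rule UN_I[OF that(1)], rule imageI[OF that(2)])
  ultimately show "abs (ze z) <= B" "abs (dd (dir_x k) ze z) <= B" "abs (dd dir_t ze z) <= B" "abs (dd (dir_x l) (dd (dir_x k) ze) z) <= B"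
   using dir_Basis by (blast intro: bB)+
 qed
 \<comment> \<open>The jet has 1 + 1 + n + n^2 entries, each a sum of at most four products bounded
   by \<open>B\<close> times the size of the derivatives.\<close>
 define M where "M = (2 + real CARD('n) + real CARD('n) * real CARD('n)) * (4 * B)"
 have M0: "M >= 0" unfolding M_def using B0 by simp
 define C where "C = max (abs C0 powr p) (M powr p * (real (card I) powr p * (real (card I) * c1 powr p)))"
 have C: "C >= 0" "abs C0 powr p <= C" "M powr p * (real (card I) powr p * (real (card I) * c1 powr p)) <= C" unfolding C_def by (auto simp: le_max_iff_disj)
 have oU: "open ?U" by (simp add: core_box_def open_box)
 have iU: "interior ?U = ?U" using oU by (simp add: interior_open)
 have UL: "?U : sets lebesgue" using oU by simp
 have Ub: "?U : sets borel" using oU by simp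
 have Uin: "par_inside (ball 0 1) 1 ?U" by (rule par_inside_unit[OF oU core_box_subset]) auto
 have UQ: "?U <= ?Q" using Uin unfolding par_inside_def by blast
 have QL: "?Q : sets lebesgue"
 proof -
  have "?Q = ball 0 1 \<times> {0<..1}" by (simp add: cylinder_def)
  hence "?Q : sets (borel \<Otimes>\<^sub>M borel)" by simp
  hence "?Q : sets borel" by (simp only: borel_prod)
  thus ?thesis by (intro sets_completionI_sets) simp
 qed
 show ?thesis
 proof (intro exI[of _ C] conjI allI impI C(1))
  fix g :: "'n pt => real" and G
  assume g[measurable]: "g : borelf" and g0: "ALL z. g z >= 0" and gc: "ALL z. z ~: core --> g z = 0" and G0: "G >= 0"
   and gG: "(NN z. ennreal (g z powr p)) <= ennreal G"
  have gz: "g z >= 0" for z using g0 by blast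
  define K where "K = G powr (1 / p)"
  have Kp: "K powr p = G" "K >= 0" using p0 G0 by (auto simp: K_def powr_powr)
  have fL: "in_Lp p ?Q (%z. - g z)" "Lp_norm p ?Q (%z. - g z) <= K" using in_Lp_borel[of "%z. - g z" p G ?Q] g0 gG G0 QL p0 unfolding K_def by auto
  from ABP[OF fL(1)] obtain u where u: "continuous_on (closure ?Q) u" "W21_loc p (ball 0 1) 1 u"
   "AE z in lebesgue_on ?Q. Dt ?Q u z + pucci_plus lam Lam (D2x ?Q u z) = - g z"
   "ALL z:?Q. - C0 * Lp_norm p ?Q (%z. max 0 (- (- g z))) <= u z & u z <= C0 * Lp_norm p ?Q (%z. max 0 (- g z))"
   "W21_norm p ?U u <= C' (par_setdist ?U (par_boundary (ball 0 1) 1)) * Lp_norm p ?Q (%z. - g z)" using Uin by blast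
  have uQ: "u z <= 0" "abs (u z) <= abs C0 * K" if "z : ?Q" for z
  proof -
   have "(%z. max 0 (- g z)) = (%z. 0)" by (intro ext max_absorb1) (simp add: gz)
   thus u0: "u z <= 0" using u(4) that by (auto simp: Lp_norm_def)
   have "(%z. max 0 (- (- g z))) = g" by (intro ext, subst max_absorb2) (simp_all add: gz)
   hence "Lp_norm p ?Q (%z. max 0 (- (- g z))) = Lp_norm p ?Q (%z. - g z)" by (simp add: Lp_norm_def)
   hence "- u z <= C0 * Lp_norm p ?Q (%z. - g z)" using u(4) that by fastforce
   also have "... <= abs C0 * Lp_norm p ?Q (%z. - g z)" by (intro mult_right_mono) (auto simp: Lp_norm_def)
   also have "... <= abs C0 * K" using fL(2) by (intro mult_left_mono) auto
   finally show "abs (u z) <= abs C0 * K" using u0 by simp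
  qed
  have W: "W21 p ?U u" using u(2) Uin unfolding W21_loc_def by blast
  define D where "D vs = (if vs = [] then u else weak_deriv ?U vs u)" for vs
  have hD: "has_weak_deriv ?U vs u (D vs)" if "vs : jet_indices" for vs
  proof -
   have "EX h. has_weak_deriv ?U vs u h" using W that unfolding W21_def iU jet_indices_def by blast
   moreover have "vs ~= []" using that by (auto simp: jet_indices_def)
   ultimately show ?thesis unfolding D_def using has_weak_deriv_weak_deriv by auto
  qed
  have LD: "in_Lp p ?U (D vs)" "Lp_norm p ?U (D vs) <= c1 * K" if vs: "vs : I" for vs
  proof -
   note u(5)
   also have "C' (par_setdist ?U (par_boundary (ball 0 1) 1)) * Lp_norm p ?Q (%z. - g z) <= c1 * Lp_norm p ?Q (%z. - g z)"
    unfolding c1_def by (intro mult_right_mono abs_ge_self) (simp add: Lp_norm_def)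
   also have "... <= c1 * K" using fL(2) by (intro mult_left_mono) (auto simp: c1_def)
   finally have W1: "W21_norm p ?U u <= c1 * K" .
   show "Lp_norm p ?U (D vs) <= c1 * K"
   proof (cases "vs = []")
    case True thus ?thesis using W21_norm_ge(1)[of p ?U u] W1 by (simp add: D_def)
   next
    case False thus ?thesis using W21_norm_ge(2)[of vs p ?U u] W1 vs by (simp add: D_def I_def iU)
   qed
   show "in_Lp p ?U (D vs)"
   proof (cases "vs = []")
    case True thus ?thesis using W by (simp add: D_def W21_def)
   next
    case False
    hence vj: "vs : jet_indices" using vs by (simp add: I_def)
    then obtain h where h: "has_weak_deriv ?U vs u h" "in_Lp p ?U h" using W unfolding W21_def iU jet_indices_def by blast
    show ?thesis by (rule in_Lp_AE[OF UL h(2) has_weak_deriv_unique[OF oU h(1) hD[OF vj]]])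
   qed
  qed
  define S where "S z = (SUM vs:I. indicator ?U z * abs (D vs z))" for z
  have S0: "S z >= 0" for z unfolding S_def by (intro sum_nonneg) auto
  have SD: "indicator ?U z * abs (D vs z) <= S z" if "vs : I" for vs z unfolding S_def by (rule member_le_sum[OF that _ fI]) auto
  have Sint: "(NL z. ennreal (S z powr p)) <= ennreal (real (card I) powr p * (real (card I) * (c1 powr p * G)))"
  proof -
   have "(NL z. ennreal (S z powr p)) <= (NL z. ennreal (real (card I) powr p) * (SUM vs:I. indicator ?U z * ennreal (abs (D vs z) powr p)))"
   proof (rule nn_integral_mono)
    fix z
    have "S z powr p <= real (card I) powr p * (SUM vs:I. (indicator ?U z * abs (D vs z)) powr p)" unfolding S_def using p0 by (intro sum_powr_le fI) auto
    also have "(SUM vs:I. (indicator ?U z * abs (D vs z)) powr p) = (SUM vs:I. indicator ?U z * abs (D vs z) powr p)"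
     by (intro sum.cong refl) (auto simp: indicator_def)
    finally have "ennreal (S z powr p) <= ennreal (real (card I) powr p) * ennreal (SUM vs:I. indicator ?U z * abs (D vs z) powr p)"
     by (simp add: ennreal_mult'[symmetric] ennreal_leI sum_nonneg)
    also have "ennreal (SUM vs:I. indicator ?U z * abs (D vs z) powr p) = (SUM vs:I. ennreal (indicator ?U z * abs (D vs z) powr p))"
     by (rule sum_ennreal[symmetric]) auto
    also have "... = (SUM vs:I. indicator ?U z * ennreal (abs (D vs z) powr p))" by (intro sum.cong refl) (auto simp: indicator_def)
    finally show "ennreal (S z powr p) <= ennreal (real (card I) powr p) * (SUM vs:I. indicator ?U z * ennreal (abs (D vs z) powr p))" .
   qed
   also have "... = ennreal (real (card I) powr p) * (SUM vs:I. NL z. indicator ?U z * ennreal (abs (D vs z) powr p))"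
   proof -
    have m: "(%z. indicator ?U z * ennreal (abs (D vs z) powr p)) : borel_measurable lebesgue" if "vs : I" for vs
    proof -
     have "(%z. ennreal (indicator ?U z * abs (D vs z) powr p)) : borel_measurable lebesgue" using LD(1)[OF that] unfolding in_Lp_iff[OF UL] by auto
     moreover have "(%z. ennreal (indicator ?U z * abs (D vs z) powr p)) = (%z. indicator ?U z * ennreal (abs (D vs z) powr p))"
      by (auto simp: indicator_def fun_eq_iff)
     ultimately show ?thesis by simp
    qed
    show ?thesis by (subst nn_integral_cmult) (auto intro!: borel_measurable_sum m simp: nn_integral_sum[OF m])
   qed
   also have "... <= ennreal (real (card I) powr p) * (SUM vs:I. ennreal (c1 powr p * G))"
   proof (intro mult_left_mono sum_mono)
    fix vs assume "vs : I"
    from Lp_norm_nn_integral[OF LD(1)[OF this] UL _ LD(2)[OF this]]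
    show "(NL z. indicator ?U z * ennreal (abs (D vs z) powr p)) <= ennreal (c1 powr p * G)" using p0 Kp by (simp add: powr_mult)
   qed simp
   also have "... = ennreal (real (card I) powr p * (real (card I) * (c1 powr p * G)))" using G0 by (simp add: ennreal_mult' ennreal_of_nat_eq_real_of_nat)
   finally show ?thesis .
  qed
  define W' where "W' z = u z * ze z" for z
  define Wt where "Wt z = D [dir_t] z * ze z + u z * dd dir_t ze z" for z
  define W1 where "W1 k z = D [dir_x k] z * ze z + u z * dd (dir_x k) ze z" for k z
  define W2 where "W2 k l z = (D [dir_x k, dir_x l] z * ze z + D [dir_x k] z * dd (dir_x l) ze z)
   + (D [dir_x l] z * dd (dir_x k) ze z + u z * dd (dir_x l) (dd (dir_x k) ze) z)" for k l z
  have wdt: "wd dir_t W' Wt" unfolding W'_def[abs_def] Wt_def[abs_def] by (rule wd_cutoff[OF hD[OF jet_indicesI(1)] ze(1)])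
  have wd1: "wd (dir_x k) W' (W1 k)" for k unfolding W'_def[abs_def] W1_def[abs_def] by (rule wd_cutoff[OF hD[OF jet_indicesI(2)] ze(1)])
  have wd2: "wd (dir_x l) (W1 k) (W2 k l)" for k l unfolding W1_def[abs_def] W2_def[abs_def]
   by (rule wd_add[OF wd_cutoff[OF has_weak_deriv_second[OF hD[OF jet_indicesI(3)] hD[OF jet_indicesI(2)]] ze(1)]
     wd_cutoff[OF hD[OF jet_indicesI(2)] test_function_dd[OF ze(1)]]])
  have tf0: "T z = 0" if "test_function ?U T" "z ~: ?U" for T z using that(1) by (rule test_functionE) (use that(2) in blast)
  have zout: "ze z = 0" "dd e ze z = 0" "dd e' (dd e ze) z = 0" if "z ~: ?U" for z e e' by (rule tf0[OF _ that], intro test_function_dd ze(1))+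
  have out: "W' z = 0" "Wt z = 0" "W1 k z = 0" "W2 k l z = 0" if "z ~: ?U" for z k l using zout[OF that] by (auto simp: W'_def Wt_def W1_def W2_def)
  have dI: "[] : I" "[dir_t] : I" "[dir_x k] : I" "[dir_x k, dir_x l] : I" for k l by (auto simp: I_def jet_indicesI)
  have DS: "abs (D vs z) <= S z" if "vs : I" "z : ?U" for vs z using SD[OF that(1), of z] that(2) by simp
  have prod: "abs (D vs z * T) <= B * S z" if "vs : I" "z : ?U" "abs T <= B" for vs z T
   using mult_mono[OF that(3) DS[OF that(1,2)] B0 abs_ge_zero] by (simp add: abs_mult mult.commute)
  have uD: "u = D []" by (simp add: D_def)
  have bnd: "abs (W' z) <= 4 * B * S z" "abs (Wt z) <= 4 * B * S z" "abs (W1 k z) <= 4 * B * S z" "abs (W2 k l z) <= 4 * B * S z" for z k l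
  proof -
   have BS: "0 <= B * S z" using B0 S0 by simp
   have "abs (W' z) <= 4 * B * S z & abs (Wt z) <= 4 * B * S z & abs (W1 k z) <= 4 * B * S z & abs (W2 k l z) <= 4 * B * S z"
   proof (cases "z : ?U")
    case True
    note q = prod[OF _ True]
    note i3 = dI(3)[where k=k] and i3' = dI(3)[where k=l] and i4 = dI(4)[where k=k and l=l]
    note b1 = bz(1)[where z=z] and b2 = bz(2)[where z=z and k=k] and b2' = bz(2)[where z=z and k=l]
     and b3 = bz(3)[where z=z] and b4 = bz(4)[where z=z and k=k and l=l]
    show ?thesis
    proof (intro conjI)
     show "abs (W' z) <= 4 * B * S z" unfolding W'_def uD using q[OF dI(1) b1] BS by linarith
     show "abs (Wt z) <= 4 * B * S z" unfolding Wt_def uD using q[OF dI(2) b1] q[OF dI(1) b3] BS by linarith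
     show "abs (W1 k z) <= 4 * B * S z" unfolding W1_def uD using q[OF i3 b1] q[OF dI(1) b2] BS by linarith
     show "abs (W2 k l z) <= 4 * B * S z" unfolding W2_def uD using q[OF i4 b1] q[OF i3 b2'] q[OF i3' b2] q[OF dI(1) b4] by linarith
    qed
   next
    case False thus ?thesis using out[OF False] BS by simp
   qed
   thus "abs (W' z) <= 4 * B * S z" "abs (Wt z) <= 4 * B * S z" "abs (W1 k z) <= 4 * B * S z" "abs (W2 k l z) <= 4 * B * S z" by auto
  qed
  have cW: "continuous_on UNIV W'"
  proof -
   obtain KK where KK: "compact KK" "KK <= ?U" "!!z. z ~: KK ==> ze z = 0" using ze(1) by (rule test_functionE) (rule that)
   have "continuous_on ?U W'" unfolding W'_def using UQ closure_subset by (intro continuous_on_mult continuous_on_subset[OF u(1)] smooth_continuous_on sze) blast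
   moreover have "continuous_on (- KK) W'" using continuous_on_const[of "- KK" "0::real"] by (rule continuous_on_eq) (simp add: W'_def KK(3))
   ultimately have "continuous_on (?U Un - KK) W'" using oU compact_imp_closed[OF KK(1)] by (intro continuous_on_open_Un) auto
   moreover have "?U Un - KK = UNIV" using KK(2) by auto
   ultimately show ?thesis by simp
  qed
  have mW: "W' : borelf" by (rule borel_measurable_continuous_onI[OF cW])
  \<comment> \<open>Representatives that vanish outside the box, so that the claim about
    \<open>jet_size\<close> holds at every point and not just almost everywhere.\<close>
  define rep where "rep f h \<longleftrightarrow> h : borelf & (AE z in lebesgue. f z = h z) & (ALL z. z ~: ?U --> h z = 0)"
   for f h :: "'n pt => real"
  have rep: "EX h. rep f h" if ff: "integrable lebesgue f" "!!z. z ~: ?U ==> f z = 0" for f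
  proof -
   obtain h where "h : borelf" "AE z in lebesgue. f z = h z" "!!z. z ~: ?U ==> h z = 0"
    by (rule borel_representative[OF borel_measurable_integrable[OF ff(1)] Ub], erule ff(2), rule that)
   hence "rep f h" unfolding rep_def by blast
   thus ?thesis by blast
  qed
  obtain wt where rt: "rep Wt wt" using rep[of Wt] wdt out(2) unfolding wd_def by blast
  have "EX h. rep (W1 k) h" for k using rep[of "W1 k"] wd1[of k] out(3) unfolding wd_def by blast
  then obtain w1 where r1: "!!k. rep (W1 k) (w1 k)" by metis
  have "EX h. rep (W2 k l) h" for k l using rep[of "W2 k l"] wd2[of l k] out(4) unfolding wd_def by blast
  then obtain w2 where r2: "!!k l. rep (W2 k l) (w2 k l)" by metis
  note wt = rt[unfolded rep_def, THEN conjunct1] rt[unfolded rep_def, THEN conjunct2, THEN conjunct1]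
   rt[unfolded rep_def, THEN conjunct2, THEN conjunct2, rule_format]
  note w1 = r1[unfolded rep_def, THEN conjunct1] r1[unfolded rep_def, THEN conjunct2, THEN conjunct1]
   r1[unfolded rep_def, THEN conjunct2, THEN conjunct2, rule_format]
  note w2 = r2[unfolded rep_def, THEN conjunct1] r2[unfolded rep_def, THEN conjunct2, THEN conjunct1]
   r2[unfolded rep_def, THEN conjunct2, THEN conjunct2, rule_format]
  have e0: "AE z in lebesgue. W' z = W' z" by simp
  have J: "jet W' wt w1 w2" unfolding jet_def by (intro conjI allI mW wt(1) w1(1) w2(1) wd_AE[OF wdt e0 wt(2)] wd_AE[OF wd1 e0 w1(2)] wd_AE[OF wd2 w1(2) w2(2)])
  have aeall: "AE z in lebesgue. Wt z = wt z & (ALL k. W1 k z = w1 k z) & (ALL k l. W2 k l z = w2 k l z)" using wt(2) w1(2) w2(2) by (simp add: AE_all_countable)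
  have size_le: "AE z in lebesgue. jet_size W' wt w1 w2 z <= M * S z" using aeall
  proof eventually_elim
   fix z assume e: "Wt z = wt z & (ALL k. W1 k z = w1 k z) & (ALL k l. W2 k l z = w2 k l z)"
   have b3: "abs (w1 k z) <= 4 * B * S z" for k using bnd(3)[where k=k and z=z] e by simp
   have b4: "abs (w2 k l z) <= 4 * B * S z" for k l using bnd(4)[where k=k and l=l and z=z] e by simp
   have "(SUM k:UNIV. abs (w1 k z)) <= real CARD('n) * (4 * B * S z)" using sum_bounded_above[of UNIV "%k. abs (w1 k z)" "4 * B * S z", OF b3] by simp
   moreover have "(SUM l:UNIV. abs (w2 k l z)) <= real CARD('n) * (4 * B * S z)" for k
    using sum_bounded_above[of UNIV "%l. abs (w2 k l z)" "4 * B * S z", OF b4] by simp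
   hence "(SUM k:UNIV. SUM l:UNIV. abs (w2 k l z)) <= real CARD('n) * (real CARD('n) * (4 * B * S z))"
    using sum_bounded_above[of UNIV "%k. SUM l:UNIV. abs (w2 k l z)" "real CARD('n) * (4 * B * S z)"] by simp
   ultimately show "jet_size W' wt w1 w2 z <= M * S z" unfolding jet_size_def M_def using bnd(1)[of z] bnd(2)[of z] e by (simp add: algebra_simps)
  qed
  have jint: "jint p W' wt w1 w2 <= ennreal (C * G)"
  proof -
   have "jint p W' wt w1 w2 = (NL z. ennreal (jet_size W' wt w1 w2 z powr p))" by (simp add: nn_integral_completion)
   also have "... <= (NL z. ennreal (M powr p) * ennreal (S z powr p))"
   proof (rule nn_integral_mono_AE, use size_le in eventually_elim)
    fix z assume "jet_size W' wt w1 w2 z <= M * S z"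
    hence "jet_size W' wt w1 w2 z powr p <= (M * S z) powr p" using p0 jet_size_ge(5)[where z=z] by (intro powr_mono2) auto
    thus "ennreal (jet_size W' wt w1 w2 z powr p) <= ennreal (M powr p) * ennreal (S z powr p)" by (simp add: powr_mult ennreal_mult'[symmetric] ennreal_leI)
   qed
   also have "... = ennreal (M powr p) * (NL z. ennreal (S z powr p))"
   proof (rule nn_integral_cmult)
    have "(%z. indicator ?U z * abs (D vs z)) : borel_measurable lebesgue" if "vs : I" for vs
    proof -
     have "(%z. abs (indicator ?U z * D vs z)) : borel_measurable lebesgue" using LD(1)[OF that] unfolding in_Lp_iff[OF UL] by (intro borel_measurable_abs) auto
     thus ?thesis by (simp add: abs_mult)
    qed
    hence "S : borel_measurable lebesgue" unfolding S_def[abs_def] by (intro borel_measurable_sum) auto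
    thus "(%z. ennreal (S z powr p)) : borel_measurable lebesgue" by measurable
   qed
   also have "... <= ennreal (M powr p) * ennreal (real (card I) powr p * (real (card I) * (c1 powr p * G)))" by (intro mult_left_mono Sint) simp
   also have "... = ennreal ((M powr p * (real (card I) powr p * (real (card I) * c1 powr p))) * G)" by (simp add: ennreal_mult'[symmetric] mult_ac)
   also have "... <= ennreal (C * G)" using C(3) G0 by (intro ennreal_leI mult_right_mono) auto
   finally show ?thesis .
  qed
  have eq: "AE z in lebesgue. z : core --> wt z + PP lam Lam w2 z <= - g z"
  proof -
   have o: "open (interior ?Q)" by simp
   have UiQ: "?U <= interior ?Q" using UQ oU by (rule interior_maximal)
   have ud: "AE z in lebesgue. z : ?U --> weak_deriv (interior ?Q) vs u z = D vs z" if "vs : jet_indices" for vs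
    by (rule has_weak_deriv_unique[OF oU has_weak_deriv_mono[OF unit_cylinder_weak_derivs[OF u(2) that] UiQ] hD[OF that]])
   have e1: "AE z in lebesgue. z : ?U --> weak_deriv (interior ?Q) [dir_t] u z = D [dir_t] z" by (rule ud[OF jet_indicesI(1)])
   have e2: "AE z in lebesgue. ALL k l. z : ?U --> weak_deriv (interior ?Q) [dir_x k, dir_x l] u z = D [dir_x k, dir_x l] z"
    by (intro AE_all_countable[THEN iffD2] allI ud[OF jet_indicesI(3)])
   have e3: "AE z in lebesgue. z : ?Q --> Dt ?Q u z + pucci_plus lam Lam (D2x ?Q u z) = - g z" using u(3) QL by (simp add: AE_restrict_space_iff)
   show ?thesis using e1 e2 e3 aeall
   proof eventually_elim
    fix z assume a: "z : ?U --> weak_deriv (interior ?Q) [dir_t] u z = D [dir_t] z"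
     "ALL k l. z : ?U --> weak_deriv (interior ?Q) [dir_x k, dir_x l] u z = D [dir_x k, dir_x l] z"
     "z : ?Q --> Dt ?Q u z + pucci_plus lam Lam (D2x ?Q u z) = - g z"
     "Wt z = wt z & (ALL k. W1 k z = w1 k z) & (ALL k l. W2 k l z = w2 k l z)"
    show "z : core --> wt z + PP lam Lam w2 z <= - g z"
    proof
     assume "z : core"
     hence zc: "z : core_box (3/8) (3/16)" using core_subset by blast
     \<comment> \<open>The cut-off is 1 on this whole neighbourhood of z, so the terms with its
       derivatives vanish there.\<close>
     have oc: "open (core_box (3/8) (3/16) :: 'n pt set)" by (simp add: core_box_def open_box)
     have "(3/8) / real CARD('n) <= (1/2) / real CARD('n)" by (rule divide_right_mono) simp_all
     hence zU: "z : ?U" using zc unfolding mem_core_box by (auto intro: less_le_trans)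
     have d1: "dd e ze y = 0" if "y : core_box (3/8) (3/16)" for e y
     proof -
      have "(ze has_derivative (%_. 0)) (at y)" by (rule has_derivative_transform_within_open[OF has_derivative_const[of 1] oc that]) (simp add: ze(3))
      thus ?thesis using dd_eq[of ze "%_. 0"] by simp
     qed
     have d2: "dd e' (dd e ze) z = 0" for e e'
     proof -
      have "(dd e ze has_derivative (%_. 0)) (at z)" by (rule has_derivative_transform_within_open[OF has_derivative_const[of 0] oc zc]) (simp add: d1)
      thus ?thesis using dd_eq[of "dd e ze" "%_. 0"] by simp
     qed
     have "wt z = D [dir_t] z" "w2 k l z = D [dir_x k, dir_x l] z" for k l using a(4) d1[OF zc] d2 ze(3)[OF zc] by (auto simp: Wt_def W2_def)
     hence "wt z = Dt ?Q u z" "(\<chi> k l. w2 k l z) = D2x ?Q u z" using a(1,2) zU by (auto simp: Dt_def D2x_def)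
     thus "wt z + PP lam Lam w2 z <= - g z" using a(3) zU UQ by auto
    qed
   qed
  qed
  have WW: "(ALL z. W' z <= 0) & (ALL z. abs (W' z) powr p <= C * G)"
  proof (intro conjI allI)
   fix z
   have *: "W' z <= 0 & abs (W' z) <= abs C0 * K"
   proof (cases "z : ?U")
    case True
    hence zQ: "z : ?Q" using UQ by blast
    have "abs (u z) * abs (ze z) <= abs (u z)" using ze(2)[of z] by (intro mult_left_le) auto
    thus ?thesis using uQ[OF zQ] ze(2)[of z] by (auto simp: W'_def abs_mult mult_nonpos_nonneg)
   next
    case False thus ?thesis using out(1) Kp(2) by simp
   qed
   thus "W' z <= 0" by blast
   have "abs (W' z) powr p <= (abs C0 * K) powr p" using * p0 by (intro powr_mono2) auto
   also have "... = abs C0 powr p * G" using Kp by (simp add: powr_mult)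
   also have "... <= C * G" using C(2) G0 by (rule mult_right_mono)
   finally show "abs (W' z) powr p <= C * G" .
  qed
  show "?R C g G"
  proof (intro exI conjI)
   show "jet W' wt w1 w2" "continuous_on UNIV W'" by (rule J cW)+
   show "ALL z. z ~: ?U --> jet_size W' wt w1 w2 z = 0" by (intro allI impI) (simp add: jet_size_def out(1) wt(3) w1(3) w2(3))
   show "AE z in lborel. z : core --> wt z + PP lam Lam w2 z <= - g z" using eq unfolding AE_completion_iff .
   show "jint p W' wt w1 w2 <= ennreal (C * G)" by (rule jint)
   show "ALL z. W' z <= 0" "ALL z. abs (W' z) powr p <= C * G" using WW by blast+
  qed
 qed
qed

section \<open>Pucci operators\<close>

lemma mat_quadratic: "xi \<bullet> (mat c *v xi) = c * (xi \<bullet> (xi :: real^'n))"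
proof -
 have "mat c *v xi = c *\<^sub>R xi" by (simp add: vec_eq_iff matrix_vector_mult_def mat_def if_distrib[where f="%x. x * _"] cong: if_cong)
 thus ?thesis by simp
qed

lemma pucci_matricesI: "lam <= Lam ==> mat lam : (pucci_matrices lam Lam :: (real^'n^'n) set)" unfolding pucci_matrices_def loewner_le_def mat_quadratic symm_def
 by (auto simp: transpose_mat mat_quadratic intro!: mult_right_mono)

lemma pucci_quadratic:
 assumes "A : pucci_matrices lam Lam"
 shows "lam * (xi \<bullet> xi) <= xi \<bullet> (A *v xi)" "xi \<bullet> (A *v xi) <= Lam * (xi \<bullet> xi)"
 using assms unfolding pucci_matrices_def loewner_le_def mat_quadratic by auto

lemma axis_quadratic: "axis i 1 \<bullet> ((A :: real^'n^'n) *v axis j 1) = A $ i $ j" by (simp add: inner_axis' inner_axis matrix_vector_mul_component)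

text \<open>Diagonal entries are values of the quadratic form at unit vectors. For the others the
  form is evaluated at e_i + e_j and e_i - e_j, and the positive diagonal entries are
  dropped.\<close>

lemma pucci_entry:
 assumes A: "A : pucci_matrices lam Lam" and l: "0 < lam" "lam <= Lam"
 shows "abs (A $ i $ j) <= Lam"
proof -
 have sym: "A $ j $ i = A $ i $ j" for i j
 proof -
  have "transpose A = A" using A by (simp add: pucci_matrices_def symm_def)
  hence "transpose A $ i $ j = A $ i $ j" by simp
  thus ?thesis by (simp add: transpose_def)
 qed
 have d: "lam <= A $ i $ i" "A $ i $ i <= Lam" for i using pucci_quadratic[OF A, of "axis i 1"] by (simp_all add: axis_quadratic inner_axis_axis)
 show ?thesis
 proof (cases "i = j")
  case True
  thus ?thesis using d[of j] l by simp
 next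
  case False
  have n: "(axis i 1 + c *\<^sub>R axis j 1) \<bullet> (axis i 1 + c *\<^sub>R axis j (1::real)) = 1 + c * c" for c
   using False by (simp add: inner_add_left inner_add_right inner_axis_axis)
  have q: "(axis i 1 + c *\<^sub>R axis j 1) \<bullet> (A *v (axis i 1 + c *\<^sub>R axis j 1)) = A $ i $ i + 2 * c * A $ i $ j + c * c * A $ j $ j" for c
   by (simp add: matrix_vector_right_distrib matrix_vector_mult_scaleR inner_add_left inner_add_right axis_quadratic sym algebra_simps)
  have e1: "A $ i $ i + 2 * 1 * A $ i $ j + 1 * 1 * A $ j $ j <= Lam * (1 + 1 * 1)"
   using pucci_quadratic(2)[OF A, of "axis i 1 + 1 *\<^sub>R axis j 1"] unfolding n q .
  have e2: "A $ i $ i + 2 * (-1) * A $ i $ j + (-1) * (-1) * A $ j $ j <= Lam * (1 + (-1) * (-1))"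
   using pucci_quadratic(2)[OF A, of "axis i 1 + (-1) *\<^sub>R axis j 1"] unfolding n q .
  have "A $ i $ i + 2 * A $ i $ j + A $ j $ j <= 2 * Lam" "A $ i $ i - 2 * A $ i $ j + A $ j $ j <= 2 * Lam" using e1 e2 by simp_all
  hence "A $ i $ j <= Lam" "- (A $ i $ j) <= Lam" using d[of i] d[of j] l by linarith+
  thus ?thesis by (rule abs_leI)
 qed
qed

lemma trace_mult: "trace ((A :: real^'n^'n) ** X) = (SUM i:UNIV. SUM k:UNIV. A $ i $ k * X $ k $ i)" by (simp add: trace_def matrix_matrix_mult_def)

definition entry_sum :: "real^'n^'n => real" where
 "entry_sum X = (SUM k:UNIV. SUM l:UNIV. abs (X $ k $ l))"

lemma pucci_trace_bound:
 assumes A: "A : pucci_matrices lam Lam" and l: "0 < lam" "lam <= Lam"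
 shows "abs (trace (A ** X)) <= Lam * entry_sum X"
proof -
 have "abs (trace (A ** X)) <= (SUM i:UNIV. SUM k:UNIV. abs (A $ i $ k * X $ k $ i))" unfolding trace_mult by (rule order_trans[OF sum_abs sum_mono[OF sum_abs]])
 also have "(SUM i:UNIV. SUM k:UNIV. abs (A $ i $ k * X $ k $ i)) <= (SUM i:UNIV. SUM k:UNIV. Lam * abs (X $ k $ i))"
  by (intro sum_mono) (simp add: abs_mult mult_right_mono pucci_entry[OF A l])
 also have "... = Lam * entry_sum X" unfolding entry_sum_def sum_distrib_left by (rule sum.swap)
 finally show ?thesis .
qed

lemma pucci_plus_bdd:
 fixes X :: "real^'n^'n"
 shows "0 < lam ==> lam <= Lam ==> bdd_above ((%A. - trace (A ** X)) ` pucci_matrices lam Lam)"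
 by (rule bdd_aboveI2[of _ _ "Lam * entry_sum X"]) (use pucci_trace_bound[of _ lam Lam X] in "force simp: abs_le_iff")

lemma pucci_plus_upper:
 assumes "0 < lam" "lam <= Lam" "A : pucci_matrices lam Lam" shows "- trace (A ** X) <= pucci_plus lam Lam X"
 unfolding pucci_plus_def by (rule cSUP_upper[OF assms(3) pucci_plus_bdd[OF assms(1,2)]])

lemma pucci_plus_least:
 fixes X :: "real^'n^'n"
 assumes "lam <= Lam" "!!A :: real^'n^'n. A : pucci_matrices lam Lam ==> - trace (A ** X) <= c" shows "pucci_plus lam Lam X <= c"
 unfolding pucci_plus_def using pucci_matricesI[OF assms(1), where 'n='n] assms(2) by (intro cSUP_least) auto

lemma pucci_plus_abs:
 assumes "0 < lam" "lam <= Lam" shows "abs (pucci_plus lam Lam X) <= Lam * entry_sum X"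
proof -
 have "pucci_plus lam Lam X <= Lam * entry_sum X" using pucci_trace_bound[OF _ assms, of _ X] by (intro pucci_plus_least assms) (simp add: abs_le_iff)
 moreover have "- (Lam * entry_sum X) <= - trace (mat lam ** X)" using pucci_trace_bound[OF pucci_matricesI[OF assms(2)] assms, of X] by (simp add: abs_le_iff)
 ultimately show ?thesis using pucci_plus_upper[OF assms pucci_matricesI[OF assms(2)], of X] by linarith
qed

lemma trace_mult_add: "trace ((A :: real^'n^'n) ** (X + Y)) = trace (A ** X) + trace (A ** Y)" unfolding trace_mult by (simp add: distrib_left sum.distrib)

lemma trace_mult_scale: "trace ((A :: real^'n^'n) ** (c *\<^sub>R X)) = c * trace (A ** X)" unfolding trace_mult by (simp add: sum_distrib_left mult.left_commute)

lemma pucci_plus_add: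
 assumes "0 < lam" "lam <= Lam" shows "pucci_plus lam Lam (X + Y) <= pucci_plus lam Lam X + pucci_plus lam Lam Y"
 using pucci_plus_upper[OF assms, of _ X] pucci_plus_upper[OF assms, of _ Y] by (intro pucci_plus_least assms) (force simp: trace_mult_add)

lemma pucci_plus_scale_le:
 fixes X :: "real^'n^'n"
 assumes "0 < lam" "lam <= Lam" "c >= 0" shows "pucci_plus lam Lam (c *\<^sub>R X) <= c * pucci_plus lam Lam X"
proof (rule pucci_plus_least[OF assms(2)])
 fix A :: "real^'n^'n" assume "A : pucci_matrices lam Lam"
 hence "c * (- trace (A ** X)) <= c * pucci_plus lam Lam X" using assms by (intro mult_left_mono pucci_plus_upper)
 thus "- trace (A ** (c *\<^sub>R X)) <= c * pucci_plus lam Lam X" by (simp add: trace_mult_scale)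
qed

text \<open>Each trace is linear and commutes with the series, and the supremum is taken afterwards.
  This countable subadditivity is what lets a series of solutions be inserted into the nonlinear
  operator.\<close>

lemma pucci_plus_suminf:
 fixes X :: "nat => 'n::finite => 'n => real"
 assumes l: "0 < lam" "lam <= Lam" and s: "!!k l. summable (%m. abs (X m k l))"
 shows "summable (%m. pucci_plus lam Lam (\<chi> k l. X m k l))"
  "pucci_plus lam Lam (\<chi> k l. \<Sum>m. X m k l) <= (\<Sum>m. pucci_plus lam Lam (\<chi> k l. X m k l))"
proof -
 have s': "summable (%m. X m k l)" for k l using s by (rule summable_rabs_cancel)
 show sp: "summable (%m. pucci_plus lam Lam (\<chi> k l. X m k l))"
 proof (rule summable_comparison_test'[of "%m. Lam * entry_sum (\<chi> k l. X m k l)" 0])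
  show "summable (%m. Lam * entry_sum (\<chi> k l. X m k l))" unfolding entry_sum_def by (intro summable_mult summable_sum) (simp add: s)
  show "norm (pucci_plus lam Lam (\<chi> k l. X m k l)) <= Lam * entry_sum (\<chi> k l. X m k l)" for m using pucci_plus_abs[OF l] by simp
 qed
 show "pucci_plus lam Lam (\<chi> k l. \<Sum>m. X m k l) <= (\<Sum>m. pucci_plus lam Lam (\<chi> k l. X m k l))"
 proof (rule pucci_plus_least[OF l(2)])
  fix A :: "real^'n^'n" assume A: "A : pucci_matrices lam Lam"
  have "(%m. SUM i:UNIV. SUM k:UNIV. A $ i $ k * X m k i) sums (SUM i:UNIV. SUM k:UNIV. A $ i $ k * (\<Sum>m. X m k i))"
   by (intro sums_sum sums_mult summable_sums s')
  hence "(%m. trace (A ** (\<chi> k l. X m k l))) sums trace (A ** (\<chi> k l. \<Sum>m. X m k l))" by (simp add: trace_mult)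
  hence t: "(%m. - trace (A ** (\<chi> k l. X m k l))) sums - trace (A ** (\<chi> k l. \<Sum>m. X m k l))" by (rule sums_minus)
  hence "- trace (A ** (\<chi> k l. \<Sum>m. X m k l)) = (\<Sum>m. - trace (A ** (\<chi> k l. X m k l)))" by (rule sums_unique)
  also have "... <= (\<Sum>m. pucci_plus lam Lam (\<chi> k l. X m k l))" by (intro suminf_le pucci_plus_upper[OF l A] sums_summable[OF t] sp)
  finally show "- trace (A ** (\<chi> k l. \<Sum>m. X m k l)) <= (\<Sum>m. pucci_plus lam Lam (\<chi> k l. X m k l))" .
 qed
qed

text \<open>The shape of the Hessian of the barrier. The rank-one part helps through the lower
  ellipticity bound; the multiple of the identity costs at most n Lam.\<close>

lemma pucci_plus_rank_one:
 fixes xi :: "real^'n"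
 assumes l: "0 < lam" "lam <= Lam" and c: "a >= 0" "b >= 0"
 shows "pucci_plus lam Lam (\<chi> k l. a * (xi $ k * xi $ l) - (if k = l then b else 0)) <= b * (real CARD('n) * Lam) - a * (lam * (xi \<bullet> xi))"
proof (rule pucci_plus_least[OF l(2)])
 fix A :: "real^'n^'n" assume A: "A : pucci_matrices lam Lam"
 have "trace (A ** (\<chi> k l. a * (xi $ k * xi $ l) - (if k = l then b else 0)))
  = (SUM i:UNIV. SUM k:UNIV. a * (A $ i $ k * (xi $ k * xi $ i)) - (if k = i then b * A $ i $ i else 0))"
  unfolding trace_mult by (intro sum.cong refl) (simp add: right_diff_distrib mult.left_commute)
 also have "... = a * (xi \<bullet> (A *v xi)) - b * (SUM i:UNIV. A $ i $ i)"
  by (simp add: sum_subtractf inner_vec_def matrix_vector_mult_def sum_distrib_left mult_ac)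
 finally have t: "trace (A ** (\<chi> k l. a * (xi $ k * xi $ l) - (if k = l then b else 0))) = a * (xi \<bullet> (A *v xi)) - b * (SUM i:UNIV. A $ i $ i)" .
 have "(SUM i:UNIV. A $ i $ i) <= real CARD('n) * Lam" using sum_bounded_above[of UNIV "%i. A $ i $ i" Lam] pucci_entry[OF A l] by (auto simp: abs_le_iff)
 hence "b * (SUM i:UNIV. A $ i $ i) <= b * (real CARD('n) * Lam)" using c by (intro mult_left_mono)
 moreover have "a * (lam * (xi \<bullet> xi)) <= a * (xi \<bullet> (A *v xi))" using pucci_quadratic(1)[OF A] c by (intro mult_left_mono)
 ultimately show "- trace (A ** (\<chi> k l. a * (xi $ k * xi $ l) - (if k = l then b else 0))) <= b * (real CARD('n) * Lam) - a * (lam * (xi \<bullet> xi))"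
  unfolding t by linarith
qed

section \<open>Adding the drift\<close>

text \<open>The drift uses the l1 norm of the gradient, which dominates the Euclidean norm and
  splits into coordinates, the form of the trace inequality. An inequality rather than an equation
  is what survives summation under the subadditive operator.\<close>

definition jet_eq :: "real => real => ((real^'n) * real) set => ('n pt => real) => ('n pt => real) =>
  ('n pt => real) => ('n => 'n pt => real) => ('n => 'n => 'n pt => real) => bool" where
 "jet_eq lam Lam S mu g wt w1 w2 \<longleftrightarrow> (AE z in lborel. z : S -->
   wt z + PP lam Lam w2 z + mu z * (SUM k:UNIV. abs (w1 k z)) <= - g z)"

lemma core_sets [measurable]: "(core :: ((real^'n) * real) set) : sets borel"
proof -
 have "continuous_on UNIV (%z::'n pt. abs (fst z $ i))" "continuous_on UNIV (snd :: 'n pt => real)" for i by (intro continuous_intros)+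
 hence "closed (core :: 'n pt set)" unfolding core_def by (intro closed_Collect_conj closed_Collect_all closed_Collect_le continuous_on_const)
 thus ?thesis by simp
qed

text \<open>Every entry of a jet is dominated by \<open>jet_size\<close>, so a single summability
  assumption serves all derivatives.\<close>

lemma jet_series:
 fixes w :: "nat => (real^'n) * real => real"
 assumes J: "!!m. jet (w m) (wt m) (w1 m) (w2 m)"
  and sH: "summable (%m. LINT z|lborel. jet_size (w m) (wt m) (w1 m) (w2 m) z)"
 shows "jet (%z. \<Sum>m. w m z) (%z. \<Sum>m. wt m z) (%k z. \<Sum>m. w1 m k z) (%k l z. \<Sum>m. w2 m k l z)"
  "AE z in lborel. summable (%m. jet_size (w m) (wt m) (w1 m) (w2 m) z)"
proof -
 define H where "H m = jet_size (w m) (wt m) (w1 m) (w2 m)" for m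
 note i = jet_integrable[OF J]
 have Hi: "integrable lborel (H m)" for m unfolding H_def by (rule i(5))
 have H0: "H m z >= 0" for m z unfolding H_def by (rule jet_size_ge(5))
 have le: "abs (w m z) <= H m z" "abs (wt m z) <= H m z" "abs (w1 m k z) <= H m z" "abs (w2 m k l z) <= H m z" for m k l z
 proof -
  show "abs (w m z) <= H m z" "abs (wt m z) <= H m z" unfolding H_def by (rule jet_size_ge)+
  have "abs (w1 m k z) <= (SUM k:UNIV. abs (w1 m k z))" by (rule member_le_sum) auto
  thus "abs (w1 m k z) <= H m z" using jet_size_ge(3)[of "w1 m" z] unfolding H_def by (rule order_trans)
  have "abs (w2 m k l z) <= abs (wt m z) + (SUM l:UNIV. abs (w2 m k l z))" using member_le_sum[of l UNIV "%l. abs (w2 m k l z)"] by simp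
  thus "abs (w2 m k l z) <= H m z" using jet_size_ge(4)[of "wt m" z "w2 m" k] unfolding H_def by (rule order_trans)
 qed
 have sum: "summable (%m. LINT z|lebesgue. abs (f m z))"
  if f: "!!m. integrable lborel (f m)" "!!m z. abs (f m z) <= H m z" for f :: "nat => 'n pt => real"
 proof (rule summable_comparison_test'[of "%m. LINT z|lborel. H m z" 0])
  show "summable (%m. LINT z|lborel. H m z)" using sH unfolding H_def .
  fix m :: nat
  have m: "(%z. abs (f m z)) : borel_measurable lborel" using f(1)[of m] by auto
  have "(LINT z|lborel. abs (f m z)) <= (LINT z|lborel. H m z)" by (intro integral_mono integrable_abs f Hi)
  thus "norm (LINT z|lebesgue. abs (f m z)) <= (LINT z|lborel. H m z)" by (simp add: integral_completion[OF m])
 qed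
 have Jm: "w m : borelf" "wt m : borelf" "w1 m k : borelf" "w2 m k l : borelf"
  "wd dir_t (w m) (wt m)" "wd (dir_x k) (w m) (w1 m k)" "wd (dir_x l) (w1 m k) (w2 m k l)" for m k l using J[of m] unfolding jet_def by auto
 show "jet (%z. \<Sum>m. w m z) (%z. \<Sum>m. wt m z) (%k z. \<Sum>m. w1 m k z) (%k l z. \<Sum>m. w2 m k l z)" unfolding jet_def
 proof (intro conjI allI borel_measurable_suminf Jm)
  show "wd dir_t (%z. \<Sum>m. w m z) (%z. \<Sum>m. wt m z)" by (intro wd_suminf Jm sum i le)
  show "wd (dir_x k) (%z. \<Sum>m. w m z) (%z. \<Sum>m. w1 m k z)" for k by (intro wd_suminf Jm sum i le)
  show "wd (dir_x l) (%z. \<Sum>m. w1 m k z) (%z. \<Sum>m. w2 m k l z)" for k l by (intro wd_suminf Jm sum i le)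
 qed
 have sH': "summable (%m. LINT z|lborel. abs (H m z))" using sH H0 unfolding H_def by (simp add: abs_of_nonneg[OF jet_size_ge(5)])
 have "AE z in lborel. summable (%m. abs (H m z))" by (rule AE_summable_abs[OF Hi sH'])
 thus "AE z in lborel. summable (%m. jet_size (w m) (wt m) (w1 m) (w2 m) z)" by eventually_elim (simp add: H_def abs_of_nonneg[OF jet_size_ge(5)])
qed

lemma jet_size_suminf:
 assumes s: "summable (%m. jet_size (w m) (wt m) (w1 m) (w2 m) z)"
 shows "summable (%m. abs (w m z))" "summable (%m. abs (wt m z))" "summable (%m. abs (w1 m k z))" "summable (%m. abs (w2 m k l z))"
  "jet_size (%z. \<Sum>m. w m z) (%z. \<Sum>m. wt m z) (%k z. \<Sum>m. w1 m k z) (%k l z. \<Sum>m. w2 m k l z) z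
   <= (\<Sum>m. jet_size (w m) (wt m) (w1 m) (w2 m) z)"
proof -
 have le: "abs (w m z) <= jet_size (w m) (wt m) (w1 m) (w2 m) z" "abs (wt m z) <= jet_size (w m) (wt m) (w1 m) (w2 m) z"
  "abs (w1 m k z) <= jet_size (w m) (wt m) (w1 m) (w2 m) z" "abs (w2 m k l z) <= jet_size (w m) (wt m) (w1 m) (w2 m) z" for m k l
 proof -
  show "abs (w m z) <= jet_size (w m) (wt m) (w1 m) (w2 m) z" "abs (wt m z) <= jet_size (w m) (wt m) (w1 m) (w2 m) z" by (rule jet_size_ge)+
  have "abs (w1 m k z) <= (SUM k:UNIV. abs (w1 m k z))" by (rule member_le_sum) auto
  thus "abs (w1 m k z) <= jet_size (w m) (wt m) (w1 m) (w2 m) z" using jet_size_ge(3)[of "w1 m" z] by (rule order_trans)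
  have "abs (w2 m k l z) <= abs (wt m z) + (SUM l:UNIV. abs (w2 m k l z))" using member_le_sum[of l UNIV "%l. abs (w2 m k l z)"] by simp
  thus "abs (w2 m k l z) <= jet_size (w m) (wt m) (w1 m) (w2 m) z" using jet_size_ge(4)[of "wt m" z "w2 m" k] by (rule order_trans)
 qed
 have sf: "summable (%m. abs (f m))" if "!!m. abs (f m) <= jet_size (w m) (wt m) (w1 m) (w2 m) z" for f :: "nat => real"
  by (rule summable_comparison_test'[OF s, of 0]) (use that in simp)
 show sw: "summable (%m. abs (w m z))" by (rule sf[OF le(1)])
 show swt: "summable (%m. abs (wt m z))" by (rule sf[OF le(2)])
 have s1: "summable (%m. abs (w1 m k z))" for k by (rule sf[OF le(3)])
 thus "summable (%m. abs (w1 m k z))" .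
 have s2: "summable (%m. abs (w2 m k l z))" for k l by (rule sf[OF le(4)])
 thus "summable (%m. abs (w2 m k l z))" .
 have "jet_size (%z. \<Sum>m. w m z) (%z. \<Sum>m. wt m z) (%k z. \<Sum>m. w1 m k z) (%k l z. \<Sum>m. w2 m k l z) z
  <= (\<Sum>m. abs (w m z)) + (\<Sum>m. abs (wt m z)) + (SUM k:UNIV. \<Sum>m. abs (w1 m k z)) + (SUM k:UNIV. SUM l:UNIV. \<Sum>m. abs (w2 m k l z))"
  unfolding jet_size_def by (intro add_mono sum_mono summable_rabs sw swt s1 s2)
 also have "... = (\<Sum>m. abs (w m z)) + (\<Sum>m. abs (wt m z)) + (\<Sum>m. SUM k:UNIV. abs (w1 m k z)) + (\<Sum>m. SUM k:UNIV. SUM l:UNIV. abs (w2 m k l z))"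
  by (simp add: suminf_sum s1 s2 summable_sum)
 also have "... = (\<Sum>m. jet_size (w m) (wt m) (w1 m) (w2 m) z)" unfolding jet_size_def
  by (subst suminf_add[symmetric] | intro summable_add summable_sum sw swt s1 s2 | simp)+
 finally show "jet_size (%z. \<Sum>m. w m z) (%z. \<Sum>m. wt m z) (%k z. \<Sum>m. w1 m k z) (%k l z. \<Sum>m. w2 m k l z) z
   <= (\<Sum>m. jet_size (w m) (wt m) (w1 m) (w2 m) z)" .
qed

text \<open>The decay that Hoelder's inequality gives on boxes of size 2^-j for a function in L^q,
  with the constant split off: for q > n+2 dilation to small cylinders makes that constant as small
  as desired.\<close>

definition morrey :: "real => real => real => ((real^'n) * real => real) => bool" where
 "morrey p q E mu \<longleftrightarrow> (ALL z j. (NN z'. indicator (near j z) z' * ennreal (mu z' powr p))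
   <= ennreal (E * 2 powr (- (real j * (real CARD('n) + 2 - p * (real CARD('n) + 2) / q)))))"

definition core_data :: "real => ((real^'n) * real => real) => real => bool" where
 "core_data p g G \<longleftrightarrow> g : borelf & (ALL z. g z >= 0) & (ALL z. z ~: core --> g z = 0) & G >= 0 &
  (NN z. ennreal (g z powr p)) <= ennreal G"

definition core_solution :: "real => real => real => real => ((real^'n) * real => real) => ('n pt => real) => real =>
  ('n pt => real) => ('n pt => real) => ('n => 'n pt => real) => ('n => 'n => 'n pt => real) => bool" where
 "core_solution lam Lam p C mu g G w wt w1 w2 \<longleftrightarrow> neg_jet w wt w1 w2 & (ALL z. abs (w z) powr p <= C * G) &
  jet_eq lam Lam core mu g wt w1 w2 & jint p w wt w1 w2 <= ennreal (C * G)"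

lemma quarter_powr: "((4::real) powr (- p)) ^ m = 4 powr (- (p * real m))" by (simp add: powr_realpow[symmetric] powr_powr)

text \<open>Splitting at the height 2^-m: the low part gives 2^-m times the measure of
  \<open>U\<close>, and the high part is at most 2^(-m(1-p)) 4^(-pm) G, hence at most 2^-m
  G.\<close>

lemma jet_L1_bound:
 fixes H :: "(real^'n) * real => real"
 assumes H: "integrable lborel H" "!!z. H z >= 0" "!!z. z ~: U ==> H z = 0" and U: "U : sets borel" "evol U = ennreal V" "V >= 0"
  and p: "p >= 1" and I: "(NN z. ennreal (H z powr p)) <= ennreal (G * (4 powr (- p)) ^ m)" "G >= 0"
 shows "(LINT z|lborel. H z) <= (V + G) * (1 / 2) ^ m"
proof -
 note [measurable] = borel_measurable_integrable[OF H(1)] U(1)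
 define l where "l = (1 / 2 :: real) ^ m"
 have l: "l > 0" by (simp add: l_def)
 have lp: "l = 2 powr (- real m)" unfolding l_def by (simp add: powr_minus powr_realpow power_one_over inverse_eq_divide)
 have "ennreal (LINT z|lborel. H z) = (NN z. ennreal (H z))" by (rule nn_integral_eq_integral[symmetric]) (auto intro: H)
 also have "... <= (NN z. ennreal l * indicator U z + ennreal (l powr (1 - p)) * ennreal (H z powr p))"
 proof (rule nn_integral_mono)
  fix z
  have "H z <= l + l powr (1 - p) * H z powr p" using powr_young[of "H z" l 1 p] H(2)[of z] l p by simp
  hence y: "ennreal (H z) <= ennreal l + ennreal (l powr (1 - p)) * ennreal (H z powr p)"
   using l by (simp add: ennreal_mult'[symmetric] ennreal_plus[symmetric] ennreal_leI del: ennreal_plus)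
  show "ennreal (H z) <= ennreal l * indicator U z + ennreal (l powr (1 - p)) * ennreal (H z powr p)" using y H(3)[of z] by (cases "z : U") auto
 qed
 also have "... = ennreal l * ennreal V + ennreal (l powr (1 - p)) * (NN z. ennreal (H z powr p))" using U by (subst nn_integral_add) (auto simp: nn_integral_cmult)
 also have "... <= ennreal l * ennreal V + ennreal (l powr (1 - p)) * ennreal (G * (4 powr (- p)) ^ m)" by (intro add_left_mono mult_left_mono I) simp
 also have "... = ennreal (l * V + l powr (1 - p) * (G * (4 powr (- p)) ^ m))"
  using l U(3) I(2) by (simp add: ennreal_mult'[symmetric] ennreal_plus[symmetric] del: ennreal_plus)
 finally have "(LINT z|lborel. H z) <= l * V + l powr (1 - p) * (G * (4 powr (- p)) ^ m)" using l U(3) I(2) by (subst (asm) ennreal_le_iff) auto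
 moreover have "l powr (1 - p) * (4 powr (- p)) ^ m <= l"
 proof -
  have four: "(4::real) powr x = 2 powr (2 * x)" for x using powr_powr[of "2::real" 2 x] by simp
  have "l powr (1 - p) * (4 powr (- p)) ^ m = 2 powr (- real m * (1 - p) + 2 * (- (p * real m)))"
   unfolding quarter_powr lp by (simp only: four powr_powr powr_add[symmetric])
  also have "... <= 2 powr (- real m)"
  proof (rule powr_mono)
   have "- real m * (1 - p) + 2 * (- (p * real m)) = - real m - p * real m" by (simp add: algebra_simps)
   thus "- real m * (1 - p) + 2 * (- (p * real m)) <= - real m" using p by simp
  qed simp
  finally show ?thesis unfolding lp .
 qed
 hence "l powr (1 - p) * (G * (4 powr (- p)) ^ m) <= G * l" using mult_left_mono[of "l powr (1 - p) * (4 powr (- p)) ^ m" l G] I(2) by (simp add: mult.left_commute)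
 ultimately show ?thesis unfolding l_def[symmetric] by (simp add: algebra_simps)
qed

text \<open>Let w_0 belong to the right-hand side -g and w_(j+1) to minus the drift term of w_j on
  \<open>core\<close>. In the sum the drift of each w_j is cancelled by the right-hand side of the
  next one, and -g remains. The trace inequality with a small Morrey constant makes the stages decay
  geometrically.\<close>

lemma drift_core:
 assumes abp: "ABP_exponent TYPE('n::finite) lam Lam p1" and p: "p > p1" "p <= q" and q: "q > real CARD('n) + 2" and l: "0 < lam" "lam <= Lam"
 shows "EX ep>0. EX C>=0. ALL (mu :: 'n pt => real) g G. mu : borelf --> (ALL z. mu z >= 0) --> morrey p q ep mu -->
  core_data p g G --> (EX w wt w1 w2. core_solution lam Lam p C mu g G w wt w1 w2)"
proof -
 have p0: "p >= 1" using abp p(1) unfolding ABP_exponent_def by auto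
 define P where "P C g G w wt w1 w2 \<longleftrightarrow> neg_jet w wt w1 w2 & (ALL z. abs (w z) powr p <= C * G) &
   (ALL z. z ~: core_box (1/2) (1/8) --> jet_size w wt w1 w2 z = 0) &
   (AE z in lborel. z : core --> wt z + PP lam Lam w2 z <= - g z) &
   jint p w wt w1 w2 <= ennreal (C * G)"
  for C G and g w wt :: "'n pt => real" and w1 w2
 have "EX C>=0. ALL g G. core_data p g G --> (EX w wt w1 w2. P C g G w wt w1 w2)" using abp_core[OF abp p(1)] unfolding P_def core_data_def imp_conjL .
 then obtain C1 where C1: "C1 >= 0" "!!g G. core_data p g G ==> EX w wt w1 w2. P C1 g G w wt w1 w2" by blast
 have "ALL g G. EX w wt w1 w2. core_data p g G --> P C1 g G w wt w1 w2" using C1(2) by blast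
 then obtain W WT W1 W2 where S: "!!g G. core_data p g G ==> P C1 g G (W g G) (WT g G) (W1 g G) (W2 g G)" by metis
 define TR where "TR C \<longleftrightarrow> (ALL (w :: 'n pt => real) wt w1 w2 i mu E. jet w wt w1 w2 --> mu : borelf --> E >= 0 -->
  morrey p q E mu --> (NN z. ennreal (mu z powr p) * ennreal (abs (w1 i z) powr p))
   <= ennreal (C * E) * jint p w wt w1 w2)" for C
 have "EX C>=0. TR C" using trace_inequality[OF p0 p(2) q] unfolding TR_def morrey_def by simp
 then obtain C2 where C2: "C2 >= 0" "TR C2" by blast
 define n where "n = real CARD('n)"
 have n: "n >= 1" by (simp add: n_def)
 \<comment> \<open>A factor for p-th powers: each stage divides the L^p bound by 4.\<close>
 define th where "th = (4::real) powr (- p)"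
 have th: "th > 0" by (simp add: th_def)
 \<comment> \<open>Chosen so that one round, trace inequality after solution operator and summed
   over the n coordinates, costs at most \<open>th\<close>; the 1 keeps the denominator
   positive.\<close>
 define ep where "ep = th / (n powr p * n * C2 * C1 + 1)"
 have D: "n powr p * n * C2 * C1 + 1 > 0" using n C1(1) C2(1) by (simp add: add_nonneg_pos)
 have ep: "ep > 0" unfolding ep_def using th D by simp
 have ep2: "n powr p * (n * (C2 * ep * C1)) <= th"
 proof -
  have "n powr p * (n * (C2 * ep * C1)) = th * ((n powr p * n * C2 * C1) / (n powr p * n * C2 * C1 + 1))" unfolding ep_def by simp
  also have "... <= th * 1" using th D by (intro mult_left_mono) (simp_all add: divide_le_eq)
  finally show ?thesis by simp
 qed
 \<comment> \<open>The factor 4^p comes from the weights 1/4 * 2^-j introduced at the end of this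
   proof, and 2 bounds the remaining geometric series.\<close>
 define C where "C = 2 * 4 powr p * C1"
 have "EX w wt w1 w2. core_solution lam Lam p C mu g G w wt w1 w2"
  if m[measurable]: "mu : borelf" and m0: "!!z. mu z >= 0" and mor: "morrey p q ep mu" and cd: "core_data p g G"
  for mu g :: "'n pt => real" and G
 proof -
  have G0: "G >= 0" using cd by (simp add: core_data_def)
  define nx where "nx g G z = indicator core z * (mu z * (SUM k:UNIV. abs (W1 g G k z)))" for g G z
  have nx: "core_data p (nx h K) (th * K)" if h: "core_data p h K" for h K
  proof -
   have K0: "K >= 0" using h by (simp add: core_data_def)
   note PS = S[OF h, unfolded P_def]
   have J: "jet (W h K) (WT h K) (W1 h K) (W2 h K)" using PS by blast
   have w1m[measurable]: "W1 h K k : borelf" for k using J unfolding jet_def by blast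
   have nm[measurable]: "nx h K : borelf" unfolding nx_def[abs_def] by measurable
   have n0: "nx h K z >= 0" for z unfolding nx_def by (intro mult_nonneg_nonneg sum_nonneg m0) auto
   have "(NN z. ennreal (nx h K z powr p)) <= (NN z. ennreal (n powr p) * (SUM k:UNIV. ennreal (mu z powr p) * ennreal (abs (W1 h K k z) powr p)))"
   proof (rule nn_integral_mono)
    fix z
    have "nx h K z <= mu z * (SUM k:UNIV. abs (W1 h K k z))" unfolding nx_def using m0[of z] by (auto simp: indicator_def intro!: mult_nonneg_nonneg sum_nonneg)
    hence "nx h K z powr p <= (mu z * (SUM k:UNIV. abs (W1 h K k z))) powr p" using n0[of z] p0 by (intro powr_mono2) auto
    also have "... = mu z powr p * (SUM k:UNIV. abs (W1 h K k z)) powr p" by (rule powr_mult)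
    also have "... <= mu z powr p * (n powr p * (SUM k:UNIV. abs (W1 h K k z) powr p))" unfolding n_def using p0 by (intro mult_left_mono sum_powr_le) auto
    also have "... = n powr p * (SUM k:UNIV. mu z powr p * abs (W1 h K k z) powr p)" by (simp add: sum_distrib_left mult.left_commute)
    finally have "ennreal (nx h K z powr p) <= ennreal (n powr p) * ennreal (SUM k:UNIV. mu z powr p * abs (W1 h K k z) powr p)"
     by (simp add: ennreal_mult'[symmetric] ennreal_leI sum_nonneg)
    also have "ennreal (SUM k:UNIV. mu z powr p * abs (W1 h K k z) powr p) = (SUM k:UNIV. ennreal (mu z powr p) * ennreal (abs (W1 h K k z) powr p))"
     by (subst sum_ennreal[symmetric]) (auto simp: ennreal_mult)
    finally show "ennreal (nx h K z powr p) <= ennreal (n powr p) * (SUM k:UNIV. ennreal (mu z powr p) * ennreal (abs (W1 h K k z) powr p))" .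
   qed
   also have "... = ennreal (n powr p) * (SUM k:UNIV. NN z. ennreal (mu z powr p) * ennreal (abs (W1 h K k z) powr p))"
    by (subst nn_integral_cmult, measurable, subst nn_integral_sum) auto
   also have "... <= ennreal (n powr p) * (SUM k:(UNIV::'n set). ennreal (C2 * ep) * ennreal (C1 * K))"
   proof (intro mult_left_mono sum_mono)
    fix k :: 'n
    have "(NN z. ennreal (mu z powr p) * ennreal (abs (W1 h K k z) powr p))
     <= ennreal (C2 * ep) * (NN z. ennreal (jet_size (W h K) (WT h K) (W1 h K) (W2 h K) z powr p))" using C2(2) J m mor ep unfolding TR_def by (meson less_imp_le)
    also have "... <= ennreal (C2 * ep) * ennreal (C1 * K)" using PS by (intro mult_left_mono) auto
    finally show "(NN z. ennreal (mu z powr p) * ennreal (abs (W1 h K k z) powr p)) <= ennreal (C2 * ep) * ennreal (C1 * K)" .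
   qed simp
   also have "... = ennreal ((n powr p * (n * (C2 * ep * C1))) * K)"
    using C1(1) C2(1) ep K0 n by (simp add: ennreal_mult ennreal_of_nat_eq_real_of_nat n_def mult_ac)
   also have "... <= ennreal (th * K)" using ep2 K0 by (intro ennreal_leI mult_right_mono)
   finally show ?thesis using nm n0 K0 th by (auto simp: core_data_def nx_def)
  qed
  \<comment> \<open>The bound travels along with the function: the right-hand side
    \<open>gs j\<close> has p-th power integral at most th^j G.\<close>
  define gs where "gs = rec_nat g (%m h. nx h (th ^ m * G))"
  have gs0: "gs 0 = g" and gsS: "gs (Suc j) = nx (gs j) (th ^ j * G)" for j by (simp_all add: gs_def)
  have cdm: "core_data p (gs j) (th ^ j * G)" for j
  proof (induction j)
   case 0 thus ?case using cd by (simp add: gs0)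
  next
   case (Suc j) thus ?case using nx[OF Suc] by (simp add: gsS mult.assoc)
  qed
  define w where "w j = W (gs j) (th ^ j * G)" for j
  define wt where "wt j = WT (gs j) (th ^ j * G)" for j
  define w1 where "w1 j = W1 (gs j) (th ^ j * G)" for j
  define w2 where "w2 j = W2 (gs j) (th ^ j * G)" for j
  have PP: "P C1 (gs j) (th ^ j * G) (w j) (wt j) (w1 j) (w2 j)" for j unfolding w_def wt_def w1_def w2_def by (rule S[OF cdm])
  note PD = PP[unfolded P_def]
  have J: "jet (w j) (wt j) (w1 j) (w2 j)" for j using PD by blast
  define H where "H j = jet_size (w j) (wt j) (w1 j) (w2 j)" for j
  have H0: "H j z >= 0" for j z unfolding H_def by (rule jet_size_ge(5))
  have Hi: "integrable lborel (H j)" for j unfolding H_def by (rule jet_integrable(5)[OF J])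
  have Hm[measurable]: "H j : borelf" for j using Hi[of j] by auto
  have HI: "(NN z. ennreal (H j z powr p)) <= ennreal (C1 * G * th ^ j)" for j using PD[of j] unfolding H_def by (simp add: mult_ac)
  obtain V where V: "V >= 0" "evol (core_box (1/2) (1/8) :: 'n pt set) = ennreal V"
  proof -
   have "evol (core_box (1/2) (1/8) :: 'n pt set) < \<infinity>" unfolding core_box_def by (rule emeasure_lborel_box_finite)
   thus ?thesis using that by (cases "evol (core_box (1/2) (1/8) :: 'n pt set)") auto
  qed
  have Hint: "(LINT z|lborel. H j z) <= (V + C1 * G) * (1 / 2) ^ j" for j
  proof (rule jet_L1_bound[OF Hi H0 _ _ V(2,1) p0])
   show "H j z = 0" if "z ~: core_box (1/2) (1/8)" for z using PD[of j] that unfolding H_def by blast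
   show "core_box (1/2) (1/8) : sets borel" by (simp add: core_box_def)
   show "(NN z. ennreal (H j z powr p)) <= ennreal (C1 * G * (4 powr (- p)) ^ j)" using HI[of j] unfolding th_def .
  qed (use C1(1) G0 in simp)
  have sH: "summable (%j. LINT z|lborel. jet_size (w j) (wt j) (w1 j) (w2 j) z)"
  proof (rule summable_comparison_test'[of "%j. (V + C1 * G) * (1 / 2) ^ j" 0])
   show "summable (%j. (V + C1 * G) * (1 / 2) ^ j)" by (intro summable_mult summable_geometric) simp
   show "norm (LINT z|lborel. jet_size (w j) (wt j) (w1 j) (w2 j) z) <= (V + C1 * G) * (1 / 2) ^ j" for j
    using Hint[of j] Bochner_Integration.integral_nonneg[of lborel "H j"] H0 unfolding H_def by simp
  qed
  note js = jet_series[OF J sH]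
  define K where "K = (C1 * G) powr (1 / p)"
  have K0: "K >= 0" by (simp add: K_def)
  have wb: "abs (w j z) <= K * (1 / 4) ^ j" for j z
  proof -
   have a: "abs (w j z) powr p <= C1 * (th ^ j * G)" using PD[of j] by blast
   have "abs (w j z) = (abs (w j z) powr p) powr (1 / p)" using p0 by (simp add: powr_powr)
   also have "... <= (C1 * (th ^ j * G)) powr (1 / p)" using a p0 by (intro powr_mono2) auto
   also have "C1 * (th ^ j * G) = (C1 * G) * 4 powr (- (p * real j))" unfolding th_def quarter_powr by simp
   also have "(...) powr (1 / p) = K * 4 powr (- real j)" unfolding K_def powr_mult using p0 by (simp add: powr_powr)
   also have "4 powr (- real j) = (1 / 4) ^ j" by (simp add: powr_minus powr_realpow power_one_over inverse_eq_divide)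
   finally show ?thesis .
  qed
  have s4: "(%j. K * (1 / 4) ^ j) sums (K * (4 / 3))" using sums_mult[OF geometric_sums[of "1 / 4 :: real"], of K] by simp
  have sw: "summable (%j. abs (w j z))" for z by (rule summable_comparison_test'[OF sums_summable[OF s4], of 0]) (use wb in simp)
  have cont: "continuous_on UNIV (%z. \<Sum>j. w j z)"
  proof (rule uniform_limit_theorem[OF _ Weierstrass_m_test[of UNIV w "%j. K * (1 / 4) ^ j"]])
   show "\<forall>\<^sub>F n in sequentially. continuous_on UNIV (%x. \<Sum>i<n. w i x)" using PD by (intro always_eventually allI continuous_on_sum) blast
  qed (use wb sums_summable[OF s4] in auto)
  have wneg: "(\<Sum>j. w j z) <= 0" for z
  proof -
   have w0: "w j z <= 0" for j using PD by blast
   have "(\<Sum>j. w j z) <= (\<Sum>j. 0)" by (intro suminf_le summable_rabs_cancel[OF sw] w0 summable_zero)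
   thus ?thesis by simp
  qed
  have CC: "2 powr p * C1 <= C"
  proof -
   have "2 powr p <= (4::real) powr p" using p0 by (intro powr_mono2) auto
   hence "2 powr p * C1 <= 4 powr p * C1" using C1(1) by (rule mult_right_mono)
   also have "... <= 2 * (4 powr p * C1)" using C1(1) by simp
   finally show ?thesis unfolding C_def by (simp only: mult.assoc)
  qed
  have wbound: "abs (\<Sum>j. w j z) powr p <= C * G" for z
  proof -
   have "abs (\<Sum>j. w j z) <= (\<Sum>j. abs (w j z))" by (rule summable_rabs[OF sw])
   also have "... <= (\<Sum>j. K * (1 / 4) ^ j)" by (intro suminf_le wb sw sums_summable[OF s4])
   also have "... = K * (4 / 3)" by (rule sums_unique[OF s4, symmetric])
   also have "... <= 2 * K" using K0 by simp
   finally have "abs (\<Sum>j. w j z) powr p <= (2 * K) powr p" using p0 by (intro powr_mono2) auto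
   also have "... = 2 powr p * (C1 * G)" using p0 C1(1) G0 by (simp add: powr_mult K_def powr_powr)
   also have "... <= C * G" using mult_right_mono[OF CC G0] by (simp add: mult.assoc)
   finally show ?thesis .
  qed
  have eq: "jet_eq lam Lam core mu g (%z. \<Sum>m. wt m z) (%k z. \<Sum>m. w1 m k z) (%k l z. \<Sum>m. w2 m k l z)"
  proof -
   have "AE z in lborel. z : core --> wt j z + pucci_plus lam Lam (\<chi> k l. w2 j k l z) <= - gs j z" for j using PD[of j] by blast
   hence "AE z in lborel. ALL j. z : core --> wt j z + pucci_plus lam Lam (\<chi> k l. w2 j k l z) <= - gs j z" by (intro AE_all_countable[THEN iffD2] allI)
   thus ?thesis unfolding jet_eq_def using js(2)
   proof eventually_elim
    fix z assume a: "ALL j. z : core --> wt j z + pucci_plus lam Lam (\<chi> k l. w2 j k l z) <= - gs j z"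
     and sm: "summable (%m. jet_size (w m) (wt m) (w1 m) (w2 m) z)"
    note s = jet_size_suminf[OF sm]
    show "z : core --> (\<Sum>m. wt m z) + pucci_plus lam Lam (\<chi> k l. \<Sum>m. w2 m k l z) + mu z * (SUM k:UNIV. abs (\<Sum>m. w1 m k z)) <= - g z"
    proof
     assume zc: "z : core"
     note pu = pucci_plus_suminf[OF l, of "%m k l. w2 m k l z", OF s(4)]
     have swt: "summable (%m. wt m z)" by (rule summable_rabs_cancel[OF s(2)])
     have s1: "summable (%m. SUM k:UNIV. abs (w1 m k z))" by (intro summable_sum s(3))
     \<comment> \<open>The right-hand side of stage m + 1 is the drift term of stage m; hence the
       sums below telescope and leave -g.\<close>
     have gS: "gs (Suc m) z = mu z * (SUM k:UNIV. abs (w1 m k z))" for m using zc unfolding gsS nx_def w1_def by simp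
     have sg: "summable (%m. gs m z)" using summable_mult[OF s1, of "mu z"] unfolding gS[symmetric] by (subst (asm) summable_Suc_iff)
     have "(\<Sum>m. wt m z) + pucci_plus lam Lam (\<chi> k l. \<Sum>m. w2 m k l z) <= (\<Sum>m. wt m z) + (\<Sum>m. pucci_plus lam Lam (\<chi> k l. w2 m k l z))"
      using pu(2) by simp
     also have "... = (\<Sum>m. wt m z + pucci_plus lam Lam (\<chi> k l. w2 m k l z))" by (rule suminf_add[OF swt pu(1)])
     also have "... <= (\<Sum>m. - gs m z)" using a zc by (intro suminf_le summable_add swt pu(1) summable_minus sg) auto
     also have "... = - (\<Sum>m. gs m z)" by (rule suminf_minus[OF sg])
     also have "(\<Sum>m. gs m z) = g z + (\<Sum>m. gs (Suc m) z)" using suminf_split_head[OF sg] by (simp add: gs0)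
     also have "(\<Sum>m. gs (Suc m) z) = mu z * (\<Sum>m. SUM k:UNIV. abs (w1 m k z))" unfolding gS by (rule suminf_mult[OF s1])
     also have "(\<Sum>m. SUM k:UNIV. abs (w1 m k z)) = (SUM k:UNIV. \<Sum>m. abs (w1 m k z))" by (rule suminf_sum[OF s(3)])
     finally have "(\<Sum>m. wt m z) + pucci_plus lam Lam (\<chi> k l. \<Sum>m. w2 m k l z) <= - (g z + mu z * (SUM k:UNIV. \<Sum>m. abs (w1 m k z)))" .
     moreover have "mu z * (SUM k:UNIV. abs (\<Sum>m. w1 m k z)) <= mu z * (SUM k:UNIV. \<Sum>m. abs (w1 m k z))"
      by (intro mult_left_mono sum_mono summable_rabs s(3) m0)
     ultimately show "(\<Sum>m. wt m z) + pucci_plus lam Lam (\<chi> k l. \<Sum>m. w2 m k l z) + mu z * (SUM k:UNIV. abs (\<Sum>m. w1 m k z)) <= - g z" by linarith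
    qed
   qed
  qed
  \<comment> \<open>Weights of total 1/2; they cost 2^(jp) against the decay 4^(-jp) of the
    stages.\<close>
  define om where "om j = (1 / 4 :: real) * (1 / 2) ^ j" for j :: nat
  have oms: "om sums (1 / 2)" unfolding om_def using sums_mult[OF geometric_sums[of "1 / 2 :: real"], of "1/4"] by simp
  have om0: "om j > 0" for j by (simp add: om_def)
  let ?X = "jet_size (%z. \<Sum>m. w m z) (%z. \<Sum>m. wt m z) (%k z. \<Sum>m. w1 m k z) (%k l z. \<Sum>m. w2 m k l z)"
  have "AE z in lborel. ennreal (?X z powr p) <= (\<Sum>j. ennreal ((1 * H j z / om j) powr p))" using js(2)
  proof eventually_elim
   fix z assume sm: "summable (%m. jet_size (w m) (wt m) (w1 m) (w2 m) z)"
   have "ennreal (?X z) <= ennreal (\<Sum>m. H m z)" using jet_size_suminf(5)[OF sm] unfolding H_def by (rule ennreal_leI)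
   also have "... = ennreal 1 * (\<Sum>m. ennreal (H m z))" using suminf_ennreal2[OF H0] sm unfolding H_def by simp
   finally show "ennreal (?X z powr p) <= (\<Sum>j. ennreal ((1 * H j z / om j) powr p))"
    using p0 sums_summable[OF oms] sums_unique[OF oms] by (intro powr_le_suminf[OF _ jet_size_ge(5) H0 _ _ om0]) auto
  qed
  hence "(NN z. ennreal (?X z powr p)) <= (NN z. (\<Sum>j. ennreal ((1 * H j z / om j) powr p)))" by (rule nn_integral_mono_AE)
  also have "... = (\<Sum>j. NN z. ennreal ((1 * H j z / om j) powr p))" by (rule nn_integral_suminf) measurable
  also have "... <= (\<Sum>j. ennreal (4 powr p * C1 * G * (2 powr (- p)) ^ j))"
  proof (intro suminf_le allI)
   fix j
   have "(NN z. ennreal ((1 * H j z / om j) powr p)) = (NN z. ennreal ((1 / om j) powr p) * ennreal (H j z powr p))"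
    by (intro nn_integral_cong) (simp add: ennreal_mult'[symmetric] powr_mult[symmetric])
   also have "... = ennreal ((1 / om j) powr p) * (NN z. ennreal (H j z powr p))" by (rule nn_integral_cmult) measurable
   also have "... <= ennreal ((1 / om j) powr p) * ennreal (C1 * G * th ^ j)" by (intro mult_left_mono HI) simp
   also have "... = ennreal ((1 / om j) powr p * (C1 * G * th ^ j))" using C1(1) G0 th by (simp add: ennreal_mult)
   also have "(1 / om j) powr p * (C1 * G * th ^ j) = 4 powr p * C1 * G * (2 powr (- p)) ^ j"
   proof -
    have "1 / om j = 4 * 2 powr real j" by (simp add: om_def power_one_over powr_realpow)
    hence "(1 / om j) powr p = 4 powr p * 2 powr (p * real j)" by (simp add: powr_mult powr_powr mult.commute)
    moreover have "(4::real) powr x = 2 powr (2 * x)" for x using powr_powr[of "2::real" 2 x] by simp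
    hence "th ^ j = 2 powr (- (2 * (p * real j)))" unfolding th_def quarter_powr by simp
    moreover have "(2 powr (- p)) ^ j = 2 powr (- (p * real j))" by (simp add: powr_realpow[symmetric] powr_powr)
    moreover have "2 powr (p * real j) * 2 powr (- (2 * (p * real j))) = (2::real) powr (- (p * real j))" by (simp add: powr_add[symmetric])
    ultimately show ?thesis by (simp add: mult_ac)
   qed
   finally show "(NN z. ennreal ((1 * H j z / om j) powr p)) <= ennreal (4 powr p * C1 * G * (2 powr (- p)) ^ j)" .
  qed auto
  also have "... <= ennreal (C * G)"
  proof -
   have r: "(2::real) powr (- p) <= 1 / 2" using powr_mono[of "- p" "- 1" "2::real"] p0 by (simp add: powr_minus_divide)
   have "(\<Sum>j. ennreal (4 powr p * C1 * G * (2 powr (- p)) ^ j)) = ennreal (\<Sum>j. 4 powr p * C1 * G * (2 powr (- p)) ^ j)"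
    using C1(1) G0 r by (intro suminf_ennreal2 summable_mult summable_geometric) auto
   also have "(\<Sum>j. 4 powr p * C1 * G * (2 powr (- p)) ^ j) = 4 powr p * C1 * G * (1 / (1 - 2 powr (- p)))"
    using r by (subst suminf_mult) (auto intro: summable_geometric simp: suminf_geometric)
   also have "... <= 4 powr p * C1 * G * 2" using r C1(1) G0 by (intro mult_left_mono) (auto simp: divide_le_eq)
   finally show ?thesis unfolding C_def by (simp add: ennreal_leI mult_ac)
  qed
  finally have "(NN z. ennreal (?X z powr p)) <= ennreal (C * G)" .
  hence "core_solution lam Lam p C mu g G (%z. \<Sum>m. w m z) (%z. \<Sum>m. wt m z) (%k z. \<Sum>m. w1 m k z) (%k l z. \<Sum>m. w2 m k l z)"
   unfolding core_solution_def using js(1) cont wneg wbound eq by blast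
  thus ?thesis by blast
 qed
 moreover have "C >= 0" using C1(1) by (simp add: C_def)
 ultimately show ?thesis using ep by (intro exI[of _ ep] conjI exI[of _ C]) blast+
qed

section \<open>Transfer to small parabolic cylinders\<close>

lemma nn_integral_par_map_lborel:
 fixes F :: "(real^'n) * real => ennreal"
 assumes "r > 0" "F : borelf"
 shows "(NN z. F z) = ennreal (r ^ (CARD('n) + 2)) * (NN z. F (par_map r z0 z))"
 using nn_integral_par_map[OF assms(1) measurable_completion, of F z0] assms(2) by (simp add: nn_integral_completion)

text \<open>A drift scales by the factor R, so the integral of its q-th power picks up R^(q-(n+2)),
  a positive power when q > n+2: small scale becomes small constant. Hoelder on each box then gives
  the Morrey decay.\<close>

lemma morrey_scaled:
 fixes mu :: "(real^'n) * real => real"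
 assumes m[measurable]: "mu : borelf" and m0: "!!z. mu z >= 0" and I: "(NN z. ennreal (mu z powr q)) <= ennreal M" "M > 0"
  and p: "1 <= p" "p <= q" and R: "R > 0"
  and V: "V = vol (unit_box :: 'n pt set)"
  and ep: "2 * V powr (1 - p / q) * (R powr (q - (real CARD('n) + 2)) * M) powr (p / q) <= ep"
 shows "morrey p q ep (%z. R * mu (par_map R z0 z))" unfolding morrey_def
proof (intro allI)
 fix z :: "'n pt" and j
 let ?N = "real CARD('n) + 2"
 let ?mu = "%z. R * mu (par_map R z0 z)"
 have V0: "V > 0" unfolding V by (rule unit_box_measure_pos)
 have mm: "?mu : borelf" by measurable
 have RN: "R ^ (CARD('n) + 2) = R powr ?N" by (subst powr_realpow[OF R, symmetric]) (simp only: of_nat_add of_nat_numeral)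
 have "(NN z. ennreal (?mu z powr q)) <= ennreal (R powr (q - ?N) * M)"
 proof -
  have "(NN z. ennreal (?mu z powr q)) = (NN z. ennreal (R powr q) * ennreal (mu (par_map R z0 z) powr q))" by (simp add: powr_mult ennreal_mult)
  also have "... = ennreal (R powr q) * (NN z. ennreal (mu (par_map R z0 z) powr q))" by (rule nn_integral_cmult) measurable
  also have "ennreal (R powr q) = ennreal (R powr (q - ?N)) * ennreal (R ^ (CARD('n) + 2))"
   unfolding RN using R by (simp add: ennreal_mult[symmetric] powr_add[symmetric])
  also have "... * (NN z. ennreal (mu (par_map R z0 z) powr q))
    = ennreal (R powr (q - ?N)) * (NN z. ennreal (mu z powr q))" using nn_integral_par_map_lborel[OF R, of "%z. ennreal (mu z powr q)" z0] by (simp add: mult.assoc)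
  also have "... <= ennreal (R powr (q - ?N)) * ennreal M" by (intro mult_left_mono I) simp
  finally show ?thesis using I(2) by (simp add: ennreal_mult)
 qed
 hence Iq: "(NN z'. indicator (near j z) z' * ennreal (?mu z' powr q)) <= ennreal (R powr (q - ?N) * M)"
  by (rule order_trans[rotated]) (intro nn_integral_mono, auto simp: indicator_def)
 have vj: "evol (near j z) = ennreal (V / 2 ^ (j * (CARD('n) + 2)))" unfolding V by (rule near_volume)
 have "(NN z'. indicator (near j z) z' * ennreal (?mu z' powr p))
  <= ennreal (2 * (V / 2 ^ (j * (CARD('n) + 2))) powr (1 - p / q) * (R powr (q - ?N) * M) powr (p / q))"
  by (rule nn_integral_powr_mono[OF mm _ near_sets vj _ _ p(2) Iq]) (use m0 R V0 p I(2) in auto)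
 also have "2 * (V / 2 ^ (j * (CARD('n) + 2))) powr (1 - p / q) * (R powr (q - ?N) * M) powr (p / q)
  = (2 * V powr (1 - p / q) * (R powr (q - ?N) * M) powr (p / q)) * 2 powr (- (real j * (?N - p * ?N / q)))"
 proof -
  have "(2 ^ (j * (CARD('n) + 2)) :: real) powr (1 - p / q) = 2 powr (real j * (?N - p * ?N / q))"
   by (simp add: powr_realpow[symmetric] powr_powr algebra_simps add_divide_distrib)
  hence "(V / 2 ^ (j * (CARD('n) + 2))) powr (1 - p / q) = V powr (1 - p / q) * 2 powr (- (real j * (?N - p * ?N / q)))"
   unfolding powr_divide by (simp only: powr_minus_divide) simp
  thus ?thesis by (simp only: mult_ac)
 qed
 also have "... <= ep * 2 powr (- (real j * (?N - p * ?N / q)))" by (rule mult_right_mono[OF ep]) simp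
 finally show "(NN z'. indicator (near j z) z' * ennreal (?mu z' powr p)) <= ennreal (ep * 2 powr (- (real j * (?N - p * ?N / q))))" by (simp add: ennreal_leI)
qed

text \<open>R^2 W at the rescaled point keeps time derivative and Hessian and multiplies the
  gradient by R, which matches the scaled drift. The factor R^(2p) for the p-th power of the
  solution and R^-(n+2) for the integral of g combine to the exponent 2p - (n+2).\<close>

lemma drift_solution:
 fixes mu :: "(real^'n) * real => real"
 assumes abp: "ABP_exponent TYPE('n::finite) lam Lam p1" and p: "p > p1" "p <= q" and q: "q > real CARD('n) + 2" and l: "0 < lam" "lam <= Lam"
  and m[measurable]: "mu : borelf" and m0: "!!z. mu z >= 0" and I: "(NN z. ennreal (mu z powr q)) <= ennreal M"
 shows "EX r1>0. EX C>=0. ALL R z0 g G. 0 < R --> R <= r1 --> g : borelf --> (ALL z. g z >= 0) -->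
  (ALL z. par_inv R z0 z ~: core --> g z = 0) --> G >= 0 --> (NN z. ennreal (g z powr p)) <= ennreal G -->
  (EX w wt w1 w2. neg_jet w wt w1 w2 & (ALL z. abs (w z) powr p <= C * R powr (2 * p - (real CARD('n) + 2)) * G) &
   jet_eq lam Lam {z. par_inv R z0 z : core} mu g wt w1 w2 & jint p w wt w1 w2 < \<infinity>)"
 (is "EX r1>0. EX C>=0. ALL R z0 g G. _ --> _ --> _ --> _ --> _ --> _ --> _ --> ?E C R z0 g G")
proof -
 let ?N = "real CARD('n) + 2"
 have p0: "p >= 1" using abp p(1) unfolding ABP_exponent_def by auto
 obtain ep C where ep: "ep > 0" and C: "C >= 0" and sol: "!!(mu :: 'n pt => real) g G. mu : borelf ==> (ALL z. mu z >= 0) ==> morrey p q ep mu ==>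
  core_data p g G ==> (EX w wt w1 w2. core_solution lam Lam p C mu g G w wt w1 w2)" using drift_core[OF abp p q l] by blast
 define V where "V = vol (unit_box :: 'n pt set)"
 have V: "V > 0" unfolding V_def by (rule unit_box_measure_pos)
 define M' where "M' = max M 1"
 have M': "M' > 0" by (simp add: M'_def)
 have I': "(NN z. ennreal (mu z powr q)) <= ennreal M'" using I by (rule order_trans) (simp add: M'_def ennreal_leI)
 \<comment> \<open>The smallness condition of \<open>morrey_scaled\<close> solved for R.\<close>
 define r1 where "r1 = ((ep / (2 * V powr (1 - p / q))) powr (q / p) / M') powr (1 / (q - ?N))"
 have r1: "r1 > 0" unfolding r1_def using ep V M' by simp
 have small: "2 * V powr (1 - p / q) * (R powr (q - ?N) * M') powr (p / q) <= ep" if R: "0 < R" "R <= r1" for R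
 proof -
  define A where "A = ep / (2 * V powr (1 - p / q))"
  have A: "A > 0" unfolding A_def using ep V by simp
  have pq: "p > 0" "q > 0" using p0 p by auto
  have "R powr (q - ?N) <= r1 powr (q - ?N)" using R q by (intro powr_mono2) auto
  also have "r1 powr (q - ?N) = A powr (q / p) / M'" unfolding r1_def A_def[symmetric] using q A M' by (simp add: powr_powr)
  finally have "R powr (q - ?N) * M' <= A powr (q / p)" using M' by (simp add: pos_le_divide_eq)
  hence "(R powr (q - ?N) * M') powr (p / q) <= (A powr (q / p)) powr (p / q)" using M' pq by (intro powr_mono2) auto
  also have "... = A" using A pq by (simp add: powr_powr)
  finally have "2 * V powr (1 - p / q) * (R powr (q - ?N) * M') powr (p / q) <= 2 * V powr (1 - p / q) * A" by (intro mult_left_mono) auto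
  also have "... = ep" using V by (simp add: A_def)
  finally show ?thesis .
 qed
 have main: "?E C R z0 g G"
  if R: "0 < R" "R <= r1" and g[measurable]: "g : borelf" and g0: "!!z. g z >= 0" and gc: "!!z. par_inv R z0 z ~: core ==> g z = 0"
   and G: "G >= 0" and gG: "(NN z. ennreal (g z powr p)) <= ennreal G"
  for R z0 and g :: "'n pt => real" and G
 proof -
  define mu' where "mu' z = R * mu (par_map R z0 z)" for z
  define g' where "g' z = g (par_map R z0 z)" for z
  define G' where "G' = G / R ^ (CARD('n) + 2)"
  have mu'm: "mu' : borelf" unfolding mu'_def[abs_def] by measurable
  have mu'0: "ALL z. mu' z >= 0" unfolding mu'_def using m0 R by (intro allI mult_nonneg_nonneg) auto
  have mor: "morrey p q ep mu'" unfolding mu'_def[abs_def] by (rule morrey_scaled[OF m m0 I' M' p0 p(2) R(1) V_def small[OF R]])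
  have cd: "core_data p g' G'" unfolding core_data_def
  proof (intro conjI allI impI)
   show "g' : borelf" unfolding g'_def[abs_def] by measurable
   show "g' z >= 0" for z unfolding g'_def by (rule g0)
   show "g' z = 0" if "z ~: core" for z unfolding g'_def by (rule gc) (use that R in "simp add: par_map_inv")
   show "G' >= 0" unfolding G'_def using G R by simp
   have c: "ennreal (R ^ (CARD('n) + 2)) * (NN z. ennreal (g' z powr p)) <= ennreal G"
    using gG nn_integral_par_map_lborel[OF R(1), of "%z. ennreal (g z powr p)" z0] unfolding g'_def by simp
   have "(NN z. ennreal (g' z powr p)) = ennreal (1 / R ^ (CARD('n) + 2)) * (ennreal (R ^ (CARD('n) + 2)) * (NN z. ennreal (g' z powr p)))"
    unfolding mult.assoc[symmetric] using R by (subst ennreal_mult[symmetric]) auto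
   also have "... <= ennreal (1 / R ^ (CARD('n) + 2)) * ennreal G" by (intro mult_left_mono c) simp
   also have "... = ennreal G'" using R G by (simp add: ennreal_mult[symmetric] G'_def)
   finally show "(NN z. ennreal (g' z powr p)) <= ennreal G'" .
  qed
  from sol[OF mu'm mu'0 mor cd] obtain W Wt W1 W2 where S: "core_solution lam Lam p C mu' g' G' W Wt W1 W2" by blast
  note S' = S[unfolded core_solution_def]
  define inv where "inv = par_inv R z0"
  have inv: "inv = par_map (1 / R) (par_inv R z0 0)" unfolding inv_def by (rule par_inv_eq_par_map[OF R(1)])
  have invm[measurable]: "inv : borelf" unfolding inv by measurable
  have map_inv: "par_map R z0 (inv z) = z" for z unfolding inv_def by (rule par_map_inv(1)[OF R(1)])
  have rR: "1 / R > 0" using R by simp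
  have J: "jet W Wt W1 W2" using S' by blast
  note JD = J[unfolded jet_def]
  have Jm[measurable]: "W : borelf" "Wt : borelf" "W1 k : borelf" "W2 k i : borelf" for k i using JD by blast+
  define w where "w z = R^2 * W (inv z)" for z
  define wt where "wt z = Wt (inv z)" for z
  define w1 where "w1 k z = R * W1 k (inv z)" for k z
  define w2 where "w2 k i z = W2 k i (inv z)" for k i z
  have jet: "jet w wt w1 w2" unfolding jet_def
  proof (intro conjI allI)
   show "w : borelf" "wt : borelf" "w1 k : borelf" "w2 k i : borelf" for k i unfolding w_def[abs_def] wt_def[abs_def] w1_def[abs_def] w2_def[abs_def] by measurable
   have "wd dir_t (%z. R^2 * W (inv z)) (%z. R^2 * ((1 / R)^2 * Wt (inv z)))" unfolding inv by (intro wd_scale wd_par_map[OF _ rR] dir_scale) (use JD in blast)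
   thus "wd dir_t w wt" unfolding w_def[abs_def] wt_def[abs_def] using R by (simp add: power_divide)
   have "wd (dir_x k) (%z. R^2 * W (inv z)) (%z. R^2 * ((1 / R) * W1 k (inv z)))" for k
    unfolding inv by (intro wd_scale wd_par_map[OF _ rR] dir_scale) (use JD in blast)
   thus "wd (dir_x k) w (w1 k)" for k unfolding w_def[abs_def] w1_def[abs_def] using R by (simp add: power2_eq_square)
   have "wd (dir_x i) (%z. R * W1 k (inv z)) (%z. R * ((1 / R) * W2 k i (inv z)))" for k i
    unfolding inv by (intro wd_scale wd_par_map[OF _ rR] dir_scale) (use JD in blast)
   thus "wd (dir_x i) (w1 k) (w2 k i)" for k i unfolding w1_def[abs_def] w2_def[abs_def] using R by simp
  qed
  have cont: "continuous_on UNIV w"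
  proof -
   have "continuous_on UNIV inv" unfolding inv_def par_inv_def using R by (intro continuous_intros) auto
   hence "continuous_on UNIV (%z. W (inv z))" using S' by (auto intro: continuous_on_compose2[of UNIV W])
   thus ?thesis unfolding w_def[abs_def] by (intro continuous_intros)
  qed
  have neg: "ALL z. w z <= 0" proof
   have W0: "W z <= 0" for z using S' by blast
   show "w z <= 0" for z unfolding w_def by (intro mult_nonneg_nonpos W0) simp
  qed
  have bd: "abs (w z) powr p <= C * R powr (2 * p - ?N) * G" for z
  proof -
   have "abs (W (inv z)) powr p <= C * G'" using S' by blast
   hence "(R^2) powr p * abs (W (inv z)) powr p <= (R^2) powr p * (C * G')" by (rule mult_left_mono) simp
   moreover have "abs (w z) powr p = (R^2) powr p * abs (W (inv z)) powr p" unfolding w_def by (simp add: abs_mult powr_mult)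
   moreover have "(R^2) powr p * (C * G') = C * R powr (2 * p - ?N) * G"
   proof -
    have "(R^2) powr p = R powr (2 * p)" using R by (simp add: powr_powr flip: powr_numeral)
    moreover have "R ^ (CARD('n) + 2) = R powr ?N" by (subst powr_realpow[OF R(1), symmetric]) (simp only: of_nat_add of_nat_numeral)
    ultimately show ?thesis unfolding G'_def by (simp add: powr_diff)
   qed
   ultimately show ?thesis by simp
  qed
  have eq: "jet_eq lam Lam {z. par_inv R z0 z : core} mu g wt w1 w2"
  proof -
   have "AE z in lebesgue. z : core --> Wt z + PP lam Lam W2 z + mu' z * (SUM k:UNIV. abs (W1 k z)) <= - g' z"
    using S' unfolding jet_eq_def by (simp add: AE_completion_iff)
   from AE_par_map[OF rR this, of "par_inv R z0 0", folded inv]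
   have "AE z in lebesgue. z : {z. par_inv R z0 z : core} --> wt z + PP lam Lam w2 z + mu z * (SUM k:UNIV. abs (w1 k z)) <= - g z"
   proof eventually_elim
    fix z assume a: "inv z : core --> Wt (inv z) + PP lam Lam W2 (inv z) + mu' (inv z) * (SUM k:UNIV. abs (W1 k (inv z))) <= - g' (inv z)"
    have "mu' (inv z) * (SUM k:UNIV. abs (W1 k (inv z))) = mu z * (SUM k:UNIV. abs (w1 k z))"
     unfolding mu'_def map_inv w1_def using R by (simp add: abs_mult sum_distrib_left[symmetric])
    thus "z : {z. par_inv R z0 z : core} --> wt z + PP lam Lam w2 z + mu z * (SUM k:UNIV. abs (w1 k z)) <= - g z"
     using a unfolding wt_def w2_def g'_def map_inv unfolding inv_def by simp
   qed
   thus ?thesis unfolding jet_eq_def by (simp only: AE_completion_iff)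
  qed
  have fin: "jint p w wt w1 w2 < \<infinity>"
  proof -
   define K where "K = R^2 + 1 + R"
   have K: "K >= 1" "R^2 <= K" "R <= K" using R by (auto simp: K_def)
   have le: "jet_size w wt w1 w2 z <= K * jet_size W Wt W1 W2 (inv z)" for z unfolding jet_size_def distrib_left sum_distrib_left
   proof (intro add_mono sum_mono)
    show "abs (w z) <= K * abs (W (inv z))" using mult_right_mono[OF K(2) abs_ge_zero, of "W (inv z)"] by (simp add: w_def abs_mult)
    show "abs (wt z) <= K * abs (Wt (inv z))" using mult_right_mono[OF K(1) abs_ge_zero, of "Wt (inv z)"] by (simp add: wt_def)
    show "abs (w1 k z) <= K * abs (W1 k (inv z))" for k using mult_right_mono[OF K(3) abs_ge_zero, of "W1 k (inv z)"] R by (simp add: w1_def abs_mult)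
    show "abs (w2 k i z) <= K * abs (W2 k i (inv z))" for k i using mult_right_mono[OF K(1) abs_ge_zero, of "W2 k i (inv z)"] by (simp add: w2_def)
   qed
   have Hm[measurable]: "jet_size W Wt W1 W2 : borelf" unfolding jet_size_def[abs_def] by measurable
   have mm: "(%z. ennreal (jet_size W Wt W1 W2 (inv z) powr p)) : borelf" by measurable
   have sc: "(NN z. ennreal (jet_size W Wt W1 W2 (inv z) powr p)) = ennreal (R ^ (CARD('n) + 2)) * jint p W Wt W1 W2"
    using nn_integral_par_map_lborel[OF R(1) mm, of z0] by (simp add: inv_def par_map_inv R)
   have "jint p w wt w1 w2 <= (NN z. ennreal (K powr p) * ennreal (jet_size W Wt W1 W2 (inv z) powr p))"
   proof (rule nn_integral_mono)
    fix z
    have "jet_size w wt w1 w2 z powr p <= (K * jet_size W Wt W1 W2 (inv z)) powr p" using le[of z] p0 jet_size_ge(5)[where z=z] by (intro powr_mono2) auto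
    thus "ennreal (jet_size w wt w1 w2 z powr p) <= ennreal (K powr p) * ennreal (jet_size W Wt W1 W2 (inv z) powr p)"
     by (simp add: powr_mult ennreal_mult'[symmetric] ennreal_leI)
   qed
   also have "... = ennreal (K powr p) * (ennreal (R ^ (CARD('n) + 2)) * jint p W Wt W1 W2)" unfolding sc[symmetric] by (rule nn_integral_cmult) measurable
   also have "ennreal (K powr p) * (ennreal (R ^ (CARD('n) + 2)) * jint p W Wt W1 W2)
    <= ennreal (K powr p) * (ennreal (R ^ (CARD('n) + 2)) * ennreal (C * G'))" using S' by (intro mult_left_mono) auto
   also have "... < \<infinity>" by (simp add: ennreal_mult_less_top)
   finally show ?thesis .
  qed
  have bd': "ALL z. abs (w z) powr p <= C * R powr (2 * p - ?N) * G" by (rule allI, rule bd)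
  show ?thesis by (rule exI[of _ w], rule exI[of _ wt], rule exI[of _ w1], rule exI[of _ w2], intro conjI, (rule jet cont neg bd' eq fin)+)
 qed
 show ?thesis
 proof (rule exI[of _ r1], rule conjI[OF r1], rule exI[of _ C], rule conjI[OF C], intro allI impI)
  fix R z0 and g :: "'n pt => real" and G
  assume h: "0 < R" "R <= r1" "g : borelf" "ALL z. 0 <= g z" "ALL z. par_inv R z0 z ~: core --> g z = 0" "0 <= G"
   "(NN z. ennreal (g z powr p)) <= ennreal G"
  show "?E C R z0 g G" by (rule main[OF h(1-3) h(4)[rule_format] h(5)[rule_format] h(6,7)])
 qed
qed

section \<open>Viscosity solutions and the extremal operator\<close>

lemma open_cube_at: "open {x :: real^'n. ALL i. abs (x $ i - a $ i) < r}"
proof -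
 have "{x :: real^'n. ALL i. abs (x $ i - a $ i) < r} = (\<Inter>i. {x. abs (x $ i - a $ i) < r})" by auto
 thus ?thesis by (simp add: open_INT open_Collect_less continuous_intros)
qed

lemma open_cube: "open (cube r :: (real^'n) set)" using open_cube_at[of 0 r] by (simp add: cube_def)

lemma par_cube_sets [measurable]: "(par_cube r z :: ((real^'n) * real) set) : sets borel"
proof -
 have "par_cube r z = {x. ALL i. abs (x $ i - fst z $ i) < r} \<times> {snd z - r^2<..snd z}" by (auto simp: par_cube_def)
 thus ?thesis by (simp only:) (intro borel_Times borel_open[OF open_cube_at]; simp)
qed

lemma eventually_ae_on: "S : sets borel ==> eventually P (ae_filter (lebesgue_on S)) \<longleftrightarrow> (AE y in lebesgue. y : S --> P y)"
 using AE_restrict_space_iff[of S lebesgue P] by simp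

text \<open>\<open>Lim\<close> carries information only once the limit is known to exist. Essential
  suprema decrease with the cylinder, so they converge to their infimum, which any single cylinder
  bounds from above. The second claim is the first one negated.\<close>

lemma Lim_ess_sup_le:
 fixes z :: "(real^'n) * real"
 assumes r: "r > 0" and h: "AE y in lebesgue. y : par_cube r z --> h y <= c"
 shows "Lim (at_right 0) (%ep. ess_sup (par_cube ep z) h) <= ereal c"
  and "Lim (at_right 0) (%ep. ess_inf (par_cube ep z) (%y. - h y)) >= ereal (- c)"
proof -
 define S where "S ep = ess_sup (par_cube ep z) h" for ep
 define l where "l = (INF ep\<in>{0<..}. S ep)"
 have sub: "par_cube a z <= par_cube b z" if "0 < a" "a <= b" for a b
 proof -
  have "a^2 <= b^2" using that by (intro power_mono) auto
  thus ?thesis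
  proof clarify
   fix x s assume ab: "a^2 <= b^2" and "(x, s) : par_cube a z"
   hence "abs (x $ i - fst z $ i) < a" "snd z - a^2 < s" "s <= snd z" for i by (auto simp: par_cube_def)
   moreover from this ab have "snd z - b^2 < s" by linarith
   ultimately show "(x, s) : par_cube b z" unfolding par_cube_def using that by (auto intro: less_le_trans)
  qed
 qed
 have mono: "S a <= S b" if "0 < a" "a <= b" for a b unfolding S_def ess_sup_def Limsup_def
 proof (rule INF_superset_mono)
  show "{P. eventually P (ae_filter (lebesgue_on (par_cube b z)))} <= {P. eventually P (ae_filter (lebesgue_on (par_cube a z)))}"
  proof clarify
   fix P assume "eventually P (ae_filter (lebesgue_on (par_cube b z)))"
   hence "AE y in lebesgue. y : par_cube b z --> P y" by (simp only: eventually_ae_on par_cube_sets)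
   hence "AE y in lebesgue. y : par_cube a z --> P y" by (rule eventually_mono) (use sub[OF that] in blast)
   thus "eventually P (ae_filter (lebesgue_on (par_cube a z)))" by (simp only: eventually_ae_on par_cube_sets)
  qed
 qed simp
 have lim: "(S \<longlongrightarrow> l) (at_right 0)"
 proof (rule order_tendstoI)
  fix a assume a: "a < l"
  have "a < S ep" if "ep > 0" for ep using a INF_lower[of ep "{0<..}" S] that by (auto simp: l_def)
  thus "eventually (%ep. a < S ep) (at_right 0)" by (auto simp: eventually_at_right_field intro!: exI[of _ 1])
 next
  fix a assume "l < a"
  then obtain e where e: "e > 0" "S e < a" unfolding l_def by (auto simp: INF_less_iff)
  hence "S ep < a" if "0 < ep" "ep < e" for ep using mono[of ep e] that by (meson le_less_trans less_imp_le)
  thus "eventually (%ep. S ep < a) (at_right 0)" using e by (auto simp: eventually_at_right_field)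
 qed
 have "S r <= ereal c" unfolding S_def ess_sup_def by (rule Limsup_bounded) (use h in "simp only: eventually_ae_on par_cube_sets ereal_less_eq")
 hence lc: "l <= ereal c" unfolding l_def using r INF_lower[of r "{0<..}" S] by auto
 have "Lim (at_right 0) S = l" by (rule tendsto_Lim[OF trivial_limit_at_right_real lim])
 thus "Lim (at_right 0) (%ep. ess_sup (par_cube ep z) h) <= ereal c" using lc by (simp add: S_def[abs_def])
 have "ess_inf (par_cube ep z) (%y. - h y) = - S ep" for ep unfolding ess_inf_def S_def ess_sup_def uminus_ereal.simps(1)[symmetric] by (rule ereal_Liminf_uminus)
 hence "((%ep. ess_inf (par_cube ep z) (%y. - h y)) \<longlongrightarrow> - l) (at_right 0)" using tendsto_uminus_ereal[OF lim] by simp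
 hence "Lim (at_right 0) (%ep. ess_inf (par_cube ep z) (%y. - h y)) = - l" by (rule tendsto_Lim[OF trivial_limit_at_right_real])
 thus "Lim (at_right 0) (%ep. ess_inf (par_cube ep z) (%y. - h y)) >= ereal (- c)" using lc by (simp only: uminus_ereal.simps(1)[symmetric] ereal_minus_le_minus)
qed

text \<open>The barrier is not integrable over the whole space and hence no jet; a test function is
  therefore a smooth part plus a jet with finite L^p integral.\<close>

definition Lp_jet :: "real => ((real^'n) * real => real) => ('n pt => real) => ('n => 'n pt => real)
  => ('n => 'n => 'n pt => real) => bool" where
 "Lp_jet p ph pht ph1 ph2 \<longleftrightarrow> (EX b w wt w1 w2. smooth b & jet w wt w1 w2 & continuous_on UNIV w &
  jint p w wt w1 w2 < \<infinity> &
  ph = (%z. b z + w z) & pht = (%z. dd dir_t b z + wt z) & ph1 = (%k z. dd (dir_x k) b z + w1 k z) &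
  ph2 = (%k l z. dd (dir_x k) (dd (dir_x l) b) z + w2 k l z))"

lemma Lp_jet_uminus:
 assumes "Lp_jet p ph pht ph1 ph2"
 shows "Lp_jet p (%z. - ph z) (%z. - pht z) (%k z. - ph1 k z) (%k l z. - ph2 k l z)"
proof -
 obtain b w wt w1 w2 where b: "smooth b" and j: "jet w wt w1 w2" and w: "continuous_on UNIV w"
  "jint p w wt w1 w2 < \<infinity>"
  and e: "ph = (%z. b z + w z)" "pht = (%z. dd dir_t b z + wt z)" "ph1 = (%k z. dd (dir_x k) b z + w1 k z)"
  "ph2 = (%k l z. dd (dir_x k) (dd (dir_x l) b) z + w2 k l z)" using assms unfolding Lp_jet_def by blast
 have m: "smooth (%z. - f z)" "dd v (%z. - f z) = (%z. - dd v f z)" if "smooth f" for f :: "(real^'n) * real => real" and v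
 proof -
  show "smooth (%z. - f z)" using smooth_diff[OF smooth_const[of 0] that] by simp
  show "dd v (%z. - f z) = (%z. - dd v f z)" by (rule ext, rule dd_eq) (intro has_derivative_minus smooth_has_derivative that)
 qed
 have "jet (%z. - w z) (%z. - wt z) (%k z. - w1 k z) (%k l z. - w2 k l z)"
 proof -
  have "wd v (%z. - f z) (%z. - g z)" if "wd v f g" for v and f g :: "(real^'n) * real => real" using wd_scale[OF that, of "-1"] by simp
  thus ?thesis using j unfolding jet_def by (intro conjI allI) (blast intro: borel_measurable_uminus)+
 qed
 moreover have "jet_size (%z. - w z) (%z. - wt z) (%k z. - w1 k z) (%k l z. - w2 k l z) = jet_size w wt w1 w2" by (rule ext) (simp add: jet_size_def)
 ultimately show ?thesis unfolding Lp_jet_def e using w b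
  by (intro exI[of _ "%z. - b z"] exI[of _ "%z. - w z"] exI[of _ "%z. - wt z"] exI[of _ "%k z. - w1 k z"] exI[of _ "%k l z. - w2 k l z"])
   (simp add: m smooth_dd continuous_on_minus)
qed

lemma Lp_jet_weak_deriv:
 assumes "Lp_jet p ph pht ph1 ph2"
 shows "has_weak_deriv U [dir_t] ph pht" "has_weak_deriv U [dir_x k] ph (ph1 k)" "has_weak_deriv U [dir_x k, dir_x l] ph (ph2 k l)"
  and "continuous_on UNIV ph" "AE z in lebesgue. ALL k l. ph2 k l z = ph2 l k z"
proof -
 obtain b w wt w1 w2 where b: "smooth b" and j: "jet w wt w1 w2" and w: "continuous_on UNIV w"
  and e: "ph = (%z. b z + w z)" "pht = (%z. dd dir_t b z + wt z)" "ph1 = (%k z. dd (dir_x k) b z + w1 k z)"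
  "ph2 = (%k l z. dd (dir_x k) (dd (dir_x l) b) z + w2 k l z)" using assms unfolding Lp_jet_def by blast
 note jd = j[unfolded jet_def]
 show "has_weak_deriv U [dir_t] ph pht" "has_weak_deriv U [dir_x k] ph (ph1 k)"
  unfolding e by (intro has_weak_deriv_add smooth_has_weak_deriv b, rule wd_has_weak_deriv, use jd in blast)+
 have "has_weak_deriv U [dir_x k, dir_x l] w (w2 k l)" by (rule wd_wd_has_weak_deriv[of _ _ "w1 k"]) (use jd in auto)
 thus "has_weak_deriv U [dir_x k, dir_x l] ph (ph2 k l)" unfolding e by (intro has_weak_deriv_add smooth_has_weak_deriv2 b)
 show "continuous_on UNIV ph" unfolding e by (intro continuous_on_add smooth_continuous_on b w)
 show "AE z in lebesgue. ALL k l. ph2 k l z = ph2 l k z" using jet_symmetric[OF j]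
 proof eventually_elim
  fix z assume "ALL k l. w2 k l z = w2 l k z"
  thus "ALL k l. ph2 k l z = ph2 l k z" unfolding e using dd_commute[OF b] by metis
 qed
qed

lemma in_Lp_smooth_plus:
 fixes b B :: "'a::euclidean_space => real"
 assumes b: "smooth b" and B[measurable]: "B : borelf" and fin: "(NN z. ennreal (abs (B z) powr p)) < \<infinity>"
  and S: "S : sets lebesgue" "bounded S" and p: "p > 0"
 shows "in_Lp p S (%z. b z + B z)"
proof -
 obtain lo where lo: "S <= cbox (- lo) lo" using bounded_subset_cbox_symmetric[OF S(2)] by blast
 define I where "I = cbox (- lo) lo"
 obtain K where K: "!!z. z : I ==> abs (b z) <= K"
 proof -
  have "bounded (b ` I)" unfolding I_def by (intro compact_imp_bounded compact_continuous_image smooth_continuous_on b compact_cbox)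
  thus ?thesis using that by (auto simp: bounded_iff)
 qed
 have K': "abs (indicator I z * b z) <= abs K * indicator I z" for z using K[of z] by (auto simp: indicator_def)
 define g where "g z = indicator I z * b z + B z" for z
 have bm[measurable]: "b : borelf" by (rule smooth_borel[OF b])
 have Im[measurable]: "I : sets borel" by (simp add: I_def)
 have gm: "g : borelf" unfolding g_def[abs_def] by measurable
 have le: "abs (g z) powr p <= 2 powr p * (abs K powr p * indicator I z + abs (B z) powr p)" for z
 proof -
  have "abs (g z) <= (SUM i:{0::nat,1}. if i = 0 then abs K * indicator I z else abs (B z))" unfolding g_def using K'[of z] by (auto simp: indicator_def)
  hence "abs (g z) powr p <= (SUM i:{0::nat,1}. if i = 0 then abs K * indicator I z else abs (B z)) powr p" using p by (intro powr_mono2) auto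
  also have "... <= real (card {0::nat,1}) powr p * (SUM i:{0::nat,1}. (if i = 0 then abs K * indicator I z else abs (B z)) powr p)"
   by (rule sum_powr_le) (use p in auto)
  also have "... = 2 powr p * (abs K powr p * indicator I z + abs (B z) powr p)" using p by (auto simp: indicator_def)
  finally show ?thesis .
 qed
 have "(NN z. ennreal (abs (g z) powr p)) <= (NN z. ennreal (2 powr p) * (ennreal (abs K powr p) * indicator I z + ennreal (abs (B z) powr p)))"
 proof (rule nn_integral_mono)
  fix z show "ennreal (abs (g z) powr p) <= ennreal (2 powr p) * (ennreal (abs K powr p) * indicator I z + ennreal (abs (B z) powr p))"
   using ennreal_leI[OF le[of z]] by (auto simp: indicator_def ennreal_mult ennreal_plus split: if_splits)
 qed
 also have "... = ennreal (2 powr p) * (ennreal (abs K powr p) * evol I + (NN z. ennreal (abs (B z) powr p)))"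
  by (subst nn_integral_cmult, measurable, subst nn_integral_add, measurable) (simp add: nn_integral_cmult_indicator)
 also have "... < \<infinity>" using fin by (simp add: I_def ennreal_mult_less_top emeasure_lborel_cbox_eq)
 finally have fg: "(NN z. ennreal (abs (g z) powr p)) < \<infinity>" .
 then obtain G where G: "G >= 0" "(NN z. ennreal (abs (g z) powr p)) = ennreal G" by (cases "NN z. ennreal (abs (g z) powr p)") auto
 have "in_Lp p S g" by (rule in_Lp_borel(1)[OF gm _ G(1) S(1) p]) (simp add: G)
 thus ?thesis by (rule in_Lp_AE[OF S(1)]) (use lo in "auto simp: g_def indicator_def I_def")
qed

lemma cylinder_bounded: "bounded (cylinder (cube r) T :: ((real^'n) * real) set)"
proof -
 have "cube r <= (cbox (\<chi> i. - r) (\<chi> i. r) :: (real^'n) set)" by (auto simp: cube_def mem_box_cart abs_le_iff less_imp_le minus_less_iff[of _ r] intro: less_imp_le) (smt (verit))+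
 hence "bounded (cube r :: (real^'n) set)" using bounded_cbox bounded_subset by blast
 thus ?thesis unfolding cylinder_def by (intro bounded_Times bounded_subset[OF bounded_cbox[of 0 T]]) auto
qed

lemma Lp_jet_W21_loc:
 fixes ph :: "(real^'n) * real => real"
 assumes "Lp_jet p ph pht ph1 ph2" and p: "p > 0"
 shows "W21_loc p (cube r) T ph" unfolding W21_loc_def
proof (intro allI impI)
 fix S :: "'n pt set" assume S: "par_inside (cube r) T S"
 obtain b w wt w1 w2 where b: "smooth b" and j: "jet w wt w1 w2"
  and fin: "jint p w wt w1 w2 < \<infinity>"
  and e: "ph = (%z. b z + w z)" "pht = (%z. dd dir_t b z + wt z)" "ph1 = (%k z. dd (dir_x k) b z + w1 k z)"
  "ph2 = (%k l z. dd (dir_x k) (dd (dir_x l) b) z + w2 k l z)" using assms unfolding Lp_jet_def by blast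
 note jd = j[unfolded jet_def]
 have Sb: "bounded S" using S bounded_subset[OF cylinder_bounded] by (auto simp: par_inside_def)
 have Sm: "S : sets lebesgue"
 proof -
  have "S - interior S : sets lebesgue" using S by (auto simp: par_inside_def)
  hence "(S - interior S) Un interior S : sets lebesgue" by (intro sets.Un) auto
  moreover have "(S - interior S) Un interior S = S" using interior_subset by blast
  ultimately show ?thesis by simp
 qed
 have f: "(NN z. ennreal (abs (g z) powr p)) < \<infinity>" if "!!z. abs (g z) <= jet_size w wt w1 w2 z" for g
 proof -
  have "(NN z. ennreal (abs (g z) powr p)) <= jint p w wt w1 w2" using that p by (intro nn_integral_mono ennreal_leI powr_mono2) auto
  thus ?thesis using fin by (rule le_less_trans)
 qed
 have g1: "abs (w1 k z) <= jet_size w wt w1 w2 z" for k z by (rule order_trans[OF member_le_sum jet_size_ge(3)]) auto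
 have g2: "abs (w2 k l z) <= jet_size w wt w1 w2 z" for k l z
 proof -
  have "abs (w2 k l z) <= (SUM l:UNIV. abs (w2 k l z))" by (rule member_le_sum) auto
  thus ?thesis using jet_size_ge(4)[where z=z and wt=wt and ?w2.0=w2 and k=k and w=w and ?w1.0=w1] by linarith
 qed
 have L: "in_Lp p S ph" "in_Lp p S pht" "in_Lp p S (ph1 k)" "in_Lp p S (ph2 k l)" for k l
  unfolding e using jd by (intro in_Lp_smooth_plus smooth_dd b Sm Sb p f g1 g2 jet_size_ge; blast)+
 show "W21 p S ph" unfolding W21_def
 proof (intro conjI L ballI)
  fix vs :: "('n pt) list" assume "vs : {[dir_t]} Un {[dir_x k] | k. True} Un {[dir_x k, dir_x l] | k l. True}"
  thus "EX g. has_weak_deriv (interior S) vs ph g & in_Lp p S g" using Lp_jet_weak_deriv(1-3)[OF assms(1)] L by blast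
 qed
qed

text \<open>What the cylinder has beyond its interior is the final time slice. The derivatives
  \<open>Dt\<close>, \<open>Dx\<close> and \<open>D2x\<close> are tied to the interior, so the slice
  must be negligible.\<close>

lemma cylinder_interior_null: "cylinder (cube r) T - interior (cylinder (cube r) T :: ((real^'n) * real) set) : null_sets lebesgue"
proof -
 have "cube r \<times> {0<..<T} <= interior (cylinder (cube r) T :: 'n pt set)"
  by (rule interior_maximal) (auto simp: cylinder_def open_Times open_cube)
 hence "cylinder (cube r) T - interior (cylinder (cube r) T) <= {z :: 'n pt. dir_t \<bullet> z = T}"
  by (force simp: cylinder_def inner_dir inner_commute[of dir_t])
 moreover have "negligible {z :: 'n pt. dir_t \<bullet> z = T}" by (rule negligible_hyperplane) (simp add: dir_t_def zero_prod_def)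
 ultimately show ?thesis using negligible_subset negligible_iff_null_sets by blast
qed

lemma Lp_jet_derivatives:
 fixes ph :: "(real^'n) * real => real"
 assumes j: "Lp_jet p ph pht ph1 ph2" and Q: "Q = cylinder (cube r) T"
 shows "AE y in lebesgue. y : Q --> Dt Q ph y = pht y & Dx Q ph y = (\<chi> k. ph1 k y) & D2x Q ph y = (\<chi> k l. ph2 k l y) & symm (\<chi> k l. ph2 k l y)"
proof -
 note W = weak_deriv_AE_eq[OF open_interior[of Q]]
 have t: "AE y in lebesgue. y : interior Q --> weak_deriv (interior Q) [dir_t] ph y = pht y" by (rule W[OF Lp_jet_weak_deriv(1)[OF j]])
 have x: "AE y in lebesgue. ALL k. y : interior Q --> weak_deriv (interior Q) [dir_x k] ph y = ph1 k y"
  unfolding AE_all_countable by (intro allI W[OF Lp_jet_weak_deriv(2)[OF j]])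
 have xx: "AE y in lebesgue. ALL k l. y : interior Q --> weak_deriv (interior Q) [dir_x k, dir_x l] ph y = ph2 k l y"
  unfolding AE_all_countable by (intro allI W[OF Lp_jet_weak_deriv(3)[OF j]])
 have n: "AE y in lebesgue. y ~: Q - interior Q" by (rule AE_not_in) (simp add: Q cylinder_interior_null)
 show ?thesis using t x xx n Lp_jet_weak_deriv(5)[OF j]
 proof eventually_elim
  case (elim y)
  show ?case
  proof
   assume "y : Q"
   hence "y : interior Q" using elim(4) by blast
   thus "Dt Q ph y = pht y & Dx Q ph y = (\<chi> k. ph1 k y) & D2x Q ph y = (\<chi> k l. ph2 k l y) & symm (\<chi> k l. ph2 k l y)"
    unfolding Dt_def Dx_def D2x_def using elim by (simp add: vec_eq_iff symm_def transpose_def)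
  qed
 qed
qed

lemma pucci_minus_uminus: "pucci_minus lam Lam (- X) = - pucci_plus lam Lam (X :: real^'n^'n)"
proof -
 have "A ** (- X) = - (A ** X)" for A :: "real^'n^'n" by (simp add: matrix_matrix_mult_def vec_eq_iff sum_negf)
 hence "- trace (A ** (- X)) = - (- trace (A ** X))" for A :: "real^'n^'n" by (simp add: trace_def sum_negf)
 thus ?thesis unfolding pucci_minus_def pucci_plus_def Inf_real_def image_image by simp
qed

text \<open>Strict viscosity inequality for the extremal operator, shared by \<open>u\<close> and \<open>- u\<close>: a strict subsolution cannot touch from below.\<close>

definition pucci_super ::
 "real => real => real => ((real^'n) * real) set => ('n pt => real) => ('n pt => real) => ('n pt => real) => bool" where
 "pucci_super lam Lam p Q m F v \<longleftrightarrow> continuous_on Q v &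
  (ALL ph pht ph1 ph2 z r et. Lp_jet p ph pht ph1 ph2 --> z : Q --> 0 < r --> par_cube r z <= Q --> 0 < et -->
   (AE y in lebesgue. y : par_cube r z -->
     pht y + PP lam Lam ph2 y + m y * (SUM k:UNIV. abs (ph1 k y)) + F y <= - et) -->
   (EX y:par_cube r z. v y - ph y < v z - ph z))"

lemma pucci_super_shift: "pucci_super lam Lam p Q m F v ==> pucci_super lam Lam p Q m F (%z. v z + c)" unfolding pucci_super_def by (auto intro!: continuous_on_add)

text \<open>Ellipticity with Y = 0 and the growth bound give G(z,xi,X) <= P+(X) + mu |xi|, so a
  strict subsolution touching u from below violates the supersolution test. For -u the negated test
  function touches u from above, and P-(-X) = -P+(X) reduces the subsolution test to the same
  inequality.\<close>

lemma visc_solution_pucci_super: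
 fixes u :: "(real^'n) * real => real"
 assumes u: "Lp_visc_solution p (cube r0) T (%z xi X. G z xi X - f z) u" and Q: "Q = cylinder (cube r0) T" and p: "p > 0"
  and ell: "!!z xi X Y. z : Q ==> symm X ==> symm Y ==>
     pucci_minus lam Lam (X - Y) <= G z xi X - G z xi Y & G z xi X - G z xi Y <= pucci_plus lam Lam (X - Y)"
  and gr: "!!z xi. z : Q ==> abs (G z xi 0) <= mu z * norm xi"
  and m: "AE z in lebesgue. z : Q --> abs (mu z) <= m z & abs (f z) <= F z"
 shows "pucci_super lam Lam p Q m F u" "pucci_super lam Lam p Q m F (%z. - u z)"
proof -
 have sub: "Lp_visc_subsolution p (cube r0) T (%z xi X. G z xi X - f z) u"
  and super: "Lp_visc_supersolution p (cube r0) T (%z xi X. G z xi X - f z) u" using u by (auto simp: Lp_visc_solution_def)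
 have cu: "continuous_on Q u" using sub by (simp add: Lp_visc_subsolution_def Let_def Q)
 have s0: "symm (0 :: real^'n^'n)" by (simp add: symm_def transpose_def vec_eq_iff)
 have G: "G y xi X <= pucci_plus lam Lam X + mu y * norm xi" "G y xi (- X) >= - (pucci_plus lam Lam X + mu y * norm xi)"
  if "y : Q" "symm X" for y xi X
 proof -
  have "symm (- X)" using that(2) by (simp add: symm_def transpose_def vec_eq_iff)
  thus "G y xi (- X) >= - (pucci_plus lam Lam X + mu y * norm xi)"
   using ell[OF that(1) _ s0, of "- X" xi] gr[OF that(1), of xi] by (simp add: pucci_minus_uminus abs_le_iff)
  show "G y xi X <= pucci_plus lam Lam X + mu y * norm xi" using ell[OF that s0, of xi] gr[OF that(1), of xi] by (simp add: abs_le_iff)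
 qed
 have bound: "mu y * norm xi + abs (f y) <= m y * (SUM k:UNIV. abs (xi $ k)) + F y" if "abs (mu y) <= m y & abs (f y) <= F y" for y and xi :: "real^'n"
 proof -
  have "mu y * norm xi <= m y * (SUM k:UNIV. abs (xi $ k))" using that by (intro mult_mono norm_le_l1_cart) auto
  thus ?thesis using that by linarith
 qed
 have main: "EX y:par_cube r z. u y - ph y < u z - ph z" "EX y:par_cube r z. - u y - ph y < - u z - ph z"
  if j: "Lp_jet p ph pht ph1 ph2" and z: "z : Q" and r: "0 < r" "par_cube r z <= Q" and et: "0 < et"
   and ae: "AE y in lebesgue. y : par_cube r z --> pht y + PP lam Lam ph2 y + m y * (SUM k:UNIV. abs (ph1 k y)) + F y <= - et"
  for ph pht ph1 ph2 z r et
 proof -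
  define ps where "ps = (%y. - ph y)"
  have jm: "Lp_jet p ps (%z. - pht z) (%k z. - ph1 k z) (%k l z. - ph2 k l z)" unfolding ps_def by (rule Lp_jet_uminus[OF j])
  have c: "continuous_on Q ph" "continuous_on Q ps" using Lp_jet_weak_deriv(4)[OF j] Lp_jet_weak_deriv(4)[OF jm] by (auto intro: continuous_on_subset)
  have W: "W21_loc p (cube r0) T ph" "W21_loc p (cube r0) T ps" by (rule Lp_jet_W21_loc[OF j p], rule Lp_jet_W21_loc[OF jm p])
  define h where "h y = Dt Q ph y + (G y (Dx Q ph y) (D2x Q ph y) - f y)" for y
  define k where "k y = - (Dt Q ps y + (G y (Dx Q ps y) (D2x Q ps y) - f y))" for y
  have h: "AE y in lebesgue. y : par_cube r z --> h y <= - et" using ae m Lp_jet_derivatives[OF j Q]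
  proof eventually_elim
   case (elim y)
   show ?case
   proof
    assume y: "y : par_cube r z"
    hence yQ: "y : Q" using r by blast
    define xi where "xi = (\<chi> k. ph1 k y)"
    have "h y = pht y + (G y xi (\<chi> k l. ph2 k l y) - f y)" unfolding h_def xi_def using elim(3) yQ by simp
    also have "... <= - et" using G(1)[OF yQ, of "\<chi> k l. ph2 k l y" xi] elim yQ y bound[of y xi] by (simp add: xi_def abs_le_iff)
    finally show "h y <= - et" .
   qed
  qed
  have k: "AE y in lebesgue. y : par_cube r z --> k y <= - et" using ae m Lp_jet_derivatives[OF jm Q] Lp_jet_derivatives[OF j Q]
  proof eventually_elim
   case (elim y)
   show ?case
   proof
    assume y: "y : par_cube r z"
    hence yQ: "y : Q" using r by blast
    define xi where "xi = (\<chi> k. - ph1 k y)"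
    have "(\<chi> k l. - ph2 k l y) = - (\<chi> k l. ph2 k l y)" by (simp add: vec_eq_iff)
    hence "k y = - (- pht y + (G y xi (- (\<chi> k l. ph2 k l y)) - f y))" unfolding k_def xi_def using elim(3) yQ by simp
    also have "... <= - et" using G(2)[OF yQ, of "\<chi> k l. ph2 k l y" xi] elim yQ y bound[of y xi] by (simp add: xi_def abs_le_iff)
    finally show "k y <= - et" .
   qed
  qed
  show "EX y:par_cube r z. u y - ph y < u z - ph z"
  proof (rule ccontr)
   assume "~ ?thesis"
   hence "ALL w:par_cube r z. u w - ph w >= u z - ph z" by (simp add: not_less)
   hence "Lim (at_right 0) (%ep. ess_sup (par_cube ep z) (%w. Dt Q ph w + (G w (Dx Q ph w) (D2x Q ph w) - f w))) >= 0"
    using super W(1) c(1) z r unfolding Lp_visc_supersolution_def Let_def Q[symmetric] by blast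
   moreover have "Lim (at_right 0) (%ep. ess_sup (par_cube ep z) h) <= ereal (- et)" by (rule Lim_ess_sup_le(1)[OF r(1) h])
   ultimately have "0 <= ereal (- et)" unfolding h_def[abs_def] by (rule order_trans)
   thus False using et by simp
  qed
  show "EX y:par_cube r z. - u y - ph y < - u z - ph z"
  proof (rule ccontr)
   assume "~ ?thesis"
   hence "ALL w:par_cube r z. u w - ps w <= u z - ps z" by (auto simp: ps_def not_less)
   hence "Lim (at_right 0) (%ep. ess_inf (par_cube ep z) (%w. Dt Q ps w + (G w (Dx Q ps w) (D2x Q ps w) - f w))) <= 0"
    using sub W(2) c(2) z r unfolding Lp_visc_subsolution_def Let_def Q[symmetric] by blast
   moreover have "Lim (at_right 0) (%ep. ess_inf (par_cube ep z) (%y. - k y)) >= ereal (- (- et))" by (rule Lim_ess_sup_le(2)[OF r(1) k])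
   ultimately have "ereal (- (- et)) <= 0" unfolding k_def[abs_def] minus_minus by (rule order_trans[rotated])
   thus False using et by simp
  qed
 qed
 show "pucci_super lam Lam p Q m F u" unfolding pucci_super_def by (intro conjI cu allI impI main(1))
 show "pucci_super lam Lam p Q m F (%z. - u z)" unfolding pucci_super_def by (intro conjI continuous_on_minus cu allI impI main(2))
qed

section \<open>The barrier\<close>

lemma smooth_exp_inner: "smooth (%z. c * exp (z \<bullet> e))"
proof (rule smooth_coinduct[of _ "{%z. c * exp (z \<bullet> e) | c. True}"])
 fix f :: "'a => real" and v z assume "f : {%z. c * exp (z \<bullet> e) | c. True}"
 then obtain c where f: "f = (%z. c * exp (z \<bullet> e))" by blast
 have d: "(f has_derivative (%v. c * (exp (z \<bullet> e) * (v \<bullet> e)))) (at z)" for z unfolding f by (auto intro!: derivative_eq_intros)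
 thus "f differentiable (at z)" by (auto simp: differentiable_def)
 have "dd v f = (%z. (c * (v \<bullet> e)) * exp (z \<bullet> e))" using dd_eq[OF d] by (auto simp: mult_ac)
 thus "dd v f : {%z. c * exp (z \<bullet> e) | c. True}" by blast
qed blast

text \<open>The slope 1/4 confines the region of positivity before time 1 to the unit cell: there
  every space coordinate is less than 1/2 in absolute value.\<close>

definition paraboloid :: "(real^'n) * real => real" where
 "paraboloid z = snd z / 4 - fst z \<bullet> fst z"

text \<open>No cut-off where the paraboloid is negative: test functions add a nonpositive term and are compared with nonnegative functions.\<close>

definition barrier :: "real => (real^'n) * real => real" where
 "barrier k z = paraboloid z ^ 3 * exp (- (k * snd z))"

abbreviation hess where "hess f z == (\<chi> i j. dd (dir_x i) (dd (dir_x j) f) z)"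

lemma barrier_derivatives:
 fixes z :: "(real^'n) * real"
 shows "dd dir_t (barrier k) z = (3 / 4 * paraboloid z ^ 2 - k * paraboloid z ^ 3) * exp (- (k * snd z))"
  and "dd (dir_x i) (barrier k) z = - 6 * paraboloid z ^ 2 * (fst z $ i) * exp (- (k * snd z))"
  and "dd (dir_x j) (dd (dir_x i) (barrier k)) z = (24 * paraboloid z * (fst z $ j * fst z $ i) - (if j = i then 6 * paraboloid z ^ 2 else 0)) * exp (- (k * snd z))"
  and "smooth (barrier k :: 'n pt => real)"
proof -
 have P: "(paraboloid has_derivative (%v. snd v / 4 - 2 * (fst z \<bullet> fst v))) (at z)" for z :: "'n pt"
  unfolding paraboloid_def[abs_def] by (auto intro!: derivative_eq_intros simp: inner_commute algebra_simps)
 have E: "((%z. exp (- (k * snd z))) has_derivative (%v. - k * snd v * exp (- (k * snd z)))) (at z)" for z :: "'n pt"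
  by (auto intro!: derivative_eq_intros)
 have B: "dd v (barrier k) z = (3 * paraboloid z ^ 2 * (snd v / 4 - 2 * (fst z \<bullet> fst v)) - k * snd v * paraboloid z ^ 3) * exp (- (k * snd z))"
  for v z :: "'n pt" by (rule dd_eq, unfold barrier_def[abs_def])
   (rule has_derivative_eq_rhs[OF has_derivative_mult[OF has_derivative_power[OF P] E]], auto simp: algebra_simps power2_eq_square power3_eq_cube)
 show "dd dir_t (barrier k) z = (3 / 4 * paraboloid z ^ 2 - k * paraboloid z ^ 3) * exp (- (k * snd z))" unfolding B by (simp add: dir_t_def)
 have X: "dd (dir_x i) (barrier k) = (%z :: 'n pt. - 6 * (paraboloid z ^ 2 * (fst z $ i)) * exp (- (k * snd z)))" for i
  by (rule ext, unfold B) (simp add: dir_x_def inner_axis)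
 show "dd (dir_x i) (barrier k) z = - 6 * paraboloid z ^ 2 * (fst z $ i) * exp (- (k * snd z))" by (simp add: X)
 have F: "((%z. fst z $ i) has_derivative (%v. fst v $ i)) (at z)" for z :: "'n pt"
  by (rule bounded_linear_imp_has_derivative) (rule bounded_linear_compose[OF bounded_linear_vec_nth bounded_linear_fst])
 show "dd (dir_x j) (dd (dir_x i) (barrier k)) z = (24 * paraboloid z * (fst z $ j * fst z $ i) - (if j = i then 6 * paraboloid z ^ 2 else 0)) * exp (- (k * snd z))"
  unfolding X by (subst dd_eq[OF has_derivative_mult[OF has_derivative_mult[OF has_derivative_const has_derivative_mult[OF has_derivative_power[OF P] F]] E]])
   (auto simp: dir_x_def inner_axis algebra_simps power2_eq_square, auto simp: axis_def)
 have "smooth (%z :: 'n pt. snd z)" "smooth (%z :: 'n pt. fst z $ i)" for i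
  using smooth_inner[of dir_t] smooth_inner[of "dir_x i"] by (simp_all add: inner_dir)
 hence "smooth (%z :: 'n pt. (1 / 4) * snd z - (SUM i:UNIV. fst z $ i * fst z $ i))" by (intro smooth_diff smooth_mult smooth_const smooth_sum) auto
 hence "smooth (paraboloid :: 'n pt => real)" by (simp add: paraboloid_def[abs_def] inner_vec_def)
 moreover have "smooth (%z :: 'n pt. exp (- (k * snd z)))" using smooth_exp_inner[of 1 "(- k) *\<^sub>R dir_t"] by (simp add: inner_dir)
 ultimately show "smooth (barrier k :: 'n pt => real)" unfolding barrier_def[abs_def] by (intro smooth_mult smooth_power)
qed

text \<open>The bound 1/2 forces v < h at a contact point; the constant \<open>K\<close> before time
  1 is the error that forcing on the cell has to pay for.\<close>

abbreviation barrier_bounds where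
 "barrier_bounds lam Lam k K z \<equiv> barrier k z <= 1/2 & (SUM i:UNIV. abs (dd (dir_x i) (barrier k) z)) <= K &
  dd dir_t (barrier k) z + pucci_plus lam Lam (hess (barrier k) z) <= (if snd z < 1 then K else 0)"

text \<open>With y the paraboloid and E the exponential, the operator is at most E y (a y - k y^2 -
  6 lam t), where -6 lam t stems from the rank-one part since |x|^2 = t/4 - y. The cube leaves that
  part a single factor y, so it dominates near y = 0, and \<open>k\<close> takes care of the rest.
  The sign is claimed from time 1 on.\<close>

lemma barrier_subsolution:
 assumes l: "0 < lam" "lam <= Lam" and T: "T >= 1"
 shows "EX k K c. K > 0 & c > 0 & (ALL z :: (real^'n) * real. 0 <= paraboloid z --> 0 <= snd z --> snd z <= T -->
  barrier_bounds lam Lam k K z &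
  (1 <= snd z --> snd z / 8 <= paraboloid z --> c <= barrier k z))"
proof -
 define n where "n = real CARD('n)"
 define a where "a = 3 / 4 + 6 * n * Lam + 24 * lam"
 define k where "k = a^2 / (24 * lam) + 1"
 define K where "K = a + 6 * n * T ^ 3"
 \<comment> \<open>1/512 is (1/8)^3: the lower bound concerns points with y >= t/8 >= 1/8.\<close>
 define c where "c = 1 / 512 * exp (- (k * T))"
 have n: "n > 0" by (simp add: n_def)
 have a: "a > 0" unfolding a_def using l n by (intro add_pos_pos mult_pos_pos) auto
 have k: "k >= 1" unfolding k_def using l by simp
 have K: "K > 0" unfolding K_def using a n T by (simp add: add_pos_nonneg)
 have "barrier_bounds lam Lam k K z &
  (1 <= snd z --> snd z / 8 <= paraboloid z --> c <= barrier k z)"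
  if y0: "0 <= paraboloid z" and t0: "0 <= snd z" and tT: "snd z <= T" for z :: "'n pt"
 proof (intro conjI impI)
  define t y E where "t = snd z" and "y = paraboloid z" and "E = exp (- (k * t))"
  define x where "x = fst z"
  have E: "0 < E" "E <= 1" using k t0 by (auto simp: E_def t_def)
  have y: "0 <= y" "y = t / 4 - x \<bullet> x" using y0 by (auto simp: y_def t_def x_def paraboloid_def)
  have yt: "y <= t / 4" using y by simp
  have B: "barrier k z = y ^ 3 * E" by (simp add: barrier_def y_def t_def E_def)
  \<comment> \<open>From t^3/27 <= e^t <= e^(kt) and y <= t/4 follows y^3 E <= 27/64.\<close>
  show "barrier k z <= 1 / 2"
  proof -
   have "(t / 3) ^ 3 <= (1 + t / 3) ^ 3" using t0 by (intro power_mono) (auto simp: t_def)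
   also have "(1 + t / 3) ^ 3 <= exp t" using exp_ge_one_plus_x_over_n_power_n[of 3 t] t0 by (simp add: t_def)
   also have "exp t <= exp (k * t)" using k t0 mult_right_mono[of 1 k t] by (simp add: t_def)
   finally have "(t / 3) ^ 3 * E <= 1" unfolding E_def by (simp add: exp_minus field_simps)
   moreover have "y ^ 3 <= (t / 4) ^ 3" using y yt by (intro power_mono) auto
   hence "y ^ 3 * E <= (t / 4) ^ 3 * E" using E by (intro mult_right_mono) auto
   ultimately show ?thesis unfolding B by (simp add: power_divide)
  qed
  have xi: "abs (x $ i) <= T" for i
  proof -
   have "(x $ i)^2 <= x \<bullet> x" unfolding inner_vec_def power2_eq_square using member_le_sum[of i UNIV "%i. x $ i * x $ i"] by simp
   also have "... <= T" using y tT t0 by (simp add: t_def)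
   also have "T <= T^2" using T by (simp add: power2_eq_square)
   finally show ?thesis using T abs_le_square_iff[of "x $ i" T] by simp
  qed
  have yT: "y <= T" using yt tT t0 by (simp add: t_def)
  show "(SUM i:UNIV. abs (dd (dir_x i) (barrier k) z)) <= K"
  proof -
   have "abs (dd (dir_x i) (barrier k) z) <= 6 * T ^ 3" for i
   proof -
    have "abs (dd (dir_x i) (barrier k) z) = 6 * ((y^2 * abs (x $ i)) * E)" unfolding barrier_derivatives using E by (simp add: abs_mult y_def x_def E_def t_def)
    also have "(y^2 * abs (x $ i)) * E <= (T^2 * T) * 1" using y yT xi[of i] T E by (intro mult_mono power_mono mult_nonneg_nonneg) auto
    finally show ?thesis by (simp add: power2_eq_square power3_eq_cube)
   qed
   hence "(SUM i:UNIV. abs (dd (dir_x i) (barrier k) z)) <= (SUM i:(UNIV :: 'n set). 6 * T ^ 3)" by (intro sum_mono)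
   thus ?thesis using a by (simp add: K_def n_def)
  qed
  show "dd dir_t (barrier k) z + pucci_plus lam Lam (hess (barrier k) z) <= (if snd z < 1 then K else 0)"
  proof -
   have "(hess (barrier k) z) = (\<chi> i j. (24 * y * E) * (x $ i * x $ j) - (if i = j then 6 * y^2 * E else 0))"
    unfolding barrier_derivatives vec_eq_iff by (auto simp: y_def x_def E_def t_def algebra_simps)
   hence "pucci_plus lam Lam (hess (barrier k) z) <= 6 * y^2 * E * (n * Lam) - 24 * y * E * (lam * (x \<bullet> x))"
    using pucci_plus_rank_one[OF l, of "24 * y * E" "6 * y^2 * E" x] y E by (simp add: n_def)
   moreover have "dd dir_t (barrier k) z = (3 / 4 * y^2 - k * y ^ 3) * E" unfolding barrier_derivatives by (simp add: y_def t_def E_def)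
   moreover have "x \<bullet> x = t / 4 - y" using y by simp
   ultimately have "dd dir_t (barrier k) z + pucci_plus lam Lam (hess (barrier k) z)
     <= (3 / 4 * y^2 - k * y ^ 3) * E + (6 * y^2 * E * (n * Lam) - 24 * y * E * (lam * (t / 4 - y)))" by simp
   also have "... = E * (y * (a * y - k * y^2 - 6 * lam * t))" by (simp add: a_def algebra_simps power2_eq_square power3_eq_cube)
   finally have le: "dd dir_t (barrier k) z + pucci_plus lam Lam (hess (barrier k) z) <= E * (y * (a * y - k * y^2 - 6 * lam * t))" .
   show ?thesis
   proof (cases "snd z < 1")
    case True
    have "y <= 1" using yt True by (simp add: t_def)
    have "E * (y * (a * y - k * y^2 - 6 * lam * t)) <= E * (y * (a * y))"
    proof (intro mult_left_mono)
     have "0 <= k * y^2" "0 <= 6 * lam * t" using k l t0 by (simp_all add: t_def)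
     thus "a * y - k * y^2 - 6 * lam * t <= a * y" by linarith
    qed (use E y in auto)
    also have "... <= 1 * (1 * (a * 1))" using E y \<open>y <= 1\<close> a by (intro mult_mono mult_left_mono mult_nonneg_nonneg) auto
    also have "... <= K" using n T by (simp add: K_def)
    finally show ?thesis using le True by simp
   next
    case False
    \<comment> \<open>Completing the square: the constant term 6 lam is paid by -6 lam t because t
      >= 1, the quadratic term by the choice of \<open>k\<close>.\<close>
    have "0 <= (a * y / sqrt (24 * lam) - sqrt (6 * lam))^2" by simp
    also have "... = a^2 * y^2 / (24 * lam) + 6 * lam - 2 * (a * y) * (sqrt (6 * lam) / sqrt (24 * lam))"
     using l by (simp add: power2_diff power_divide power_mult_distrib)
    also have "sqrt (6 * lam) / sqrt (24 * lam) = sqrt (1 / 4)" using l by (simp only: real_sqrt_divide[symmetric]) simp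
    also have "sqrt (1 / 4) = 1 / 2" by (simp add: real_sqrt_divide)
    finally have q: "a * y <= a^2 * y^2 / (24 * lam) + 6 * lam" by simp
    have "k * y^2 = a^2 * y^2 / (24 * lam) + y^2" by (simp add: k_def algebra_simps)
    moreover have "6 * lam <= 6 * lam * t" using l False by (simp add: t_def)
    ultimately have "a * y - k * y^2 - 6 * lam * t <= 0" using q zero_le_power2[of y] by linarith
    hence "E * (y * (a * y - k * y^2 - 6 * lam * t)) <= 0" using E y by (intro mult_nonneg_nonpos) auto
    thus ?thesis using le False by simp
   qed
  qed
  assume "1 <= snd z" "snd z / 8 <= paraboloid z"
  hence "(1 / 8) ^ 3 <= y ^ 3" by (intro power_mono) (auto simp: y_def)
  moreover have "exp (- (k * T)) <= E" using k tT by (simp add: E_def t_def)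
  ultimately have "(1 / 8) ^ 3 * exp (- (k * T)) <= y ^ 3 * E" using y by (intro mult_mono) auto
  thus "c <= barrier k z" unfolding B c_def by (simp add: power_divide)
 qed
 thus ?thesis using K by (intro exI[of _ k] exI[of _ K] exI[of _ c]) (auto simp: c_def)
qed

section \<open>Comparison with rescaled barriers\<close>

lemma dd_scaleR: "smooth f ==> dd (c *\<^sub>R v) f z = c * dd v f z" using linear_cmul[OF has_derivative_linear[OF smooth_has_derivative[of f z]]] by simp

lemma dd_par_inv:
 fixes f :: "(real^'n) * real => real"
 assumes f: "smooth f"
 shows "smooth (%z. h * f (par_inv s z0 z))"
  "dd dir_t (%z. h * f (par_inv s z0 z)) = (%z. (h / s^2) * dd dir_t f (par_inv s z0 z))"
  "dd (dir_x i) (%z. h * f (par_inv s z0 z)) = (%z. (h / s) * dd (dir_x i) f (par_inv s z0 z))"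
proof -
 define L where "L = (%z :: 'n pt. ((1 / s) *\<^sub>R fst z, (1 / s^2) * snd z))"
 have L: "bounded_linear L" unfolding L_def by (rule par_map_linear)
 define c where "c = par_inv s z0 0"
 have e: "par_inv s z0 z = L z + c" for z by (auto simp: c_def L_def par_inv_def prod_eq_iff algebra_simps divide_inverse)
 have s: "smooth (%z. f (par_inv s z0 z))" unfolding e by (rule smooth_affine[OF f L])
 thus "smooth (%z. h * f (par_inv s z0 z))" by (intro smooth_mult smooth_const)
 have D: "dd v (%z. h * f (par_inv s z0 z)) = (%z. h * dd (L v) f (par_inv s z0 z))" for v
 proof -
  have "dd v (%z. h * f (par_inv s z0 z)) = (%z. h * dd v (%z. f (par_inv s z0 z)) z)"
   by (rule ext, rule dd_eq[OF has_derivative_mult_right[OF smooth_has_derivative[OF s]]])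
  also have "dd v (%z. f (par_inv s z0 z)) = (%z. dd (L v) f (par_inv s z0 z))" unfolding e by (rule dd_affine[OF f L])
  finally show ?thesis .
 qed
 have "L dir_t = (1 / s^2) *\<^sub>R dir_t" "L (dir_x i) = (1 / s) *\<^sub>R dir_x i" by (simp_all add: L_def dir_t_def dir_x_def)
 thus "dd dir_t (%z. h * f (par_inv s z0 z)) = (%z. (h / s^2) * dd dir_t f (par_inv s z0 z))"
  "dd (dir_x i) (%z. h * f (par_inv s z0 z)) = (%z. (h / s) * dd (dir_x i) f (par_inv s z0 z))" unfolding D by (simp_all add: dd_scaleR[OF f])
qed

lemma par_cube_in_open:
 fixes z :: "(real^'n) * real"
 assumes U: "open U" "z : U" shows "EX r>0. par_cube r z <= U"
proof -
 obtain e where e: "e > 0" "ball z e <= U" using U by (auto simp: open_contains_ball)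
 define r where "r = min 1 (e / (real CARD('n) + 1))"
 have r: "r > 0" "r <= 1" using e by (auto simp: r_def)
 have "r <= e / (real CARD('n) + 1)" by (simp add: r_def)
 hence r3: "(real CARD('n) + 1) * r <= e" by (simp add: pos_le_divide_eq mult.commute add_pos_nonneg)
 have "par_cube r z <= ball z e"
 proof clarify
  fix x t assume h: "(x, t) : par_cube r z"
  have "norm ((x, t) - z) <= norm (x - fst z) + norm (t - snd z)" using norm_Pair_le[of "x - fst z" "t - snd z"] by (simp add: minus_prod_def)
  also have "norm (x - fst z) <= (SUM i:UNIV. abs ((x - fst z) $ i))" by (rule norm_le_l1_cart)
  also have "(SUM i:UNIV. abs ((x - fst z) $ i)) <= (SUM i:(UNIV :: 'n set). r)" using h by (intro sum_mono) (auto simp: par_cube_def less_imp_le)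
  also have "norm (t - snd z) < r^2" using h by (auto simp: par_cube_def)
  also have "r^2 <= r" using r by (simp add: power2_eq_square mult_left_le)
  finally show "(x, t) : ball z e" using r3 by (simp add: dist_norm norm_minus_commute algebra_simps)
 qed
 thus ?thesis using e r by blast
qed

text \<open>\<open>z0\<close> is the centre of the bottom face. The half-open faces make the dyadic
  children a partition.\<close>

definition cell :: "real => (real^'n) * real => 'n pt set" where
 "cell s z0 = {z. (ALL i. fst z0 $ i - s / 2 <= fst z $ i & fst z $ i < fst z0 $ i + s / 2) & snd z0 < snd z & snd z <= snd z0 + s^2}"

text \<open>The part of space-time on which a function must be nonnegative for the comparison.
  Stopping at \<open>te\<close> keeps the argument causal: nothing is asked of the function after
  the time of interest.\<close>

definition dom :: "real => real => (real^'n) * real => real => 'n pt set" where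
 "dom L s z0 te = {z. (ALL i. abs (fst z $ i - fst z0 $ i) < L * s) & snd z0 <= snd z & snd z <= te}"

definition base :: "real => real^'n => (real^'n) set" where
 "base s x0 = {x. ALL i. x0 $ i - s / 2 <= x $ i & x $ i < x0 $ i + s / 2}"

lemma cell_eq: "cell s z = base s (fst z) \<times> {snd z<..snd z + s^2}" by (auto simp: cell_def base_def)

lemma base_sets [measurable]: "(base s x :: (real^'n) set) : sets borel"
proof -
 have "base s x = (\<Inter>i. {y. x $ i - s / 2 <= y $ i}) Int (\<Inter>i. {y. y $ i < x $ i + s / 2})" by (auto simp: base_def)
 moreover have "{y :: real^'n. x $ i - s / 2 <= y $ i} : sets borel" "{y :: real^'n. y $ i < x $ i + s / 2} : sets borel" for i
  by (intro borel_closed closed_Collect_le continuous_intros) (intro borel_open open_Collect_less continuous_intros)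
 ultimately show ?thesis by (simp add: sets.finite_INT sets.Int)
qed

lemma cell_sets [measurable]: "(cell s z0 :: ((real^'n) * real) set) : sets borel" unfolding cell_eq by (intro borel_Times) auto

lemma dom_sets [measurable]: "(dom L s z0 te :: ((real^'n) * real) set) : sets borel"
proof -
 have "dom L s z0 te = {x. ALL i. abs (x $ i - fst z0 $ i) < L * s} \<times> {snd z0..te}" by (auto simp: dom_def)
 thus ?thesis by (simp only:) (intro borel_Times borel_open[OF open_cube_at]; simp)
qed

lemma paraboloid_entry:
 assumes s: "s > 0" and "0 <= paraboloid (par_inv s z0 z)"
 shows "(fst z $ i - fst z0 $ i)^2 <= s^2 * (snd (par_inv s z0 z) / 4 - paraboloid (par_inv s z0 z))"
proof -
 let ?x = "fst (par_inv s z0 z)"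
 have "(?x $ i)^2 <= ?x \<bullet> ?x" unfolding inner_vec_def power2_eq_square using member_le_sum[of i UNIV "%i. ?x $ i * ?x $ i"] by simp
 hence "s^2 * (?x $ i)^2 <= s^2 * (?x \<bullet> ?x)" by (rule mult_left_mono) simp
 thus ?thesis using s unfolding power_mult_distrib[symmetric] paraboloid_def by (simp add: par_inv_def)
qed

text \<open>\<open>m\<close> and \<open>F\<close> stand for |mu| and |f|, as nonnegative Borel
  functions on the whole space; \<open>M\<close> and \<open>Fp\<close> bound integrals of their q-th
  and p-th powers, not norms.\<close>

locale pucci_drift =
 fixes lam Lam p1 p q :: real and Q :: "((real^'n) * real) set" and m F :: "'n pt => real" and M Fp N :: real
 assumes N: "N = real CARD('n) + 2" and abp: "ABP_exponent TYPE('n) lam Lam p1" and p: "p > p1" "p <= q" and q: "q > real CARD('n) + 2" and l: "0 < lam" "lam <= Lam"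
  and m[measurable]: "m : borelf" and m0: "!!z. m z >= 0" and mq: "(NN z. ennreal (m z powr q)) <= ennreal M" and M: "M >= 0"
  and F[measurable]: "F : borelf" and F0: "!!z. F z >= 0" and FFp: "(NN z. ennreal (F z powr p)) <= ennreal Fp" and Fp: "Fp >= 0"
begin

abbreviation super where "super v \<equiv> pucci_super lam Lam p Q m F v"

text \<open>At a negative minimum of v minus the test function the barrier is positive, because v >=
  0 >= w. So the point is off the lateral boundary and after the initial time, and a past cylinder
  at it stays in the region. There the forcing pays for the drift on the barrier, for F and for the
  error before time 1, and n0 h / s^2 remains for strictness.\<close>

lemma touching:
 assumes T: "T >= 1" and bar: "!!z :: (real^'n) * real. 0 <= paraboloid z ==> 0 <= snd z ==> snd z <= T ==>
  barrier_bounds lam Lam k K z"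
  and K: "K > 0" and v: "super v" and s: "s > 0" and h: "h > 0" and n0: "n0 > 0" and L: "L > T" and dQ: "dom L s z0 te <= Q"
  and v0: "!!z. z : dom L s z0 te ==> 0 <= v z"
  and j: "jet w wt w1 w2" and w: "continuous_on UNIV w" "!!z. w z <= 0" and fin: "jint p w wt w1 w2 < \<infinity>"
  and eq: "jet_eq lam Lam {z. 0 <= paraboloid (par_inv s z0 z) & 0 <= snd (par_inv s z0 z) & snd (par_inv s z0 z) <= T} m
   (%z. m z * (K * h / s) + F z + n0 * h / s^2 + (if z : cell s z0 & v z < h then K * h / s^2 else 0)) wt w1 w2"
  and z: "0 <= paraboloid (par_inv s z0 z)" "0 <= snd (par_inv s z0 z)" "snd (par_inv s z0 z) <= T" "snd z <= te"
 shows "h * barrier k (par_inv s z0 z) + w z <= v z"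
proof -
 define ze where "ze = par_inv s z0"
 define b where "b z = h * barrier k (ze z)" for z
 define Ph where "Ph z = v z - (b z + w z)" for z
 define E where "E = {z. 0 <= paraboloid (ze z) & 0 <= snd (ze z) & snd (ze z) <= T & snd z <= te}"
 note sm = barrier_derivatives(4)[of k, where 'n='n]
 have bs: "smooth b" unfolding b_def[abs_def] ze_def by (rule dd_par_inv(1)[OF sm])
 have zec: "continuous_on UNIV ze" unfolding ze_def par_inv_def using s by (intro continuous_intros) auto
 have pc: "continuous_on UNIV (%z. paraboloid (ze z))" unfolding paraboloid_def by (intro continuous_intros zec) auto
 have tc: "continuous_on UNIV (%z. snd (ze z))" by (intro continuous_intros zec)
 have t: "snd (ze z) = (snd z - snd z0) / s^2" for z by (simp add: ze_def par_inv_def)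
 have entry: "abs (fst z $ i - fst z0 $ i) < L * s" if "0 <= paraboloid (ze z)" "snd (ze z) <= T" for z i
 proof -
  have "(fst z $ i - fst z0 $ i)^2 <= s^2 * (snd (ze z) / 4 - paraboloid (ze z))" using paraboloid_entry[OF s] that by (simp add: ze_def)
  also have "... <= s^2 * T" using that T by (intro mult_left_mono) auto
  also have "... <= s^2 * T^2" using T by (intro mult_left_mono) (auto simp: power2_eq_square)
  finally have "abs (fst z $ i - fst z0 $ i) <= T * s" using s T by (simp add: power_mult_distrib[symmetric] abs_le_square_iff[symmetric] mult.commute)
  also have "... < L * s" using L s by simp
  finally show ?thesis .
 qed
 have Ed: "E <= dom L s z0 te"
 proof
  fix z assume "z : E"
  thus "z : dom L s z0 te" using entry[of z] s by (auto simp: E_def dom_def t zero_le_divide_iff)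
 qed
 have "compact E"
 proof (rule compact_eq_bounded_closed[THEN iffD2], rule conjI)
  have "E <= cbox (\<chi> i. fst z0 $ i - L * s, snd z0) (\<chi> i. fst z0 $ i + L * s, te)"
  proof
   fix z assume "z : E"
   hence d: "z : dom L s z0 te" using Ed by blast
   have "fst z0 $ i - L * s <= fst z $ i & fst z $ i <= fst z0 $ i + L * s" for i
   proof -
    have "abs (fst z $ i - fst z0 $ i) < L * s" using d by (auto simp: dom_def)
    thus ?thesis by linarith
   qed
   thus "z : cbox (\<chi> i. fst z0 $ i - L * s, snd z0) (\<chi> i. fst z0 $ i + L * s, te)"
    unfolding mem_box ball_Basis_dir inner_dir using d by (simp add: dom_def)
  qed
  thus "bounded E" by (rule bounded_subset[OF bounded_cbox])
  have "closed {z :: 'n pt. snd z <= te}" by (intro closed_Collect_le continuous_intros)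
  moreover have "closed {z. 0 <= paraboloid (ze z)}" "closed {z. 0 <= snd (ze z)}" "closed {z. snd (ze z) <= T}" using pc tc by (auto intro!: closed_Collect_le)
  ultimately show "closed E" unfolding E_def by (intro closed_Collect_conj)
 qed
 moreover have zE: "z : E" using z by (simp add: E_def ze_def)
 moreover have cv: "continuous_on (dom L s z0 te) v" using v dQ continuous_on_subset by (auto simp: pucci_super_def)
 hence "continuous_on E Ph" unfolding Ph_def using Ed
  by (intro continuous_intros smooth_continuous_on bs continuous_on_subset[OF cv] continuous_on_subset[OF w(1)]) auto
 ultimately obtain a where a: "a : E" and amin: "!!y. y : E ==> Ph a <= Ph y" using continuous_attains_inf[of E Ph] by blast
 have "Ph a >= 0"
 proof (rule ccontr)
  assume "~ ?thesis"
  hence neg: "Ph a < 0" by simp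
  have aQ: "a : dom L s z0 te" using a Ed by blast
  have va: "0 <= v a" using v0 aQ by blast
  have aE: "0 <= paraboloid (ze a)" "0 <= snd (ze a)" "snd (ze a) <= T" using a by (auto simp: E_def)
  have ba: "v a < b a" using neg w(2)[of a] by (simp add: Ph_def)
  have pa: "paraboloid (ze a) > 0"
  proof (rule ccontr)
   assume "~ ?thesis"
   hence "b a = 0" using aE(1) by (simp add: b_def barrier_def)
   thus False using ba va by simp
  qed
  have ta: "snd (ze a) > 0" using pa unfolding paraboloid_def using inner_ge_zero[of "fst (ze a)"] by linarith
  \<comment> \<open>Since the barrier is at most 1/2, v < h holds at the contact point and, by
    continuity, near it; this switches on the forcing on the cell.\<close>
  have "b a <= h * (1 / 2)" unfolding b_def using bar[OF aE] h by (intro mult_left_mono) auto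
  hence vh: "v a < h" using ba h by linarith
  obtain U where U: "open U" "a : U" "!!y. y : U ==> y : dom L s z0 te ==> v y < h"
  proof -
   have "openin (top_of_set (dom L s z0 te)) {z : dom L s z0 te. v z < h}" using continuous_openin_preimage_gen[OF cv, of "{..<h}"] by (simp add: vimage_def Int_def)
   then obtain U where "open U" "{z : dom L s z0 te. v z < h} = dom L s z0 te Int U" unfolding openin_open by blast
   thus ?thesis using that aQ vh by blast
  qed
  define W where "W = U Int {y. 0 < paraboloid (ze y)} Int {y. 0 < snd (ze y)} Int (if snd (ze a) > 1 then {y. 1 < snd (ze y)} else UNIV)"
  have "open {y. 0 < paraboloid (ze y)}" "open {y. 0 < snd (ze y)}" "open {y. 1 < snd (ze y)}" by (intro open_Collect_less pc tc continuous_intros)+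
  hence "open W" "a : W" unfolding W_def using U pa ta by auto
  then obtain r where r: "r > 0" "par_cube r a <= W" using par_cube_in_open by blast
  have past: "y : E" "snd (ze y) <= snd (ze a)" if y: "y : par_cube r a" for y
  proof -
   have "snd y <= snd a" using y by (auto simp: par_cube_def)
   thus le: "snd (ze y) <= snd (ze a)" using s by (simp add: t divide_right_mono)
   have "y : W" using y r by blast
   thus "y : E" using le aE(3) \<open>snd y <= snd a\<close> a by (auto simp: E_def W_def)
  qed
  have J: "Lp_jet p (%z. b z + w z) (%z. dd dir_t b z + wt z) (%k z. dd (dir_x k) b z + w1 k z) (%k l z. dd (dir_x k) (dd (dir_x l) b) z + w2 k l z)"
   unfolding Lp_jet_def using bs j w(1) fin by blast
  have D1: "dd (dir_x i) b = (%z. (h / s) * dd (dir_x i) (barrier k) (ze z))" for i unfolding b_def[abs_def] ze_def by (rule dd_par_inv(3)[OF sm])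
  have D2: "dd (dir_x i) (dd (dir_x i') b) = (%z. (h / s^2) * dd (dir_x i) (dd (dir_x i') (barrier k)) (ze z))" for i i'
  proof -
   have "dd (dir_x i) (dd (dir_x i') b) = (%z. (h / s / s) * dd (dir_x i) (dd (dir_x i') (barrier k)) (ze z))"
    unfolding D1 unfolding ze_def by (rule dd_par_inv(3)[OF smooth_dd[OF sm]])
   thus ?thesis by (simp add: power2_eq_square)
  qed
  have Dt: "dd dir_t b = (%z. (h / s^2) * dd dir_t (barrier k) (ze z))" unfolding b_def[abs_def] ze_def by (rule dd_par_inv(2)[OF sm])
  have "AE y in lebesgue. y : par_cube r a -->
    (dd dir_t b y + wt y) + pucci_plus lam Lam (\<chi> k l. dd (dir_x k) (dd (dir_x l) b) y + w2 k l y) + m y * (SUM k:UNIV. abs (dd (dir_x k) b y + w1 k y)) + F y <= - (n0 * h / s^2)"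
   using AE_completion[OF eq[unfolded jet_eq_def]]
  proof eventually_elim
   case (elim y)
   show ?case
   proof
    assume y: "y : par_cube r a"
    define cy where "cy = (if y : cell s z0 & v y < h then K * h / s^2 else 0)"
    have yE: "0 <= paraboloid (ze y)" "0 <= snd (ze y)" "snd (ze y) <= T" "snd y <= te" using past(1)[OF y] by (auto simp: E_def)
    have yW: "y : W" using y r by blast
    have e: "wt y + PP lam Lam w2 y + m y * (SUM k:UNIV. abs (w1 k y)) <= - (m y * (K * h / s) + F y + n0 * h / s^2 + cy)"
     using elim yE unfolding cy_def ze_def by blast
    have B: "dd dir_t (barrier k) (ze y) + pucci_plus lam Lam (hess (barrier k) (ze y)) <= (if snd (ze y) < 1 then K else 0)"
     "(SUM i:UNIV. abs (dd (dir_x i) (barrier k) (ze y))) <= K" using bar[OF yE(1-3)] by blast+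
    \<comment> \<open>Before time 1 the point lies in the cell by the slope of the paraboloid, and v
      < h there, so the indicator term covers the error of the barrier.\<close>
    have "(h / s^2) * (if snd (ze y) < 1 then K else 0) <= cy"
    proof (cases "snd (ze y) < 1")
     case True
     hence "snd (ze a) <= 1" using yW by (auto simp: W_def split: if_splits)
     have "v y < h" by (rule U(3)) (use yW past(1)[OF y] Ed in "auto simp: W_def")
     moreover have "y : cell s z0"
     proof -
      have "fst z0 $ i - s / 2 <= fst y $ i & fst y $ i < fst z0 $ i + s / 2" for i
      proof -
      have "(fst y $ i - fst z0 $ i)^2 <= s^2 * (snd (ze y) / 4 - paraboloid (ze y))" using paraboloid_entry[OF s] yE by (simp add: ze_def)
      also have "... < s^2 * (1 / 4)" using yW True s by (intro mult_strict_left_mono) (auto simp: W_def)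
      also have "... = (s / 2)^2" by (simp add: power_divide)
      finally have "abs (fst y $ i - fst z0 $ i) < s / 2" using s power2_less_imp_less[of "abs (fst y $ i - fst z0 $ i)" "s / 2"] by simp
      thus ?thesis by linarith
      qed
      moreover have "snd z0 < snd y & snd y <= snd z0 + s^2"
      proof -
      have "0 < (snd y - snd z0) / s^2" "(snd y - snd z0) / s^2 < 1" using yW True by (auto simp: W_def t)
      thus ?thesis using s by (simp add: zero_less_divide_iff)
      qed
      ultimately show ?thesis unfolding cell_def by simp
     qed
     ultimately show ?thesis using True by (simp add: cy_def mult.commute)
    qed (use K h in "simp add: cy_def")
    moreover have "dd dir_t b y + pucci_plus lam Lam (\<chi> k l. dd (dir_x k) (dd (dir_x l) b) y) <= (h / s^2) * (if snd (ze y) < 1 then K else 0)"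
    proof -
     have "(\<chi> k' l. dd (dir_x k') (dd (dir_x l) b) y) = (h / s^2) *\<^sub>R (hess (barrier k) (ze y))" by (simp add: vec_eq_iff D2)
     hence "pucci_plus lam Lam (\<chi> k l. dd (dir_x k) (dd (dir_x l) b) y) <= (h / s^2) * pucci_plus lam Lam (hess (barrier k) (ze y))"
      using pucci_plus_scale_le[OF l, of "h / s^2"] h by simp
     moreover have "(h / s^2) * (dd dir_t (barrier k) (ze y) + pucci_plus lam Lam (hess (barrier k) (ze y))) <= (h / s^2) * (if snd (ze y) < 1 then K else 0)"
      using h by (intro mult_left_mono B) simp
     ultimately show ?thesis by (simp only: Dt distrib_left)
    qed
    moreover have "pucci_plus lam Lam (\<chi> k l. dd (dir_x k) (dd (dir_x l) b) y + w2 k l y) <= pucci_plus lam Lam (\<chi> k l. dd (dir_x k) (dd (dir_x l) b) y) + PP lam Lam w2 y"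
    proof -
     have "(\<chi> k l. dd (dir_x k) (dd (dir_x l) b) y + w2 k l y) = (\<chi> k l. dd (dir_x k) (dd (dir_x l) b) y) + (\<chi> k l. w2 k l y)" by (simp add: vec_eq_iff)
     thus ?thesis using pucci_plus_add[OF l] by simp
    qed
    moreover have "m y * (SUM k:UNIV. abs (dd (dir_x k) b y + w1 k y)) <= m y * (K * h / s) + m y * (SUM k:UNIV. abs (w1 k y))"
    proof -
     have "(SUM k:UNIV. abs (dd (dir_x k) b y + w1 k y)) <= (SUM i:UNIV. abs (dd (dir_x i) b y)) + (SUM k:UNIV. abs (w1 k y))"
      unfolding sum.distrib[symmetric] by (intro sum_mono abs_triangle_ineq)
     moreover have "(SUM i:UNIV. abs (dd (dir_x i) b y)) = (h / s) * (SUM i:UNIV. abs (dd (dir_x i) (barrier k) (ze y)))"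
      using h s by (simp add: D1 abs_mult sum_distrib_left)
     moreover have "(h / s) * (SUM i:UNIV. abs (dd (dir_x i) (barrier k) (ze y))) <= (h / s) * K" using h s by (intro mult_left_mono B) simp
     ultimately show ?thesis unfolding distrib_left[symmetric] using m0 by (intro mult_left_mono) (auto simp: mult_ac)
    qed
    ultimately show "(dd dir_t b y + wt y) + pucci_plus lam Lam (\<chi> k l. dd (dir_x k) (dd (dir_x l) b) y + w2 k l y) + m y * (SUM k:UNIV. abs (dd (dir_x k) b y + w1 k y)) + F y <= - (n0 * h / s^2)"
     using e by linarith
   qed
  qed
  moreover have "a : Q" "par_cube r a <= Q" using past(1) Ed dQ aQ by blast+
  moreover have "0 < n0 * h / s^2" using n0 h s by simp
  ultimately obtain y where "y : par_cube r a" "v y - (b y + w y) < v a - (b a + w a)" using v J r(1) unfolding pucci_super_def by blast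
  thus False using amin[OF past(1)] unfolding Ph_def by fastforce
 qed
 hence "0 <= Ph z" using amin[OF zE] by linarith
 thus ?thesis by (simp add: Ph_def b_def ze_def)
qed
end

text \<open>Bookkeeping for the four parts of the forcing: bad set, drift on the barrier, F, and
  strictness. Each gets the share A h^p, and A is c^p divided by four times their common constant
  plus one.\<close>

lemma forcing_power_bound:
 fixes s h :: real
 assumes s: "s > 0" and h: "h > 0" and p: "p > 0" and L: "L > 0" and K: "K > 0" and V: "V >= 0" and M: "M >= 0" and C: "C >= 0" and n0: "n0 > 0" and d: "d >= 0" and c: "c > 0"
  and A: "A = c powr p / (4 * (C * L powr (2 * p - N) * 4 powr p + 1))"
  and e: "K powr p * d <= A" "K powr p * s powr (p - N * p / q) * (L powr N * V + M) <= A" "s powr (2 * p - N) * Fp <= A * h powr p" "n0 powr p * (L powr N * V) <= A"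
 shows "C * (L * s) powr (2 * p - N) * (4 powr p * ((K * h / s^2) powr p * (d * s powr N) + (K * h / s) powr p * (s powr (N - N * p / q) * (L powr N * V + M))
  + Fp + (n0 * h / s^2) powr p * (L powr N * s powr N * V))) <= (c * h) powr p"
proof -
 define W where "W = L powr N * V"
 define B where "B = C * L powr (2 * p - N) * 4 powr p"
 have B: "B >= 0" using C by (simp add: B_def)
 have A0: "A > 0" unfolding A B_def[symmetric] using B c by (simp add: add_nonneg_pos)
 have s2: "(s^2) powr p = s powr (2 * p)" using s by (simp add: powr_powr flip: powr_numeral)
 have D: "(x * h / s^2) powr p = x powr p * h powr p / s powr (2 * p)" for x by (simp add: powr_divide powr_mult s2)
 have t1: "s powr (2 * p - N) * ((K * h / s^2) powr p * (d * s powr N)) = h powr p * (K powr p * d)" unfolding D using s by (simp add: powr_diff)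
 have t4: "s powr (2 * p - N) * ((n0 * h / s^2) powr p * (L powr N * s powr N * V)) = h powr p * (n0 powr p * W)" unfolding D using s by (simp add: powr_diff W_def)
 have "s powr (2 * p - N) * s powr (N - N * p / q) / s powr p = s powr (p - N * p / q)" unfolding powr_add[symmetric] powr_diff[symmetric] by simp
 hence "s powr (2 * p - N) * s powr (N - N * p / q) = s powr (p - N * p / q) * s powr p" using s by (simp add: field_simps)
 hence t2: "s powr (2 * p - N) * ((K * h / s) powr p * (s powr (N - N * p / q) * (W + M))) = h powr p * (K powr p * s powr (p - N * p / q) * (W + M))"
  using s by (simp add: powr_divide powr_mult field_simps)
 have "C * (L * s) powr (2 * p - N) * (4 powr p * ((K * h / s^2) powr p * (d * s powr N) + (K * h / s) powr p * (s powr (N - N * p / q) * (W + M))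
  + Fp + (n0 * h / s^2) powr p * (L powr N * s powr N * V)))
  = B * (s powr (2 * p - N) * ((K * h / s^2) powr p * (d * s powr N)) + s powr (2 * p - N) * ((K * h / s) powr p * (s powr (N - N * p / q) * (W + M)))
  + s powr (2 * p - N) * Fp + s powr (2 * p - N) * ((n0 * h / s^2) powr p * (L powr N * s powr N * V)))" by (simp add: B_def powr_mult algebra_simps)
 also have "... = B * (h powr p * (K powr p * d) + h powr p * (K powr p * s powr (p - N * p / q) * (W + M)) + s powr (2 * p - N) * Fp + h powr p * (n0 powr p * W))"
  unfolding t1 t2 t4 ..
 also have "... <= B * (h powr p * A + h powr p * A + h powr p * A + h powr p * A)"
  using e by (intro mult_left_mono[OF _ B] add_mono mult_left_mono) (auto simp: W_def mult.commute)
 also have "... = 4 * B * A * h powr p" by simp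
 also have "... <= 4 * (B + 1) * A * h powr p" using A0 by (intro mult_right_mono) auto
 also have "4 * (B + 1) * A = c powr p" unfolding A B_def[symmetric] using B by simp
 finally show ?thesis by (simp add: powr_mult W_def)
qed

section \<open>Growth of nonnegative functions from a small bad set\<close>

lemma four_powr:
 fixes a b c d :: real
 assumes "a >= 0" "b >= 0" "c >= 0" "d >= 0" "p > 0"
 shows "(a + b + c + d) powr p <= 4 powr p * (a powr p + b powr p + c powr p + d powr p)"
proof -
 define x where "x = (%i::nat. if i = 0 then a else if i = 1 then b else if i = 2 then c else d)"
 have "(SUM i:{0,1,2,3}. x i) powr p <= real (card {0::nat,1,2,3}) powr p * (SUM i:{0,1,2,3}. x i powr p)" by (rule sum_powr_le) (use assms in "auto simp: x_def")
 thus ?thesis by (simp add: x_def add.assoc)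
qed

lemma core_emeasure: "evol (core :: ((real^'n) * real) set) = ennreal (vol (core :: 'n pt set))"
proof -
 have "bounded (core :: 'n pt set)" by (rule bounded_subset[OF bounded_box core_subset[unfolded core_box_def]])
 thus ?thesis using emeasure_bounded_finite by (intro emeasure_eq_ennreal_measure) (simp add: less_top)
qed

context pucci_drift begin

text \<open>These exponents are the positive powers of the scale on which all smallness rests: 2p >
  N follows from p > p1 >= N/2, and p > N p/q from q > N.\<close>

lemma p_pos: "p >= 1" "2 * p - N > 0" "q > 0" "p - N * p / q > 0"
proof -
 show "p >= 1" "2 * p - N > 0" using abp p unfolding ABP_exponent_def N by auto
 show "q > 0" using q by simp
 have "N / q < 1" using q by (simp add: N)
 hence "p * (N / q) < p * 1" using \<open>p >= 1\<close> by (intro mult_strict_left_mono) auto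
 thus "p - N * p / q > 0" by (simp add: mult.commute)
qed

text \<open>The threshold s^(-N/q) makes both parts of the Young splitting scale like s^(N -
  Np/q).\<close>

lemma drift_integral:
 assumes s: "s > 0" and D[measurable]: "D : sets borel" and eD: "evol D = ennreal (L powr N * s powr N * V)" and V: "V >= 0"
 shows "(NN z. indicator D z * ennreal (m z powr p)) <= ennreal (s powr (N - N * p / q) * (L powr N * V + M))"
proof -
 define l where "l = s powr (- (N / q))"
 have l: "l > 0" using s by (simp add: l_def)
 have "(NN z. indicator D z * ennreal (m z powr p)) <= (NN z. ennreal (l powr p) * indicator D z + ennreal (l powr (p - q)) * ennreal (m z powr q))"
 proof (rule nn_integral_mono)
  fix z
  have "m z powr p <= l powr p + l powr (p - q) * m z powr q" using powr_young[OF m0[of z] l] p_pos(1) p(2) by simp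
  hence "ennreal (m z powr p) <= ennreal (l powr p) + ennreal (l powr (p - q)) * ennreal (m z powr q)"
   by (simp add: ennreal_mult[symmetric] ennreal_plus[symmetric] ennreal_leI del: ennreal_plus)
  thus "indicator D z * ennreal (m z powr p) <= ennreal (l powr p) * indicator D z + ennreal (l powr (p - q)) * ennreal (m z powr q)" by (simp add: indicator_def)
 qed
 also have "... = ennreal (l powr p) * evol D + ennreal (l powr (p - q)) * (NN z. ennreal (m z powr q))"
  by (subst nn_integral_add) (auto simp: nn_integral_cmult nn_integral_cmult_indicator)
 also have "... <= ennreal (l powr p) * ennreal (L powr N * s powr N * V) + ennreal (l powr (p - q)) * ennreal M"
  unfolding eD by (intro add_left_mono mult_left_mono mq) simp
 also have "... = ennreal (l powr p * (L powr N * s powr N * V) + l powr (p - q) * M)"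
  using V M by (simp add: ennreal_mult[symmetric] ennreal_plus[symmetric] del: ennreal_plus)
 also have "l powr p * (L powr N * s powr N * V) + l powr (p - q) * M = s powr (N - N * p / q) * (L powr N * V + M)"
 proof -
  have "- (N / q) * (p - q) = N - N * p / q" using p_pos(3) by (simp add: field_simps)
  hence a: "l powr p = s powr (- (N * p / q))" "l powr (p - q) = s powr (N - N * p / q)" unfolding l_def powr_powr by simp_all
  have "l powr p * s powr N = s powr (N - N * p / q)" unfolding a powr_add[symmetric] by simp
  hence "l powr p * (L powr N * s powr N * V) = s powr (N - N * p / q) * (L powr N * V)" by (metis mult.assoc mult.left_commute)
  thus ?thesis unfolding a(2) by (simp add: distrib_left)
 qed
 finally show ?thesis .
qed

text \<open>The condition on \<open>Fp\<close> is the scale-invariant way to say that F is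
  negligible at height h on size s: the strong solution it generates has p-th power of order
  s^(2p-N) Fp.\<close>

definition admissible where
 "admissible nu r0 L v s z0 h te \<longleftrightarrow> super v & 0 < s & s <= r0 & 0 < h & s powr (2 * p - N) * Fp <= nu * h powr p &
  dom L s z0 te <= Q & (ALL z:dom L s z0 te. 0 <= v z)"

text \<open>The last condition on z says that, in rescaled variables, the paraboloid is at least
  t/8, where the barrier has its lower bound.\<close>

definition grows where
 "grows T d c nu r0 L \<longleftrightarrow> (ALL v s z0 h te z. admissible nu r0 L v s z0 h te --> evol {z : cell s z0. v z < h} <= ennreal (d * s powr N) -->
  snd z <= te --> snd z0 + s^2 <= snd z --> snd z <= snd z0 + T * s^2 --> 8 * ((fst z - fst z0) \<bullet> (fst z - fst z0)) <= snd z - snd z0 --> c * h <= v z)"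

text \<open>The strong solution is asked to absorb all the forcing at once. A small bad set, a small
  scale and a small F make its modulus at most half of the lower bound c0 h of the barrier, and the
  other half remains for v.\<close>

lemma growth:
 assumes T: "T >= 1"
 shows "EX d>0. EX c>0. EX nu>0. EX r0>0. EX L>=1. grows T d c nu r0 L"
proof -
 define n where "n = real CARD('n)"
 have n: "n >= 1" using zero_less_card_finite[where 'a='n] unfolding n_def by linarith
 obtain k K c0 where K: "K > 0" and c0: "c0 > 0" and bar: "!!z :: (real^'n) * real. 0 <= paraboloid z ==> 0 <= snd z ==> snd z <= T ==>
  barrier_bounds lam Lam k K z &
  (1 <= snd z --> snd z / 8 <= paraboloid z --> c0 <= barrier k z)" using barrier_subsolution[OF l T, where 'n='n] by blast
 obtain r1 C where r1: "r1 > 0" and C: "C >= 0" and sol: "!!R z0 g G. 0 < R ==> R <= r1 ==> g : borelf ==> (ALL z. g z >= 0) ==>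
  (ALL z :: (real^'n) * real. par_inv R z0 z ~: core --> g z = 0) ==> G >= 0 ==> (NN z. ennreal (g z powr p)) <= ennreal G ==>
  (EX w wt w1 w2. neg_jet w wt w1 w2 & (ALL z. abs (w z) powr p <= C * R powr (2 * p - N) * G) &
   jet_eq lam Lam {z. par_inv R z0 z : core} m g wt w1 w2 & jint p w wt w1 w2 < \<infinity>)" using drift_solution[OF abp p q l m m0 mq, folded N] by blast
 define V where "V = vol (core :: ((real^'n) * real) set)"
 have V: "V >= 0" by (simp add: V_def)
 \<comment> \<open>In a cylinder of size R = L s the core has half-width R/(4n) >= T s and duration
   R^2/2 >= T s^2, so it contains the whole region of comparison.\<close>
 define L where "L = 4 * n * T + 1"
 define c where "c = c0 / 2"
 define A where "A = c powr p / (4 * (C * L powr (2 * p - N) * 4 powr p + 1))"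
 define X Y where "X = L powr N * V + 1" and "Y = L powr N * V + M + 1"
 have X: "X > 0" and Y: "Y > 0" unfolding X_def Y_def using V M by (intro add_nonneg_pos add_nonneg_nonneg mult_nonneg_nonneg; simp)+
 \<comment> \<open>Each constant settles one condition of \<open>forcing_power_bound\<close>:
   \<open>n0\<close> strictness, \<open>d\<close> the bad set, \<open>r2\<close> the drift; the
   remaining one is the assumption on F with nu = A.\<close>
 define n0 where "n0 = (A / X) powr (1 / p)"
 define d where "d = A / K powr p"
 define e where "e = p - N * p / q"
 define r2 where "r2 = (A / (K powr p * Y)) powr (1 / e)"
 define r0 where "r0 = min (r1 / L) r2"
 have nT: "n * T >= T" "n * T >= 1" using n T mult_mono[of 1 n 1 T] by auto
 have "L = 4 * (n * T) + 1" by (simp add: L_def)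
 hence L: "L > T" "L >= 1" "L > 0" using nT T by linarith+
 have c: "c > 0" using c0 by (simp add: c_def)
 have A: "A > 0" unfolding A_def using c C by (simp add: add_nonneg_pos)
 have pp: "p > 0" and e: "e > 0" using p_pos by (auto simp: e_def)
 have n0: "n0 > 0" unfolding n0_def using A X by simp
 have r2: "r2 > 0" unfolding r2_def using A Y K by simp
 have r0: "r0 > 0" unfolding r0_def using r1 r2 L by simp
 have d: "d > 0" unfolding d_def using A K by simp
 have cond4: "n0 powr p * (L powr N * V) <= A"
 proof -
  have "n0 powr p = A / X" unfolding n0_def powr_powr using pp A X by simp
  moreover have "A / X * (L powr N * V) <= A / X * X" using A X by (intro mult_left_mono) (auto simp: X_def)
  ultimately show ?thesis using X by simp
 qed
 have cond2: "K powr p * s powr e * (L powr N * V + M) <= A" if "0 < s" "s <= r0" for s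
 proof -
  have "s powr e <= r2 powr e" using that e by (intro powr_mono2) (auto simp: r0_def)
  also have "r2 powr e = A / (K powr p * Y)" unfolding r2_def powr_powr using e A Y K by simp
  finally have "s powr e * (K powr p * Y) <= A" using K Y by (simp add: pos_le_divide_eq)
  moreover have "s powr e * (K powr p * (L powr N * V + M)) <= s powr e * (K powr p * Y)" unfolding Y_def by (intro mult_left_mono) auto
  ultimately show ?thesis by (simp only: mult_ac)
 qed
 have main: "c * h <= v z"
  if v: "super v" and s: "0 < s" "s <= r0" and h: "0 < h" and sF: "s powr (2 * p - N) * Fp <= A * h powr p" and dQ: "dom L s z0 te <= Q"
   and v0: "ALL z:dom L s z0 te. 0 <= v z" and bad: "evol {z : cell s z0. v z < h} <= ennreal (d * s powr N)"
   and te: "snd z <= te" and z1: "1 <= snd (par_inv s z0 z)" and zT: "snd (par_inv s z0 z) <= T" and zp: "snd (par_inv s z0 z) / 8 <= paraboloid (par_inv s z0 z)"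
  for v s z0 h te and z :: "(real^'n) * real"
 proof -
  define R where "R = L * s"
  \<comment> \<open>The core starts at relative time 1/4; the shift lets it start at the time of
    \<open>z0\<close>.\<close>
  define z1 where "z1 = (fst z0, snd z0 - R^2 / 4)"
  define D where "D = {z. par_inv R z1 z : core}"
  define Bad where "Bad = {z : cell s z0. v z < h}"
  have R: "0 < R" "R <= r1"
  proof -
   have "s <= r1 / L" using s(2) by (simp add: r0_def)
   thus "0 < R" "R <= r1" unfolding R_def using s(1) L(3) by (simp_all add: pos_le_divide_eq mult.commute)
  qed
  have cd: "cell s z0 <= dom L s z0 te"
  proof
   fix y assume y: "y : cell s z0"
   have "1 <= (snd z - snd z0) / s^2" using that(10) by (simp add: par_inv_def)
   hence "snd y <= te" using y te s by (simp add: cell_def pos_le_divide_eq)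
   moreover have "abs (fst y $ i - fst z0 $ i) < L * s" for i
   proof -
    have "fst z0 $ i - s / 2 <= fst y $ i & fst y $ i < fst z0 $ i + s / 2" using y by (auto simp: cell_def)
    hence "abs (fst y $ i - fst z0 $ i) <= s / 2" by linarith
    also have "s / 2 < L * s" using s L mult_right_mono[of 1 L s] by linarith
    finally show ?thesis .
   qed
   ultimately show "y : dom L s z0 te" using y by (simp add: cell_def dom_def)
  qed
  have Bm[measurable]: "Bad : sets borel"
  proof -
   have "continuous_on (dom L s z0 te) v" using v dQ continuous_on_subset by (auto simp: pucci_super_def)
   hence "(%z. indicator (dom L s z0 te) z *\<^sub>R v z) : borelf" by (rule borel_measurable_continuous_on_indicator[OF dom_sets])
   hence "{z : space borel. indicator (dom L s z0 te) z *\<^sub>R v z < h} : sets borel" by (rule borel_measurable_less[OF _ borel_measurable_const])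
   hence "cell s z0 Int {z. indicator (dom L s z0 te) z *\<^sub>R v z < h} : sets borel" by auto
   moreover have "Bad = cell s z0 Int {z. indicator (dom L s z0 te) z *\<^sub>R v z < h}" using cd by (auto simp: Bad_def indicator_def)
   ultimately show ?thesis by simp
  qed
  have Dmem: "z : D" if "0 <= paraboloid (par_inv s z0 z)" "0 <= snd (par_inv s z0 z)" "snd (par_inv s z0 z) <= T" for z
  proof -
   have tz: "snd z - snd z0 = s^2 * snd (par_inv s z0 z)" using s by (simp add: par_inv_def)
   have R2: "R^2 = L^2 * s^2" by (simp add: R_def power_mult_distrib)
   have "2 * T <= L^2"
   proof -
    have "2 * T <= 4 * n * T" using nT by linarith
    also have "... <= L * 1" by (simp add: L_def)
    also have "... <= L * L" using L by (intro mult_left_mono) auto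
    finally show ?thesis by (simp add: power2_eq_square)
   qed
   hence "s^2 * (2 * T) <= R^2" unfolding R2 mult.commute[of "L^2"] by (intro mult_left_mono) auto
   moreover have "snd z - snd z0 <= s^2 * T" unfolding tz using that by (intro mult_left_mono) auto
   moreover have "snd z - snd z0 >= 0" unfolding tz using that by simp
   ultimately have time: "1 / 4 <= snd (par_inv R z1 z)" "snd (par_inv R z1 z) <= 3 / 4"
    unfolding par_inv_def z1_def snd_conv using R by (simp_all add: pos_le_divide_eq pos_divide_le_eq)
   have "abs (fst (par_inv R z1 z) $ i) <= 1 / (4 * n)" for i
   proof -
    have "(fst z $ i - fst z0 $ i)^2 <= s^2 * (snd (par_inv s z0 z) / 4 - paraboloid (par_inv s z0 z))" by (rule paraboloid_entry[OF s(1) that(1)])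
    also have "... <= s^2 * T^2"
    proof (rule mult_left_mono)
     have "T <= T^2" using T by (simp add: power2_eq_square)
     thus "snd (par_inv s z0 z) / 4 - paraboloid (par_inv s z0 z) <= T^2" using that by linarith
    qed simp
    finally have "abs (fst z $ i - fst z0 $ i) <= T * s" using s T by (simp add: power_mult_distrib[symmetric] abs_le_square_iff[symmetric] mult.commute)
    also have "T * s <= R * (1 / (4 * n))" using n s by (simp add: R_def L_def field_simps)
    finally have "abs (fst z $ i - fst z0 $ i) <= R * (1 / (4 * n))" .
    thus ?thesis using R by (simp add: par_inv_def z1_def abs_mult pos_divide_le_eq mult.commute)
   qed
   thus ?thesis using time by (simp add: D_def core_def n_def)
  qed
  have RN: "R ^ (CARD('n) + 2) = L powr N * s powr N" by (subst powr_realpow[OF R(1), symmetric]) (use s L in "simp add: R_def powr_mult N add.commute")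
  have im: "par_inv R z1 : borelf" unfolding par_inv_def[abs_def] using R by (intro borel_measurable_continuous_onI continuous_intros) auto
  have Dm[measurable]: "D : sets borel" using measurable_sets_borel[OF im core_sets] by (simp add: D_def vimage_def)
  have eD: "evol D = ennreal (L powr N * s powr N * V)"
  proof -
   have "evol D = (NN z. indicator D z)" by simp
   also have "... = ennreal (R ^ (CARD('n) + 2)) * (NN z. indicator D (par_map R z1 z))" by (rule nn_integral_par_map_lborel[OF R(1)]) simp
   also have "(%z. indicator D (par_map R z1 z)) = (indicator core :: _ => ennreal)" using R by (auto simp: fun_eq_iff indicator_def D_def par_map_inv)
   also have "(NN z. indicator (core :: ((real^'n) * real) set) z) = ennreal V" by (simp add: core_emeasure V_def)
   finally show ?thesis unfolding RN using V by (simp add: ennreal_mult)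
  qed
  define a1 a2 a4 where "a1 = K * h / s^2" and "a2 = K * h / s" and "a4 = n0 * h / s^2"
  have a: "a1 >= 0" "a2 >= 0" "a4 >= 0" using K h s n0 by (auto simp: a1_def a2_def a4_def)
  define f where "f z = m z * a2 + F z + a4 + (if z : cell s z0 & v z < h then a1 else 0)" for z
  define g where "g z = indicator D z * f z" for z
  have f: "f = (%z. m z * a2 + F z + a4 + a1 * indicator Bad z)" by (auto simp: f_def Bad_def indicator_def fun_eq_iff)
  have gm: "g : borelf" unfolding g_def[abs_def] f by measurable
  have f0: "f z >= 0" for z unfolding f using m0[of z] F0[of z] a by (intro add_nonneg_nonneg mult_nonneg_nonneg) auto
  define G where "G = 4 powr p * (a1 powr p * (d * s powr N) + a2 powr p * (s powr (N - N * p / q) * (L powr N * V + M)) + Fp + a4 powr p * (L powr N * s powr N * V))"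
  have gG: "(NN z. ennreal (g z powr p)) <= ennreal G"
  proof -
   have "(NN z. ennreal (g z powr p)) <= (NN z. ennreal (4 powr p) * (ennreal (a1 powr p) * indicator Bad z + ennreal (a2 powr p) * (indicator D z * ennreal (m z powr p)) + ennreal (F z powr p) + ennreal (a4 powr p) * indicator D z))"
   proof (rule nn_integral_mono)
    fix z
    have "f z powr p <= 4 powr p * ((m z * a2) powr p + F z powr p + a4 powr p + (a1 * indicator Bad z) powr p)"
     unfolding f using a m0[of z] F0[of z] pp by (intro four_powr mult_nonneg_nonneg) auto
    also have "(a1 * indicator Bad z) powr p = a1 powr p * indicator Bad z" using pp by (simp add: indicator_def)
    also have "(m z * a2) powr p = a2 powr p * m z powr p" by (simp add: powr_mult)
    finally have "ennreal (f z powr p) <= ennreal (4 powr p * (a2 powr p * m z powr p + F z powr p + a4 powr p + a1 powr p * indicator Bad z))" by (rule ennreal_leI)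
    also have "... = ennreal (4 powr p) * (ennreal (a1 powr p) * indicator Bad z + ennreal (a2 powr p) * ennreal (m z powr p) + ennreal (F z powr p) + ennreal (a4 powr p))"
     by (simp add: ennreal_mult ennreal_plus ennreal_indicator add_ac)
    finally show "ennreal (g z powr p) <= ennreal (4 powr p) * (ennreal (a1 powr p) * indicator Bad z + ennreal (a2 powr p) * (indicator D z * ennreal (m z powr p)) + ennreal (F z powr p) + ennreal (a4 powr p) * indicator D z)"
     using pp by (cases "z : D") (simp_all add: g_def)
   qed
   also have "... = ennreal (4 powr p) * (ennreal (a1 powr p) * evol Bad + ennreal (a2 powr p) * (NN z. indicator D z * ennreal (m z powr p)) + (NN z. ennreal (F z powr p)) + ennreal (a4 powr p) * evol D)"
    by (simp add: nn_integral_add nn_integral_cmult nn_integral_cmult_indicator)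
   also have "... <= ennreal (4 powr p) * (ennreal (a1 powr p) * ennreal (d * s powr N) + ennreal (a2 powr p) * ennreal (s powr (N - N * p / q) * (L powr N * V + M)) + ennreal Fp + ennreal (a4 powr p) * ennreal (L powr N * s powr N * V))"
    using bad eD FFp drift_integral[OF s(1) Dm eD V] by (intro mult_left_mono add_mono) (auto simp: Bad_def)
   also have "... = ennreal G" unfolding G_def using d V M Fp by (simp add: ennreal_mult'[symmetric] ennreal_plus[symmetric] del: ennreal_plus)
   finally show ?thesis .
  qed
  have G0: "G >= 0" unfolding G_def using d V M Fp by (intro mult_nonneg_nonneg add_nonneg_nonneg) auto
  obtain w wt w1 w2 where j: "jet w wt w1 w2" and w: "continuous_on UNIV w" "ALL z. w z <= 0" and wp: "ALL z. abs (w z) powr p <= C * R powr (2 * p - N) * G"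
   and je: "jet_eq lam Lam D m g wt w1 w2" and fin: "jint p w wt w1 w2 < \<infinity>"
  proof -
   have g0: "ALL z. 0 <= g z" unfolding g_def using f0 by simp
   have gc: "ALL z. par_inv R z1 z ~: core --> g z = 0" by (simp add: g_def D_def)
   show ?thesis using sol[OF R gm g0 gc G0 gG] that unfolding D_def by blast
  qed
  have "jet_eq lam Lam {z. 0 <= paraboloid (par_inv s z0 z) & 0 <= snd (par_inv s z0 z) & snd (par_inv s z0 z) <= T} m f wt w1 w2" using je unfolding jet_eq_def
  proof eventually_elim
   case (elim z)
   thus ?case using Dmem[of z] by (auto simp: g_def)
  qed
  hence eq: "jet_eq lam Lam {z. 0 <= paraboloid (par_inv s z0 z) & 0 <= snd (par_inv s z0 z) & snd (par_inv s z0 z) <= T} m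
   (%z. m z * (K * h / s) + F z + n0 * h / s^2 + (if z : cell s z0 & v z < h then K * h / s^2 else 0)) wt w1 w2" by (simp only: f_def[abs_def] a1_def a2_def a4_def)
  have z0': "0 <= paraboloid (par_inv s z0 z)" "0 <= snd (par_inv s z0 z)" using that(10) zp by linarith+
  have W0: "w y <= 0" for y using w(2) by blast
  have V0: "0 <= v y" if "y : dom L s z0 te" for y using v0 that by blast
  have bar': "barrier_bounds lam Lam k K z"
   if "0 <= paraboloid z" "0 <= snd z" "snd z <= T" for z :: "(real^'n) * real" using bar[OF that] by blast
  have "h * barrier k (par_inv s z0 z) + w z <= v z" by (rule touching[OF T bar' K v s(1) h n0 L(1) dQ V0 j w(1) W0 fin eq z0' zT te])
  moreover have "h * c0 <= h * barrier k (par_inv s z0 z)" using bar[OF z0' zT] that(10) zp h by (intro mult_left_mono) auto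
  moreover have "- (c * h) <= w z"
  proof -
   have "abs (w z) powr p <= C * R powr (2 * p - N) * G" using wp by blast
   also have "... <= (c * h) powr p" unfolding G_def R_def a1_def a2_def a4_def
    by (rule forcing_power_bound[OF s(1) h pp L(3) K V M C n0 less_imp_le[OF d] c A_def _ cond2[OF s, unfolded e_def] sF cond4])
     (use K in "simp add: d_def")
   finally have "abs (w z) <= c * h" using powr_less_mono2[of p "c * h" "abs (w z)"] pp c h by (force simp: not_le[symmetric])
   thus ?thesis by simp
  qed
  ultimately show ?thesis by (simp add: c_def field_simps)
 qed
 have "grows T d c A r0 L" unfolding grows_def
 proof (intro allI impI)
  fix v s z0 h te z
  assume a: "admissible A r0 L v s z0 h te" and e: "evol {z : cell s z0. v z < h} <= ennreal (d * s powr N)"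
   and z: "snd z <= te" "snd z0 + s^2 <= snd z" "snd z <= snd z0 + T * s^2" "8 * ((fst z - fst z0) \<bullet> (fst z - fst z0)) <= snd z - snd z0"
  have H: "super v" "0 < s" "s <= r0" "0 < h" "s powr (2 * p - N) * Fp <= A * h powr p" "dom L s z0 te <= Q" "ALL z:dom L s z0 te. 0 <= v z"
   using a unfolding admissible_def by blast+
  define I where "I = (fst z - fst z0) \<bullet> (fst z - fst z0)"
  have "paraboloid (par_inv s z0 z) = (snd z - snd z0) / s^2 / 4 - I / s^2" by (simp add: paraboloid_def par_inv_def I_def power2_eq_square)
  moreover have "8 * I / s^2 <= (snd z - snd z0) / s^2" using z(4) by (intro divide_right_mono) (auto simp: I_def)
  ultimately have P: "snd (par_inv s z0 z) / 8 <= paraboloid (par_inv s z0 z)" by (simp add: par_inv_def)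
  have "1 <= snd (par_inv s z0 z)" "snd (par_inv s z0 z) <= T" using z H(2) by (simp_all add: par_inv_def pos_le_divide_eq pos_divide_le_eq)
  thus "c * h <= v z" by (rule main[OF H e z(1) _ _ P])
 qed
 thus ?thesis using d c r0 A L(2) by blast
qed
end

section \<open>Coverings\<close>

text \<open>Induction removes the interval with the smallest left end and cuts the others off on the left at its right end, which preserves the hypothesis.\<close>

lemma interval_stack:
 fixes a m b :: "'i => real"
 assumes k: "0 <= k" "k <= 1" and fin: "finite I" and h: "!!i. i : I ==> a i <= m i & m i <= b i & m i - a i <= k * (b i - a i)"
 shows "ennreal (1 - k) * evol ((UN i:I. {a i<..b i}) Int {c<..}) <= evol ((UN i:I. {m i<..b i}) Int {c<..})" using fin h
proof (induction I arbitrary: c rule: finite_ranking_induct[where f="%i. - a i"])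
 case (insert x S)
 have hx: "a x <= m x" "m x <= b x" "m x - a x <= k * (b x - a x)" using insert.prems by auto
 have IH: "ennreal (1 - k) * evol ((UN i:S. {a i<..b i}) Int {c<..}) <= evol ((UN i:S. {m i<..b i}) Int {c<..})" for c using insert by auto
 have ms: "(UN i:S. {f i<..b i}) Int {c<..} : sets lborel" for c and f :: "'i => real" using insert(1) by auto
 show ?case
 proof (cases "b x <= c")
  case True
  hence "(UN i:insert x S. {f i<..b i}) Int {c<..} = (UN i:S. {f i<..b i}) Int {c<..}" for f :: "'i => real" by auto
  thus ?thesis using IH by simp
 next
  case False
  have key: "(1 - k) * (b x - max (a x) c) <= b x - max (m x) c"
  proof (cases "c <= m x")
   case True
   have "(1 - k) * (b x - max (a x) c) <= (1 - k) * (b x - a x)" using k by (intro mult_left_mono) auto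
   also have "... <= b x - m x" using hx(3) by (simp add: algebra_simps)
   finally show ?thesis using True by simp
  next
   case False': False
   have "(1 - k) * (b x - max (a x) c) <= 1 * (b x - max (a x) c)" using k False hx by (intro mult_right_mono) auto
   thus ?thesis using False' hx by simp
  qed
  have "(UN i:insert x S. {a i<..b i}) Int {c<..} <= {max (a x) c<..b x} Un (UN i:S. {a i<..b i}) Int {b x<..}" using insert(2) by (fastforce intro: le_less_trans)
  hence "evol ((UN i:insert x S. {a i<..b i}) Int {c<..}) <= evol ({max (a x) c<..b x} Un (UN i:S. {a i<..b i}) Int {b x<..})"
   using insert(1) by (intro emeasure_mono) auto
  also have "... <= evol {max (a x) c<..b x} + evol ((UN i:S. {a i<..b i}) Int {b x<..})" by (rule emeasure_subadditive) (use ms in auto)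
  also have "evol {max (a x) c<..b x} = ennreal (b x - max (a x) c)" using hx False by (intro emeasure_lborel_Ioc) auto
  finally have "ennreal (1 - k) * evol ((UN i:insert x S. {a i<..b i}) Int {c<..})
    <= ennreal (1 - k) * (ennreal (b x - max (a x) c) + evol ((UN i:S. {a i<..b i}) Int {b x<..}))" by (rule mult_left_mono) simp
  also have "... = ennreal ((1 - k) * (b x - max (a x) c)) + ennreal (1 - k) * evol ((UN i:S. {a i<..b i}) Int {b x<..})"
   using k hx False by (simp add: distrib_left ennreal_mult)
  also have "... <= ennreal (b x - max (m x) c) + evol ((UN i:S. {m i<..b i}) Int {b x<..})" by (intro add_mono IH ennreal_leI key)
  also have "ennreal (b x - max (m x) c) = evol {max (m x) c<..b x}" using hx False by (intro emeasure_lborel_Ioc[symmetric]) auto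
  also have "evol {max (m x) c<..b x} + evol ((UN i:S. {m i<..b i}) Int {b x<..})
   = evol ({max (m x) c<..b x} Un (UN i:S. {m i<..b i}) Int {b x<..})" by (rule plus_emeasure) (use ms in auto)
  also have "... <= evol ((UN i:insert x S. {m i<..b i}) Int {c<..})" using insert(1) False by (intro emeasure_mono) auto
  finally show ?thesis .
 qed
qed simp

text \<open>Fubini reduces the claim to time fibres, which are finite unions of intervals; the cut
  \<open>c\<close> of \<open>interval_stack\<close> is put below all left ends.\<close>

lemma stack_measure:
 fixes B :: "'i => (real^'n) set" and a m b :: "'i => real"
 assumes k: "0 <= k" "k <= 1" and fin: "finite I" and h: "!!i. i : I ==> a i <= m i & m i <= b i & m i - a i <= k * (b i - a i)"
  and B: "!!i. i : I ==> B i : sets borel"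
 shows "ennreal (1 - k) * evol (UN i:I. B i \<times> {a i<..b i}) <= evol (UN i:I. B i \<times> {m i<..b i})"
proof -
 have ms: "(UN i:I. B i \<times> {f i<..b i}) : sets (lborel \<Otimes>\<^sub>M lborel)" for f :: "'i => real"
  using fin B by (intro sets.finite_UN pair_measureI) auto
 have e: "evol (UN i:I. B i \<times> {f i<..b i}) = (NN x. evol (UN i:{i : I. x : B i}. {f i<..b i}))" for f :: "'i => real"
 proof -
  have "Pair x -` (UN i:I. B i \<times> {f i<..b i}) = (UN i:{i : I. x : B i}. {f i<..b i})" for x by auto
  thus ?thesis using lborel.emeasure_pair_measure_alt[OF ms[of f]] by (simp add: lborel_prod)
 qed
 have mm: "(%x. evol (UN i:{i : I. x : B i}. {a i<..b i})) : borel_measurable lborel"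
 proof -
  have "Pair x -` (UN i:I. B i \<times> {a i<..b i}) = (UN i:{i : I. x : B i}. {a i<..b i})" for x by auto
  thus ?thesis using lborel.measurable_emeasure_Pair[OF ms[of a]] by simp
 qed
 have "ennreal (1 - k) * evol (UN i:J. {a i<..b i}) <= evol (UN i:J. {m i<..b i})" if J: "J <= I" for J
 proof -
  have fJ: "finite J" using J fin finite_subset by blast
  define c where "c = Min (insert 0 (a ` J)) - 1"
  have c: "c < a i" if "i : J" for i
  proof -
   have "Min (insert 0 (a ` J)) <= a i" using that fJ by (intro Min_le) auto
   thus ?thesis by (simp add: c_def)
  qed
  have "(UN i:J. {f i<..b i}) Int {c<..} = (UN i:J. {f i<..b i})" if "!!i. i : J ==> a i <= f i" for f :: "'i => real"
   using c that by (fastforce intro: less_trans less_le_trans)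
  thus ?thesis using interval_stack[OF k fJ, of a m b c] h J by (auto simp: subset_iff)
 qed
 hence "(NN x. ennreal (1 - k) * evol (UN i:{i : I. x : B i}. {a i<..b i})) <= (NN x. evol (UN i:{i : I. x : B i}. {m i<..b i}))" by (intro nn_integral_mono) auto
 thus ?thesis unfolding e using nn_integral_cmult[OF mm] by simp
qed

section \<open>Parabolic dyadic cubes\<close>

definition sub :: "real => (real^'n) * real => real => 'n pt => bool" where
 "sub s' z' s z \<longleftrightarrow> (ALL i. fst z $ i - s / 2 <= fst z' $ i - s' / 2 & fst z' $ i + s' / 2 <= fst z $ i + s / 2) & snd z <= snd z' & snd z' + s'^2 <= snd z + s^2"

text \<open>Halving in space and quartering in time: the sign pattern \<open>fst k\<close> selects a
  spatial half in each coordinate and \<open>snd k\<close> below 4 the time layer.\<close>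

definition child :: "real => (real^'n) * real => ('n => bool) \<times> nat => 'n pt" where
 "child s z k = ((\<chi> i. fst z $ i + (if fst k i then s / 4 else - s / 4)), snd z + real (snd k) * (s / 2)^2)"

lemma sub_cell: "sub s' z' s z ==> cell s' z' <= cell s z" unfolding sub_def cell_def by (auto intro: order_trans less_le_trans le_less_trans)

lemma sub_trans: "sub s1 z1 s2 z2 ==> sub s2 z2 s3 z3 ==> sub s1 z1 s3 z3" unfolding sub_def by (meson order_trans)

lemma sub_refl: "sub s z s z" by (simp add: sub_def)

lemma child_sub: assumes "s > 0" "snd k < 4" shows "sub (s / 2) (child s z k) s z"
proof -
 have "real (snd k) + 1 <= 4" using assms(2) by linarith
 hence "(real (snd k) + 1) * (s / 2)^2 <= 4 * (s / 2)^2" by (rule mult_right_mono) simp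
 hence "real (snd k) * (s / 2)^2 + (s / 2)^2 <= s^2" by (simp add: algebra_simps power_divide)
 thus ?thesis using assms(1) by (auto simp: sub_def child_def)
qed

lemma child_cover:
 assumes s: "s > 0" and z: "z : cell s z0"
 shows "EX k. snd k < 4 & z : cell (s / 2) (child s z0 k)"
proof -
 define r where "r = (snd z - snd z0) / (s / 2)^2"
 have q: "(s / 2)^2 > 0" using s by simp
 have r: "0 < r" "r <= 4" unfolding r_def using z s by (auto simp: cell_def pos_divide_le_eq power_divide)
 define j where "j = nat (\<lceil>r\<rceil> - 1)"
 have j: "real j < r" "r <= real j + 1" "j < 4" unfolding j_def using r by (auto, linarith+)
 have "real j * (s / 2)^2 < snd z - snd z0" "snd z - snd z0 <= (real j + 1) * (s / 2)^2"
  using j q unfolding r_def by (simp_all only: pos_less_divide_eq pos_divide_le_eq)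
 hence t: "snd z0 + real j * (s / 2)^2 < snd z" "snd z <= snd z0 + real j * (s / 2)^2 + (s / 2)^2" by (simp_all add: algebra_simps)
 show ?thesis
 proof (intro exI[of _ "(%i. fst z0 $ i <= fst z $ i, j)"] conjI)
  show "z : cell (s / 2) (child s z0 (%i. fst z0 $ i <= fst z $ i, j))"
  proof -
   have zi: "fst z0 $ i - s / 2 <= fst z $ i & fst z $ i < fst z0 $ i + s / 2" for i using z by (auto simp: cell_def)
   have "(if fst z0 $ i <= fst z $ i then s / 4 else - s / 4) <= fst z $ i - fst z0 $ i + s / 4 &
    fst z $ i - fst z0 $ i - s / 4 < (if fst z0 $ i <= fst z $ i then s / 4 else - s / 4)" for i using zi[of i] by (simp split: if_split; linarith)
   thus ?thesis using t by (auto simp: cell_def child_def algebra_simps)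
  qed
 qed (use j in simp)
qed

lemma child_disjoint:
 assumes s: "s > 0" and z: "z : cell (s / 2) (child s z0 k)" "z : cell (s / 2) (child s z0 k')"
 shows "k = k'"
proof (rule prod_eqI)
 have "fst k i \<longleftrightarrow> fst z0 $ i <= fst z $ i" if "z : cell (s / 2) (child s z0 k)" for k i
 proof -
  have "fst (child s z0 k) $ i - s / 2 / 2 <= fst z $ i & fst z $ i < fst (child s z0 k) $ i + s / 2 / 2" using that by (auto simp: cell_def)
  thus ?thesis by (cases "fst k i") (simp_all add: child_def)
 qed
 thus "fst k = fst k'" using z by blast
 have t: "real (snd k) * (s / 2)^2 < snd z - snd z0 & snd z - snd z0 <= (real (snd k) + 1) * (s / 2)^2"
  if "z : cell (s / 2) (child s z0 k)" for k using that by (auto simp: cell_def child_def algebra_simps)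
 have q: "(s / 2)^2 > 0" using s by simp
 have "snd k <= snd k'" if "z : cell (s / 2) (child s z0 k)" "z : cell (s / 2) (child s z0 k')" for k k'
 proof -
  have "real (snd k) * (s / 2)^2 < (real (snd k') + 1) * (s / 2)^2" using t that by (meson less_le_trans)
  hence "real (snd k) < real (snd k') + 1" using q by (simp only: mult_less_cancel_right_pos)
  thus ?thesis by linarith
 qed
 thus "snd k = snd k'" using z by (meson order_antisym)
qed

lemma cell_finite: "evol (cell s z :: ((real^'n) * real) set) < \<infinity>"
proof -
 have "cell s z <= cbox (\<chi> i. fst z $ i - s / 2, snd z) (\<chi> i. fst z $ i + s / 2, snd z + s^2)"
  unfolding mem_box ball_Basis_dir inner_dir subset_iff by (simp add: cell_def less_imp_le)
 thus ?thesis by (rule emeasure_bounded_finite[OF bounded_subset[OF bounded_cbox]])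
qed

lemma cell_fmeasurable: "S : sets borel ==> S <= cell s z ==> S : fmeasurable lborel" by (rule fmeasurableI2[of "cell s z"]) (auto intro: fmeasurableI cell_finite)

text \<open>A is dense in some child: the parents of dense cubes are what the decomposition
  selects.\<close>

abbreviation ripe where
 "ripe A th s z \<equiv> EX k. snd k < 4 & th * vol (cell (s / 2) (child s z k)) <= vol (A Int cell (s / 2) (child s z k))"

text \<open>The assumption \<open>small\<close> takes the place of Lebesgue points: below the side
  \<open>et\<close>, a cube that meets B has high density. So after J halvings a cube of low density
  misses B and subdivision may stop, which keeps the family finite. Selected cubes have low density
  themselves; since children are disjoint, this adds up to the bound on the union.\<close>

lemma calderon_zygmund:
 fixes A B :: "((real^'n) * real) set"
 assumes A[measurable]: "A : sets borel"
  and small: "!!s z. 0 < s ==> s <= et ==> sub s z S Z ==> cell s z Int B ~= {} ==> th * vol (cell s z) <= vol (A Int cell s z)"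
  and s: "0 < s" "s <= 2 ^ J * et" and sub: "sub s z S Z" and bad: "vol (A Int cell s z) < th * vol (cell s z)"
 shows "EX P. finite P & (ALL (s', z'):P. 0 < s' & sub s' z' s z &
  ripe A th s' z') &
  B Int cell s z <= (\<Union>(s', z')\<in>P. cell s' z') & vol (A Int (\<Union>(s', z')\<in>P. cell s' z')) <= th * vol (\<Union>(s', z')\<in>P. cell s' z')"
 using s sub bad
proof (induction J arbitrary: s z)
 case 0
 have "cell s z Int B = {}" using small[of s z] 0 by force
 thus ?case by (intro exI[of _ "{}"]) auto
next
 case (Suc J)
 let ?U = "%P. \<Union>(s', z')\<in>P. cell s' z'"
 show ?case
 proof (cases "ripe A th s z")
  \<comment> \<open>A child is dense while the cube itself is not: it is selected and subdivision
    stops.\<close>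
  case True
  thus ?thesis using Suc.prems sub_refl[of s z] by (intro exI[of _ "{(s, z)}"]) auto
 next
  case False
  define K where "K = {k :: ('n => bool) \<times> nat. snd k < 4}"
  have "K = UNIV \<times> {..<4}" by (auto simp: K_def)
  hence fK: "finite K" by simp
  have cs: "sub (s / 2) (child s z k) s z" if "k : K" for k by (rule child_sub) (use Suc.prems that in "simp_all add: K_def")
  define R where "R k P \<longleftrightarrow> finite P & (ALL (s', z'):P. 0 < s' & sub s' z' (s / 2) (child s z k) &
  ripe A th s' z') &
  B Int cell (s / 2) (child s z k) <= ?U P & vol (A Int ?U P) <= th * vol (?U P)" for k P
  have "EX P. R k P" if k: "k : K" for k unfolding R_def
  proof (rule Suc.IH)
   show "sub (s / 2) (child s z k) S Z" by (rule sub_trans[OF cs[OF k] Suc.prems(3)])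
   show "vol (A Int cell (s / 2) (child s z k)) < th * vol (cell (s / 2) (child s z k))"
    by (rule ccontr) (use False k in "simp only: K_def mem_Collect_eq not_less; blast")
  qed (use Suc.prems in auto)
  then obtain P where P0: "ALL k:K. R k (P k)" using bchoice[of K R] by blast
  have P: "finite (P k) & (ALL (s', z'):P k. 0 < s' & sub s' z' (s / 2) (child s z k) &
  ripe A th s' z') &
  B Int cell (s / 2) (child s z k) <= ?U (P k) & vol (A Int ?U (P k)) <= th * vol (?U (P k))" if "k : K" for k using bspec[OF P0 that] unfolding R_def .
  define V where "V k = ?U (P k)" for k
  have Vs: "V k <= cell (s / 2) (child s z k)" if "k : K" for k using P[OF that] sub_cell unfolding V_def by fastforce
  have Vm: "V k : sets borel" if "k : K" for k unfolding V_def using P[OF that] by (intro sets.finite_UN) auto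
  have Un: "?U (UN k:K. P k) = (UN k:K. V k)" by (auto simp: V_def)
  have dis: "disjoint_family_on V K" unfolding disjoint_family_on_def using Vs child_disjoint[of s] Suc.prems(1) by blast
  have fV: "evol (A Int V k) ~= \<infinity>" "evol (V k) ~= \<infinity>" if "k : K" for k
  proof -
   have "V k : fmeasurable lborel" "A Int V k : fmeasurable lborel" using Vm[OF that] Vs[OF that] A by (intro cell_fmeasurable[of _ "s / 2" "child s z k"]; blast)+
   thus "evol (A Int V k) ~= \<infinity>" "evol (V k) ~= \<infinity>" using fmeasurableD2 by (simp_all add: infinity_ennreal_def)
  qed
  have "vol (A Int (UN k:K. V k)) = vol (UN k:K. A Int V k)" by (simp only: Int_UN_distrib)
  also have "... = (SUM k:K. vol (A Int V k))"
  proof (rule measure_finite_Union[OF fK])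
   show "disjoint_family_on (%k. A Int V k) K" using dis unfolding disjoint_family_on_def by blast
  qed (use Vm fV in auto)
  also have "... <= (SUM k:K. th * vol (V k))" using P by (intro sum_mono) (auto simp: V_def)
  also have "... = th * vol (UN k:K. V k)"
  proof -
   have "vol (UN k:K. V k) = (SUM k:K. vol (V k))" by (rule measure_finite_Union[OF fK _ dis]) (use Vm fV in auto)
   thus ?thesis by (simp only: sum_distrib_left)
  qed
  finally have le: "vol (A Int ?U (UN k:K. P k)) <= th * vol (?U (UN k:K. P k))" unfolding Un .
  have cov: "B Int cell s z <= (UN k:K. V k)"
  proof
   fix y assume y: "y : B Int cell s z"
   then obtain k where k: "k : K" "y : cell (s / 2) (child s z k)" using child_cover[OF Suc.prems(1), of y z] by (auto simp: K_def)
   hence "y : V k" using P[OF k(1)] y unfolding V_def by blast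
   thus "y : (UN k:K. V k)" using k by blast
  qed
  show ?thesis
  proof (intro exI[of _ "UN k:K. P k"] conjI le)
   show "finite (UN k:K. P k)" using fK P by blast
   show "B Int cell s z <= ?U (UN k:K. P k)" using cov unfolding Un .
   show "ALL (s', z'):UN k:K. P k. 0 < s' & sub s' z' s z &
    ripe A th s' z'"
   proof clarify
    fix s' z' k assume k: "k : K" "(s', z') : P k"
    hence "0 < s' & sub s' z' (s / 2) (child s z k) &
    ripe A th s' z'" using P[OF k(1)] by blast
    thus "0 < s' & sub s' z' s z &
    ripe A th s' z'" using sub_trans[OF _ cs[OF k(1)]] by blast
   qed
  qed
 qed
qed

section \<open>Propagation of positivity\<close>

lemma cell_emeasure: "evol (cell s z) = ennreal (vol (cell s z :: ((real^'n) * real) set))"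
 using cell_finite by (intro emeasure_eq_ennreal_measure) (simp add: less_top)

lemma slab_emeasure:
 fixes x :: "real^'n"
 assumes s: "s > 0" and r: "r >= 0"
 shows "evol (base s x \<times> {t<..t + r * s^2}) = ennreal (r * vol (cell s (x, t0)))"
proof -
 have e: "evol (base s x \<times> {t<..t + l}) = evol (base s x) * ennreal l" if "l >= 0" for t l :: real
  using lborel.emeasure_pair_measure_Times[of "base s x" lborel "{t<..t + l}"] that by (simp add: lborel_prod)
 have "evol (base s x \<times> {t<..t + r * s^2}) = ennreal r * (evol (base s x) * ennreal (s^2))" using e[of "r * s^2" t] r by (simp add: ennreal_mult mult_ac)
 also have "evol (base s x) * ennreal (s^2) = ennreal (vol (cell s (x, t0)))" using e[of "s^2" t0] cell_emeasure[of s "(x, t0)"] by (simp add: cell_eq)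
 finally show ?thesis using r by (simp add: ennreal_mult)
qed

lemma cell_measure:
 fixes z :: "(real^'n) * real"
 assumes s: "s > 0"
 shows "vol (cell s z) = s powr (real CARD('n) + 2) * vol (cell 1 (0 :: 'n pt))"
proof -
 have "ennreal (vol (cell s z)) = (NN y. indicator (cell s z) y)" by (simp add: cell_emeasure)
 also have "... = ennreal (s ^ (CARD('n) + 2)) * (NN y. indicator (cell s z) (par_map s z y))" by (rule nn_integral_par_map_lborel[OF s]) simp
 also have "(%y. indicator (cell s z) (par_map s z y)) = (indicator (cell 1 0) :: _ => ennreal)"
 proof -
  have "par_map s z y : cell s z \<longleftrightarrow> y : cell 1 0" for y
  proof -
   have "- s / 2 <= s * c \<longleftrightarrow> - 1 / 2 <= c" "s * c < s / 2 \<longleftrightarrow> c < 1 / 2" for c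
    using s mult_le_cancel_left_pos[OF s, of "- 1 / 2" c] mult_less_cancel_left_pos[OF s, of c "1 / 2"] by simp_all
   thus ?thesis using s by (simp add: cell_def par_map_def zero_less_mult_iff)
  qed
  thus ?thesis by (simp add: fun_eq_iff indicator_def)
 qed
 also have "(NN y. indicator (cell 1 (0 :: 'n pt)) y) = ennreal (vol (cell 1 (0 :: 'n pt)))" by (simp add: cell_emeasure)
 finally have "vol (cell s z) = s ^ (CARD('n) + 2) * vol (cell 1 (0 :: 'n pt))" using s by (simp add: ennreal_mult[symmetric])
 moreover have "s ^ (CARD('n) + 2) = s powr (real CARD('n) + 2)" by (subst powr_realpow[OF s, symmetric]) (simp add: add.commute)
 ultimately show ?thesis by simp
qed

lemma cell_dom: assumes "L >= 1" "s > 0" "snd z0 + s^2 <= te" shows "cell s z0 <= dom L s z0 te"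
proof
 fix y assume y: "y : cell s z0"
 have "abs (fst y $ i - fst z0 $ i) < L * s" for i
 proof -
  have "fst z0 $ i - s / 2 <= fst y $ i & fst y $ i < fst z0 $ i + s / 2" using y by (auto simp: cell_def)
  hence "abs (fst y $ i - fst z0 $ i) <= s / 2" by linarith
  also have "s / 2 < L * s" using assms mult_right_mono[of 1 L s] by linarith
  finally show ?thesis .
 qed
 thus "y : dom L s z0 te" using y assms by (simp add: cell_def dom_def)
qed

lemma level_borel:
 fixes v :: "'a::topological_space => real"
 assumes "continuous_on S v" "S : sets borel"
 shows "{z : S. a <= v z} : sets borel" "{z : S. a < v z} : sets borel"
proof -
 have m: "(%z. indicator S z *\<^sub>R v z) : borelf" by (rule borel_measurable_continuous_on_indicator[OF assms(2,1)])
 have "S Int {z : space borel. a <= indicator S z *\<^sub>R v z} : sets borel" "S Int {z : space borel. a < indicator S z *\<^sub>R v z} : sets borel"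
  using assms(2) borel_measurable_le[OF borel_measurable_const m] borel_measurable_less[OF borel_measurable_const m] by blast+
 moreover have "S Int {z : space borel. a <= indicator S z *\<^sub>R v z} = {z : S. a <= v z}" "S Int {z : space borel. a < indicator S z *\<^sub>R v z} = {z : S. a < v z}" by auto
 ultimately show "{z : S. a <= v z} : sets borel" "{z : S. a < v z} : sets borel" by simp_all
qed

lemma inner_bound: assumes "!!i. abs (y $ i) <= a" shows "y \<bullet> (y :: real^'n) <= real CARD('n) * a^2"
proof -
 have "y $ i * y $ i <= a^2" for i using assms[of i] abs_le_square_iff[of "y $ i" a] by (simp add: power2_eq_square)
 hence "(SUM i:UNIV. y $ i * y $ i) <= (SUM i:(UNIV :: 'n set). a^2)" by (rule sum_mono)
 thus ?thesis by (simp add: inner_vec_def)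
qed

context pucci_drift begin

text \<open>A smaller cylinder, started later at a lower height: its centre moves by at most s/2,
  which a reserve of 1 in \<open>L\<close> absorbs, and the forcing condition loses the factor
  c^p.\<close>

lemma admissible_mono:
 assumes a: "admissible nu r0 L v s z0 h te" and s: "0 < s'" "s' <= s" and r: "r0 <= r0'" and h: "h' = c * h" "c > 0" and n: "nu <= nu' * c powr p"
  and x: "!!i. abs (fst z' $ i - fst z0 $ i) <= s / 2" and t: "snd z0 <= snd z'" and L: "0 <= L'" "L' + 1 <= L"
 shows "admissible nu' r0' L' v s' z' h' te"
proof -
 have A: "super v" "0 < s" "s <= r0" "0 < h" "s powr (2 * p - N) * Fp <= nu * h powr p" "dom L s z0 te <= Q" "ALL z:dom L s z0 te. 0 <= v z"
  using a unfolding admissible_def by blast+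
 have "dom L' s' z' te <= dom L s z0 te"
 proof
  fix y assume y: "y : dom L' s' z' te"
  have "abs (fst y $ i - fst z0 $ i) < L * s" for i
  proof -
   have "abs (fst y $ i - fst z' $ i) < L' * s'" using y by (auto simp: dom_def)
   moreover have "L' * s' <= L' * s" using s L by (intro mult_left_mono) auto
   moreover have "(L' + 1) * s <= L * s" using L A by (intro mult_right_mono) auto
   hence "L' * s + s <= L * s" by (simp add: algebra_simps)
   ultimately show ?thesis using x[of i] A(2) by linarith
  qed
  thus "y : dom L s z0 te" using y t by (auto simp: dom_def)
 qed
 moreover have "s' powr (2 * p - N) * Fp <= nu' * h' powr p"
 proof -
  have "s' powr (2 * p - N) * Fp <= s powr (2 * p - N) * Fp" using s p_pos Fp by (intro mult_right_mono powr_mono2) auto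
  also have "... <= nu * h powr p" by (rule A)
  also have "... <= (nu' * c powr p) * h powr p" using n by (intro mult_right_mono) auto
  finally show ?thesis by (simp add: h powr_mult)
 qed
 ultimately show ?thesis using A s r h unfolding admissible_def by (auto intro: order_trans)
qed

text \<open>From density in a cell to a pointwise bound after the delay \<open>g\<close>. The reach
  3/2 s gives a cube of three times the side: taken from a child, it covers the whole
  parent.\<close>

definition spread where
 "spread th g T c nu r0 L \<longleftrightarrow> (ALL v s z0 h te. admissible nu r0 L v s z0 h te --> snd z0 + s^2 <= te -->
  th * vol (cell s z0) <= vol {z : cell s z0. h <= v z} -->
  (ALL z. snd z <= te --> snd z0 + g * s^2 <= snd z --> snd z <= snd z0 + T * s^2 --> (ALL i. abs (fst z $ i - fst z0 $ i) <= 3 / 2 * s) --> c * h <= v z))"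

text \<open>The delay \<open>g\<close> is fixed before the horizon \<open>T\<close>, so that stacks
  can later be chosen long in comparison with the delay.\<close>

definition propagates where
 "propagates th \<longleftrightarrow> (EX g>=1. ALL T. EX c>0. EX nu>0. EX r0>0. EX L>=1. spread th g T c nu r0 L)"

lemma cell_level_sets:
 assumes a: "admissible nu r0 L v s z0 h te" "L >= 1" "snd z0 + s^2 <= te"
 shows "{z : cell s z0. b <= v z} : sets borel" "{z : cell s z0. b < v z} : sets borel"
proof -
 have "continuous_on Q v" "cell s z0 <= Q" using a cell_dom[of L s z0 te] by (auto simp: admissible_def pucci_super_def)
 hence "continuous_on (cell s z0) v" by (rule continuous_on_subset)
 from level_borel[OF this cell_sets] show "{z : cell s z0. b <= v z} : sets borel" "{z : cell s z0. b < v z} : sets borel" .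
qed

lemma growsD:
 assumes "grows T d c nu r0 L" "admissible nu r0 L v s z0 h te" "evol {z : cell s z0. v z < h} <= ennreal (d * s powr N)"
  "snd z <= te" "snd z0 + s^2 <= snd z" "snd z <= snd z0 + T * s^2" "8 * ((fst z - fst z0) \<bullet> (fst z - fst z0)) <= snd z - snd z0"
 shows "c * h <= v z" using assms unfolding grows_def by blast

lemma spreadD:
 assumes "spread th g T c nu r0 L" "admissible nu r0 L v s z0 h te" "snd z0 + s^2 <= te" "th * vol (cell s z0) <= vol {z : cell s z0. h <= v z}"
  "snd z <= te" "snd z0 + g * s^2 <= snd z" "snd z <= snd z0 + T * s^2" "!!i. abs (fst z $ i - fst z0 $ i) <= 3 / 2 * s"
 shows "c * h <= v z" using assms unfolding spread_def by blast

text \<open>The tolerated bad set depends on the horizon. So growth is first used with a fixed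
  horizon, which determines \<open>th\<close>, to fill a whole later cell; from that cell, whose bad
  set is empty, it is used again with the arbitrary horizon.\<close>

lemma propagates_base: "EX th. 0 < th & th < 1 & propagates th"
proof -
 define n where "n = real CARD('n)"
 have n: "n >= 1" using zero_less_card_finite[where 'a='n] unfolding n_def by linarith
 define V where "V = vol (cell 1 (0 :: (real^'n) * real))"
 have V: "V >= 0" by (simp add: V_def)
 have "2 * n + 1 >= 1" using n by simp
 from growth[OF this] obtain d c1 nu1 r1 L1 where pos1: "d > 0" "c1 > 0" "nu1 > 0" "r1 > 0" "L1 >= 1"
  and G1: "grows (2 * n + 1) d c1 nu1 r1 L1" by blast
 define th where "th = 1 - min (1 / 2) (d / (V + 1))"
 have th: "0 < th" "th < 1" using pos1 V by (auto simp: th_def)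
 have thd: "(1 - th) * V <= d"
 proof -
  have "(1 - th) * V <= d / (V + 1) * (V + 1)" using V pos1 by (intro mult_mono) (auto simp: th_def)
  thus ?thesis using V by simp
 qed
 \<comment> \<open>In units of s^2: 8|x|^2 is at most 2n over the cell and 18n within the reach 3/2.
   The first stage takes the time 2n, the second 18n, and 1 leaves room for the intermediate
   cell.\<close>
 define g where "g = 20 * n + 1"
 have "EX c>0. EX nu>0. EX r0>0. EX L>=1. spread th g T c nu r0 L" for T
 proof -
  have "max T 1 >= 1" by simp
  from growth[OF this] obtain d2 c2 nu2 r2 L2 where pos2: "d2 > 0" "c2 > 0" "nu2 > 0" "r2 > 0" "L2 >= 1"
   and G2: "grows (max T 1) d2 c2 nu2 r2 L2" by blast
  define nu r0 L where "nu = min nu1 (nu2 * c1 powr p)" and "r0 = min r1 r2" and "L = max L1 L2 + 1"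
  have "spread th g T (c2 * c1) nu r0 L" unfolding spread_def
  proof (intro allI impI)
   fix v s z0 h te z
   assume a: "admissible nu r0 L v s z0 h te" and te: "snd z0 + s^2 <= te" and dens: "th * vol (cell s z0) <= vol {z : cell s z0. h <= v z}"
    and z: "snd z <= te" "snd z0 + g * s^2 <= snd z" "snd z <= snd z0 + T * s^2" "ALL i. abs (fst z $ i - fst z0 $ i) <= 3 / 2 * s"
   have s: "s > 0" and h: "h > 0" using a by (auto simp: admissible_def)
   have s2: "s^2 > 0" "n * s^2 >= s^2" using s n by auto
   have gs: "g * s^2 = 20 * (n * s^2) + s^2" by (simp add: g_def algebra_simps)
   define z1 where "z1 = (fst z0, snd z0 + 2 * (n * s^2))"
   have a1: "admissible nu1 r1 L1 v s z0 h te" by (rule admissible_mono[OF a s order_refl, where c=1]) (use s pos1 in "auto simp: nu_def r0_def L_def")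
   have a2: "admissible nu2 r2 L2 v s z1 (c1 * h) te"
    by (rule admissible_mono[OF a s order_refl, where c=c1]) (use s n pos1 pos2 in "auto simp: nu_def r0_def L_def z1_def")
   have L1: "L >= 1" using pos1 by (simp add: L_def)
   have bad: "evol {z : cell s z0. v z < h} <= ennreal (d * s powr N)"
   proof -
    let ?G = "{z : cell s z0. h <= v z}"
    have Gm: "?G : sets borel" by (rule cell_level_sets(1)[OF a L1 te])
    have "{z : cell s z0. v z < h} = cell s z0 - ?G" by auto
    hence "evol {z : cell s z0. v z < h} = ennreal (vol (cell s z0 - ?G))"
     using cell_fmeasurable[of "cell s z0 - ?G" s z0] Gm by (simp add: emeasure_eq_measure2 fmeasurableD2 emeasure_eq_ennreal_measure)
    also have "vol (cell s z0 - ?G) = vol (cell s z0) - vol ?G" using Gm cell_finite[of s z0] by (intro measure_Diff) (auto simp: less_top)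
    also have "... <= (1 - th) * vol (cell s z0)" using dens by (simp add: algebra_simps)
    also have "... = (1 - th) * V * s powr N" by (simp add: cell_measure[OF s] V_def N)
    also have "... <= d * s powr N" by (rule mult_right_mono[OF thd]) simp
    finally show ?thesis by (simp add: ennreal_leI)
   qed
   have full: "c1 * h <= v y" if y: "y : cell s z1" for y
   proof (rule growsD[OF G1 a1 bad])
    have yt: "snd z0 + 2 * (n * s^2) < snd y" "snd y <= snd z0 + 2 * (n * s^2) + s^2" using y by (auto simp: cell_def z1_def)
    show "snd y <= te" using yt z(1,2) gs s2 by linarith
    show "snd z0 + s^2 <= snd y" using yt s2 by linarith
    show "snd y <= snd z0 + (2 * n + 1) * s^2" using yt by (simp add: algebra_simps)
    have "abs ((fst y - fst z0) $ i) <= s / 2" for i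
    proof -
     have "fst z0 $ i - s / 2 <= fst y $ i & fst y $ i < fst z0 $ i + s / 2" using y by (auto simp: cell_def z1_def)
     thus ?thesis unfolding vector_minus_component by linarith
    qed
    from inner_bound[OF this] have "8 * ((fst y - fst z0) \<bullet> (fst y - fst z0)) <= 2 * (n * s^2)" by (simp add: n_def power_divide)
    thus "8 * ((fst y - fst z0) \<bullet> (fst y - fst z0)) <= snd y - snd z0" using yt by linarith
   qed
   have e: "{y : cell s z1. v y < c1 * h} = {}" using full by (auto simp: not_less)
   have "c2 * (c1 * h) <= v z"
   proof (rule growsD[OF G2 a2 _ z(1)])
    show "evol {y : cell s z1. v y < c1 * h} <= ennreal (d2 * s powr N)" unfolding e by simp
    show "snd z1 + s^2 <= snd z" using z(2) gs s2 unfolding z1_def snd_conv by linarith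
    have "T * s^2 <= max T 1 * s^2" by (intro mult_right_mono) auto
    thus "snd z <= snd z1 + max T 1 * s^2" using z(3) s2 unfolding z1_def snd_conv by linarith
    have "abs ((fst z - fst z0) $ i) <= 3 / 2 * s" for i using z(4) by simp
    from inner_bound[OF this] have "8 * ((fst z - fst z0) \<bullet> (fst z - fst z0)) <= 18 * (n * s^2)" by (simp add: n_def power_mult_distrib power_divide)
    thus "8 * ((fst z - fst z1) \<bullet> (fst z - fst z1)) <= snd z - snd z1" using z(2) gs s2 unfolding z1_def fst_conv snd_conv by linarith
   qed
   thus "c2 * c1 * h <= v z" by (simp add: mult.assoc)
  qed
  moreover have "c2 * c1 > 0" "nu > 0" "r0 > 0" "L >= 1" using pos1 pos2 by (auto simp: nu_def r0_def L_def)
  ultimately show ?thesis by blast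
 qed
 moreover have "g >= 1" using n by (simp add: g_def)
 ultimately show ?thesis unfolding propagates_def using th by blast
qed

lemma propagates_mono: "propagates th ==> th <= th' ==> propagates th'"
proof -
 assume P: "propagates th" and le: "th <= th'"
 have "th * vol (cell s z) <= m" if "th' * vol (cell s z) <= m" for s z m using mult_right_mono[OF le, of "vol (cell s z)"] that by simp
 hence "spread th g T c nu r0 L ==> spread th' g T c nu r0 L" for g T c nu r0 L unfolding spread_def by blast
 thus "propagates th'" using P unfolding propagates_def by meson
qed
end

context pucci_drift begin

text \<open>The closure of the cell is compact and still lies in Q, so v is uniformly continuous
  there. This supplies the side at which the decomposition stops, at the price of lowering the level
  from h to h/2.\<close>

lemma uniform_cells:
 assumes a: "admissible nu r0 L v s z0 h te" "L >= 1" "snd z0 + s^2 <= te"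
 shows "EX et>0. ALL s' z'. 0 < s' --> s' <= et --> sub s' z' s z0 --> cell s' z' Int {y : cell s z0. h <= v y} ~= {} --> cell s' z' <= {y : cell s z0. h / 2 < v y}"
proof -
 have A: "continuous_on Q v" "0 < s" "0 < h" "dom L s z0 te <= Q" using a unfolding admissible_def pucci_super_def by blast+
 define K where "K = cbox (\<chi> i. fst z0 $ i - s / 2, snd z0) (\<chi> i. fst z0 $ i + s / 2, snd z0 + s^2)"
 have mK: "y : K \<longleftrightarrow> (ALL i. fst z0 $ i - s / 2 <= fst y $ i & fst y $ i <= fst z0 $ i + s / 2) & snd z0 <= snd y & snd y <= snd z0 + s^2" for y
  unfolding K_def mem_box ball_Basis_dir inner_dir by auto
 have KQ: "K <= Q"
 proof
  fix y assume y: "y : K"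
  have "abs (fst y $ i - fst z0 $ i) < L * s" for i
  proof -
   have "fst z0 $ i - s / 2 <= fst y $ i & fst y $ i <= fst z0 $ i + s / 2" using y unfolding mK by blast
   moreover have "s <= L * s" using A a(2) by simp
   ultimately show ?thesis using A by linarith
  qed
  hence "y : dom L s z0 te" using y a(3) unfolding mK dom_def by simp
  thus "y : Q" using A by blast
 qed
 have "uniformly_continuous_on K v" by (rule compact_uniformly_continuous[OF continuous_on_subset[OF A(1) KQ]]) (simp add: K_def)
 then obtain d where d: "d > 0" "!!x y. x : K ==> y : K ==> dist y x < d ==> dist (v y) (v x) < h / 2"
  using A(3) unfolding uniformly_continuous_on_def by (meson half_gt_zero)
 define n where "n = real CARD('n)"
 have n: "n >= 0" by (simp add: n_def)
 define et where "et = min 1 (d / (n + 2))"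
 have et: "et > 0" "et <= 1" using d n by (auto simp: et_def)
 have "et <= d / (n + 2)" by (simp add: et_def)
 hence etd: "(n + 2) * et <= d" using n by (simp add: pos_le_divide_eq mult.commute)
 show ?thesis
 proof (intro exI[of _ et] conjI[OF et(1)] allI impI subsetI)
  fix s' z' w assume s': "0 < s'" "s' <= et" and su: "sub s' z' s z0" and ne: "cell s' z' Int {y : cell s z0. h <= v y} ~= {}" and w: "w : cell s' z'"
  obtain y where y: "y : cell s' z'" "h <= v y" using ne by blast
  have cK: "cell s z0 <= K" by (auto simp: mK cell_def less_imp_le)
  have "norm (w - y) <= norm (fst w - fst y) + norm (snd w - snd y)" using norm_Pair_le[of "fst w - fst y" "snd w - snd y"] by (simp add: minus_prod_def)
  also have "norm (fst w - fst y) <= (SUM i:UNIV. abs ((fst w - fst y) $ i))" by (rule norm_le_l1_cart)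
  also have "(SUM i:UNIV. abs ((fst w - fst y) $ i)) <= (SUM i:(UNIV :: 'n set). s')"
  proof (rule sum_mono)
   fix i
   have "fst z' $ i - s' / 2 <= fst u $ i & fst u $ i < fst z' $ i + s' / 2" if "u : cell s' z'" for u using that by (auto simp: cell_def)
   from this[OF w] this[OF y(1)] show "abs ((fst w - fst y) $ i) <= s'" unfolding vector_minus_component by linarith
  qed
  also have "norm (snd w - snd y) <= s'^2" using w y by (auto simp: cell_def)
  also have "s'^2 <= s'" using s' et by (simp add: power2_eq_square mult_left_le)
  also have "(SUM i:(UNIV :: 'n set). s') + s' <= (n + 1) * et" using s' n by (simp add: n_def algebra_simps add_mono mult_left_mono)
  also have "... < d" using etd et by (simp add: algebra_simps)
  finally have "dist w y < d" by (simp add: dist_norm)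
  hence "dist (v w) (v y) < h / 2" using w y(1) sub_cell[OF su] cK by (intro d) blast+
  hence "h / 2 < v w" using y(2) unfolding dist_real_def by linarith
  thus "w : {y : cell s z0. h / 2 < v y}" using w sub_cell[OF su] by blast
 qed
qed

text \<open>Either all selected cubes are small, and their stacks fill a larger part of the original cube; or one is large, and its stack is where the barrier starts.\<close>

lemma propagates_step:
 assumes th: "0 < th" "th < 1" and P: "propagates th"
 shows "propagates (th * (1 + th) / 2)"
proof -
 obtain g where g: "g >= 1" and sp: "!!T. EX c>0. EX nu>0. EX r0>0. EX L>=1. spread th g T c nu r0 L" using P unfolding propagates_def by blast
 define n where "n = real CARD('n)"
 have n: "n >= 1" using zero_less_card_finite[where 'a='n] unfolding n_def by linarith
 \<comment> \<open>Stacks are M times as long as their base cubes, so the delay costs the fraction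
   g/M = (1 - th)/4. \<open>rh2\<close> separates large cubes from small ones: stacks over small
   cubes leave the cell by at most M rh2 s^2, the fraction (1 - th)/8 of its duration.\<close>
 define M where "M = 4 * g / (1 - th)"
 define rh2 where "rh2 = (1 - th) / (8 * M)"
 have "4 * g * (1 - th) <= 4 * g * 1" using th g by (intro mult_left_mono) auto
 hence Mg: "4 * g <= M" unfolding M_def using th by (simp add: pos_le_divide_eq)
 hence M: "M > 0" "g + 1 <= M" using g by auto
 have rh2: "rh2 > 0" "rh2 < 1" "M * rh2 = (1 - th) / 8" "g / M = (1 - th) / 4"
  unfolding rh2_def using th M g Mg by (simp_all add: pos_divide_less_eq) (simp add: M_def)
 \<comment> \<open>In units of a child, of half the side, the length M s'^2 of a stack is 4
   M.\<close>
 obtain c1 nu1 r1 L1 where pos1: "c1 > 0" "nu1 > 0" "r1 > 0" "L1 >= 1" and S1: "spread th g (4 * M) c1 nu1 r1 L1" using sp by blast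
 define k where "k = c1 / 2"
 have k: "k > 0" using pos1 by (simp add: k_def)
 \<comment> \<open>The new delay is dictated by a large cube: s^2 for its position, g s^2 for its
   own delay, s^2 for a cell on its stack, and 32 n s^2 since z is within 2s of its centre in every
   coordinate.\<close>
 have "EX c>0. EX nu>0. EX r0>0. EX L>=1. spread (th * (1 + th) / 2) (g + 2 + 32 * n) T c nu r0 L" for T
 proof -
  obtain c2 nu2 r2 L2 where pos2: "c2 > 0" "nu2 > 0" "r2 > 0" "L2 >= 1" and S2: "spread th g T c2 nu2 r2 L2" using sp by blast
  \<comment> \<open>A large cube has s'^2 >= rh2 s^2, so the horizon T s^2 is at most T/rh2 in its
    own units.\<close>
  have "max 1 (T / rh2) >= 1" by simp
  from growth[OF this] obtain d3 c3 nu3 r3 L3 where pos3: "d3 > 0" "c3 > 0" "nu3 > 0" "r3 > 0" "L3 >= 1" and G3: "grows (max 1 (T / rh2)) d3 c3 nu3 r3 L3" by blast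
  define c nu r0 L where "c = min (c2 * k) (min (c3 * k) (c2 * (1 / 2)))" and "nu = min (nu1 * (1 / 2) powr p) (min (nu2 * (1 / 2) powr p) (min (nu2 * k powr p) (nu3 * k powr p)))"
   and "r0 = min r1 (min r2 r3)" and "L = max L1 (max L2 L3) + 1"
  have pos: "c > 0" "nu > 0" "r0 > 0" "L >= 1" using pos1 pos2 pos3 k by (auto simp: c_def nu_def r0_def L_def)
  have "spread (th * (1 + th) / 2) (g + 2 + 32 * n) T c nu r0 L" unfolding spread_def
  proof (intro allI impI)
   fix v s z0 h te z
   assume a: "admissible nu r0 L v s z0 h te" and te: "snd z0 + s^2 <= te" and dens: "th * (1 + th) / 2 * vol (cell s z0) <= vol {z : cell s z0. h <= v z}"
    and z: "snd z <= te" "snd z0 + (g + 2 + 32 * n) * s^2 <= snd z" "snd z <= snd z0 + T * s^2" and zx: "ALL i. abs (fst z $ i - fst z0 $ i) <= 3 / 2 * s"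
   have s: "s > 0" and h: "h > 0" using a by (auto simp: admissible_def)
   have q: "(g + 2 + 32 * n) * s^2 = g * s^2 + 2 * s^2 + 32 * (n * s^2)" by (simp add: algebra_simps)
   have q0: "s^2 > 0" "n * s^2 >= 0" "g * s^2 >= s^2" using s n g by auto
   have zg: "snd z0 + g * s^2 <= snd z" using z(2) q q0 by linarith
   have goal: "c * h <= v z" if "c' * h <= v z" "c <= c'" for c' using that mult_right_mono[of c c' h] h by linarith
   have dn: "0 <= th * vol (cell s z0)" using th by simp
   define A B where "A = {y : cell s z0. h / 2 < v y}" and "B = {y : cell s z0. h <= v y}"
   note lev = cell_level_sets[OF a pos(4) te]
   have Am[measurable]: "A : sets borel" and Bm: "B : sets borel" unfolding A_def B_def by (rule lev)+
   have fin: "S : fmeasurable lborel" if "S : sets borel" "S <= cell s z0" for S using that by (rule cell_fmeasurable)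
   have mono: "vol S <= vol S'" if "S <= S'" "S : sets borel" "S' : sets borel" "S' <= cell s z0" for S S' using that by (intro measure_mono_fmeasurable fin) auto
   have ad: "admissible nu2 r2 L2 v s z0 (x * h) te" if "0 < x" "nu <= nu2 * x powr p" for x
    by (rule admissible_mono[OF a s order_refl _ refl that]) (use s pos2 in "auto simp: r0_def L_def")
   have again: "c2 * (x * h) <= v z" if x: "0 < x" "nu <= nu2 * x powr p" and m: "th * vol (cell s z0) <= vol {y : cell s z0. x * h <= v y}" for x
    by (rule spreadD[OF S2 ad[OF x] te m z(1) zg z(3)]) (use zx in blast)
   show "c * h <= v z"
   \<comment> \<open>If {v > h/2} is already dense, the assumption applies at level h/2; otherwise
     the cell has low density and can be decomposed.\<close>
   proof (cases "th * vol (cell s z0) <= vol A")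
    case True
    also have "vol A <= vol {y : cell s z0. 1 / 2 * h <= v y}" by (rule mono[OF _ Am lev(1)]) (auto simp: A_def)
    finally have "c2 * (1 / 2 * h) <= v z" by (intro again) (auto simp: nu_def)
    thus ?thesis using goal[of "c2 * (1 / 2)"] by (simp add: c_def)
   next
    case False
    have AI: "A Int cell s z0 = A" by (auto simp: A_def)
    obtain et where et: "et > 0" and un: "!!s' z'. 0 < s' ==> s' <= et ==> sub s' z' s z0 ==> cell s' z' Int B ~= {} ==> cell s' z' <= A"
     using uniform_cells[OF a pos(4) te] unfolding A_def B_def by blast
    obtain J where "s / et < 2 ^ J" using real_arch_pow[of 2 "s / et"] by auto
    hence J: "s <= 2 ^ J * et" using et by (simp add: pos_divide_less_eq)
    have small: "th * vol (cell s' z') <= vol (A Int cell s' z')" if "0 < s'" "s' <= et" "sub s' z' s z0" "cell s' z' Int B ~= {}" for s' z'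
    proof -
     have "A Int cell s' z' = cell s' z'" using un[OF that] by blast
     thus ?thesis using th by (simp add: mult_left_le_one_le)
    qed
    have lt: "vol (A Int cell s z0) < th * vol (cell s z0)" using False unfolding AI by linarith
    define R where "R F \<longleftrightarrow> finite F & (ALL (s', z'):F. 0 < s' & sub s' z' s z0 &
     ripe A th s' z') &
     B Int cell s z0 <= (\<Union>(s', z')\<in>F. cell s' z') & vol (A Int (\<Union>(s', z')\<in>F. cell s' z')) <= th * vol (\<Union>(s', z')\<in>F. cell s' z')" for F
    have "EX F. R F" unfolding R_def by (rule calderon_zygmund[OF Am small s J sub_refl lt])
    then obtain F where "R F" by blast
    note RF = this[unfolded R_def]
    note F = conjunct1[OF RF] and FP = conjunct1[OF conjunct2[OF RF]] and BU = conjunct1[OF conjunct2[OF conjunct2[OF RF]]] and AU = conjunct2[OF conjunct2[OF conjunct2[OF RF]]]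
    define U where "U = (\<Union>(s', z')\<in>F. cell s' z')"
    have Um: "U : sets borel" unfolding U_def using F by (intro sets.finite_UN) auto
    have Us: "U <= cell s z0" unfolding U_def using FP sub_cell by fastforce
    \<comment> \<open>B is covered by U, and A has density at most th in U: covering gains the
      factor 1/th, so U fills at least the fraction (1 + th)/2 of the cell.\<close>
    have "th * ((1 + th) / 2 * vol (cell s z0)) <= vol B" using dens by (simp add: B_def)
    also have "... <= vol (A Int U)" by (rule mono) (use BU Bm Am Um h in "auto simp: U_def A_def B_def")
    also have "... <= th * vol U" using AU by (simp add: U_def)
    finally have dU: "(1 + th) / 2 * vol (cell s z0) <= vol U" using th by (simp only: mult_le_cancel_left_pos)
    have Fd: "0 < s'" "sub s' z' s z0" "s' <= s" if "(s', z') : F" for s' z'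
    proof -
     show p1: "0 < s'" "sub s' z' s z0" using FP that by blast+
     hence "s'^2 <= s^2" by (auto simp: sub_def)
     thus "s' <= s" by (rule power2_le_imp_le) (use s in simp)
    qed
    \<comment> \<open>The dense child spreads over its parent, which gives v >= k h on the stack
      above the parent once the delay is over.\<close>
    have stack: "k * h <= v y" if P: "(s', z') : F" and y: "fst y : base s' (fst z')" "snd z' + g * s'^2 < snd y" "snd y <= snd z' + M * s'^2" "snd y <= te" for s' z' y
    proof -
     obtain j where j: "snd j < 4" "th * vol (cell (s' / 2) (child s' z' j)) <= vol (A Int cell (s' / 2) (child s' z' j))" using FP P by blast
     note p = Fd[OF P]
     have su: "sub (s' / 2) (child s' z' j) s z0" using sub_trans[OF child_sub[OF p(1) j(1)] p(2)] .
     have s2: "0 < s' / 2" "s' / 2 <= s" using p by auto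
     have xj: "abs (fst (child s' z' j) $ i - fst z' $ i) = s' / 4" for i using p by (simp add: child_def)
     have adm: "admissible nu1 r1 L1 v (s' / 2) (child s' z' j) (1 / 2 * h) te"
     proof (rule admissible_mono[OF a s2, where c="1 / 2"])
      fix i
      have "fst z0 $ i - s / 2 <= fst (child s' z' j) $ i - s' / 2 / 2 & fst (child s' z' j) $ i + s' / 2 / 2 <= fst z0 $ i + s / 2" using su by (auto simp: sub_def)
      thus "abs (fst (child s' z' j) $ i - fst z0 $ i) <= s / 2" using p by linarith
     qed (use su pos1 in "auto simp: nu_def r0_def L_def sub_def")
     have "c1 * (1 / 2 * h) <= v y"
     proof (rule spreadD[OF S1 adm])
      show "snd (child s' z' j) + (s' / 2)^2 <= te" using su te by (auto simp: sub_def)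
      note j(2)
      also have "vol (A Int cell (s' / 2) (child s' z' j)) <= vol {y : cell (s' / 2) (child s' z' j). 1 / 2 * h <= v y}"
      proof (rule mono)
      have "{y : cell (s' / 2) (child s' z' j). 1 / 2 * h <= v y} = cell (s' / 2) (child s' z' j) Int {y : cell s z0. 1 / 2 * h <= v y}" using sub_cell[OF su] by blast
      thus "{y : cell (s' / 2) (child s' z' j). 1 / 2 * h <= v y} : sets borel" by (simp only:) (intro sets.Int cell_sets lev(1))
      show "A Int cell (s' / 2) (child s' z' j) : sets borel" by (intro sets.Int cell_sets Am)
      qed (use sub_cell[OF su] in "auto simp: A_def")
      finally show "th * vol (cell (s' / 2) (child s' z' j)) <= vol {y : cell (s' / 2) (child s' z' j). 1 / 2 * h <= v y}" .
      have t: "snd z' <= snd (child s' z' j)" "snd (child s' z' j) <= snd z' + 3 * (s' / 2)^2"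
      proof -
      have "real (snd j) <= 3" using j(1) by linarith
      thus "snd (child s' z' j) <= snd z' + 3 * (s' / 2)^2" unfolding child_def snd_conv by (intro add_left_mono mult_right_mono) auto
      qed (simp add: child_def)
      have q: "s'^2 = 4 * (s' / 2)^2" "(s' / 2)^2 > 0" using p by (auto simp: power_divide)
      have "g * s'^2 = g * (s' / 2)^2 + 3 * (g * (s' / 2)^2)" unfolding q(1) by simp
      moreover have "(s' / 2)^2 <= g * (s' / 2)^2" using g q by simp
      ultimately show "snd (child s' z' j) + g * (s' / 2)^2 <= snd y" using t y by linarith
      have "4 * M * (s' / 2)^2 = M * s'^2" unfolding q(1) by simp
      thus "snd y <= snd (child s' z' j) + 4 * M * (s' / 2)^2" using t y by linarith
      fix i
      have "fst z' $ i - s' / 2 <= fst y $ i & fst y $ i < fst z' $ i + s' / 2" using y by (auto simp: base_def)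
      thus "abs (fst y $ i - fst (child s' z' j) $ i) <= 3 / 2 * (s' / 2)" using xj[of i] by linarith
     qed (use y in auto)
     thus ?thesis by (simp add: k_def)
    qed
    show ?thesis
    proof (cases "EX (s', z'):F. rh2 * s^2 <= s'^2")
     case True
     then obtain s' z' where P: "(s', z') : F" and big: "rh2 * s^2 <= s'^2" by blast
     note p = Fd[OF P]
     \<comment> \<open>A cell on the stack of a large cube has an empty bad set at height k h, so
       growth carries the bound from there to z.\<close>
     define z1 where "z1 = (fst z', snd z' + g * s'^2)"
     have zs: "snd z0 <= snd z'" "snd z' <= snd z0 + s^2" "s'^2 <= s^2" using p by (auto simp: sub_def power_mono intro: order_trans[of _ "snd z' + s'^2"])
     have gs: "g * s'^2 <= g * s^2" using zs g by (intro mult_left_mono) auto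
     have xz: "abs (fst z' $ i - fst z0 $ i) <= s / 2" for i
     proof -
      have "fst z0 $ i - s / 2 <= fst z' $ i - s' / 2 & fst z' $ i + s' / 2 <= fst z0 $ i + s / 2" using p(2) by (auto simp: sub_def)
      thus ?thesis using p by linarith
     qed
     have adm: "admissible nu3 r3 L3 v s' z1 (k * h) te"
      by (rule admissible_mono[OF a p(1,3) _ refl k]) (use xz zs g pos3 in "auto simp: nu_def r0_def L_def z1_def intro: add_increasing2")
     have "k * h <= v y" if y: "y : cell s' z1" for y
     proof (rule stack[OF P])
      have yt: "snd z' + g * s'^2 < snd y" "snd y <= snd z' + g * s'^2 + s'^2" using y by (auto simp: cell_def z1_def)
      show "fst y : base s' (fst z')" using y by (auto simp: cell_eq z1_def)
      show "snd z' + g * s'^2 < snd y" by (rule yt)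
      have "(g + 1) * s'^2 <= M * s'^2" using M by (intro mult_right_mono) auto
      hence "g * s'^2 + s'^2 <= M * s'^2" by (simp add: algebra_simps)
      thus "snd y <= snd z' + M * s'^2" using yt by linarith
      show "snd y <= te" using yt zs gs z q q0 by linarith
     qed
     hence e: "{y : cell s' z1. v y < k * h} = {}" by (auto simp: not_less)
     have "c3 * (k * h) <= v z"
     proof (rule growsD[OF G3 adm _ z(1)])
      show "evol {y : cell s' z1. v y < k * h} <= ennreal (d3 * s' powr N)" unfolding e by simp
      show "snd z1 + s'^2 <= snd z" unfolding z1_def snd_conv using zs gs z q q0 by linarith
      have "T * s^2 <= max 1 (T / rh2) * s'^2"
      proof -
      have "T * s^2 = T / rh2 * (rh2 * s^2)" using rh2 by simp
      also have "... <= max 1 (T / rh2) * (rh2 * s^2)" using rh2 by (intro mult_right_mono) auto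
      also have "... <= max 1 (T / rh2) * s'^2" by (intro mult_left_mono big) auto
      finally show ?thesis .
      qed
      moreover have "0 <= g * s'^2" using g by simp
      ultimately show "snd z <= snd z1 + max 1 (T / rh2) * s'^2" unfolding z1_def snd_conv using z(3) zs by linarith
      have "abs ((fst z - fst z') $ i) <= 2 * s" for i using zx[rule_format, of i] xz[of i] unfolding vector_minus_component by linarith
      from inner_bound[OF this] have "8 * ((fst z - fst z') \<bullet> (fst z - fst z')) <= 32 * (n * s^2)" by (simp add: n_def power_mult_distrib)
      thus "8 * ((fst z - fst z1) \<bullet> (fst z - fst z1)) <= snd z - snd z1" unfolding z1_def fst_conv snd_conv using zs gs z q q0 by linarith
     qed
     thus ?thesis using goal[of "c3 * k"] by (simp add: c_def mult.assoc)
    next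
     case small: False
     \<comment> \<open>\<open>W\<close> collects the full stacks, \<open>W'\<close> their parts
       after the delay, and \<open>Top\<close> is the slab above the cell into which stacks over
       small cubes may reach.\<close>
     define W W' where "W = (UN P:F. base (fst P) (fst (snd P)) \<times> {snd (snd P)<..snd (snd P) + M * (fst P)^2})"
      and "W' = (UN P:F. base (fst P) (fst (snd P)) \<times> {snd (snd P) + g * (fst P)^2<..snd (snd P) + M * (fst P)^2})"
     define Top where "Top = base s (fst z0) \<times> {snd z0 + s^2<..snd z0 + s^2 + (M * rh2) * s^2}"
     define D where "D = {y : cell s z0. k * h <= v y}"
     have Dm: "D : sets borel" unfolding D_def by (rule lev)
     have Dc: "D <= cell s z0" by (auto simp: D_def)
     have Tm: "Top : sets borel" unfolding Top_def by (intro borel_Times) auto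
     have le: "ennreal (1 - g / M) * evol W <= evol W'" unfolding W_def W'_def
     proof (rule stack_measure)
      have Ms: "(g / M) * (M * x) = g * x" for x using M by simp
      fix P :: "real \<times> (real^'n) * real"
      have "g * (fst P)^2 <= M * (fst P)^2" using M g by (intro mult_right_mono) auto
      thus "snd (snd P) <= snd (snd P) + g * (fst P)^2 & snd (snd P) + g * (fst P)^2 <= snd (snd P) + M * (fst P)^2 &
      snd (snd P) + g * (fst P)^2 - snd (snd P) <= g / M * (snd (snd P) + M * (fst P)^2 - snd (snd P))" using g M by simp
     qed (use F M g in auto)
     have "U <= W"
     proof
      fix y assume "y : U"
      then obtain s' z' where P: "(s', z') : F" "y : cell s' z'" by (auto simp: U_def)
      have "1 * s'^2 <= M * s'^2" using M g by (intro mult_right_mono) auto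
      hence "y : base s' (fst z') \<times> {snd z'<..snd z' + M * s'^2}" using P(2) unfolding cell_eq by auto
      thus "y : W" unfolding W_def using P(1) by force
     qed
     moreover have Wm: "W : sets borel" unfolding W_def using F by (intro sets.finite_UN borel_Times) auto
     ultimately have "ennreal (vol U) <= evol W" using emeasure_mono[of U W lborel] emeasure_eq_measure2[OF fin[OF Um Us]] by simp
     hence "ennreal (1 - g / M) * ennreal (vol U) <= evol W'" using le by (meson mult_left_mono order_trans zero_le)
     also have "... <= evol (D Un Top)"
     proof (rule emeasure_mono)
      show "W' <= D Un Top"
      proof
      fix y assume "y : W'"
      then obtain s' z' where P: "(s', z') : F" and y: "fst y : base s' (fst z')" "snd z' + g * s'^2 < snd y" "snd y <= snd z' + M * s'^2" by (auto simp: W'_def)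
      note p = Fd[OF P]
      have by': "fst y : base s (fst z0)" using y(1) p(2) unfolding base_def sub_def by (simp, meson order_trans less_le_trans)
      have t: "snd z0 <= snd z'" "snd z' + s'^2 <= snd z0 + s^2" using p(2) by (auto simp: sub_def)
      have "0 <= g * s'^2" using g by simp
      hence ty: "snd z0 < snd y" using t y by linarith
      show "y : D Un Top"
      proof (cases "snd y <= snd z0 + s^2")
      case True
      hence "k * h <= v y" using te by (intro stack[OF P y]) auto
      moreover have "y : cell s z0" unfolding cell_eq using by' ty True by (simp add: mem_Times_iff)
      ultimately show ?thesis by (simp add: D_def)
      next
      case False
      have "s'^2 <= rh2 * s^2" using small P by force
      hence "M * s'^2 <= M * (rh2 * s^2)" using M by (intro mult_left_mono) auto
      hence "snd y <= snd z0 + s^2 + M * rh2 * s^2" using y t zero_le_power2[of s'] unfolding mult.assoc by linarith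
      thus ?thesis using False by' by (simp add: Top_def mem_Times_iff)
      qed
      qed
     qed (use Dm Tm in auto)
     also have "... <= evol D + evol Top" by (rule emeasure_subadditive) (use Dm Tm in auto)
     also have "evol D = ennreal (vol D)" by (rule emeasure_eq_measure2[OF fin[OF Dm Dc]])
     also have "evol Top = ennreal (M * rh2 * vol (cell s z0))"
     proof -
      have "0 <= M * rh2" using M(1) rh2(1) by simp
      from slab_emeasure[OF s this, of "fst z0" "snd z0 + s^2" "snd z0"] show ?thesis unfolding Top_def prod.collapse .
     qed
     finally have e: "ennreal (1 - g / M) * ennreal (vol U) <= ennreal (vol D) + ennreal (M * rh2 * vol (cell s z0))" .
     have n: "0 <= 1 - g / M" "0 <= M * rh2 * vol (cell s z0)" using M rh2(1) th unfolding rh2(4) by (simp_all add: mult_nonneg_nonneg)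
     have "ennreal ((1 - g / M) * vol U) <= ennreal (vol D + M * rh2 * vol (cell s z0))"
      using e unfolding ennreal_mult[OF n(1) measure_nonneg] ennreal_plus[OF measure_nonneg n(2)] .
     hence "(1 - g / M) * vol U <= vol D + M * rh2 * vol (cell s z0)" by (rule ennreal_le_iff[THEN iffD1, rotated]) (intro add_nonneg_nonneg measure_nonneg n(2))
     moreover have "(1 - g / M) * ((1 + th) / 2 * vol (cell s z0)) <= (1 - g / M) * vol U" by (rule mult_left_mono[OF dU]) (rule n(1))
     moreover have "th * vol (cell s z0) <= (1 - g / M) * ((1 + th) / 2 * vol (cell s z0)) - M * rh2 * vol (cell s z0)"
     proof -
      have "0 <= (1 - th) * (1 - th)" by simp
      \<comment> \<open>With e = 1 - th this reads 1 - e <= (1 - e/4)(1 - e/2) - e/8: losses by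
        delay and overhang together stay below the gain of the covering.\<close>
      hence "th <= (1 - (1 - th) / 4) * ((1 + th) / 2) - (1 - th) / 8" using th by (simp add: field_simps)
      from mult_right_mono[OF this, of "vol (cell s z0)"] show ?thesis unfolding rh2(3,4) left_diff_distrib mult.assoc by simp
     qed
     ultimately have "th * vol (cell s z0) <= vol {y : cell s z0. k * h <= v y}" unfolding D_def by linarith
     hence "c2 * (k * h) <= v z" by (intro again[OF k]) (simp add: nu_def)
     thus ?thesis using goal[of "c2 * k"] by (simp add: c_def mult.assoc)
    qed
   qed
  qed
  thus ?thesis using pos by blast
 qed
 moreover have "g + 2 + 32 * n >= 1" using g n by simp
 ultimately show ?thesis unfolding propagates_def by blast
qed

text \<open>With e = 1 - th, one step turns the deficit e into e (3 - e)/2, at least 5/4 e while th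
  > 1/2. The deficit stays below 1, so the density 1/2 is reached after finitely many steps.\<close>

lemma propagates_half: "propagates (1 / 2)"
proof (rule ccontr)
 assume no: "~ propagates (1 / 2)"
 obtain th0 where th0: "0 < th0" "th0 < 1" "propagates th0" using propagates_base by blast
 have "EX th. 0 < th & th < 1 & propagates th & (5 / 4) ^ j * (1 - th0) <= 1 - th" for j
 proof (induction j)
  case 0 show ?case using th0 by auto
 next
  case (Suc j)
  then obtain th where t: "0 < th" "th < 1" "propagates th" "(5 / 4) ^ j * (1 - th0) <= 1 - th" by blast
  have "th > 1 / 2" using no propagates_mono[OF t(3), of "1 / 2"] by force
  hence "0 <= (1 - th) * (th - 1 / 2)" using t by simp
  hence "5 / 4 * (1 - th) <= 1 - th * (1 + th) / 2" by (simp add: field_simps)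
  moreover have "th * (1 + th) < 1 * 2" using t by (intro mult_strict_mono) auto
  ultimately show ?case using t propagates_step[OF t(1-3)] by (intro exI[of _ "th * (1 + th) / 2"]) auto
 qed
 moreover obtain j where "1 / (1 - th0) < (5 / 4) ^ j" using real_arch_pow[of "5 / 4" "1 / (1 - th0)"] by auto
 hence "1 < (5 / 4) ^ j * (1 - th0)" using th0 by (simp add: pos_divide_less_eq)
 ultimately show False by (metis less_diff_eq less_le_trans not_less_iff_gr_or_eq add_less_same_cancel1 order_less_trans)
qed
end

section \<open>Hoelder continuity\<close>

context pucci_drift begin

text \<open>At each point of an earlier cell u lies in the upper or the lower half of its range, so
  one of u - b and b + om - u is at least om/2 on half of the cell: this is where density 1/2 is
  used. Spreading then raises the lower bound or lowers the upper one.\<close>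

lemma oscillation_decay:
 "EX kp>0. EX nu>0. EX r0>0. EX K>1. kp < 1 & (ALL u rh z om b. super u --> super (%z. - u z) --> 0 < rh --> rh <= r0 --> 0 < om -->
  rh powr (2 * p - N) * Fp <= nu * om powr p --> par_cube rh z <= Q --> (ALL y:par_cube rh z. b <= u y & u y <= b + om) -->
  (EX b'. ALL y:par_cube (rh / K) z. b' <= u y & u y <= b' + (1 - kp) * om))"
proof -
 obtain g c nu r0 L where g: "g >= 1" and pos: "c > 0" "nu > 0" "r0 > 0" "L >= 1" and S: "spread (1 / 2) g (g + 1) c nu r0 L"
  using propagates_half unfolding propagates_def by meson
 \<comment> \<open>\<open>L\<close> provides the room in space and g + 2 the room in time, as (g +
   1) s^2 < K^2 s^2.\<close>
 define K where "K = max L (g + 2)"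
 define kp where "kp = min (c / 2) (1 / 2)"
 have K: "K > 1" "K >= L" "K >= g + 2" using g by (auto simp: K_def)
 have kp: "kp > 0" "kp < 1" "kp <= c / 2" using pos by (auto simp: kp_def)
 have main: "EX b'. ALL y:par_cube (rh / K) z. b' <= u y & u y <= b' + (1 - kp) * om"
  if u: "super u" "super (%z. - u z)" and rh: "0 < rh" "rh <= r0" and om: "0 < om" and f: "rh powr (2 * p - N) * Fp <= nu * (1 / 2) powr p * om powr p"
   and Q: "par_cube rh z <= Q" and b: "ALL y:par_cube rh z. b <= u y & u y <= b + om" for u rh om b and z :: "(real^'n) * real"
 proof -
  define s where "s = rh / K"
  \<comment> \<open>So placed, the last s^2 of time before z is the window between the delay g and
    the horizon g + 1.\<close>
  define z0 where "z0 = (fst z, snd z - (g + 1) * s^2)"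
  have s: "0 < s" "s <= rh" "rh = K * s" using rh K by (auto simp: s_def pos_divide_le_eq)
  have s2: "s^2 > 0" using s by simp
  have te: "snd z0 + s^2 <= snd z" using g s2 by (simp add: z0_def algebra_simps)
  have D: "dom L s z0 (snd z) <= par_cube rh z"
  proof clarify
   fix x t assume y: "(x, t) : dom L s z0 (snd z)"
   have "L * s <= rh" unfolding s(3) using K s by (intro mult_right_mono) auto
   moreover have "(g + 1) * s^2 < rh^2"
   proof -
    have "(g + 2) * 1 <= K * K" using K g by (intro mult_mono) auto
    hence "(g + 1) * s^2 < K * K * s^2" using s2 by (intro mult_strict_right_mono) auto
    thus ?thesis by (simp add: s(3) power2_eq_square mult_ac)
   qed
   moreover have "abs (x $ i - fst z $ i) < L * s" for i using y by (auto simp: dom_def z0_def)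
   ultimately show "(x, t) : par_cube rh z" using y unfolding par_cube_def by (auto simp: dom_def z0_def intro: less_le_trans)
  qed
  have adm: "admissible nu r0 L v s z0 (om / 2) (snd z)" if "super v" "!!y. y : par_cube rh z ==> 0 <= v y" for v
  proof -
   have "s powr (2 * p - N) * Fp <= rh powr (2 * p - N) * Fp" using s p_pos Fp by (intro mult_right_mono powr_mono2) auto
   also note f
   also have "nu * (1 / 2) powr p * om powr p = nu * (om / 2) powr p" using powr_mult[of "1 / 2" om p] by simp
   finally have e: "s powr (2 * p - N) * Fp <= nu * (om / 2) powr p" .
   have "ALL y:dom L s z0 (snd z). 0 <= v y" using D that(2) by blast
   thus ?thesis unfolding admissible_def using that(1) s(1) om D Q order_trans[OF s(2) rh(2)] e by simp
  qed
  have con: "c * (om / 2) <= v y" if v: "super v" "!!y. y : par_cube rh z ==> 0 <= v y"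
   and m: "1 / 2 * vol (cell s z0) <= vol {y : cell s z0. om / 2 <= v y}" and y: "y : par_cube s z" for v y
  proof (rule spreadD[OF S adm[OF v] te m])
   show "snd y <= snd z" using y by (auto simp: par_cube_def)
   have "snd z - s^2 < snd y" using y by (auto simp: par_cube_def)
   thus "snd z0 + g * s^2 <= snd y" by (simp add: z0_def algebra_simps)
   show "snd y <= snd z0 + (g + 1) * s^2" using y by (auto simp: z0_def par_cube_def)
   show "abs (fst y $ i - fst z0 $ i) <= 3 / 2 * s" for i
   proof -
    have "abs (fst y $ i - fst z $ i) < s" using y by (auto simp: par_cube_def)
    thus ?thesis using s by (simp add: z0_def)
   qed
  qed
  define v1 v2 where "v1 = (%z. u z + - b)" and "v2 = (%z. - u z + (b + om))"
  have v: "super v1" "super v2" unfolding v1_def v2_def by (intro pucci_super_shift u)+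
  have vp: "0 <= v1 y" "0 <= v2 y" if "y : par_cube rh z" for y using b that by (auto simp: v1_def v2_def)
  note ms = cell_level_sets(1)[OF adm[OF v(1) vp(1)] pos(4) te, of "om / 2"] cell_level_sets(1)[OF adm[OF v(2) vp(2)] pos(4) te, of "om / 2"]
  have "cell s z0 = {y : cell s z0. om / 2 <= v1 y} Un {y : cell s z0. om / 2 <= v2 y}" by (auto simp: v1_def v2_def)
  hence "vol (cell s z0) <= vol {y : cell s z0. om / 2 <= v1 y} + vol {y : cell s z0. om / 2 <= v2 y}"
   using measure_Un_le[of "{y : cell s z0. om / 2 <= v1 y}" lborel "{y : cell s z0. om / 2 <= v2 y}"] ms by simp
  then consider "1 / 2 * vol (cell s z0) <= vol {y : cell s z0. om / 2 <= v1 y}"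
   | "1 / 2 * vol (cell s z0) <= vol {y : cell s z0. om / 2 <= v2 y}" by linarith
  moreover have ck: "kp * om <= c * (om / 2)" using mult_right_mono[OF kp(3), of om] om by simp
  moreover have sub: "b <= u y" "u y <= b + om" if "y : par_cube s z" for y
  proof -
   have "s^2 <= rh^2" using s by (intro power_mono) auto
   moreover obtain x t where y: "y = (x, t)" by (cases y)
   moreover have "abs (x $ i - fst z $ i) < s" "snd z - s^2 < t" "t <= snd z" for i using that by (auto simp: y par_cube_def)
   moreover from calculation have "snd z - rh^2 < t" by linarith
   ultimately have "y : par_cube rh z" using s(2) unfolding par_cube_def by (auto intro: less_le_trans)
   thus "b <= u y" "u y <= b + om" using b by blast+
  qed
  ultimately show ?thesis
  proof cases
   case 1
   have "b + kp * om <= u y & u y <= b + kp * om + (1 - kp) * om" if "y : par_cube s z" for y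
    using con[OF v(1) vp(1) 1 that] ck sub[OF that] by (simp add: v1_def algebra_simps)
   thus ?thesis unfolding s_def by blast
  next
   case 2
   have "b <= u y & u y <= b + (1 - kp) * om" if "y : par_cube s z" for y using con[OF v(2) vp(2) 2 that] ck sub[OF that] by (simp add: v2_def algebra_simps)
   thus ?thesis unfolding s_def by blast
  qed
 qed
 show ?thesis
  by (rule exI[of _ kp], rule conjI[OF kp(1)], rule exI[of _ "nu * (1 / 2) powr p"], rule conjI, use pos in simp, rule exI[of _ r0], rule conjI[OF pos(3)],
   rule exI[of _ K], rule conjI[OF K(1)], rule conjI[OF kp(2)], intro allI impI, rule main)
qed

text \<open>The decay is iterated on cylinders shrinking by the factor K. The forcing condition
  survives because the p-th power of \<open>om k\<close> decays no faster than the power 2p - N of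
  \<open>rh k\<close>. Cylinders extend into the past, so they are centred at the later of the two
  points.\<close>

lemma hoelder_estimate:
 assumes Q: "Q = cylinder (cube 10) 10"
 shows "EX C>0. EX al. 0 < al & al < 1 & (ALL u U x t x' t'. super u --> super (%z. - u z) --> (ALL z:Q. abs (u z) <= U) --> 0 < U + Fp powr (1 / p) -->
  (x, t) : cube 5 \<times> {10 - 10/4 <.. 10} --> (x', t') : cube 5 \<times> {10 - 10/4 <.. 10} -->
  abs (u (x, t) - u (x', t')) <= C * ((norm (x - x'))^2 + abs (t - t')) powr (al / 2) * (U + Fp powr (1 / p)))"
proof -
 obtain kp nu r0 K where pos: "kp > 0" "nu > 0" "r0 > 0" "K > 1" "kp < 1" and dec: "!!u rh z om b. super u ==> super (%z. - u z) ==> 0 < rh ==> rh <= r0 ==> 0 < om ==>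
  rh powr (2 * p - N) * Fp <= nu * om powr p ==> par_cube rh z <= Q ==> (ALL y:par_cube rh z. b <= u y & u y <= b + om) ==>
  (EX b'. ALL y:par_cube (rh / K) z. b' <= u y & u y <= b' + (1 - kp) * om)" using oscillation_decay by blast
 note pp = p_pos
 \<comment> \<open>The last entry is the rate of the oscillation decay, the middle one the rate that
   the forcing permits.\<close>
 define al where "al = min (1 / 2) (min ((2 * p - N) / p) (- ln (1 - kp) / ln K))"
 define rh0 where "rh0 = min r0 1"
 \<comment> \<open>J >= 2 covers the initial oscillation 2 U, and nu J^p >= 1 yields the forcing
   condition at every scale.\<close>
 define J where "J = max 2 ((1 / nu) powr (1 / p))"
 have al: "0 < al" "al < 1" "al * p <= 2 * p - N"
 proof -
  have "ln (1 - kp) < 0" "ln K > 0" using pos by simp_all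
  thus "0 < al" "al < 1" unfolding al_def using pp by (auto simp: divide_neg_pos)
  have "al <= (2 * p - N) / p" by (simp add: al_def)
  thus "al * p <= 2 * p - N" using pp by (simp add: pos_le_divide_eq)
 qed
 have kpK: "1 - kp <= K powr (- al)"
 proof -
  have "al <= - ln (1 - kp) / ln K" by (simp add: al_def)
  hence "al * ln K <= - ln (1 - kp)" using pos by (subst (asm) pos_le_divide_eq) auto
  hence "ln (1 - kp) <= - al * ln K" by simp
  hence "exp (ln (1 - kp)) <= exp (- al * ln K)" by simp
  thus ?thesis using pos by (simp add: powr_def)
 qed
 have rh0: "0 < rh0" "rh0 <= r0" "rh0 <= 1" using pos by (auto simp: rh0_def)
 have J: "J >= 2" "1 <= nu * J powr p"
 proof -
  have "1 / nu = ((1 / nu) powr (1 / p)) powr p" using pos pp by (simp add: powr_powr)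
  also have "... <= J powr p" using pp by (intro powr_mono2) (auto simp: J_def)
  finally show "1 <= nu * J powr p" using pos by (simp add: pos_divide_le_eq mult.commute)
 qed (simp add: J_def)
 define C where "C = J * K powr al * (1 / rh0) powr al"
 have C: "C > 0" unfolding C_def using J pos rh0 by simp
 have main: "abs (u (x, t) - u (x', t')) <= C * ((norm (x - x'))^2 + abs (t - t')) powr (al / 2) * (U + Fp powr (1 / p))"
  if u: "super u" "super (%z. - u z)" and U: "ALL z:Q. abs (u z) <= U" and A0: "0 < U + Fp powr (1 / p)"
   and x: "(x, t) : cube 5 \<times> {10 - 10/4 <.. 10}" and x': "(x', t') : cube 5 \<times> {10 - 10/4 <.. 10}" and le: "t' <= t" for u U x t x' t'
 proof -
  define A where "A = U + Fp powr (1 / p)"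
  define B where "B = J * A"
  define rh om where "rh k = rh0 / K ^ k" and "om k = B * (K ^ k) powr (- al)" for k
  have xQ: "(x, t) : Q" "(x', t') : Q" using x x' unfolding Q cylinder_def cube_def by (auto intro: less_trans)
  have U0: "0 <= U" using U xQ by force
  have Kk: "K ^ k >= 1" for k using pos by (simp add: one_le_power)
  have B: "B > 0" "2 * U <= B"
  proof -
   show "B > 0" unfolding B_def using J A0 by (simp add: A_def)
   have "2 * U <= J * U" using J U0 by (intro mult_right_mono) auto
   also have "... <= B" unfolding B_def A_def using J by (intro mult_left_mono) auto
   finally show "2 * U <= B" .
  qed
  \<comment> \<open>Radius 1 is harmless: coordinates stay below 5 + 1 and times above 7.5 -
    1.\<close>
  have cubeQ: "par_cube r (x, t) <= Q" if "r <= 1" "0 < r" for r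
  proof clarify
   fix y s assume y: "(y, s) : par_cube r (x, t)"
   have "abs (y $ i) < 10" for i
   proof -
    have "abs (y $ i - x $ i) < r" "abs (x $ i) < 5" using y x by (auto simp: par_cube_def cube_def)
    thus ?thesis using that by linarith
   qed
   moreover have "r^2 <= 1" using that by (simp add: power_le_one)
   ultimately show "(y, s) : Q" using y x unfolding Q cylinder_def cube_def par_cube_def by auto
  qed
  have rhk: "0 < rh k" "rh k <= rh0" for k using rh0 Kk[of k] pos by (auto simp: rh_def pos_divide_le_eq mult_le_cancel_left1)
  have force: "rh k powr (2 * p - N) * Fp <= nu * om k powr p" for k
  proof -
   have "rh k powr (2 * p - N) <= (1 / K ^ k) powr (2 * p - N)" unfolding rh_def using rh0 pos pp by (intro powr_mono2 divide_right_mono) auto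
   also have "... = (K ^ k) powr (- (2 * p - N))" unfolding powr_minus_divide powr_divide by simp
   also have "... <= (K ^ k) powr (- (al * p))" using al Kk by (intro powr_mono) auto
   finally have "rh k powr (2 * p - N) * Fp <= (K ^ k) powr (- (al * p)) * A powr p"
   proof (rule mult_mono)
    have "Fp = (Fp powr (1 / p)) powr p" using pp Fp by (simp add: powr_powr)
    also have "... <= A powr p" using pp U0 by (intro powr_mono2) (auto simp: A_def)
    finally show "Fp <= A powr p" .
   qed (use Fp in auto)
   also have "... <= (nu * J powr p) * ((K ^ k) powr (- (al * p)) * A powr p)" by (rule mult_right_mono[OF J(2), unfolded mult_1]) simp
   finally show ?thesis by (simp add: om_def B_def powr_mult powr_powr mult_ac)
  qed
  have osc: "EX b. ALL y:par_cube (rh k) (x, t). b <= u y & u y <= b + om k" for k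
  proof (induction k)
   case 0
   have "- U <= u y & u y <= - U + om 0" if y: "y : par_cube (rh 0) (x, t)" for y
   proof -
    have "y : Q" using y cubeQ[of "rh 0"] rh0 rhk[of 0] by auto
    hence "abs (u y) <= U" using U by blast
    moreover have "om 0 = B" by (simp add: om_def)
    ultimately show ?thesis using B by linarith
   qed
   thus ?case by blast
  next
   case (Suc k)
   then obtain b where b: "ALL y:par_cube (rh k) (x, t). b <= u y & u y <= b + om k" by blast
   have "0 < om k" unfolding om_def using B pos by simp
   from dec[OF u rhk(1) _ this force cubeQ[OF _ rhk(1)] b] obtain b' where b': "ALL y:par_cube (rh k / K) (x, t). b' <= u y & u y <= b' + (1 - kp) * om k"
    using rh0 rhk(2)[of k] by auto
   have "(1 - kp) * om k <= K powr (- al) * om k" using kpK \<open>0 < om k\<close> by (intro mult_right_mono) auto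
   also have "... = om (Suc k)" using pos by (simp add: om_def powr_mult)
   finally have w: "(1 - kp) * om k <= om (Suc k)" .
   have r: "rh (Suc k) = rh k / K" by (simp add: rh_def)
   have "b' <= u y & u y <= b' + om (Suc k)" if "y : par_cube (rh (Suc k)) (x, t)" for y using bspec[OF b', of y] that w unfolding r by linarith
   thus ?case by blast
  qed
  define D where "D = (norm (x - x'))^2 + abs (t - t')"
  define d where "d = sqrt D"
  have D: "D >= 0" "d^2 = D" "d >= 0" by (auto simp: D_def d_def)
  have dD: "d powr al = D powr (al / 2)" unfolding d_def using D by (simp add: powr_half_sqrt[symmetric] powr_powr)
  have CB: "C * D powr (al / 2) * A = B * K powr al * (d / rh0) powr al" unfolding dD[symmetric] C_def B_def by (simp add: powr_divide)
  have "abs (u (x, t) - u (x', t')) <= C * D powr (al / 2) * A"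
  proof (cases "d = 0")
   case True
   hence "x = x'" "t = t'" using D(2) by (auto simp: D_def add_nonneg_eq_0_iff)
   thus ?thesis using C D A0 by (simp add: A_def)
  next
   case False
   hence d0: "d > 0" using D by simp
   show ?thesis
   proof (cases "d < rh0")
    case False
    have "abs (u (x, t) - u (x', t')) <= abs (u (x, t)) + abs (u (x', t'))" by simp
    also have "... <= B * 1 * 1" using bspec[OF U xQ(1)] bspec[OF U xQ(2)] B(2) by linarith
    also have "... <= B * K powr al * (d / rh0) powr al" using False pos al rh0 B by (intro mult_mono) (auto intro!: ge_one_powr_ge_zero mult_nonneg_nonneg)
    finally show ?thesis unfolding CB .
   next
    case True
    obtain j where "rh0 / d < K ^ j" using real_arch_pow[OF pos(4)] by blast
    hence ex: "EX j. rh j <= d" using d0 pos by (intro exI[of _ j]) (simp add: rh_def pos_divide_less_eq pos_divide_le_eq mult.commute less_imp_le)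
    \<comment> \<open>The first radius not exceeding the distance d. The cylinder of the preceding
      radius still contains the other point; going back one scale costs the factor K^al.\<close>
    define j where "j = (LEAST j. rh j <= d)"
    have j: "rh j <= d" unfolding j_def using LeastI_ex[OF ex] .
    then obtain k where k: "j = Suc k" using True by (cases j) (auto simp: rh_def)
    have dk: "d < rh k" using not_less_Least[of k "%j. rh j <= d"] k by (auto simp: j_def)
    have mem: "(x', t') : par_cube (rh k) (x, t)"
    proof -
     have "D < (rh k)^2" unfolding D(2)[symmetric] using dk D by (intro power_strict_mono) auto
     moreover have "norm (x - x') <= d" unfolding d_def D_def by (rule real_le_rsqrt) simp
     moreover have "abs (x' $ i - x $ i) <= norm (x - x')" for i using component_le_norm_cart[of "x - x'" i] by (simp add: abs_minus_commute)
     ultimately show ?thesis using dk le unfolding par_cube_def D_def by (auto intro: le_less_trans) (smt (verit) zero_le_power2)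
    qed
    have "0 < rh k" by (rule rhk)
    hence mem0: "(x, t) : par_cube (rh k) (x, t)" by (simp add: par_cube_def)
    obtain b where b: "ALL y:par_cube (rh k) (x, t). b <= u y & u y <= b + om k" using osc by blast
    have "abs (u (x, t) - u (x', t')) <= om k" using bspec[OF b mem] bspec[OF b mem0] by linarith
    also have "om k = B * K powr al * (1 / K ^ j) powr al" using pos unfolding om_def k by (simp add: powr_minus_divide powr_divide powr_mult)
    also have "... <= B * K powr al * (d / rh0) powr al"
    proof (intro mult_left_mono powr_mono2)
     show "1 / K ^ j <= d / rh0" using j rh0 pos by (simp add: rh_def field_simps)
    qed (use al pos B in auto)
    finally show ?thesis unfolding CB .
   qed
  qed
  thus ?thesis by (simp add: D_def A_def)
 qed
 show ?thesis
 proof (rule exI[of _ C], rule conjI[OF C], rule exI[of _ al], rule conjI[OF al(1)], rule conjI[OF al(2)], intro allI impI)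
  fix u :: "(real^'n) * real => real" and U t t' :: real and x x' :: "real^'n"
  assume h: "super u" "super (%z. - u z)" "ALL z:Q. abs (u z) <= U" "0 < U + Fp powr (1 / p)" "(x, t) : cube 5 \<times> {10 - 10/4 <.. 10}" "(x', t') : cube 5 \<times> {10 - 10/4 <.. 10}"
  show "abs (u (x, t) - u (x', t')) <= C * ((norm (x - x'))^2 + abs (t - t')) powr (al / 2) * (U + Fp powr (1 / p))"
  proof (cases "t' <= t")
   case False
   thus ?thesis using main[OF h(1-4,6,5)] by (simp add: norm_minus_commute abs_minus_commute)
  qed (rule main[OF h])
 qed
qed
end

section \<open>From the extremal inequality to the stated norms\<close>

lemma cylinder_sets: "(cylinder (cube r) T :: ((real^'n) * real) set) : sets borel" unfolding cylinder_def by (intro borel_Times borel_open[OF open_cube]) simp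

lemma in_Lp_representative:
 fixes f :: "'a::euclidean_space => real"
 assumes f: "in_Lp p S f" and S: "S : sets borel" and p: "p > 0"
 shows "EX F. F : borelf & (ALL z. 0 <= F z) & (AE z in lebesgue. z : S --> abs (f z) = F z) &
  (NN z. ennreal (F z powr p)) <= ennreal (Lp_norm p S f powr p)"
proof -
 have Sl: "S : sets lebesgue" using S by simp
 have "(%z. indicator S z * f z) : borel_measurable lebesgue" using f in_Lp_iff[OF Sl] by blast
 then obtain g where g: "g : borel_measurable lborel" "AE z in lborel. indicator S z * f z = g z" using completion_ex_borel_measurable_real by blast
 have e: "AE z in lebesgue. indicator S z * f z = g z" by (rule AE_completion[OF g(2)])
 have gm: "(%z. abs (g z)) : borelf" using g(1) by simp
 have "(NN z. ennreal (abs (g z) powr p)) = (NL z. ennreal (abs (g z) powr p))" by (rule nn_integral_completion[symmetric]) 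
 also have "... = (NL z. indicator S z * ennreal (abs (f z) powr p))"
  by (rule nn_integral_cong_AE, use e in eventually_elim) (use p in "auto simp: indicator_def split: if_splits")
 also have "... <= ennreal (Lp_norm p S f powr p)" by (rule Lp_norm_nn_integral[OF f Sl p order_refl])
 finally have "(NN z. ennreal (abs (g z) powr p)) <= ennreal (Lp_norm p S f powr p)" .
 moreover have "AE z in lebesgue. z : S --> abs (f z) = abs (g z)" using e by eventually_elim (auto simp: indicator_def)
 ultimately show ?thesis using gm by (intro exI[of _ "%z. abs (g z)"]) auto
qed

text \<open>At the final time a relative neighbourhood in Q need not be open. Slightly earlier times
  provide a nonempty open box on which the continuous function is still too large, and such a box is
  not a null set.\<close>

lemma Linf_norm_bound:
 fixes u :: "(real^'n) * real => real"
 assumes Q: "Q = cylinder (cube r) T" and u: "continuous_on Q u" and c: "Linf_norm Q u < ereal c" and z: "z : Q"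
 shows "abs (u z) <= c"
proof (rule ccontr)
 assume big: "~ abs (u z) <= c"
 obtain P where P: "eventually P (ae_filter (lebesgue_on Q))" "(SUP y\<in>Collect P. ereal (abs (u y))) < ereal c"
  using c unfolding Linf_norm_def ess_sup_def Limsup_def by (auto simp: INF_less_iff)
 have Pc: "abs (u y) < c" if "P y" for y
 proof -
  have "ereal (abs (u y)) <= (SUP y\<in>Collect P. ereal (abs (u y)))" using that by (intro SUP_upper) simp
  thus ?thesis using P(2) by (meson le_less_trans ereal_less(2) less_ereal.simps(1))
 qed
 have Qm: "Q : sets borel" unfolding Q by (rule cylinder_sets)
 have ae: "AE y in lebesgue. y : Q --> P y" using P(1) eventually_ae_on[OF Qm] by simp
 have "openin (top_of_set Q) (Q Int (%y. abs (u y)) -` {c<..})" by (rule continuous_openin_preimage_gen) (auto intro: continuous_intros u)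
 then obtain U where U: "open U" "Q Int (%y. abs (u y)) -` {c<..} = Q Int U" unfolding openin_open by blast
 have "z : U" using U big z by auto
 then obtain e where e: "e > 0" "par_cube e z <= U" using par_cube_in_open[OF U(1)] by blast
 define W where "W = {y. (ALL i. abs (fst y $ i - fst z $ i) < e) & fst y : cube r & snd z - e^2 < snd y & snd y < snd z & 0 < snd y}"
 have "W = ({x. ALL i. abs (x $ i - fst z $ i) < e} Int cube r) \<times> ({snd z - e^2<..<snd z} Int {0<..})" by (auto simp: W_def)
 hence oW: "open W" by (simp only:) (intro open_Times open_Int open_cube_at open_cube; simp)
 have WQ: "W <= Q Int U" using e z unfolding W_def Q cylinder_def by (auto simp: par_cube_def subset_iff)
 have "0 < snd z" using z by (auto simp: Q cylinder_def)
 hence "max (snd z - e^2) 0 < snd z" using e by simp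
 then obtain t where "max (snd z - e^2) 0 < t" "t < snd z" using dense by blast
 hence "(fst z, t) : W" using z e by (auto simp: W_def Q cylinder_def)
 hence "~ negligible W" using open_not_negligible[OF oW] by blast
 moreover have "AE y in lebesgue. y ~: W" using ae
 proof eventually_elim
  case (elim y)
  have "c < abs (u y)" if "y : W" using that WQ U(2) by blast
  thus ?case using elim Pc[of y] WQ by force
 qed
 hence "W : null_sets lebesgue" using oW by (simp add: AE_iff_null_sets)
 ultimately show False by (simp add: negligible_iff_null_sets)
qed

theorem theorem4p2:
  fixes lam Lam p1 p q :: real
    and Q Qhalf :: "((real^'n) \<times> real) set"
    and G :: "(real^'n) \<times> real \<Rightarrow> real^'n \<Rightarrow> real^'n^'n \<Rightarrow> real"
    and f \<mu> :: "(real^'n) \<times> real \<Rightarrow> real"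
  assumes "0 < lam" and "lam \<le> Lam"
    and "ABP_exponent TYPE('n) lam Lam p1"
    and "Q = cylinder (cube 10) 10"
    and "Qhalf = cube 5 \<times> {10 - 10/4 <.. 10}"
    and "operator_measurable Q G"
    and "\<And>z \<xi> X Y. z \<in> Q \<Longrightarrow> symm X \<Longrightarrow> symm Y \<Longrightarrow>
           pucci_minus lam Lam (X - Y) \<le> G z \<xi> X - G z \<xi> Y \<and>
           G z \<xi> X - G z \<xi> Y \<le> pucci_plus lam Lam (X - Y)"
    and "q > real CARD('n) + 2"
    and "in_Lp q Q \<mu>"
    and "\<And>z \<xi>. z \<in> Q \<Longrightarrow> \<bar>G z \<xi> 0\<bar> \<le> \<mu> z * norm \<xi>"
    and "p1 < p" and "p \<le> q"
    and "in_Lp p Q f"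
  shows "\<exists>C>0. \<exists>\<alpha>. 0 < \<alpha> \<and> \<alpha> < 1 \<and>
           (\<forall>u. Lp_visc_solution p (cube 10) 10 (\<lambda>z \<xi> X. G z \<xi> X - f z) u \<longrightarrow>
              (\<forall>x t x' t'. (x, t) \<in> Qhalf \<and> (x', t') \<in> Qhalf \<longrightarrow>
                 ereal \<bar>u (x, t) - u (x', t')\<bar>
                   \<le> ereal (C * ((norm (x - x'))\<^sup>2 + \<bar>t - t'\<bar>) powr (\<alpha> / 2))
                      * (Linf_norm Q u + ereal (Lp_norm p Q f))))"
proof -
 note lL = assms(1,2) and abp = assms(3) and Q = assms(4) and Qh = assms(5) and q = assms(8) and pp = assms(11,12)
 have p0: "p > 0" "q > 0" using abp pp q unfolding ABP_exponent_def by auto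
 have Qm: "Q : sets borel" unfolding Q by (rule cylinder_sets)
 define Fp where "Fp = Lp_norm p Q f powr p"
 have Ln: "Fp powr (1 / p) = Lp_norm p Q f" unfolding Fp_def powr_powr using p0 by (simp add: Lp_norm_def)
 from in_Lp_representative[OF assms(9) Qm p0(2)] obtain m where m: "m : borelf" "ALL z. 0 <= m z"
  "AE z in lebesgue. z : Q --> abs (\<mu> z) = m z" "(NN z. ennreal (m z powr q)) <= ennreal (Lp_norm q Q \<mu> powr q)" by blast
 from in_Lp_representative[OF assms(13) Qm p0(1)] obtain F where F: "F : borelf" "ALL z. 0 <= F z"
  "AE z in lebesgue. z : Q --> abs (f z) = F z" "(NN z. ennreal (F z powr p)) <= ennreal Fp" unfolding Fp_def by blast
 interpret A: pucci_drift lam Lam p1 p q Q m F "Lp_norm q Q \<mu> powr q" Fp "real CARD('n) + 2"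
  by unfold_locales (rule refl abp pp q lL m(1,4) m(2)[rule_format] F(1,4) F(2)[rule_format] powr_ge_zero powr_ge_zero[of "Lp_norm p Q f" p, folded Fp_def])+
 have mF: "AE z in lebesgue. z : Q --> abs (\<mu> z) <= m z & abs (f z) <= F z" using m(3) F(3) by eventually_elim simp
 obtain C \<alpha> where C: "C > 0" and \<alpha>: "0 < \<alpha>" "\<alpha> < 1" and H: "!!u U x t x' t'. A.super u ==> A.super (%z. - u z) ==> (ALL z:Q. abs (u z) <= U) ==> 0 < U + Lp_norm p Q f ==>
  (x, t) : Qhalf ==> (x', t') : Qhalf ==> abs (u (x, t) - u (x', t')) <= C * ((norm (x - x'))^2 + abs (t - t')) powr (\<alpha> / 2) * (U + Lp_norm p Q f)"
  using A.hoelder_estimate[OF Q] unfolding Ln Qh by blast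
 have main: "ereal (abs (u (x, t) - u (x', t'))) <= ereal (C * ((norm (x - x'))^2 + abs (t - t')) powr (\<alpha> / 2)) * (Linf_norm Q u + ereal (Lp_norm p Q f))"
  if u: "Lp_visc_solution p (cube 10) 10 (%z \<xi> X. G z \<xi> X - f z) u" and x: "(x, t) : Qhalf" "(x', t') : Qhalf" for u x t x' t'
 proof -
  let ?D = "(norm (x - x'))^2 + abs (t - t')"
  have sup: "A.super u" "A.super (%z. - u z)" by (rule visc_solution_pucci_super[OF u Q p0(1) assms(7) assms(10) mF], assumption+)+
  have cu: "continuous_on Q u" using sup(1) by (simp add: pucci_super_def)
  have xQ: "(x, t) : Q" using x unfolding Qh Q cylinder_def cube_def by (auto intro: less_trans)
  have D0: "?D >= 0" by simp
  have n0: "Lp_norm p Q f >= 0" by (simp add: Lp_norm_def)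
  show ?thesis
  proof (cases "Linf_norm Q u")
   case (real r)
   have ur: "abs (u z) <= r" if "z : Q" for z by (rule field_le_epsilon, rule Linf_norm_bound[OF Q cu _ that]) (simp add: real)
   have r0: "r >= 0" using ur[OF xQ] by simp
   have "abs (u (x, t) - u (x', t')) <= C * ?D powr (\<alpha> / 2) * (r + Lp_norm p Q f)"
   \<comment> \<open>\<open>H\<close> asks for a positive scale; if the scale is zero, u vanishes on
     Q.\<close>
   proof (cases "r + Lp_norm p Q f = 0")
    case True
    have "(x', t') : Q" using x unfolding Qh Q cylinder_def cube_def by (auto intro: less_trans)
    thus ?thesis using ur[OF xQ] ur[of "(x', t')"] True n0 r0 by simp
   next
    case False
    thus ?thesis using ur n0 r0 by (intro H[OF sup _ _ x]) auto
   qed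
   thus ?thesis by (simp add: real)
  next
   case PInf
   show ?thesis
   \<comment> \<open>At distance zero both sides vanish, by the convention that 0 times infinity is
     0; at positive distance the right side is infinite.\<close>
   proof (cases "?D = 0")
    case True
    hence "x = x'" "t = t'" by (auto simp: add_nonneg_eq_0_iff)
    thus ?thesis using C by (simp add: PInf)
   next
    case False
    define k where "k = C * ?D powr (\<alpha> / 2)"
    have "k > 0" unfolding k_def using False C D0 by simp
    thus ?thesis unfolding k_def[symmetric] PInf by simp
   qed
  next
   case MInf
   thus ?thesis using Linf_norm_bound[OF Q cu _ xQ, of "- 1"] by simp
  qed
 qed
 show ?thesis using C \<alpha> main by (intro exI[of _ C] conjI exI[of _ \<alpha>]) auto
qed

end
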